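(* In the setting of the context, for every level $L$ and every sequence of marked sets, the matrix $\mathbf P_{\mathcal A}$ (defined through $\mathbf P_{\mathcal A}^{-1}=\sum_{\ell=0}^L\widetilde{\mathbf I}^\ell(\widetilde{\mathbf D}_{\mathcal A}^\ell)^{-1}(\widetilde{\mathbf I}^\ell)^T$) is symmetric and positive definite, and $$d_{\mathcal A}\langle\mathbf P_{\mathcal A}\mathbf X,\mathbf X\rangle_2\le\langle\mathbf A_{\mathcal A}\mathbf X,\mathbf X\rangle_2\le D_{\mathcal A}\langle\mathbf P_{\mathcal A}\mathbf X,\mathbf X\rangle_2\qquad\text{for all }\mathbf X\in\mathbb{R}^{N_L},$$ where the constants $0<d_{\mathcal A}\le D_{\mathcal A}$ depend only on $\Omega$, the initial triangulation $\mathcal T_0^\Omega$, and the use of newest vertex bisection for mesh-refinement.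
   Context: $\Omega\subset\mathbb{R}^2$ is a polygonal, simply connected domain with boundary $\Gamma$; $A\in L^\infty(\Omega;\mathbb{R}^{2\times2}_{\rm sym})$ with $0<\operatorname{ess\,inf}\lambda_{\min}(A)\le\operatorname{ess\,sup}\lambda_{\max}(A)<\infty$. $K$ is the double-layer operator $Kv(x)=\int_\Gamma\partial_{\boldsymbol n(y)}G(x,y)v(y)\,dy$ with $G(x,y)=-\frac1{2\pi}\log|x-y|$, and $\langle\cdot,\cdot\rangle_\Gamma$ is the $L^2(\Gamma)$ (duality) pairing. For $u,v\in H^1(\Omega)$ let $\langle\mathcal Au,v\rangle=\langle A\nabla u,\nabla v\rangle_{L^2(\Omega)}+\langle1,(\tfrac12-K)u|_\Gamma\rangle_\Gamma\langle1,(\tfrac12-K)v|_\Gamma\rangle_\Gamma$. $\mathcal T_0^\Omega$ is a conforming triangulation of $\Omega$ into triangles, and $\mathcal T_{\ell+1}^\Omega$ is the coarsest conforming refinement of $\mathcal T_\ell^\Omega$ by newest vertex bisection bisecting all elements of an arbitrary nonempty marked set. $\mathcal N_\ell^\Omega$ is the node set, $\omega_\ell(z)$ the set of triangles of $\mathcal T_\ell^\Omega$ containing $z$, $\eta_z^\ell$ the continuous piecewise affine hat function on $\mathcal T_\ell^\Omega$ at $z$. $\widetilde{\mathcal N}_0^\Omega=\mathcal N_0^\Omega$, and for $\ell\ge1$ $\widetilde{\mathcal N}_\ell^\Omega=(\mathcal N_\ell^\Omega\setminus\mathcal N_{\ell-1}^\Omega)\cup\{z\in\mathcal N_{\ell-1}^\Omega:\omega_\ell(z)\subsetneq\omega_{\ell-1}(z)\}$.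 $N_L=\#\mathcal N_L^\Omega$ with nodes $z_1,\dots,z_{N_L}$; $(\mathbf A_{\mathcal A})_{jk}=\langle\mathcal A\eta_{z_k}^L,\eta_{z_j}^L\rangle$. For each $\ell\le L$, with $\widetilde{\mathcal N}_\ell^\Omega$ enumerated, $\widetilde{\mathbf I}^\ell\in\mathbb{R}^{N_L\times\#\widetilde{\mathcal N}_\ell^\Omega}$ has as $k$-th column the coefficient vector of $\eta_{z_k}^\ell$ in the basis $(\eta_z^L)_{z\in\mathcal N_L^\Omega}$, and $\widetilde{\mathbf D}_{\mathcal A}^\ell$ is the diagonal matrix with entries $\langle\mathcal A\eta_{z_k}^\ell,\eta_{z_k}^\ell\rangle$, $z_k\in\widetilde{\mathcal N}_\ell^\Omega$.
   Formalization: The constants may also depend on the coefficient A (for A=κI, L=0, X=(1,…,1) the lower constant must tend to 0 as κ→∞), and the strict inclusion of ω_ℓ(z) is taken for the unions of the triangles, since as sets of triangles it can never be strict; Ω is the interior of a simple closed polygon. *)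

theory Defs
  imports "HOL-Analysis.Analysis"
begin

type_synonym point = "real^2"
type_synonym ltri = "point \<times> point \<times> point"
  \<comment> \<open>labelled triangle (a,b,c): reference edge [a,b], opposite (newest) vertex c\<close>

definition pv :: "point list \<Rightarrow> nat \<Rightarrow> point" where
  "pv ps i = ps ! (i mod length ps)"

definition pedge :: "point list \<Rightarrow> nat \<Rightarrow> point set" where
  "pedge ps i = closed_segment (pv ps i) (pv ps (Suc i))"

definition polygon_image :: "point list \<Rightarrow> point set" where
  "polygon_image ps = (\<Union>i<length ps. pedge ps i)"

definition simple_polygon :: "point list \<Rightarrow> bool" where
  "simple_polygon ps \<longleftrightarrow> length ps \<ge> 3 \<and> distinct ps \<and>
     (\<forall>i<length ps. \<forall>j<length ps. i \<noteq> j \<longrightarrow>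
        pedge ps i \<inter> pedge ps j =
          (if Suc i mod length ps = j then {pv ps j}
           else if Suc j mod length ps = i then {pv ps i} else {}))"

definition outward_normal :: "point set \<Rightarrow> point \<Rightarrow> point \<Rightarrow> point" where
  "outward_normal \<Omega> a b = (SOME \<nu>. norm \<nu> = 1 \<and> \<nu> \<bullet> (b - a) = 0 \<and>
      (\<exists>\<epsilon>>0. \<forall>\<delta>. 0 < \<delta> \<and> \<delta> < \<epsilon> \<longrightarrow> midpoint a b + \<delta> *\<^sub>R \<nu> \<notin> \<Omega>))"

definition bdry_int :: "point list \<Rightarrow> (point \<Rightarrow> real) \<Rightarrow> real" where
  "bdry_int ps f = (\<Sum>i<length ps. norm (pv ps (Suc i) - pv ps i) *
      integral {0..1} (\<lambda>t. f (pv ps i + t *\<^sub>R (pv ps (Suc i) - pv ps i))))"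

text \<open>Double-layer operator K v(x) = int_Gamma d_n(y) G(x,y) v(y) dy,
  G(x,y) = -(1/(2 pi)) log|x-y|, so d_n(y) G(x,y) = ((x-y).n(y)) / (2 pi |x-y|^2).\<close>
definition double_layer :: "point set \<Rightarrow> point list \<Rightarrow> (point \<Rightarrow> real) \<Rightarrow> point \<Rightarrow> real" where
  "double_layer \<Omega> ps v x = (\<Sum>i<length ps.
      norm (pv ps (Suc i) - pv ps i) *
      integral {0..1} (\<lambda>t. let y = pv ps i + t *\<^sub>R (pv ps (Suc i) - pv ps i) in
         ((x - y) \<bullet> outward_normal \<Omega> (pv ps i) (pv ps (Suc i))) / (2 * pi * (norm (x - y))\<^sup>2) * v y))"

definition eigval :: "real^2^2 \<Rightarrow> real \<Rightarrow> bool" where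
  "eigval M mu \<longleftrightarrow> (\<exists>v. v \<noteq> 0 \<and> M *v v = mu *\<^sub>R v)"

definition admissible_coeff :: "point set \<Rightarrow> (point \<Rightarrow> real^2^2) \<Rightarrow> bool" where
  "admissible_coeff \<Omega> A \<longleftrightarrow>
     (\<forall>i j. (\<lambda>x. A x $ i $ j) \<in> borel_measurable (lebesgue_on \<Omega>)) \<and>
     (AE x in lebesgue. x \<in> \<Omega> \<longrightarrow> transpose (A x) = A x) \<and>
     (\<exists>c C::real. 0 < c \<and> (AE x in lebesgue. x \<in> \<Omega> \<longrightarrow>
         (\<forall>mu. eigval (A x) mu \<longrightarrow> c \<le> mu \<and> mu \<le> C)))"

text \<open>(Pointwise) gradient; for the piecewise affine functions considered it is the a.e. gradient.\<close>
definition grad :: "(point \<Rightarrow> real) \<Rightarrow> point \<Rightarrow> point" where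
  "grad u x = (if u differentiable (at x)
      then (\<chi> i. frechet_derivative u (at x) (axis i 1)) else 0)"

definition bterm :: "point set \<Rightarrow> point list \<Rightarrow> (point \<Rightarrow> real) \<Rightarrow> real" where
  "bterm \<Omega> ps u = bdry_int ps (\<lambda>x. u x / 2 - double_layer \<Omega> ps u x)"

definition aform :: "point set \<Rightarrow> point list \<Rightarrow> (point \<Rightarrow> real^2^2) \<Rightarrow>
    (point \<Rightarrow> real) \<Rightarrow> (point \<Rightarrow> real) \<Rightarrow> real" where
  "aform \<Omega> ps A u v = (LINT x:\<Omega>|lebesgue. (A x *v grad u x) \<bullet> grad v x)
      + bterm \<Omega> ps u * bterm \<Omega> ps v"

fun verts :: "ltri \<Rightarrow> point set" where
  "verts (a, b, c) = {a, b, c}"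

definition tri :: "ltri \<Rightarrow> point set" where
  "tri t = convex hull (verts t)"

definition conforming :: "ltri set \<Rightarrow> bool" where
  "conforming T \<longleftrightarrow> finite T \<and> T \<noteq> {} \<and> inj_on verts T \<and>
     (\<forall>t\<in>T. \<not> collinear (verts t)) \<and>
     (\<forall>t\<in>T. \<forall>t'\<in>T. t \<noteq> t' \<longrightarrow> tri t \<inter> tri t' = convex hull (verts t \<inter> verts t'))"

definition triangulation :: "point set \<Rightarrow> ltri set \<Rightarrow> bool" where
  "triangulation \<Omega> T \<longleftrightarrow> conforming T \<and> \<Union> (tri ` T) = closure \<Omega>"

fun bisect :: "ltri \<Rightarrow> ltri set" where
  "bisect (a, b, c) = {(a, c, midpoint a b), (c, b, midpoint a b)}"

inductive nvb_ref :: "ltri set \<Rightarrow> ltri set \<Rightarrow> bool" for T where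
  refl: "nvb_ref T T"
| step: "nvb_ref T T' \<Longrightarrow> t \<in> T' \<Longrightarrow> nvb_ref T ((T' - {t}) \<union> bisect t)"

definition nvb_refine :: "ltri set \<Rightarrow> ltri set \<Rightarrow> ltri set \<Rightarrow> bool" where
  "nvb_refine T M T' \<longleftrightarrow> nvb_ref T T' \<and> conforming T' \<and> M \<inter> T' = {} \<and>
     (\<forall>T''. nvb_ref T T'' \<and> conforming T'' \<and> M \<inter> T'' = {} \<longrightarrow> nvb_ref T' T'')"

definition nodes :: "ltri set \<Rightarrow> point set" where
  "nodes T = \<Union> (verts ` T)"

definition patch :: "ltri set \<Rightarrow> point \<Rightarrow> point set" where
  "patch T z = \<Union> {tri t | t. t \<in> T \<and> z \<in> tri t}"

definition newnodes :: "(nat \<Rightarrow> ltri set) \<Rightarrow> nat \<Rightarrow> point set" where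
  "newnodes T l = (if l = 0 then nodes (T 0)
     else (nodes (T l) - nodes (T (l - 1))) \<union>
          {z \<in> nodes (T (l - 1)). patch (T l) z \<subset> patch (T (l - 1)) z})"

definition det2 :: "point \<Rightarrow> point \<Rightarrow> real" where
  "det2 u v = u $ 1 * v $ 2 - u $ 2 * v $ 1"

definition lam :: "point \<Rightarrow> point \<Rightarrow> point \<Rightarrow> point \<Rightarrow> real" where
  "lam z p q x = det2 (p - x) (q - x) / det2 (p - z) (q - z)"

fun bary :: "ltri \<Rightarrow> point \<Rightarrow> point \<Rightarrow> real" where
  "bary (a, b, c) z x = (if z = a then lam a b c x else if z = b then lam b c a x else lam c a b x)"

definition hat :: "ltri set \<Rightarrow> point \<Rightarrow> point \<Rightarrow> real" where
  "hat T z x = (if \<exists>t\<in>T. x \<in> tri t \<and> z \<in> verts t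
      then bary (SOME t. t \<in> T \<and> x \<in> tri t \<and> z \<in> verts t) z x else 0)"

definition coeffs :: "ltri set \<Rightarrow> (point \<Rightarrow> real) \<Rightarrow> point \<Rightarrow> real" where
  "coeffs T f = (THE c. (\<forall>z. z \<notin> nodes T \<longrightarrow> c z = 0) \<and>
      (\<forall>x. f x = (\<Sum>z\<in>nodes T. c z * hat T z x)))"

definition Itil :: "(nat \<Rightarrow> ltri set) \<Rightarrow> nat \<Rightarrow> nat \<Rightarrow> point \<Rightarrow> point \<Rightarrow> real" where
  "Itil T L l z' z = coeffs (T L) (hat (T l) z) z'"

text \<open>P_A^{-1} = sum_l I~^l (D~^l)^{-1} (I~^l)^T (D~^l diagonal, so inverted entrywise)\<close>
definition Pinv :: "point set \<Rightarrow> point list \<Rightarrow> (point \<Rightarrow> real^2^2) \<Rightarrow> (nat \<Rightarrow> ltri set) \<Rightarrow> nat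
    \<Rightarrow> point \<Rightarrow> point \<Rightarrow> real" where
  "Pinv \<Omega> ps A T L j k = (\<Sum>l\<le>L. \<Sum>z\<in>newnodes T l.
      Itil T L l j z * inverse (aform \<Omega> ps A (hat (T l) z) (hat (T l) z)) * Itil T L l k z)"

definition Amat :: "point set \<Rightarrow> point list \<Rightarrow> (point \<Rightarrow> real^2^2) \<Rightarrow> ltri set
    \<Rightarrow> point \<Rightarrow> point \<Rightarrow> real" where
  "Amat \<Omega> ps A TL j k = aform \<Omega> ps A (hat TL k) (hat TL j)"

definition is_inverse_on :: "'i set \<Rightarrow> ('i \<Rightarrow> 'i \<Rightarrow> real) \<Rightarrow> ('i \<Rightarrow> 'i \<Rightarrow> real) \<Rightarrow> bool" where
  "is_inverse_on I M P \<longleftrightarrow> (\<forall>j\<in>I. \<forall>k\<in>I.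
      (\<Sum>i\<in>I. M j i * P i k) = (if j = k then 1 else 0) \<and>
      (\<Sum>i\<in>I. P j i * M i k) = (if j = k then 1 else 0))"

definition symmetric_on :: "'i set \<Rightarrow> ('i \<Rightarrow> 'i \<Rightarrow> real) \<Rightarrow> bool" where
  "symmetric_on I M \<longleftrightarrow> (\<forall>j\<in>I. \<forall>k\<in>I. M j k = M k j)"

definition qform :: "'i set \<Rightarrow> ('i \<Rightarrow> 'i \<Rightarrow> real) \<Rightarrow> ('i \<Rightarrow> real) \<Rightarrow> real" where
  "qform I M X = (\<Sum>j\<in>I. (\<Sum>k\<in>I. M j k * X k) * X j)"

definition pos_def_on :: "'i set \<Rightarrow> ('i \<Rightarrow> 'i \<Rightarrow> real) \<Rightarrow> bool" where
  "pos_def_on I M \<longleftrightarrow> (\<forall>X. (\<exists>i\<in>I. X i \<noteq> 0) \<longrightarrow> qform I M X > 0)"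

end

theory Submission
 imports Defs "HOL-Complex_Analysis.Complex_Analysis"
begin

text \<open>Additive Schwarz reduces the claim to two estimates for the multilevel splitting by the hat functions
 \<open>\<eta>\<close> of the new nodes: every finite element function \<open>v\<close> is a constant plus a sum \<open>\<Sum> c \<eta>\<close> with \<open>\<Sum> c\<^sup>2\<close> bounded by
 its energy, and every such sum has energy at most a multiple of \<open>\<Sum> c\<^sup>2\<close>. Both are proved on the forest of all
 bisected triangles through the edge means of \<open>v\<close> (its Crouzeix--Raviart averages): bisecting a triangle increases
 the energy of the averages by a fixed fraction of the squared jumps it creates, so these squares sum up to at most
 a multiple of the energy. Minimal refinement bisects an element at most twice, and shape regularity bounds how many
 new nodes charge the same triangle.
 The boundary functional \<open>\<langle>1, (1/2 - K) u\<rangle>\<close> is positive on constants because the winding number of the polygon jumps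
 by one across each edge. On a function supported in a ball of radius \<open>h\<close> it is \<open>O(h\<^bsup>5/8\<^esup>)\<close>, and the forest has
 only \<open>O(2\<^bsup>k/2\<^esup>)\<close> boundary triangles in generation \<open>k\<close>, so its squares over all hat functions are summable.\<close>

text \<open>Edge means are used because they are compatible with halving an edge: the
  Crouzeix--Raviart gradient on a triangle is the mean gradient there, so under bisection the
  gradients form a martingale, and orthogonality of its increments turns differences of energies
  into squared jumps. The obstacle is that steps of the adaptive loop are not levels of size: one
  step creates nodes of all sizes, and a node may stay untouched for arbitrarily many steps. All
  estimates are therefore charged to single forest triangles, and a triangle leaves the meshes only
  once, which limits the steps that can charge it. The exponent 5/8 comes from the corners: between
  two edges meeting at a vertex the kernel of K is only bounded by 1/|x - y|, and splitting this
  into the powers -3/4 and -1/4 of the distances to the corner keeps both factors integrable at the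
  cost of part of the natural rate h. Any exponent above 1/2 suffices: squared, it has to beat
  2^(k/2) boundary triangles of area 2^(-k).\<close>

notation scaleR (infixr "*R" 75)

section \<open>Positive definite matrices over finite index sets and the additive Schwarz
  lemma\<close>

lemma qform_alt: "qform I M X = (\<Sum>j\<in>I. \<Sum>k\<in>I. M j k * X k * X j)"
 by (simp add: qform_def sum_distrib_right)

lemma pos_def_onD: "pos_def_on I M ==> i \<in> I ==> X i ~= 0 ==> qform I M X > 0"
 unfolding pos_def_on_def by blast

text \<open>Elimination of one unknown. The restriction to I stays positive definite, so the new
  column is \<open>M w\<close> on I. The Schur complement s is the value of the form at the vector
  with entry 1 at a and -w elsewhere, hence positive.\<close>

lemma pos_def_on_solve:
 assumes "finite I" "pos_def_on I M"
 shows "\<exists>x. \<forall>j\<in>I. (\<Sum>i\<in>I. M j i * x i) = b j"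
 using assms
proof (induction I arbitrary: b rule: finite_induct)
 case empty
 thus ?case by simp
next
 case (insert a I)
 have pd: "pos_def_on I M"
  unfolding pos_def_on_def
 proof (intro allI impI)
  fix X assume X: "\<exists>i\<in>I. X i ~= (0::real)"
  let ?X = "%i. if i = a then 0 else X i"
  have e: "(\<Sum>k\<in>insert a I. M j k * ?X k) = (\<Sum>k\<in>I. M j k * X k)" for j
   using insert by (auto intro!: sum.cong)
  have "qform (insert a I) M ?X = qform I M X"
   unfolding qform_def e using insert by (auto intro!: sum.cong)
  moreover have "qform (insert a I) M ?X > 0"
  proof -
   obtain i where "i \<in> I" "X i ~= 0" using X by blast
   hence "?X i ~= 0" using insert by auto
   thus ?thesis using pos_def_onD[OF insert.prems, of i ?X] \<open>i \<in> I\<close> by simp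
  qed
  ultimately show "0 < qform I M X" by simp
 qed
 obtain y where y: "\<forall>j\<in>I. (\<Sum>i\<in>I. M j i * y i) = b j" using insert.IH[OF pd] by blast
 obtain w where w: "\<forall>j\<in>I. (\<Sum>i\<in>I. M j i * w i) = M j a"
  using insert.IH[OF pd, of "%j. M j a"] by blast
 define s where "s = M a a - (\<Sum>i\<in>I. M a i * w i)"
 let ?X = "%i. if i = a then 1 else - w i"
 have e: "(\<Sum>k\<in>insert a I. M j k * ?X k) = M j a - (\<Sum>k\<in>I. M j k * w k)" for j
 proof -
  have "(\<Sum>k\<in>I. M j k * ?X k) = (\<Sum>k\<in>I. - (M j k * w k))"
   using insert by (intro sum.cong) auto
  thus ?thesis using insert by (simp add: sum_negf)
 qed
 have "qform (insert a I) M ?X = s + (\<Sum>j\<in>I. (M j a - (\<Sum>k\<in>I. M j k * w k)) * ?X j)"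
  unfolding qform_def e using insert by (simp add: s_def)
 also have "(\<Sum>j\<in>I. (M j a - (\<Sum>k\<in>I. M j k * w k)) * ?X j) = 0"
  by (rule sum.neutral) (simp add: w)
 finally have q: "qform (insert a I) M ?X = s" by simp
 have "?X a ~= 0" by simp
 hence "qform (insert a I) M ?X > 0" using pos_def_onD[OF insert.prems, of a ?X] by simp
 hence "s > 0" using q by simp
 define \<xi> where "\<xi> = (b a - (\<Sum>i\<in>I. M a i * y i)) / s"
 let ?x = "%i. if i = a then \<xi> else y i - \<xi> * w i"
 have f: "(\<Sum>k\<in>insert a I. M j k * ?x k) = M j a * \<xi> + (\<Sum>k\<in>I. M j k * y k) - \<xi> * (\<Sum>k\<in>I. M j k * w k)" for j
 proof -
  have "(\<Sum>k\<in>I. M j k * ?x k) = (\<Sum>k\<in>I. M j k * y k - \<xi> * (M j k * w k))"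
   using insert by (intro sum.cong) (auto simp: algebra_simps)
  thus ?thesis using insert by (simp add: sum_subtractf sum_distrib_left)
 qed
 have "\<forall>j\<in>insert a I. (\<Sum>i\<in>insert a I. M j i * ?x i) = b j"
 proof
  fix j assume "j \<in> insert a I"
  then consider "j = a" | "j \<in> I" by blast
  thus "(\<Sum>i\<in>insert a I. M j i * ?x i) = b j"
  proof cases
   case 1
   have "s * \<xi> = b a - (\<Sum>i\<in>I. M a i * y i)" using \<open>s > 0\<close> by (simp add: \<xi>_def)
   thus ?thesis unfolding f 1 by (simp add: s_def algebra_simps)
  next
   case 2
   thus ?thesis unfolding f using y w by simp
  qed
 qed
 thus ?case by (intro exI[of _ ?x])
qed

text \<open>The columns \<open>x k\<close> solve \<open>M x = e_k\<close>. Evaluating the symmetric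
  form of M at two columns in both orders gives the symmetry of the inverse, and this turns the
  right inverse into a left one.\<close>

lemma pos_def_on_inverse:
 assumes fin: "finite I" and pd: "pos_def_on I M" and sy: "symmetric_on I M"
 shows "\<exists>P. is_inverse_on I M P & symmetric_on I P"
proof -
 have "\<forall>k. \<exists>x. \<forall>j\<in>I. (\<Sum>i\<in>I. M j i * x i) = (if j = k then 1 else 0)"
  by (rule allI, rule pos_def_on_solve[OF fin pd])
 then obtain x where x: "\<And>k j. j \<in> I ==> (\<Sum>i\<in>I. M j i * x k i) = (if j = k then 1 else 0)"
  by metis
 have xs: "x j k = x k j" if "j \<in> I" "k \<in> I" for j k
 proof -
  have "x k j = (\<Sum>i\<in>I. x k i * (\<Sum>m\<in>I. M i m * x j m))"
   using that fin by (subst sum.cong[OF HOL.refl, of _ _ "%i. if i = j then x k i else 0"]) (auto simp: x)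
  also have "... = (\<Sum>i\<in>I. \<Sum>m\<in>I. x k i * M i m * x j m)" by (simp add: sum_distrib_left mult.assoc)
  also have "... = (\<Sum>m\<in>I. \<Sum>i\<in>I. x k i * M i m * x j m)" by (rule sum.swap)
  also have "... = (\<Sum>m\<in>I. x j m * (\<Sum>i\<in>I. M m i * x k i))"
   using sy unfolding symmetric_on_def sum_distrib_left
   by (intro sum.cong HOL.refl) (simp add: mult.commute mult.left_commute)
  also have "... = x j k"
   using that fin by (subst sum.cong[OF HOL.refl, of _ _ "%i. if i = k then x j i else 0"]) (auto simp: x)
  finally show ?thesis by simp
 qed
 define P where "P = (%i k. x k i)"
 have 1: "(\<Sum>i\<in>I. M j i * P i k) = (if j = k then 1 else 0)" if "j \<in> I" for j k
  using x that by (simp add: P_def)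
 have 2: "(\<Sum>i\<in>I. P j i * M i k) = (if j = k then 1 else 0)" if "j \<in> I" "k \<in> I" for j k
 proof -
  have "(\<Sum>i\<in>I. P j i * M i k) = (\<Sum>i\<in>I. M k i * P i j)"
   using that sy xs unfolding symmetric_on_def P_def by (intro sum.cong) (auto simp: mult.commute)
  thus ?thesis using 1[of k j] that by auto
 qed
 show ?thesis
  by (rule exI[of _ P]) (use 1 2 xs in \<open>auto simp: is_inverse_on_def symmetric_on_def P_def\<close>)
qed

text \<open>The preconditioner norm of X is the infimum of the weighted coefficient norms over all
 representations of X by the columns; the minimiser has coefficients \<open>D\<inverse> S\<^sup>T P X\<close>.\<close>

lemma additive_schwarz:
 fixes S :: "'i => 'n => real" and Dg :: "'i => real"
 assumes fN: "finite N" and fI: "finite I" and Dg: "\<And>i. i \<in> I ==> Dg i > 0" and "d > 0"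
  and M: "\<And>j k. M j k = (\<Sum>i\<in>I. S i j * inverse (Dg i) * S i k)"
  and lower: "\<And>X. \<exists>c. (\<forall>n\<in>N. X n = (\<Sum>i\<in>I. c i * S i n)) & d * (\<Sum>i\<in>I. Dg i * (c i)^2) <= qform N A X"
  and upper: "\<And>c. qform N A (%n. \<Sum>i\<in>I. c i * S i n) <= D * (\<Sum>i\<in>I. Dg i * (c i)^2)"
 shows "\<exists>P. is_inverse_on N M P & symmetric_on N P & pos_def_on N P \<and>
  (\<forall>X. d * qform N P X <= qform N A X & qform N A X <= D * qform N P X)"
proof -
 define St where "St = (%Y i. \<Sum>n\<in>N. S i n * Y n)"
 have qM: "qform N M Y = (\<Sum>i\<in>I. inverse (Dg i) * (St Y i)^2)" for Y
 proof -
  have "qform N M Y = (\<Sum>j\<in>N. \<Sum>k\<in>N. \<Sum>i\<in>I. S i j * inverse (Dg i) * S i k * Y k * Y j)"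
   unfolding qform_alt M by (simp add: sum_distrib_right)
  also have "... = (\<Sum>j\<in>N. \<Sum>i\<in>I. \<Sum>k\<in>N. S i j * inverse (Dg i) * S i k * Y k * Y j)"
   by (rule sum.cong[OF HOL.refl]) (rule sum.swap)
  also have "... = (\<Sum>i\<in>I. \<Sum>j\<in>N. \<Sum>k\<in>N. S i j * inverse (Dg i) * S i k * Y k * Y j)"
   by (rule sum.swap)
  also have "... = (\<Sum>i\<in>I. inverse (Dg i) * (St Y i)^2)"
   unfolding St_def power2_eq_square sum_product sum_distrib_left
   by (intro sum.cong HOL.refl) (simp add: sum_distrib_left mult_ac)
  finally show ?thesis .
 qed
 have pdM: "pos_def_on N M"
  unfolding pos_def_on_def
 proof (intro allI impI)
  fix Y assume Y: "\<exists>i\<in>N. Y i ~= (0::real)"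
  have nn: "qform N M Y >= 0" unfolding qM using Dg by (intro sum_nonneg) (simp add: less_imp_le)
  have "qform N M Y ~= 0"
  proof
   assume "qform N M Y = 0"
   hence "\<forall>i\<in>I. inverse (Dg i) * (St Y i)^2 = 0" unfolding qM
    using Dg fI by (subst (asm) sum_nonneg_eq_0_iff) (auto simp: less_imp_le)
   hence z: "\<forall>i\<in>I. St Y i = 0" using Dg by fastforce
   \<comment> \<open>The columns span all vectors, so a Y orthogonal to every column is orthogonal
     to itself.\<close>
   obtain c where c: "\<forall>n\<in>N. Y n = (\<Sum>i\<in>I. c i * S i n)" using lower by blast
   have "(\<Sum>n\<in>N. Y n * Y n) = (\<Sum>n\<in>N. (\<Sum>i\<in>I. c i * S i n) * Y n)" using c by (intro sum.cong) auto
   also have "... = (\<Sum>n\<in>N. \<Sum>i\<in>I. c i * (S i n * Y n))" by (simp add: sum_distrib_right mult.assoc)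
   also have "... = (\<Sum>i\<in>I. c i * St Y i)" unfolding St_def sum_distrib_left by (rule sum.swap)
   also have "... = 0" using z by simp
   finally have "\<forall>n\<in>N. Y n * Y n = 0" using fN by (subst (asm) sum_nonneg_eq_0_iff) auto
   thus False using Y by auto
  qed
  thus "0 < qform N M Y" using nn by simp
 qed
 have syM: "symmetric_on N M" unfolding symmetric_on_def M by (auto intro!: sum.cong simp: mult_ac)
 obtain P where P: "is_inverse_on N M P" "symmetric_on N P"
  using pos_def_on_inverse[OF fN pdM syM] by blast
 define PX where "PX = (%X j. \<Sum>k\<in>N. P j k * X k)"
 have MP: "(\<Sum>k\<in>N. M j k * PX X k) = X j" if "j \<in> N" for X j
 proof -
  have "(\<Sum>k\<in>N. M j k * PX X k) = (\<Sum>k\<in>N. \<Sum>i\<in>N. M j k * P k i * X i)"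
   unfolding PX_def by (simp add: sum_distrib_left mult.assoc)
  also have "... = (\<Sum>i\<in>N. (\<Sum>k\<in>N. M j k * P k i) * X i)"
   unfolding sum_distrib_right by (rule sum.swap)
  also have "... = (\<Sum>i\<in>N. if i = j then X i else 0)"
   using P(1) that unfolding is_inverse_on_def by (intro sum.cong) auto
  finally show ?thesis using fN that by simp
 qed
 have qP: "qform N P X = (\<Sum>j\<in>N. PX X j * X j)" for X unfolding qform_def PX_def ..
 have qPM: "qform N P X = qform N M (PX X)" for X
  unfolding qP qform_def[of N M] using MP by (intro sum.cong) (auto simp: mult.commute)
 have pdP: "pos_def_on N P"
  unfolding pos_def_on_def
 proof (intro allI impI)
  fix X assume X: "\<exists>i\<in>N. X i ~= (0::real)"
  then obtain j where j: "j \<in> N" "X j ~= 0" by blast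
  have "\<exists>k\<in>N. PX X k ~= 0" using MP[OF j(1), of X] j(2) by (metis (no_types, lifting) mult_zero_right sum.neutral)
  thus "0 < qform N P X" unfolding qPM using pdM unfolding pos_def_on_def by blast
 qed
 have low: "d * qform N P X <= qform N A X" for X
 proof -
  obtain c where c: "\<forall>n\<in>N. X n = (\<Sum>i\<in>I. c i * S i n)"
   and cd: "d * (\<Sum>i\<in>I. Dg i * (c i)^2) <= qform N A X" using lower by blast
  let ?q = "qform N P X" and ?s = "St (PX X)"
  have "?q = (\<Sum>n\<in>N. PX X n * (\<Sum>i\<in>I. c i * S i n))" unfolding qP using c by (intro sum.cong) auto
  also have "... = (\<Sum>n\<in>N. \<Sum>i\<in>I. c i * (S i n * PX X n))"
   by (simp add: sum_distrib_left mult_ac)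
  also have "... = (\<Sum>i\<in>I. c i * ?s i)" unfolding St_def sum_distrib_left by (rule sum.swap)
  also have "... <= (\<Sum>i\<in>I. (Dg i * (c i)^2 + inverse (Dg i) * (?s i)^2) / 2)"
  proof (rule sum_mono)
   fix i assume "i \<in> I"
   hence "Dg i > 0" using Dg by simp
   \<comment> \<open>Young's inequality with weight \<open>Dg i\<close>. After summation its second
     half is \<open>?q / 2\<close>, which is absorbed on the left.\<close>
   have "0 <= (Dg i * c i - ?s i)^2 / Dg i" using \<open>Dg i > 0\<close> by simp
   also have "... = Dg i * (c i)^2 + inverse (Dg i) * (?s i)^2 - 2 * (c i * ?s i)"
    using \<open>Dg i > 0\<close> by (simp add: field_simps power2_eq_square)
   finally show "c i * ?s i <= (Dg i * (c i)^2 + inverse (Dg i) * (?s i)^2) / 2" by simp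
  qed
  also have "... = ((\<Sum>i\<in>I. Dg i * (c i)^2) + ?q) / 2"
   unfolding qPM qM by (simp add: sum.distrib flip: sum_divide_distrib)
  finally have "?q <= (\<Sum>i\<in>I. Dg i * (c i)^2)" by simp
  hence "d * ?q <= d * (\<Sum>i\<in>I. Dg i * (c i)^2)" using \<open>d > 0\<close> by simp
  thus ?thesis using cd by linarith
 qed
 have up: "qform N A X <= D * qform N P X" for X
 proof -
  \<comment> \<open>The minimising coefficients: they reproduce X because M inverts P, and their
    weighted norm is exactly the form of P at X.\<close>
  define c where "c = (%i. inverse (Dg i) * St (PX X) i)"
  have "(\<Sum>i\<in>I. c i * S i n) = X n" if "n \<in> N" for n
  proof -
   have "(\<Sum>i\<in>I. c i * S i n) = (\<Sum>i\<in>I. \<Sum>k\<in>N. S i n * inverse (Dg i) * S i k * PX X k)"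
    unfolding c_def St_def by (simp add: sum_distrib_left sum_distrib_right mult_ac)
   also have "... = (\<Sum>k\<in>N. M n k * PX X k)" unfolding M sum_distrib_right by (rule sum.swap)
   finally show ?thesis using MP[OF that] by simp
  qed
  hence "qform N A X = qform N A (%n. \<Sum>i\<in>I. c i * S i n)"
   unfolding qform_def by (intro sum.cong) auto
  also have "... <= D * (\<Sum>i\<in>I. Dg i * (c i)^2)" by (rule upper)
  also have "(\<Sum>i\<in>I. Dg i * (c i)^2) = qform N P X"
   unfolding qPM qM c_def using Dg by (intro sum.cong HOL.refl) (auto simp: power_mult_distrib power2_eq_square field_simps)
  finally show ?thesis .
 qed
 show ?thesis using P pdP low up by blast
qed

section \<open>Determinants, barycentric coordinates and triangles\<close>

lemma det2_simps:
 "det2 (x + y) z = det2 x z + det2 y z" "det2 z (x + y) = det2 z x + det2 z y"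
 "det2 (x - y) z = det2 x z - det2 y z" "det2 z (x - y) = det2 z x - det2 z y"
 "det2 (k *R x) z = k * det2 x z" "det2 z (k *R x) = k * det2 z x"
 "det2 (- x) z = - det2 x z" "det2 z (- x) = - det2 z x"
 "det2 x x = 0" "det2 0 x = 0" "det2 x 0 = 0"
 by (simp_all add: det2_def algebra_simps)

lemma det2_swap: "det2 y x = - det2 x y"
 by (simp add: det2_def)

lemma inner_2: "(x::real^2) \<bullet> y = x $ 1 * y $ 1 + x $ 2 * y $ 2"
 by (simp add: inner_vec_def sum_2)

lemma point_eqI: "x $ 1 = y $ 1 ==> x $ 2 = y $ 2 ==> x = (y :: real^2)"
 by (simp add: vec_eq_iff forall_2)

lemma det2_le_norm: "\<bar>det2 x y\<bar> <= norm x * norm y"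
proof -
 have "(det2 x y)^2 + (x \<bullet> y)^2 = (norm x * norm y)^2"
  unfolding power_mult_distrib power2_norm_eq_inner
  by (simp add: det2_def inner_2 power2_eq_square algebra_simps)
 hence "(det2 x y)^2 <= (norm x * norm y)^2" by (metis le_add_same_cancel1 zero_le_power2)
 thus ?thesis by (metis abs_le_square_iff abs_mult abs_norm_cancel)
qed

fun nd :: "ltri => bool" where "nd (a, b, c) = (det2 (b - a) (c - a) ~= 0)"
fun ar :: "ltri => real" where "ar (a, b, c) = \<bar>det2 (b - a) (c - a)\<bar> / 2"
text \<open>Squared size: squared refinement edge plus four times the squared median. Unlike the
  squared diameter it is halved exactly by every bisection, as the area is. So
  \<open>Qs / ar\<close> is constant on each tree of the forest, which is the shape regularity of
  newest vertex bisection.\<close>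

fun Qs :: "ltri => real" where "Qs (a, b, c) = (norm (b - a))^2 + 4 * (norm (c - midpoint a b))^2"

lemma ar_pos: "nd t ==> ar t > 0" by (cases t) auto
lemma ar_nonneg [simp]: "ar t >= 0" by (cases t) auto
lemma Qs_nonneg [simp]: "Qs t >= 0" by (cases t) auto

lemma det2_zero_collinear:
 assumes "x ~= 0" "det2 x y = 0" shows "\<exists>k. y = k *R x"
proof -
 have xx: "x \<bullet> x ~= 0" using assms by simp
 have "(x \<bullet> x) *R y = (x \<bullet> y) *R x"
  using assms(2) by (intro point_eqI) (simp_all add: inner_2 det2_def, algebra+)
 hence "y = ((x \<bullet> y) / (x \<bullet> x)) *R x"
  using xx by (metis (no_types, lifting) divideR_right scaleR_scaleR divide_inverse_commute)
 thus ?thesis by blast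
qed

lemma collinear_det2: "collinear {a, b, c} \<longleftrightarrow> det2 (b - a) (c - a) = 0"
proof -
 have "collinear {a, b, c} \<longleftrightarrow> collinear {0, b - a, c - a}"
  using collinear_3[of b a c] by (simp add: insert_commute)
 also have "... \<longleftrightarrow> det2 (b - a) (c - a) = 0"
 proof
  assume "collinear {0, b - a, c - a}"
  then consider "b - a = 0" | "c - a = 0" | k where "c - a = k *R (b - a)"
   unfolding collinear_lemma by blast
  thus "det2 (b - a) (c - a) = 0"
  proof cases
   case 3
   thus ?thesis by (simp only: det2_simps(6,9) mult_zero_right)
  qed (simp_all only: det2_simps(10,11))
 next
  assume "det2 (b - a) (c - a) = 0"
  thus "collinear {0, b - a, c - a}"
   unfolding collinear_lemma using det2_zero_collinear[of "b - a" "c - a"] by blast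
 qed
 finally show ?thesis .
qed

lemma nd_iff: "nd t \<longleftrightarrow> \<not> collinear (verts t)"
 by (cases t) (simp add: collinear_det2)

lemma nd_rot: "nd (a, b, c) ==> nd (b, c, a)" "nd (a, b, c) ==> nd (c, a, b)" "nd (a, b, c) ==> nd (b, a, c)"
 by (auto simp: det2_def algebra_simps)

lemma nd_distinct: "nd (a, b, c) ==> a ~= b & b ~= c & a ~= c"
 by (auto simp: det2_def algebra_simps)

lemma lam_comb:
 assumes "nd (a, b, c)" "u + v + w = 1"
 shows "lam a b c (u *R a + v *R b + w *R c) = u"
proof -
 have u: "u = 1 - v - w" using assms by simp
 have "det2 (b - (u *R a + v *R b + w *R c)) (c - (u *R a + v *R b + w *R c)) = u * det2 (b - a) (c - a)"
  unfolding u by (simp add: det2_def algebra_simps)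
 thus ?thesis using assms by (simp add: lam_def)
qed

lemma lam_sum: assumes "nd (a, b, c)" shows "lam a b c x + lam b c a x + lam c a b x = 1"
proof -
 have "det2 (c - b) (a - b) = det2 (b - a) (c - a)" "det2 (a - c) (b - c) = det2 (b - a) (c - a)"
  by (simp_all add: det2_def algebra_simps)
 moreover have "det2 (b - x) (c - x) + det2 (c - x) (a - x) + det2 (a - x) (b - x) = det2 (b - a) (c - a)"
  by (simp add: det2_def algebra_simps)
 ultimately show ?thesis using assms by (simp add: lam_def flip: add_divide_distrib)
qed

lemma lam_rep: assumes "nd (a, b, c)"
 shows "x = lam a b c x *R a + lam b c a x *R b + lam c a b x *R c"
proof -
 let ?D = "det2 (b - a) (c - a)"
 have D: "?D ~= 0" using assms by simp
 have e: "det2 (c - b) (a - b) = ?D" "det2 (a - c) (b - c) = ?D"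
  by (simp_all add: det2_def algebra_simps)
 have "?D *R x = det2 (b - x) (c - x) *R a + det2 (c - x) (a - x) *R b + det2 (a - x) (b - x) *R c"
  by (intro point_eqI) (simp_all add: det2_def algebra_simps)
 hence "(1 / ?D) *R (?D *R x) = (1 / ?D) *R (det2 (b - x) (c - x) *R a + det2 (c - x) (a - x) *R b + det2 (a - x) (b - x) *R c)"
  by simp
 thus ?thesis using D by (simp add: lam_def e scaleR_add_right)
qed

text \<open>The constant gradient of the barycentric coordinate \<open>lam z p q\<close>.\<close>

definition bg :: "point => point => point => point" where
 "bg z p q = (1 / det2 (p - z) (q - z)) *R vector [(p - q) $ 2, (q - p) $ 1]"

fun bgr :: "ltri => point => point" where
 "bgr (a, b, c) z = (if z = a then bg a b c else if z = b then bg b c a else bg c a b)"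

lemma lam_affine: "lam z p q x = lam z p q y + bg z p q \<bullet> (x - y)"
proof -
 have "det2 (p - x) (q - x) = det2 (p - y) (q - y) + vector [(p - q) $ 2, (q - p) $ 1] \<bullet> (x - y)"
  by (simp add: det2_def inner_2 algebra_simps)
 thus ?thesis by (simp add: lam_def bg_def add_divide_distrib)
qed

lemma bary_affine: "bary t z x = bary t z y + bgr t z \<bullet> (x - y)"
 by (cases t) (auto intro: lam_affine)

lemma bary_simps:
 assumes "nd (a, b, c)"
 shows "bary (a, b, c) a x = lam a b c x" "bary (a, b, c) b x = lam b c a x" "bary (a, b, c) c x = lam c a b x"
  "bgr (a, b, c) a = bg a b c" "bgr (a, b, c) b = bg b c a" "bgr (a, b, c) c = bg c a b"
 using nd_distinct[OF assms] by auto

lemma finite_verts [simp]: "finite (verts t)" by (cases t) auto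

lemma card_verts: "nd t ==> card (verts t) = 3"
 by (cases t) (use nd_distinct in \<open>fastforce simp del: nd.simps\<close>)

lemma verts_sum: assumes "nd (a, b, c)" shows "(\<Sum>z\<in>{a, b, c}. f z) = f a + f b + (f c :: 'a::ab_group_add)"
 using nd_distinct[OF assms] by (simp add: algebra_simps)

lemma bary_sum: "nd t ==> (\<Sum>z\<in>verts t. bary t z x) = 1"
 by (cases t) (simp only: verts.simps verts_sum bary_simps lam_sum)

lemma bary_rep: "nd t ==> (\<Sum>z\<in>verts t. bary t z x *R z) = x"
 by (cases t) (simp only: verts.simps verts_sum bary_simps lam_rep[symmetric])

lemma bary_unique:
 assumes "nd t" "sum u (verts t) = 1" "z \<in> verts t"
 shows "bary t z (\<Sum>y\<in>verts t. u y *R y) = u z"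
proof -
 obtain a b c where t: "t = (a, b, c)" by (cases t)
 have n: "nd (a, b, c)" using assms t by simp
 have s: "u a + u b + u c = 1" using assms(2) unfolding t verts.simps verts_sum[OF n] .
 show ?thesis
  using assms(3) lam_comb[OF n s] lam_comb[OF nd_rot(1)[OF n], of "u b" "u c" "u a"]
   lam_comb[OF nd_rot(2)[OF n], of "u c" "u a" "u b"] s
  unfolding t verts.simps verts_sum[OF n] by (auto simp: bary_simps[OF n] algebra_simps simp del: bary.simps)
qed

lemma bary_vertex:
 assumes "nd t" "z \<in> verts t" "y \<in> verts t" shows "bary t z y = (if z = y then 1 else 0)"
proof -
 have "(\<Sum>w\<in>verts t. (if w = y then 1 else 0) *R w) = (\<Sum>w\<in>verts t. if w = y then w else 0)"
  by (intro sum.cong) auto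
 hence "(\<Sum>w\<in>verts t. (if w = y then 1 else 0) *R w) = y" using assms by simp
 moreover have "(\<Sum>w\<in>verts t. (if w = y then 1 else 0::real)) = 1" using assms by simp
 ultimately show ?thesis using bary_unique[OF assms(1) _ assms(2), of "%w. if w = y then 1 else 0"]
  by simp
qed

lemma tri_iff: assumes "nd t" shows "x \<in> tri t \<longleftrightarrow> (\<forall>z\<in>verts t. bary t z x >= 0)"
proof
 assume "x \<in> tri t"
 then obtain u where u: "\<forall>y\<in>verts t. 0 <= u y" "sum u (verts t) = 1" "(\<Sum>y\<in>verts t. u y *R y) = x"
  unfolding tri_def convex_hull_finite[OF finite_verts] by blast
 show "\<forall>z\<in>verts t. bary t z x >= 0" using bary_unique[OF assms u(2)] u(1) unfolding u(3) by simp
next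
 assume a: "\<forall>z\<in>verts t. bary t z x >= 0"
 show "x \<in> tri t"
  unfolding tri_def convex_hull_finite[OF finite_verts] mem_Collect_eq
  by (rule exI[of _ "%z. bary t z x"]) (use a bary_sum[OF assms, of x] bary_rep[OF assms, of x] in simp)
qed

text \<open>Faces in barycentric form. It translates the intersection condition in
  \<open>conforming\<close> into the vanishing of coordinates.\<close>

lemma hull_sub_iff:
 assumes "nd t" "W \<subseteq> verts t"
 shows "x \<in> convex hull W \<longleftrightarrow> x \<in> tri t & (\<forall>z\<in>verts t - W. bary t z x = 0)"
proof
 assume x: "x \<in> convex hull W"
 have fW: "finite W" using assms(2) by (rule finite_subset) simp
 obtain u where u: "\<forall>y\<in>W. 0 <= u y" "sum u W = 1" "(\<Sum>y\<in>W. u y *R y) = x"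
  using x unfolding convex_hull_finite[OF fW] by blast
 let ?u = "%y. if y \<in> W then u y else 0"
 have s1: "sum ?u (verts t) = 1"
  using sum.mono_neutral_right[OF finite_verts assms(2), of ?u] u(2) by simp
 have s2: "(\<Sum>y\<in>verts t. ?u y *R y) = x"
  using sum.mono_neutral_right[OF finite_verts assms(2), of "%y. ?u y *R y"] u(3) by simp
 have "\<forall>z\<in>verts t - W. bary t z x = 0" using bary_unique[OF assms(1) s1] unfolding s2 by auto
 moreover have "x \<in> tri t" using x hull_mono[OF assms(2)] unfolding tri_def by blast
 ultimately show "x \<in> tri t & (\<forall>z\<in>verts t - W. bary t z x = 0)" by blast
next
 assume a: "x \<in> tri t & (\<forall>z\<in>verts t - W. bary t z x = 0)"
 have fW: "finite W" using assms(2) by (rule finite_subset) simp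
 have "(\<Sum>z\<in>W. bary t z x) = 1"
  using sum.mono_neutral_right[OF finite_verts assms(2), of "%z. bary t z x"] a bary_sum[OF assms(1)] by simp
 moreover have "(\<Sum>z\<in>W. bary t z x *R z) = x"
  using sum.mono_neutral_right[OF finite_verts assms(2), of "%z. bary t z x *R z"] a bary_rep[OF assms(1)] by simp
 ultimately show "x \<in> convex hull W"
  unfolding convex_hull_finite[OF fW] mem_Collect_eq
  by (intro exI[of _ "%z. bary t z x"]) (use a assms tri_iff[OF assms(1)] in auto)
qed

text \<open>The interior in coordinates: open, dense in \<open>tri t\<close> and of the same
  measure. Overlaps of triangles are tested with it, so that shared edges and vertices do not
  count.\<close>

definition otri :: "ltri => point set" where
 "otri t = {x. \<forall>z\<in>verts t. bary t z x > 0}"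

lemma otri_sub: "nd t ==> otri t \<subseteq> tri t"
 by (auto simp: otri_def tri_iff less_imp_le)

lemma open_otri: "open (otri t)"
proof -
 have "otri t = (\<Inter>z\<in>verts t. {x. bary t z x > 0})" by (auto simp: otri_def)
 moreover have "open {x. bary t z x > 0}" for z
  by (subst bary_affine[of _ _ _ 0]) (intro open_Collect_less continuous_intros)
 ultimately show ?thesis by auto
qed

lemma closed_tri: "closed (tri t)" and compact_tri: "compact (tri t)" and convex_tri: "convex (tri t)"
proof -
 show "compact (tri t)" unfolding tri_def by (intro compact_convex_hull finite_imp_compact finite_verts)
 thus "closed (tri t)" by (rule compact_imp_closed)
 show "convex (tri t)" by (simp add: tri_def)
qed

lemma bary_convex: "bary t z ((1 - s) *R x + s *R y) = (1 - s) * bary t z x + s * bary t z y"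
proof -
 have "bary t z ((1 - s) *R x + s *R y) = bary t z x + bgr t z \<bullet> (s *R (y - x))"
  by (subst bary_affine[of _ _ _ x]) (simp add: algebra_simps)
 also have "... = (1 - s) * bary t z x + s * bary t z y"
  by (subst bary_affine[of t z y x]) (simp add: algebra_simps)
 finally show ?thesis .
qed

lemma otri_nonempty: assumes "nd t" shows "\<exists>x. x \<in> otri t"
proof -
 let ?u = "%_::point. 1/3 :: real"
 have "sum ?u (verts t) = 1" using card_verts[OF assms] by simp
 from bary_unique[OF assms this] have "(\<Sum>y\<in>verts t. (1/3) *R y) \<in> otri t" unfolding otri_def mem_Collect_eq
  by (metis zero_less_divide_1_iff zero_less_numeral)
 thus ?thesis by blast
qed

lemma tri_closure_otri: assumes "nd t" shows "tri t \<subseteq> closure (otri t)"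
proof
 fix x assume x: "x \<in> tri t"
 obtain y where y: "y \<in> otri t" using otri_nonempty[OF assms] by blast
 let ?f = "%n. (1 - inverse (real (Suc n))) *R x + inverse (real (Suc n)) *R y"
 have "?f n \<in> otri t" for n
  unfolding otri_def mem_Collect_eq
 proof
  fix z assume z: "z \<in> verts t"
  have b: "bary t z x >= 0" "bary t z y > 0" using x y z tri_iff[OF assms] by (auto simp: otri_def)
  have "inverse (real (Suc n)) <= 1" by (simp add: field_simps)
  hence "0 <= (1 - inverse (real (Suc n))) * bary t z x" using b(1) by (intro mult_nonneg_nonneg) auto
  moreover have "0 < inverse (real (Suc n)) * bary t z y" using b(2) by (intro mult_pos_pos) auto
  ultimately show "bary t z (?f n) > 0" unfolding bary_convex by linarith
 qed
 moreover have "?f \<longlonglongrightarrow> (1 - 0) *R x + 0 *R y"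
  by (intro tendsto_intros LIMSEQ_inverse_real_of_nat)
 ultimately show "x \<in> closure (otri t)" unfolding closure_sequential by (metis (no_types, lifting) add.right_neutral diff_zero scaleR_one scale_zero_left)
qed

lemma otri_meets: assumes "nd t" "open U" "U \<inter> tri t ~= {}" shows "U \<inter> otri t ~= {}"
 using tri_closure_otri[OF assms(1)] assms(2,3) open_Int_closure_eq_empty by blast

lemma interior_tri_sub: assumes "nd t" shows "interior (tri t) \<subseteq> otri t"
proof
 fix x assume x: "x \<in> interior (tri t)"
 then obtain e where e: "e > 0" "ball x e \<subseteq> tri t" by (meson mem_interior)
 show "x \<in> otri t"
  unfolding otri_def mem_Collect_eq
 proof
  fix z assume z: "z \<in> verts t"
  obtain y where y: "y \<in> otri t" using otri_nonempty[OF assms] by blast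
  hence yz: "bary t z y > 0" using z by (simp add: otri_def)
  \<comment> \<open>Moving x slightly away from an inner point y stays inside the triangle, where
    coordinates are nonnegative. The positive coordinate at y then forces the one at x to be
    positive.\<close>
  define s where "s = e / (2 * (norm (x - y) + 1))"
  have s: "s > 0" using e by (simp add: s_def add_nonneg_pos)
  have "norm (s *R (x - y)) < e"
  proof -
   have "norm (s *R (x - y)) = e * (norm (x - y) / (2 * (norm (x - y) + 1)))" using e by (simp add: s_def abs_of_pos add_nonneg_pos)
   also have "... < e * 1"
   proof (rule mult_strict_left_mono[OF _ e(1)])
    have "2 * (norm (x - y) + 1) > 0" "norm (x - y) < 2 * (norm (x - y) + 1)"
     using norm_ge_zero[of "x - y"] by (simp_all add: add_nonneg_pos del: norm_ge_zero)
    thus "norm (x - y) / (2 * (norm (x - y) + 1)) < 1" by (simp only: divide_less_eq_1_pos)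
   qed
   finally show ?thesis by simp
  qed
  hence "x + s *R (x - y) \<in> tri t" using e by (auto simp: dist_norm)
  hence "0 <= bary t z (x + s *R (x - y))" using tri_iff[OF assms] z by blast
  also have "... = bary t z x + s * (bary t z x - bary t z y)"
   by (subst bary_affine[of _ _ _ x], subst (2) bary_affine[of _ _ x y]) simp
  finally have "s * bary t z y <= (1 + s) * bary t z x" by (simp add: algebra_simps)
  moreover have "s * bary t z y > 0" using s yz by simp
  ultimately show "bary t z x > 0" using s by (smt (verit) zero_less_mult_iff)
 qed
qed

lemma negligible_tri_boundary: assumes "nd t" shows "negligible (tri t - otri t)"
proof -
 have "tri t - otri t \<subseteq> frontier (tri t)"
  using interior_tri_sub[OF assms] closed_tri[of t] by (auto simp: frontier_def)
 moreover have "negligible (frontier (tri t))" by (rule negligible_convex_frontier[OF convex_tri])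
 ultimately show ?thesis using negligible_subset by blast
qed

lemma measure_tri: "measure lebesgue (tri t) = ar t"
proof (cases t)
 case (fields a b c)
 have "convex hull {a, b, c} \<in> sets lborel"
  using closed_tri[of t] unfolding fields tri_def by (simp add: borel_closed)
 hence "measure lebesgue (convex hull {a, b, c}) = measure lborel (convex hull {a, b, c})"
  by (rule measure_completion)
 also have "... = \<bar>(c$1 - a$1) * (b$2 - a$2) - (b$1 - a$1) * (c$2 - a$2)\<bar> / 2"
  by (rule content_triangle)
 also have "... = \<bar>det2 (b - a) (c - a)\<bar> / 2"
  by (simp add: det2_def abs_minus_commute mult.commute)
 finally show ?thesis unfolding fields tri_def by simp
qed

lemma lmeasurable_tri: "tri t \<in> lmeasurable" by (rule lmeasurable_compact[OF compact_tri])

lemma measure_otri: assumes "nd t" shows "measure lebesgue (otri t) = ar t" "otri t \<in> lmeasurable"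
proof -
 have d: "otri t = tri t - (tri t - otri t)" using otri_sub[OF assms] by blast
 show l: "otri t \<in> lmeasurable"
  using lmeasurable_negligible_symdiff[OF lmeasurable_tri[of t], of "otri t"] negligible_tri_boundary[OF assms] otri_sub[OF assms]
  by (metis Diff_eq_empty_iff sup_bot.right_neutral)
 show "measure lebesgue (otri t) = ar t"
  using measure_negligible_symdiff[OF lmeasurable_tri[of t], of "otri t"] negligible_tri_boundary[OF assms] otri_sub[OF assms]
   measure_tri[of t] by (metis Diff_eq_empty_iff sup_bot.right_neutral)
qed

subsection \<open>Bisection\<close>

lemma midpoint_rep: "u *R a + v *R b + w *R c = (u - v) *R a + w *R c + (2 * v) *R midpoint a b"
 "u *R a + v *R b + w *R c = w *R c + (v - u) *R b + (2 * u) *R midpoint a b"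
 by (simp_all add: midpoint_def algebra_simps flip: scaleR_add_left)

lemma nd_bisect:
 assumes "nd (a, b, c)"
 shows "nd (a, c, midpoint a b)" "nd (c, b, midpoint a b)"
  "ar (a, c, midpoint a b) = ar (a, b, c) / 2" "ar (c, b, midpoint a b) = ar (a, b, c) / 2"
proof -
 have "det2 (c - a) (midpoint a b - a) = - det2 (b - a) (c - a) / 2"
  "det2 (b - c) (midpoint a b - c) = - det2 (b - a) (c - a) / 2"
  by (simp_all add: midpoint_def det2_def field_simps)
 thus "nd (a, c, midpoint a b)" "nd (c, b, midpoint a b)"
  "ar (a, c, midpoint a b) = ar (a, b, c) / 2" "ar (c, b, midpoint a b) = ar (a, b, c) / 2"
  using assms by auto
qed

lemma Qs_bisect: "Qs (a, c, midpoint a b) = Qs (a, b, c) / 2" "Qs (c, b, midpoint a b) = Qs (a, b, c) / 2"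
 unfolding Qs.simps power2_norm_eq_inner
 by (simp_all add: midpoint_def inner_2 algebra_simps power2_eq_square)

text \<open>Rewriting x over the vertices of a child by replacing equal amounts of a and b by the
  midpoint shows that child coordinates are combinations of parent coordinates. Questions about
  bisection thus become linear inequalities in the latter.\<close>

lemma lam_bisect:
 assumes "nd (a, b, c)" and m: "m = midpoint a b"
 shows "lam a c m x = lam a b c x - lam b c a x" "lam c m a x = lam c a b x" "lam m a c x = 2 * lam b c a x"
  "lam c b m x = lam c a b x" "lam b m c x = lam b c a x - lam a b c x" "lam m c b x = 2 * lam a b c x"
proof -
 let ?u = "lam a b c x" and ?v = "lam b c a x" and ?w = "lam c a b x"
 have s: "?u + ?v + ?w = 1" by (rule lam_sum[OF assms(1)])
 note n = nd_bisect(1,2)[OF assms(1), folded m]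
 have e1: "x = (?u - ?v) *R a + ?w *R c + (2 * ?v) *R m"
  and e2: "x = ?w *R c + (?v - ?u) *R b + (2 * ?u) *R m"
  using lam_rep[OF assms(1), of x] midpoint_rep[of ?u a ?v b ?w c] unfolding m by simp_all
 show "lam a c m x = ?u - ?v" by (subst e1, rule lam_comb[OF n(1)]) (use s in simp)
 show "lam c b m x = ?w" by (subst e2, rule lam_comb[OF n(2)]) (use s in simp)
 have e1': "x = ?w *R c + (2 * ?v) *R m + (?u - ?v) *R a" "x = (2 * ?v) *R m + (?u - ?v) *R a + ?w *R c"
  and e2': "x = (?v - ?u) *R b + (2 * ?u) *R m + ?w *R c" "x = (2 * ?u) *R m + ?w *R c + (?v - ?u) *R b"
  using e1 e2 by (simp_all only: add_ac)
 show "lam c m a x = ?w" by (subst e1'(1), rule lam_comb[OF nd_rot(1)[OF n(1)]]) (use s in simp)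
 show "lam m a c x = 2 * ?v" by (subst e1'(2), rule lam_comb[OF nd_rot(2)[OF n(1)]]) (use s in simp)
 show "lam b m c x = ?v - ?u" by (subst e2'(1), rule lam_comb[OF nd_rot(1)[OF n(2)]]) (use s in simp)
 show "lam m c b x = 2 * ?u" by (subst e2'(2), rule lam_comb[OF nd_rot(2)[OF n(2)]]) (use s in simp)
qed

lemma bg_unique:
 assumes "\<And>x. lam z p q x = k * lam z1 p1 q1 x + l * lam z2 p2 q2 x"
 shows "bg z p q = k *R bg z1 p1 q1 + l *R bg z2 p2 q2"
proof -
 have "bg z p q \<bullet> x = (k *R bg z1 p1 q1 + l *R bg z2 p2 q2) \<bullet> x" for x
  using assms[of x] assms[of 0] lam_affine[of z p q x 0] lam_affine[of z1 p1 q1 x 0] lam_affine[of z2 p2 q2 x 0]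
  by (simp add: algebra_simps)
 thus ?thesis using vector_eq_rdot by blast
qed

lemma bg_bisect:
 assumes "nd (a, b, c)" and m: "m = midpoint a b"
 shows "bg a c m = bg a b c - bg b c a" "bg c m a = bg c a b" "bg m a c = 2 *R bg b c a"
  "bg c b m = bg c a b" "bg b m c = bg b c a - bg a b c" "bg m c b = 2 *R bg a b c"
 using bg_unique[of a c m 1 a b c "-1" b c a] bg_unique[of c m a 1 c a b 0 a b c]
  bg_unique[of m a c 2 b c a 0 a b c] bg_unique[of c b m 1 c a b 0 a b c]
  bg_unique[of b m c 1 b c a "-1" a b c] bg_unique[of m c b 2 a b c 0 a b c] lam_bisect[OF assms]
 by simp_all

lemma tri_lam: assumes "nd (a, b, c)"
 shows "x \<in> tri (a, b, c) \<longleftrightarrow> lam a b c x >= 0 & lam b c a x >= 0 & lam c a b x >= 0"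
  "x \<in> otri (a, b, c) \<longleftrightarrow> lam a b c x > 0 & lam b c a x > 0 & lam c a b x > 0"
 unfolding tri_iff[OF assms] otri_def verts.simps by (auto simp: bary_simps[OF assms] simp del: bary.simps)

lemma tri_bisect:
 assumes "nd (a, b, c)" and m: "m = midpoint a b"
 shows "x \<in> tri (a, c, m) \<longleftrightarrow> lam a b c x >= lam b c a x & lam b c a x >= 0 & lam c a b x >= 0"
  "x \<in> tri (c, b, m) \<longleftrightarrow> lam b c a x >= lam a b c x & lam a b c x >= 0 & lam c a b x >= 0"
  "x \<in> otri (a, c, m) \<longleftrightarrow> lam a b c x > lam b c a x & lam b c a x > 0 & lam c a b x > 0"
  "x \<in> otri (c, b, m) \<longleftrightarrow> lam b c a x > lam a b c x & lam a b c x > 0 & lam c a b x > 0"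
 using nd_bisect(1,2)[OF assms(1), folded m] by (auto simp: tri_lam lam_bisect[OF assms] simp del: nd.simps)

definition child :: "ltri => ltri => bool" where "child t s \<longleftrightarrow> s \<in> bisect t"

lemma child_cases:
 assumes "child t s" obtains a b c where "t = (a, b, c)" "s = (a, c, midpoint a b) | s = (c, b, midpoint a b)"
 using assms unfolding child_def by (cases t) auto

lemma child_props:
 assumes "child t s" "nd t"
 shows "nd s" "ar s = ar t / 2" "Qs s = Qs t / 2" "tri s \<subseteq> tri t" "otri s \<subseteq> otri t"
proof -
 obtain a b c where t: "t = (a, b, c)" and s: "s = (a, c, midpoint a b) | s = (c, b, midpoint a b)"
  using assms(1) by (rule child_cases)
 have n: "nd (a, b, c)" using assms t by simp
 show "nd s" "ar s = ar t / 2" "Qs s = Qs t / 2" using s nd_bisect[OF n] Qs_bisect unfolding t by auto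
 show "tri s \<subseteq> tri t" "otri s \<subseteq> otri t"
  using s unfolding t by (auto simp: tri_bisect[OF n HOL.refl] tri_lam[OF n] simp del: nd.simps)
qed

lemma bisect_cover: assumes "nd t" shows "\<Union> (tri ` bisect t) = tri t"
proof -
 obtain a b c where t: "t = (a, b, c)" by (cases t)
 have n: "nd (a, b, c)" using assms t by simp
 show ?thesis unfolding t by (auto simp: tri_bisect[OF n HOL.refl] tri_lam[OF n] simp del: nd.simps)
qed

lemma bisect_disjoint: assumes "nd t" "s \<in> bisect t" "s' \<in> bisect t" "s ~= s'" shows "otri s \<inter> otri s' = {}"
proof -
 obtain a b c where t: "t = (a, b, c)" by (cases t)
 have n: "nd (a, b, c)" using assms t by simp
 show ?thesis using assms(2-4) unfolding t by (auto simp: tri_bisect[OF n HOL.refl] simp del: nd.simps)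
qed

lemma bisect_distinct: assumes "nd (a, b, c)" shows "(a, c, midpoint a b) ~= (c, b, midpoint a b)"
 using nd_distinct[OF assms] by auto

subsection \<open>Diameter bounds\<close>

lemma edge_le_Qs: assumes "p \<in> verts t" "q \<in> verts t" shows "(norm (p - q))^2 <= Qs t"
proof -
 obtain a b c where t: "t = (a, b, c)" by (cases t)
 \<comment> \<open>Apollonius' theorem: \<open>Qs\<close> is also twice the sum of the other two
   squared edges.\<close>
 have e: "2 * ((norm (c - a))^2 + (norm (c - b))^2) = Qs t" unfolding t Qs.simps power2_norm_eq_inner
  by (simp add: midpoint_def inner_2 algebra_simps power2_eq_square)
 have ab: "(norm (a - b))^2 <= Qs t" unfolding t by (simp add: norm_minus_commute)
 have ac: "(norm (c - a))^2 <= Qs t"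
  using e zero_le_power2[of "norm (c - a)"] zero_le_power2[of "norm (c - b)"] unfolding distrib_left by linarith
 have bc: "(norm (c - b))^2 <= Qs t"
  using e zero_le_power2[of "norm (c - a)"] zero_le_power2[of "norm (c - b)"] unfolding distrib_left by linarith
 show ?thesis using assms ab ac bc unfolding t by (auto simp: norm_minus_commute)
qed

lemma tri_dist: assumes "x \<in> tri t" "y \<in> tri t" shows "dist x y <= sqrt (Qs t)"
proof -
 have v: "dist p q <= sqrt (Qs t)" if "p \<in> verts t" "q \<in> verts t" for p q
  using edge_le_Qs[OF that] by (simp add: dist_norm real_le_rsqrt)
 have 1: "dist p x <= sqrt (Qs t)" if "p \<in> verts t" for p
 proof -
  have "convex hull (verts t) \<subseteq> cball p (sqrt (Qs t))" using v[OF that] by (intro hull_minimal) auto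
  thus ?thesis using assms(1) unfolding tri_def by auto
 qed
 have "convex hull (verts t) \<subseteq> cball x (sqrt (Qs t))" using 1 by (intro hull_minimal) (auto simp: dist_commute)
 thus ?thesis using assms(2) unfolding tri_def by auto
qed

lemma verts_tri: "z \<in> verts t ==> z \<in> tri t" unfolding tri_def by (simp add: hull_inc)

text \<open>The coordinate of z falls from 1 to 0 along an edge, whose squared length is at most
  \<open>Qs t\<close>. It later bounds the diagonal entries of the form from below.\<close>

lemma norm_bgr_ge: assumes "nd t" "z \<in> verts t" shows "1 <= (norm (bgr t z))^2 * Qs t"
proof -
 obtain p where p: "p \<in> verts t" "p ~= z"
  using card_verts[OF assms(1)] assms(2)
  by (metis card_1_singletonE card.infinite is_singletonI' is_singleton_altdef numeral_eq_one_iff semiring_norm(86) empty_iff)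
 have "1 = bgr t z \<bullet> (z - p)"
  using bary_affine[of t z z p] bary_vertex[OF assms(1,2) assms(2)] bary_vertex[OF assms(1,2) p(1)] p(2) by auto
 also have "... <= norm (bgr t z) * norm (z - p)" by (rule norm_cauchy_schwarz)
 finally have "1 <= (norm (bgr t z) * norm (z - p))^2" by (simp add: one_le_power)
 also have "... <= (norm (bgr t z))^2 * Qs t" unfolding power_mult_distrib
  by (intro mult_left_mono edge_le_Qs assms p) simp
 finally show ?thesis .
qed

section \<open>Bisection forests and meshes\<close>

abbreviation desc :: "ltri => ltri => bool" where "desc \<equiv> child\<^sup>*\<^sup>*"

lemma desc_props:
 assumes "desc t s" "nd t"
 shows "nd s & ar s <= ar t & Qs s * ar t = Qs t * ar s & tri s \<subseteq> tri t & otri s \<subseteq> otri t & (s = t | ar s <= ar t / 2)"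
 using assms
proof (induction rule: rtranclp_induct)
 case base
 thus ?case by auto
next
 case (step y z)
 hence y: "nd y" by simp
 note c = child_props[OF step(2) y]
 have q: "Qs z * ar t = Qs t * ar z" using step.IH[OF step.prems] unfolding c(2,3) by simp
 show ?case using step.IH[OF step.prems] c ar_pos[OF y] by (intro conjI q) auto
qed

lemma desc_eq_ar: "desc t s ==> nd t ==> ar t <= ar s ==> s = t"
 using desc_props[of t s] ar_pos[of t] by fastforce

lemma desc_antisym: "desc t s ==> desc s t ==> nd t ==> s = t"
 using desc_eq_ar desc_props by blast

lemma desc_step: "desc t s ==> s ~= t ==> \<exists>u. child t u & desc u s"
 by (metis converse_rtranclpE)

lemma desc_step_last: "desc t s ==> s ~= t ==> \<exists>u. desc t u & child u s"
 by (metis rtranclp.cases)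

text \<open>A partition that may have hanging nodes: single bisections, the steps of
  \<open>nvb_ref\<close>, destroy conformity but not this property.\<close>

definition mesh :: "ltri set => bool" where
 "mesh T \<longleftrightarrow> finite T & (\<forall>t\<in>T. nd t) & (\<forall>t\<in>T. \<forall>t'\<in>T. t ~= t' --> otri t \<inter> otri t' = {})"

lemma meshD: "mesh T ==> finite T" "mesh T ==> t \<in> T ==> nd t"
 "mesh T ==> t \<in> T ==> t' \<in> T ==> x \<in> otri t ==> x \<in> otri t' ==> t = t'"
 unfolding mesh_def by blast+

lemma mesh_otri_tri: assumes "mesh T" "t \<in> T" "t' \<in> T" "x \<in> otri t" "x \<in> tri t'" shows "t = t'"
proof -
 have "otri t \<inter> otri t' ~= {}" using otri_meets[OF meshD(2)[OF assms(1,3)] open_otri] assms(4,5) by blast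
 thus ?thesis using meshD(3)[OF assms(1-3)] by blast
qed

lemma conformingD:
 assumes "conforming T"
 shows "finite T" "T ~= {}" "t \<in> T ==> nd t" "inj_on verts T"
  "t \<in> T ==> t' \<in> T ==> t ~= t' ==> tri t \<inter> tri t' = convex hull (verts t \<inter> verts t')"
 using assms unfolding conforming_def nd_iff by auto

lemma conforming_verts_neq:
 assumes "conforming T" "t \<in> T" "t' \<in> T" "t ~= t'" shows "\<not> verts t \<subseteq> verts t'"
proof
 assume "verts t \<subseteq> verts t'"
 hence "verts t = verts t'"
  using card_subset_eq[of "verts t'" "verts t"] card_verts conformingD(3)[OF assms(1)] assms by simp
 thus False using conformingD(4)[OF assms(1)] assms by (auto dest: inj_onD)
qed

lemma conforming_bary_zero:
 assumes "conforming T" "t \<in> T" "t' \<in> T" "x \<in> tri t" "x \<in> tri t'" "z \<in> verts t" "z \<notin> verts t'"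
 shows "bary t z x = 0"
proof -
 have "t ~= t'" using assms by blast
 hence "x \<in> convex hull (verts t \<inter> verts t')" using conformingD(5)[OF assms(1-3)] assms by blast
 thus ?thesis using hull_sub_iff[of t "verts t \<inter> verts t'" x] conformingD(3)[OF assms(1,2)] assms by auto
qed

text \<open>The point lies in the hull of the common vertices, so its coordinates in one triangle,
  extended by zero, are its coordinates in the other. Hence the choice made in \<open>hat\<close>
  does not matter.\<close>

lemma conforming_bary_eq:
 assumes c: "conforming T" and t: "t \<in> T" "t' \<in> T" "x \<in> tri t" "x \<in> tri t'" "z \<in> verts t" "z \<in> verts t'"
 shows "bary t z x = bary t' z x"
proof -
 note n = conformingD(3)[OF c t(1)] conformingD(3)[OF c t(2)]
 let ?W = "verts t \<inter> verts t'"
 let ?u = "%y. if y \<in> ?W then bary t y x else 0"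
 have zero: "\<And>y. y \<in> verts t - ?W ==> bary t y x = 0" using conforming_bary_zero[OF c t(1-4)] by blast
 have "sum ?u (verts t') = sum ?u ?W" by (rule sum.mono_neutral_right) auto
 also have "... = (\<Sum>y\<in>?W. bary t y x)" by (rule sum.cong) auto
 also have "... = (\<Sum>y\<in>verts t. bary t y x)" by (rule sum.mono_neutral_left) (use zero in auto)
 finally have s1: "sum ?u (verts t') = 1" using bary_sum[OF n(1)] by simp
 have "(\<Sum>y\<in>verts t'. ?u y *R y) = (\<Sum>y\<in>?W. ?u y *R y)" by (rule sum.mono_neutral_right) auto
 also have "... = (\<Sum>y\<in>?W. bary t y x *R y)" by (rule sum.cong) auto
 also have "... = (\<Sum>y\<in>verts t. bary t y x *R y)" by (rule sum.mono_neutral_left) (use zero in auto)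
 finally have s2: "(\<Sum>y\<in>verts t'. ?u y *R y) = x" using bary_rep[OF n(1)] by simp
 show ?thesis using bary_unique[OF n(2) s1 t(6)] t(5,6) unfolding s2 by simp
qed

lemma conforming_vertex:
 assumes "conforming T" "t \<in> T" "t' \<in> T" "z \<in> verts t" "z \<in> tri t'" shows "z \<in> verts t'"
proof (rule ccontr)
 assume "z \<notin> verts t'"
 from conforming_bary_zero[OF assms(1-3) verts_tri[OF assms(4)] assms(5,4) this]
 show False using bary_vertex[OF conformingD(3)[OF assms(1,2)] assms(4,4)] by simp
qed

lemma conforming_mesh: assumes "conforming T" shows "mesh T"
 unfolding mesh_def
proof (intro conjI ballI impI)
 show "finite T" by (rule conformingD(1)[OF assms])
 show "nd t" if "t \<in> T" for t by (rule conformingD(3)[OF assms that])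
 fix t t' assume t: "t \<in> T" "t' \<in> T" "t ~= t'"
 obtain z where z: "z \<in> verts t" "z \<notin> verts t'" using conforming_verts_neq[OF assms t] by blast
 show "otri t \<inter> otri t' = {}"
 proof (rule ccontr)
  assume "otri t \<inter> otri t' ~= {}"
  then obtain x where x: "x \<in> otri t" "x \<in> otri t'" by blast
  hence "x \<in> tri t" "x \<in> tri t'" using otri_sub conformingD(3)[OF assms] t by blast+
  from conforming_bary_zero[OF assms t(1,2) this z] x(1) z show False by (auto simp: otri_def)
 qed
qed

lemma nvb_ref_trans: "nvb_ref T' T'' ==> nvb_ref T T' ==> nvb_ref T T''"
 by (induction rule: nvb_ref.induct) (auto intro: nvb_ref.intros)

lemma nvb_ref_anc: assumes "nvb_ref T T'" "s \<in> T'" shows "\<exists>t\<in>T. desc t s"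
 using assms
proof (induction arbitrary: s rule: nvb_ref.induct)
 case (step T' t)
 then consider "s \<in> T'" | "child t s" unfolding child_def by blast
 thus ?case
 proof cases
  case 2
  thus ?thesis using step.IH[OF step(2)] by (meson rtranclp.rtrancl_into_rtrancl)
 qed (use step.IH in blast)
qed blast

lemma bisect_ne: "bisect t ~= {}" by (cases t) auto

lemma finite_bisect [simp]: "finite (bisect t)" by (cases t) auto

lemma nvb_ref_desc: assumes "nvb_ref T T'" "t \<in> T" shows "\<exists>s\<in>T'. desc t s"
 using assms
proof (induction rule: nvb_ref.induct)
 case (step T' u)
 then obtain s where s: "s \<in> T'" "desc t s" by blast
 obtain v where v: "v \<in> bisect u" using bisect_ne by blast
 show ?case
 proof (cases "s = u")
  case True
  hence "desc t v" using s v by (meson child_def rtranclp.rtrancl_into_rtrancl)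
  thus ?thesis using v by blast
 qed (use s in blast)
qed blast

lemma nvb_ref_mesh: assumes "nvb_ref T T'" "mesh T" shows "mesh T' & \<Union> (tri ` T') = \<Union> (tri ` T)"
 using assms
proof (induction rule: nvb_ref.induct)
 case (step T' t)
 hence m: "mesh T'" and u: "\<Union> (tri ` T') = \<Union> (tri ` T)" by auto
 have n: "nd t" by (rule meshD(2)[OF m step(2)])
 have c: "nd s" "otri s \<subseteq> otri t" if "s \<in> bisect t" for s using child_props[OF _ n] that unfolding child_def by blast+
 have "mesh (T' - {t} \<union> bisect t)"
  unfolding mesh_def
 proof (intro conjI ballI impI)
  show "finite (T' - {t} \<union> bisect t)" using meshD(1)[OF m] by simp
  show "nd s" if "s \<in> T' - {t} \<union> bisect t" for s using that c meshD(2)[OF m] by blast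
  fix s s' assume s: "s \<in> T' - {t} \<union> bisect t" "s' \<in> T' - {t} \<union> bisect t" "s ~= s'"
  have d: "otri r \<inter> otri r' = {}" if "r \<in> T' - {t}" "r' \<in> bisect t" for r r'
   using c(2)[OF that(2)] that(1) meshD(3)[OF m step(2), of r] by blast
  consider "s \<in> T' - {t}" "s' \<in> T' - {t}" | "s \<in> T' - {t}" "s' \<in> bisect t" | "s \<in> bisect t" "s' \<in> T' - {t}"
   | "s \<in> bisect t" "s' \<in> bisect t" using s by blast
  thus "otri s \<inter> otri s' = {}"
  proof cases
   case 1
   thus ?thesis using meshD(3)[OF m, of s s'] s(3) by blast
  next
   case 2 thus ?thesis using d by blast
  next
   case 3 thus ?thesis using d by blast
  next
   case 4 thus ?thesis using bisect_disjoint[OF n] s(3) by blast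
  qed
 qed
 moreover have "\<Union> (tri ` (T' - {t} \<union> bisect t)) = \<Union> (tri ` T')"
  using bisect_cover[OF n] step(2) by (auto 4 4)
 ultimately show ?case using u by simp
qed auto

locale forest =
 fixes T0 :: "ltri set"
 assumes mesh0: "mesh T0"
begin

definition F :: "ltri set" where "F = {s. \<exists>t\<in>T0. desc t s}"

lemma F_nd: "s \<in> F ==> nd s"
 unfolding F_def using desc_props meshD(2)[OF mesh0] by blast

lemma F_desc: "s \<in> F ==> desc s u ==> u \<in> F"
 unfolding F_def by (auto intro: rtranclp_trans)

lemma T0_F: "T0 \<subseteq> F" unfolding F_def by blast

lemma F_ref: "nvb_ref T T' ==> T \<subseteq> F ==> T' \<subseteq> F"
 using nvb_ref_anc F_desc by blast

text \<open>Dyadic structure: going down from the common ancestor, siblings have disjoint interiors,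
  so two triangles whose interiors meet must lie on the same branch.\<close>

lemma desc_nested:
 assumes "desc r s'" "desc r s" "nd r" "otri s \<inter> otri s' ~= {}" shows "desc s s' | desc s' s"
 using assms(1,4)
proof (induction rule: rtranclp_induct)
 case base
 thus ?case using assms(2) by blast
next
 case (step y z)
 have ny: "nd y" using desc_props[OF step(1) assms(3)] by blast
 have "otri s \<inter> otri y ~= {}" using child_props(5)[OF step(2) ny] step.prems by blast
 from step.IH[OF this] show ?case
 proof
  assume "desc s y"
  thus ?thesis using step(2) by (meson rtranclp.rtrancl_into_rtrancl)
 next
  assume ys: "desc y s"
  show ?thesis
  proof (cases "s = y")
   case True
   thus ?thesis using step(2) by blast
  next
   case False
   then obtain u where u: "child y u" "desc u s" using desc_step[OF ys] by blast
   have nu: "nd u" by (rule child_props(1)[OF u(1) ny])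
   have "otri s \<subseteq> otri u" using desc_props[OF u(2) nu] by blast
   hence "otri u \<inter> otri z ~= {}" using step.prems by blast
   hence "u = z" using bisect_disjoint[OF ny, of u z] u(1) step(2) unfolding child_def by blast
   thus ?thesis using u by blast
  qed
 qed
qed

lemma F_nested:
 assumes "s \<in> F" "s' \<in> F" "otri s \<inter> otri s' ~= {}" shows "desc s s' | desc s' s"
proof -
 obtain r r' where r: "r \<in> T0" "desc r s" "r' \<in> T0" "desc r' s'" using assms unfolding F_def by blast
 have "otri s \<subseteq> otri r" "otri s' \<subseteq> otri r'" using desc_props r meshD(2)[OF mesh0] by blast+
 hence "r = r'" using meshD(3)[OF mesh0 r(1,3)] assms(3) by blast
 thus ?thesis using desc_nested[of r s' s] r assms(3) meshD(2)[OF mesh0] by blast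
qed

lemma F_nested': assumes "s \<in> F" "s' \<in> F" "x \<in> otri s" "x \<in> tri s'" shows "desc s s' | desc s' s"
 using F_nested[OF assms(1,2)] otri_meets[OF F_nd[OF assms(2)] open_otri] assms(3,4) by blast

lemma unique_parent: assumes "x \<in> F" "y \<in> F" "child x s" "child y s" shows "x = y"
proof -
 note n = F_nd[OF assms(1)] F_nd[OF assms(2)]
 have "otri s \<subseteq> otri x" "otri s \<subseteq> otri y" using child_props(5) assms n by blast+
 moreover have "otri s ~= {}" using otri_nonempty child_props(1)[OF assms(3) n(1)] by blast
 ultimately have "desc x y | desc y x" using F_nested[OF assms(1,2)] by blast
 moreover have "ar x = ar y" using child_props(2)[OF assms(3) n(1)] child_props(2)[OF assms(4) n(2)] by simp
 ultimately show ?thesis using desc_eq_ar n by (metis order_refl)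
qed

lemma F_ratio: assumes "\<And>t. t \<in> T0 ==> Qs t <= sg * ar t" "s \<in> F" shows "Qs s <= sg * ar s"
proof -
 obtain t where t: "t \<in> T0" "desc t s" using assms(2) unfolding F_def by blast
 have p: "ar t > 0" using ar_pos meshD(2)[OF mesh0 t(1)] by blast
 have "Qs s * ar t = Qs t * ar s" using desc_props[OF t(2)] meshD(2)[OF mesh0 t(1)] by blast
 also have "... <= sg * ar t * ar s" using assms(1)[OF t(1)] by (intro mult_right_mono) auto
 finally have "Qs s * ar t <= (sg * ar s) * ar t" by (simp add: mult_ac)
 thus ?thesis using p by simp
qed

text \<open>A covering mesh that is finer than s on one side is finer than s on the other side too.
  An element over an inner point of u that lay strictly above u would lie above s by uniqueness of
  parents, and so overlap \<open>ka\<close>.\<close>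

lemma branch_desc:
 assumes T: "mesh T" "T \<subseteq> F" "\<Union> (tri ` T) = \<Union> (tri ` T0)" and s: "s \<in> F" "ka \<in> T" "desc s ka" "ka ~= s" and u: "child s u"
 shows "\<exists>ka'\<in>T. desc u ka'"
proof -
 have uF: "u \<in> F" using F_desc[OF s(1)] u by blast
 obtain x where x: "x \<in> otri u" using otri_nonempty[OF F_nd[OF uF]] by blast
 obtain r where r: "r \<in> T0" "desc r u" using uF unfolding F_def by blast
 have "x \<in> tri r" using x otri_sub[OF F_nd[OF uF]] desc_props[OF r(2)] meshD(2)[OF mesh0 r(1)] by blast
 then obtain k where k: "k \<in> T" "x \<in> tri k" using T(3) r(1) by blast
 have kF: "k \<in> F" using k T by blast
 have "desc u k | desc k u" using F_nested'[OF uF kF x k(2)] .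
 thus ?thesis
 proof
  assume ku: "desc k u"
  show ?thesis
  proof (cases "k = u")
   case False
   then obtain v where "desc k v" "child v u" using desc_step_last[OF ku] by blast
   hence "desc k s" using unique_parent[OF _ s(1) _ u] F_desc[OF kF] by blast
   hence "desc k ka" using s(3) by (meson rtranclp_trans)
   hence "otri ka \<subseteq> otri k" using desc_props F_nd[OF kF] by blast
   hence "k = ka" using meshD(3)[OF T(1) k(1) s(2)] otri_nonempty[OF meshD(2)[OF T(1) s(2)]] by blast
   hence "s = ka" using desc_antisym[OF s(3)] \<open>desc k s\<close> F_nd[OF s(1)] by blast
   thus ?thesis using s(4) by blast
  qed (use k in blast)
 qed (use k in blast)
qed

end

section \<open>Piecewise affine functions\<close>

text \<open>The coefficients are values of f itself, so continuity across shared edges is built in.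
  Vanishing off the mesh agrees with \<open>hat\<close> and makes the expansion an identity on the
  whole plane, as \<open>coeffs\<close> demands.\<close>

definition pwaff :: "ltri set => (point => real) => bool" where
 "pwaff T f \<longleftrightarrow> (\<forall>t\<in>T. \<forall>x\<in>tri t. f x = (\<Sum>z\<in>verts t. f z * bary t z x)) & (\<forall>x. x \<notin> \<Union> (tri ` T) --> f x = 0)"

lemma pwaffD: "pwaff T f ==> t \<in> T ==> x \<in> tri t ==> f x = (\<Sum>z\<in>verts t. f z * bary t z x)"
 "pwaff T f ==> x \<notin> \<Union> (tri ` T) ==> f x = 0"
 unfolding pwaff_def by blast+

lemma finite_nodes: "finite T ==> finite (nodes T)" by (simp add: nodes_def)

lemma nodesI: "t \<in> T ==> z \<in> verts t ==> z \<in> nodes T" by (auto simp: nodes_def)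

lemma hat_eq:
 assumes "conforming T" "t \<in> T" "x \<in> tri t"
 shows "hat T z x = (if z \<in> verts t then bary t z x else 0)"
proof (cases "\<exists>s\<in>T. x \<in> tri s & z \<in> verts s")
 case True
 define s where "s = (SOME s. s \<in> T & x \<in> tri s & z \<in> verts s)"
 have s: "s \<in> T & x \<in> tri s & z \<in> verts s" unfolding s_def by (rule someI_ex) (use True in blast)
 have "hat T z x = bary s z x" using True by (simp add: hat_def s_def)
 thus ?thesis using conforming_bary_eq[OF assms(1), of s t x z] conforming_bary_zero[OF assms(1), of s t x z] s assms by auto
next
 case False
 thus ?thesis using assms by (auto simp: hat_def)
qed

lemma hat_outside: "x \<notin> \<Union> (tri ` T) ==> hat T z x = 0"
 by (auto simp: hat_def)

lemma hat_node:
 assumes "conforming T" "y \<in> nodes T" shows "hat T z y = (if z = y then 1 else 0)"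
proof -
 obtain t where t: "t \<in> T" "y \<in> verts t" using assms by (auto simp: nodes_def)
 show ?thesis using hat_eq[OF assms(1) t(1) verts_tri[OF t(2)], of z] bary_vertex[OF conformingD(3)[OF assms(1) t(1)], of z y] t(2)
  by auto
qed

lemma hat_bounds: assumes "conforming T" shows "0 <= hat T z x" "hat T z x <= 1"
proof -
 have "0 <= hat T z x & hat T z x <= 1"
 proof (cases "x \<in> \<Union> (tri ` T)")
  case True
  then obtain t where t: "t \<in> T" "x \<in> tri t" by blast
  note n = conformingD(3)[OF assms t(1)]
  have b: "\<forall>z\<in>verts t. bary t z x >= 0" using tri_iff[OF n] t by blast
  have "bary t z x <= 1" if "z \<in> verts t"
   using bary_sum[OF n, of x] member_le_sum[OF that, of "%z. bary t z x"] b by simp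
  thus ?thesis using hat_eq[OF assms t, of z] b by auto
 qed (simp add: hat_outside)
 thus "0 <= hat T z x" "hat T z x <= 1" by auto
qed

lemma pwaff_hat: assumes "conforming T" shows "pwaff T (hat T z)"
 unfolding pwaff_def
proof (intro conjI ballI allI impI)
 fix t x assume t: "t \<in> T" "x \<in> tri t"
 have "(\<Sum>y\<in>verts t. hat T z y * bary t y x) = (\<Sum>y\<in>verts t. if y = z then bary t y x else 0)"
  using hat_node[OF assms nodesI[OF t(1)]] by (intro sum.cong) auto
 also have "... = (if z \<in> verts t then bary t z x else 0)" by simp
 also have "... = hat T z x" using hat_eq[OF assms t] by simp
 finally show "hat T z x = (\<Sum>y\<in>verts t. hat T z y * bary t y x)" by simp
qed (rule hat_outside)

lemma pwaff_sum: assumes "\<And>i. i \<in> I ==> pwaff T (f i)" shows "pwaff T (%x. \<Sum>i\<in>I. c i * f i x)"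
 unfolding pwaff_def
proof (intro conjI ballI allI impI)
 fix t x assume t: "t \<in> T" "x \<in> tri t"
 have "(\<Sum>i\<in>I. c i * f i x) = (\<Sum>i\<in>I. c i * (\<Sum>z\<in>verts t. f i z * bary t z x))"
  using pwaffD(1)[OF assms t] by (intro sum.cong) auto
 also have "... = (\<Sum>z\<in>verts t. \<Sum>i\<in>I. c i * f i z * bary t z x)"
  unfolding sum_distrib_left by (subst sum.swap) (simp add: mult.assoc)
 finally show "(\<Sum>i\<in>I. c i * f i x) = (\<Sum>z\<in>verts t. (\<Sum>i\<in>I. c i * f i z) * bary t z x)"
  by (simp add: sum_distrib_right)
next
 fix x assume "x \<notin> \<Union> (tri ` T)"
 thus "(\<Sum>i\<in>I. c i * f i x) = 0" using pwaffD(2)[OF assms] by simp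
qed

lemma pwaff_rep:
 assumes "conforming T" "pwaff T f" shows "f x = (\<Sum>z\<in>nodes T. f z * hat T z x)"
proof (cases "x \<in> \<Union> (tri ` T)")
 case True
 then obtain t where t: "t \<in> T" "x \<in> tri t" by blast
 have "(\<Sum>z\<in>nodes T. f z * hat T z x) = (\<Sum>z\<in>nodes T. if z \<in> verts t then f z * bary t z x else 0)"
  using hat_eq[OF assms(1) t] by (intro sum.cong) auto
 also have "... = (\<Sum>z\<in>verts t. f z * bary t z x)"
  using t finite_nodes[OF conformingD(1)[OF assms(1)]]
  by (subst sum.inter_restrict[symmetric]) (auto simp: nodes_def intro!: sum.cong)
 finally show ?thesis using pwaffD(1)[OF assms(2) t] by simp
next
 case False
 thus ?thesis using pwaffD(2)[OF assms(2)] hat_outside by simp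
qed

lemma pwaff_of_nodes: assumes "conforming T" shows "pwaff T (%x. \<Sum>z\<in>nodes T. X z * hat T z x)"
 by (intro pwaff_sum pwaff_hat assms)

lemma of_nodes_node:
 assumes "conforming T" "y \<in> nodes T" shows "(\<Sum>z\<in>nodes T. X z * hat T z y) = X y"
proof -
 have "(\<Sum>z\<in>nodes T. X z * hat T z y) = (\<Sum>z\<in>nodes T. if z = y then X z else 0)"
  using hat_node[OF assms] by (intro sum.cong) auto
 thus ?thesis using assms finite_nodes[OF conformingD(1)[OF assms(1)]] by simp
qed

lemma coeffs_eq:
 assumes "conforming T" "pwaff T f" "z \<in> nodes T" shows "coeffs T f z = f z"
proof -
 let ?c = "%z. if z \<in> nodes T then f z else 0"
 have "coeffs T f = ?c"
  unfolding coeffs_def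
 proof (rule the_equality)
  show "(\<forall>z. z \<notin> nodes T --> ?c z = 0) & (\<forall>x. f x = (\<Sum>z\<in>nodes T. ?c z * hat T z x))"
  proof (intro conjI allI impI)
   fix x show "f x = (\<Sum>z\<in>nodes T. ?c z * hat T z x)"
    by (subst pwaff_rep[OF assms(1,2)]) (rule sum.cong, auto)
  qed simp
  fix c assume c: "(\<forall>z. z \<notin> nodes T --> c z = 0) & (\<forall>x. f x = (\<Sum>z\<in>nodes T. c z * hat T z x))"
  show "c = ?c"
  proof
   fix z
   show "c z = ?c z"
   proof (cases "z \<in> nodes T")
    case True
    have "f z = (\<Sum>y\<in>nodes T. c y * hat T y z)" using c by blast
    thus ?thesis using of_nodes_node[OF assms(1) True, of c] True by simp
   qed (use c in simp)
  qed
 qed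
 thus ?thesis using assms(3) by simp
qed

lemma bary_sum_affine:
 "(\<Sum>z\<in>verts t. f z * bary t z y) = (\<Sum>z\<in>verts t. f z * bary t z x) + (\<Sum>z\<in>verts t. f z *R bgr t z) \<bullet> (y - x)"
proof -
 have "(\<Sum>z\<in>verts t. f z * bary t z y) = (\<Sum>z\<in>verts t. f z * (bary t z x + bgr t z \<bullet> (y - x)))"
  by (intro sum.cong HOL.refl) (metis bary_affine)
 thus ?thesis unfolding distrib_left sum.distrib inner_sum_left inner_scaleR_left .
qed

lemma affine_on_sub:
 assumes n: "nd t" "nd s" and s: "tri s \<subseteq> tri t" and f: "\<And>x. x \<in> tri t ==> f x = (\<Sum>z\<in>verts t. f z * bary t z x)"
  and x: "x \<in> tri s"
 shows "f x = (\<Sum>z\<in>verts s. f z * bary s z x)"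
proof -
 define g where "g = (\<Sum>z\<in>verts t. f z *R bgr t z)"
 have d: "(\<Sum>z\<in>verts t. f z * bary t z y) = (\<Sum>z\<in>verts t. f z * bary t z x) + g \<bullet> (y - x)" for y
  unfolding g_def by (rule bary_sum_affine)
 have v: "f z = f x + g \<bullet> (z - x)" if "z \<in> verts s" for z
 proof -
  have "z \<in> tri t" "x \<in> tri t" using x s verts_tri[OF that] by auto
  from f[OF this(1)] f[OF this(2)] show ?thesis using d[of z] by simp
 qed
 have "(\<Sum>z\<in>verts s. f z * bary s z x) = (\<Sum>z\<in>verts s. (f x + g \<bullet> (z - x)) * bary s z x)"
  using v by (intro sum.cong) auto
 also have "... = f x * (\<Sum>z\<in>verts s. bary s z x) + g \<bullet> ((\<Sum>z\<in>verts s. bary s z x *R z) - (\<Sum>z\<in>verts s. bary s z x) *R x)"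
  unfolding sum_distrib_left inner_diff_right inner_sum_right inner_scaleR_right scaleR_sum_left sum_subtractf[symmetric] sum.distrib[symmetric]
  by (intro sum.cong) (auto simp: algebra_simps)
 also have "... = f x" by (simp add: bary_sum[OF n(2)] bary_rep[OF n(2)])
 finally show ?thesis by simp
qed

lemma pwaff_refine:
 assumes "nvb_ref T T'" "mesh T" "pwaff T f" shows "pwaff T' f"
proof -
 note m = nvb_ref_mesh[OF assms(1,2)]
 show ?thesis
  unfolding pwaff_def
 proof (intro conjI ballI allI impI)
  fix s x assume s: "s \<in> T'" "x \<in> tri s"
  obtain t where t: "t \<in> T" "desc t s" using nvb_ref_anc[OF assms(1) s(1)] by blast
  note n = meshD(2)[OF assms(2) t(1)]
  show "f x = (\<Sum>z\<in>verts s. f z * bary s z x)"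
   using affine_on_sub[OF n, of s f x] desc_props[OF t(2) n] pwaffD(1)[OF assms(3) t(1)] s(2) by blast
 next
  fix x assume "x \<notin> \<Union> (tri ` T')"
  thus "f x = 0" using m pwaffD(2)[OF assms(3)] by simp
 qed
qed

lemma pwaff_continuous_on: assumes "finite T" "pwaff T f" shows "continuous_on (\<Union> (tri ` T)) f"
proof (rule continuous_on_closed_Union)
 show "finite T" by fact
 show "closed (tri t)" if "t \<in> T" for t by (rule closed_tri)
 show "continuous_on (tri t) f" if "t \<in> T" for t
 proof (rule continuous_on_eq)
  show "continuous_on (tri t) (%x. \<Sum>z\<in>verts t. f z * (bary t z 0 + bgr t z \<bullet> (x - 0)))"
   by (intro continuous_intros)
  show "(\<Sum>z\<in>verts t. f z * (bary t z 0 + bgr t z \<bullet> (x - 0))) = f x" if "x \<in> tri t" for x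
   using pwaffD(1)[OF assms(2) \<open>t \<in> T\<close> that] bary_affine[of t _ x 0] by simp
 qed
qed

lemma of_nodes_one:
 assumes "conforming T" "x \<in> \<Union> (tri ` T)" shows "(\<Sum>z\<in>nodes T. hat T z x) = 1"
proof -
 let ?f = "%x. if x \<in> \<Union> (tri ` T) then 1 else 0 :: real"
 have "pwaff T ?f"
  unfolding pwaff_def
 proof (intro conjI ballI allI impI)
  fix t x assume t: "t \<in> T" "x \<in> tri t"
  have "?f z = 1" if "z \<in> verts t" for z using verts_tri[OF that] t by auto
  hence "(\<Sum>z\<in>verts t. ?f z * bary t z x) = (\<Sum>z\<in>verts t. bary t z x)"
   by (intro sum.cong) auto
  thus "?f x = (\<Sum>z\<in>verts t. ?f z * bary t z x)" using bary_sum[OF conformingD(3)[OF assms(1) t(1)]] t by auto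
 qed auto
 from pwaff_rep[OF assms(1) this, of x] have "1 = (\<Sum>z\<in>nodes T. ?f z * hat T z x)" using assms(2) by simp
 also have "... = (\<Sum>z\<in>nodes T. hat T z x)"
 proof (rule sum.cong)
  fix z assume "z \<in> nodes T"
  then obtain t where "t \<in> T" "z \<in> verts t" by (auto simp: nodes_def)
  thus "?f z * hat T z x = hat T z x" using verts_tri[of z t] by auto
 qed simp
 finally show ?thesis by simp
qed

definition tgrad :: "(point => real) => ltri => point" where
 "tgrad f t = (\<Sum>z\<in>verts t. f z *R bgr t z)"

lemma grad_pwaff:
 assumes "pwaff T f" "t \<in> T" "nd t" "x \<in> otri t" shows "grad f x = tgrad f t"
proof -
 let ?g = "%y. (\<Sum>z\<in>verts t. f z * bary t z x) + tgrad f t \<bullet> (y - x)"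
 have e: "?g y = (\<Sum>z\<in>verts t. f z * bary t z y)" for y
  unfolding tgrad_def by (rule bary_sum_affine[symmetric])
 have "(?g has_derivative (%h. tgrad f t \<bullet> h)) (at x)" by (auto intro!: derivative_eq_intros)
 moreover have "?g y = f y" if "y \<in> otri t" for y
  using e[of y] pwaffD(1)[OF assms(1,2), of y] otri_sub[OF assms(3)] that by auto
 ultimately have d: "(f has_derivative (%h. tgrad f t \<bullet> h)) (at x)"
  using has_derivative_transform_within_open[OF _ open_otri assms(4)] by blast
 hence "f differentiable (at x)" unfolding differentiable_def by blast
 moreover have "frechet_derivative f (at x) = (%h. tgrad f t \<bullet> h)" using frechet_derivative_at[OF d] by simp
 ultimately show ?thesis unfolding grad_def by (simp add: vec_eq_iff inner_axis)
qed

definition energy :: "ltri set => (point => real) => real" where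
 "energy T f = (\<Sum>t\<in>T. ar t * (norm (tgrad f t))^2)"

lemma tgrad_sum: "tgrad (%x. \<Sum>i\<in>I. c i * f i x) t = (\<Sum>i\<in>I. c i *R tgrad (f i) t)"
 unfolding tgrad_def scaleR_sum_right scaleR_sum_left by (subst sum.swap) simp

section \<open>Crouzeix--Raviart averages on the forest\<close>

lemma lam_at: assumes "nd (a, b, c)"
 shows "lam a b c a = 1" "lam a b c b = 0" "lam a b c c = 0"
 using lam_comb[OF assms, of 1 0 0] lam_comb[OF assms, of 0 1 0] lam_comb[OF assms, of 0 0 1] by auto

lemma bg_inner: assumes "nd (a, b, c)"
 shows "bg a b c \<bullet> (b - a) = -1" "bg a b c \<bullet> (c - a) = -1" "bg a b c \<bullet> (c - b) = 0"
  "bg b c a \<bullet> (b - a) = 1" "bg b c a \<bullet> (c - a) = 0" "bg b c a \<bullet> (c - b) = -1"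
  "bg c a b \<bullet> (b - a) = 0" "bg c a b \<bullet> (c - a) = 1" "bg c a b \<bullet> (c - b) = 1"
 using lam_affine[of a b c b a] lam_affine[of a b c c a] lam_affine[of a b c c b]
  lam_affine[of b c a b a] lam_affine[of b c a c a] lam_affine[of b c a c b]
  lam_affine[of c a b b a] lam_affine[of c a b c a] lam_affine[of c a b c b]
  lam_at[OF assms] lam_at[OF nd_rot(1)[OF assms]] lam_at[OF nd_rot(2)[OF assms]] by auto

context forest begin

text \<open>For a refinement T of \<open>T0\<close> this is the finite part of the forest at or
  above T: the leaves and everything bisected on the way to them.\<close>

definition anc :: "ltri set => ltri set" where "anc T = {s\<in>F. \<exists>ka\<in>T. desc s ka}"

lemma anc_T0: "anc T0 = T0"
proof
 show "anc T0 \<subseteq> T0"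
 proof
  fix s assume "s \<in> anc T0"
  then obtain ka r where k: "s \<in> F" "ka \<in> T0" "desc s ka" "r \<in> T0" "desc r s" unfolding anc_def F_def by blast
  have "desc r ka" using k by (meson rtranclp_trans)
  hence "otri ka \<subseteq> otri r" using desc_props meshD(2)[OF mesh0 k(4)] by blast
  hence "r = ka" using meshD(3)[OF mesh0 k(4,2)] otri_nonempty[OF meshD(2)[OF mesh0 k(2)]] by blast
  hence "s = r" using desc_antisym[OF k(5)] k meshD(2)[OF mesh0 k(4)] by blast
  thus "s \<in> T0" using k by blast
 qed
 show "T0 \<subseteq> anc T0" using T0_F unfolding anc_def by blast
qed

lemma anc_step:
 assumes "T \<subseteq> F" "t \<in> T" shows "anc (T - {t} \<union> bisect t) \<subseteq> anc T \<union> bisect t"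
proof
 fix s assume "s \<in> anc (T - {t} \<union> bisect t)"
 then obtain ka where k: "s \<in> F" "desc s ka" "ka \<in> T - {t} \<union> bisect t" unfolding anc_def by blast
 show "s \<in> anc T \<union> bisect t"
 proof (cases "ka \<in> bisect t & s ~= ka")
  case True
  then obtain u where u: "desc s u" "child u ka" using desc_step_last[OF k(2)] by blast
  have "u = t" using unique_parent[OF F_desc[OF k(1) u(1)] _ u(2), of t] assms True unfolding child_def by blast
  thus ?thesis using u k(1) assms unfolding anc_def by blast
 next
  case False
  thus ?thesis using k unfolding anc_def by blast
 qed
qed

lemma finite_anc: assumes "nvb_ref T0 T" shows "finite (anc T)"
 using assms
proof (induction rule: nvb_ref.induct)
 case refl
 thus ?case using anc_T0 meshD(1)[OF mesh0] by simp
next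
 case (step T t)
 hence "finite (anc T \<union> bisect t)" by simp
 thus ?case using finite_subset anc_step[OF F_ref[OF step(1) T0_F] step(2)] by blast
qed

end

text \<open>Only two properties of edge means matter, symmetry and compatibility with halving an
  edge inside the domain. Later \<open>\<mu> p q\<close> is the mean of a fixed finite element
  function over the segment.\<close>

locale cr = forest +
 fixes \<mu> :: "point => point => real"
 assumes mu_sym: "\<mu> p q = \<mu> q p"
  and mu_half: "closed_segment p q \<subseteq> \<Union> (tri ` T0) ==> \<mu> p q = (\<mu> p (midpoint p q) + \<mu> (midpoint p q) q) / 2"
begin

text \<open>Gradient of the affine function with prescribed values at the edge midpoints. Its basis
  functions are 1 - 2\<lambda> with the coordinate \<lambda> of the opposite vertex, hence the
  factor -2 and the pairing of edges with vertices.\<close>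

fun crg :: "ltri => point" where
 "crg (a, b, c) = - 2 *R (\<mu> b c *R bg a b c + \<mu> a c *R bg b c a + \<mu> a b *R bg c a b)"

fun crp :: "ltri => point => real" where
 "crp (a, b, c) x = \<mu> a b + crg (a, b, c) \<bullet> (x - midpoint a b)"

lemma crp_affine: "crp t x = crp t y + crg t \<bullet> (x - y)"
 by (cases t) (simp add: inner_diff_right del: crg.simps)

lemma crp_edge: assumes "nd t" "p \<in> verts t" "q \<in> verts t" "p ~= q" shows "crp t (midpoint p q) = \<mu> p q"
proof -
 obtain a b c where t: "t = (a, b, c)" by (cases t)
 have n: "nd (a, b, c)" using assms t by simp
 have 1: "crp t (midpoint a c) = \<mu> a c" "crp t (midpoint b c) = \<mu> b c"
 proof -
  have d: "midpoint a c - midpoint a b = (1/2) *R (c - b)" "midpoint b c - midpoint a b = (1/2) *R (c - a)"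
   by (simp_all add: midpoint_def algebra_simps)
  show "crp t (midpoint a c) = \<mu> a c" "crp t (midpoint b c) = \<mu> b c"
   unfolding t crp.simps crg.simps d inner_scaleR_left inner_scaleR_right inner_add_left bg_inner[OF n] by (simp_all add: field_simps)
 qed
 have 2: "crp t (midpoint a b) = \<mu> a b" by (simp add: t del: crg.simps)
 show ?thesis using assms(2-4) 1 2 unfolding t verts.simps by (auto simp: midpoint_sym mu_sym simp del: crg.simps crp.simps)
qed

lemma crp_adj:
 assumes "nd t" "nd t'" "p \<in> verts t" "q \<in> verts t" "p \<in> verts t'" "q \<in> verts t'" "p ~= q"
 shows "crp t x - crp t' x = (crg t - crg t') \<bullet> (x - midpoint p q)"
 using crp_affine[of t x "midpoint p q"] crp_affine[of t' x "midpoint p q"] crp_edge assms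
 by (simp add: inner_diff_left)

lemma F_sub: "t \<in> F ==> tri t \<subseteq> \<Union> (tri ` T0)"
 unfolding F_def using desc_props meshD(2)[OF mesh0] by blast

text \<open>The martingale property. The mean over the new edge enters both children with opposite
  coordinate gradients and drops out; the means over the two halves of ab combine by
  \<open>mu_half\<close>.\<close>

lemma crg_bisect:
 assumes "(a, b, c) \<in> F" and m: "m = midpoint a b"
 shows "crg (a, c, m) + crg (c, b, m) = 2 *R crg (a, b, c)"
proof -
 have n: "nd (a, b, c)" using F_nd assms by blast
 have "closed_segment a b \<subseteq> tri (a, b, c)"
  unfolding tri_def segment_convex_hull by (intro hull_mono) auto
 hence "\<mu> a b = (\<mu> a m + \<mu> m b) / 2" unfolding m by (intro mu_half) (use F_sub[OF assms(1)] in blast)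
 hence h: "\<mu> m b = 2 * \<mu> a b - \<mu> a m" by simp
 show ?thesis unfolding crg.simps bg_bisect[OF n m] mu_sym[of b m] mu_sym[of c b] h
  by (simp add: algebra_simps flip: scaleR_add_left)
qed

text \<open>Parent and child share a whole edge, ac or cb, and the two affine functions agree at its
  midpoint; only the difference of gradients separates them.\<close>

lemma crp_child:
 assumes "t \<in> F" "child t s" "x \<in> tri t" shows "\<bar>crp s x - crp t x\<bar> <= norm (crg s - crg t) * sqrt (Qs t)"
proof -
 obtain a b c where t: "t = (a, b, c)" and s: "s = (a, c, midpoint a b) | s = (c, b, midpoint a b)"
  using assms(2) by (rule child_cases)
 have n: "nd t" "nd s" using F_nd assms child_props(1) by blast+
 have d: "a ~= c" "c ~= b" using nd_distinct[OF n(1)[unfolded t]] by auto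
 have "\<exists>p q. p ~= q & p \<in> verts t & q \<in> verts t & p \<in> verts s & q \<in> verts s"
  using s
 proof
  assume "s = (a, c, midpoint a b)"
  thus ?thesis using d(1) unfolding t by (intro exI[of _ a] exI[of _ c]) auto
 next
  assume "s = (c, b, midpoint a b)"
  thus ?thesis using d(2) unfolding t by (intro exI[of _ c] exI[of _ b]) auto
 qed
 then obtain p q where pq: "p ~= q" "p \<in> verts t" "q \<in> verts t" "p \<in> verts s" "q \<in> verts s" by blast
 have "midpoint p q \<in> tri t" using pq verts_tri[of _ t] convex_tri[of t]
  by (meson closed_segment_subset midpoint_in_closed_segment subsetD)
 hence "norm (x - midpoint p q) <= sqrt (Qs t)" using tri_dist[OF assms(3)] by (simp add: dist_norm)
 have "\<bar>crp s x - crp t x\<bar> = \<bar>(crg s - crg t) \<bullet> (x - midpoint p q)\<bar>" using crp_adj[OF n(2,1) pq(4,5,2,3,1)] by simp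
 also have "... <= norm (crg s - crg t) * norm (x - midpoint p q)" by (rule Cauchy_Schwarz_ineq2)
 also have "... <= norm (crg s - crg t) * sqrt (Qs t)" by (intro mult_left_mono) (auto intro: \<open>norm (x - midpoint p q) <= _\<close>)
 finally show ?thesis .
qed

text \<open>The average over the smallest forest triangle whose interior contains \<open>x\<close>; for \<open>x\<close> the midpoint of an
 edge this is the triangle whose bisection created that edge.\<close>

definition gbirth :: "point => point" where
 "gbirth x = (if \<exists>\<tau>\<in>F. x \<in> otri \<tau>
  then crg (SOME \<tau>. \<tau> \<in> F & x \<in> otri \<tau> & (\<forall>\<tau>'\<in>F. x \<in> otri \<tau>' --> desc \<tau>' \<tau>)) else 0)"

lemma gbirth_cong: "(\<And>\<tau>. \<tau> \<in> F ==> x \<in> otri \<tau> \<longleftrightarrow> y \<in> otri \<tau>) ==> gbirth x = gbirth y"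
proof -
 assume a: "\<And>\<tau>. \<tau> \<in> F ==> x \<in> otri \<tau> \<longleftrightarrow> y \<in> otri \<tau>"
 have "(\<tau> \<in> F & x \<in> otri \<tau> & (\<forall>\<tau>'\<in>F. x \<in> otri \<tau>' --> desc \<tau>' \<tau>)) = (\<tau> \<in> F & y \<in> otri \<tau> & (\<forall>\<tau>'\<in>F. y \<in> otri \<tau>' --> desc \<tau>' \<tau>))" for \<tau>
  using a by blast
 moreover have "(\<exists>\<tau>\<in>F. x \<in> otri \<tau>) = (\<exists>\<tau>\<in>F. y \<in> otri \<tau>)" using a by blast
 ultimately show ?thesis unfolding gbirth_def by presburger
qed

lemma gbirth_min:
 assumes "t \<in> F" "x \<in> otri t" "\<And>\<tau>. \<tau> \<in> F ==> x \<in> otri \<tau> ==> desc \<tau> t" shows "gbirth x = crg t"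
proof -
 let ?P = "%\<tau>. \<tau> \<in> F & x \<in> otri \<tau> & (\<forall>\<tau>'\<in>F. x \<in> otri \<tau>' --> desc \<tau>' \<tau>)"
 have "?P (SOME \<tau>. ?P \<tau>)" by (rule someI[of ?P t]) (use assms in blast)
 hence "(SOME \<tau>. ?P \<tau>) = t" using assms F_nd desc_antisym by blast
 thus ?thesis using assms unfolding gbirth_def by auto
qed

lemma edge_not_otri:
 assumes "nd t" "p \<in> verts t" "q \<in> verts t" "x \<in> closed_segment p q" shows "x \<notin> otri t"
proof
 assume x: "x \<in> otri t"
 have "card {p, q} < card (verts t)" using card_verts[OF assms(1)] by (simp add: card_insert_if)
 then obtain z where z: "z \<in> verts t" "z ~= p" "z ~= q"
  by (metis card_mono finite.emptyI finite_insert insertCI leD subsetI insertE)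
 have "bary t z x = 0"
  using hull_sub_iff[OF assms(1), of "{p, q}" x] assms z unfolding segment_convex_hull by auto
 thus False using x z unfolding otri_def by auto
qed

lemma tri_mid_pos:
 assumes "nd \<tau>" "a \<in> tri \<tau>" "b \<in> tri \<tau>" "x = (1 - u) *R a + u *R b" "y = (1 - v) *R a + v *R b"
  "0 < u" "u < 1" "0 < v" "v < 1" "x \<in> otri \<tau>"
 shows "y \<in> otri \<tau>"
 unfolding otri_def mem_Collect_eq
proof
 fix z assume z: "z \<in> verts \<tau>"
 have p: "bary \<tau> z a >= 0" "bary \<tau> z b >= 0" using assms tri_iff z by blast+
 have "(1 - u) * bary \<tau> z a + u * bary \<tau> z b > 0"
  using assms(10) z unfolding otri_def assms(4) by (auto simp: bary_convex)
 hence "bary \<tau> z a > 0 | bary \<tau> z b > 0" using p by (smt (verit) mult_eq_0_iff)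
 thus "bary \<tau> z y > 0" unfolding assms(5) bary_convex using p assms(8,9)
  by (smt (verit) mult_nonneg_nonneg mult_pos_pos)
qed

lemma otri_edge_anc:
 assumes "t \<in> F" "\<tau> \<in> F" "p \<in> verts t" "q \<in> verts t" "x \<in> closed_segment p q" "x \<in> otri \<tau>" shows "desc \<tau> t"
proof -
 have "x \<in> tri t" using assms convex_tri[of t] verts_tri[of _ t] by (meson closed_segment_subset subsetD)
 hence "desc \<tau> t | desc t \<tau>" using F_nested'[OF assms(2,1,6)] by blast
 moreover have "\<not> desc t \<tau>" using edge_not_otri[OF F_nd[OF assms(1)] assms(3-5)] desc_props F_nd[OF assms(1)] assms(6) by blast
 ultimately show ?thesis by blast
qed

text \<open>A forest triangle with an inner point of the edge in its interior is an ancestor of t,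
  so it contains the whole edge and then all inner points in its interior. Hence the two halves of a
  bisected edge keep its birth gradient.\<close>

lemma gbirth_edge:
 assumes "t \<in> F" "p \<in> verts t" "q \<in> verts t" "x = (1 - u) *R p + u *R q" "y = (1 - v) *R p + v *R q"
  "0 < u" "u < 1" "0 < v" "v < 1"
 shows "gbirth x = gbirth y"
proof (rule gbirth_cong)
 have one: "y \<in> otri \<tau>" if "\<tau> \<in> F" "x \<in> otri \<tau>" "x = (1 - u) *R p + u *R q" "y = (1 - v) *R p + v *R q"
  "0 < u" "u < 1" "0 < v" "v < 1" for \<tau> x y u v
 proof -
  have "x \<in> closed_segment p q" using that by (auto simp: closed_segment_def)
  hence "desc \<tau> t" using otri_edge_anc assms(1-3) that by blast
  hence "p \<in> tri \<tau>" "q \<in> tri \<tau>" using desc_props[of \<tau> t] F_nd[OF that(1)] verts_tri[of _ t] assms by blast+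
  thus ?thesis using tri_mid_pos[OF F_nd[OF that(1)], of p q x u y v] that by blast
 qed
 fix \<tau> assume "\<tau> \<in> F"
 thus "x \<in> otri \<tau> \<longleftrightarrow> y \<in> otri \<tau>" using one[of \<tau> x u y v] one[of \<tau> y v x u] assms by blast
qed

text \<open>Two edges of the children are halves of ab and inherit; only the bisecting segment is
  new, and no proper descendant of the triangle contains its midpoint in the interior because it is
  an edge of both children.\<close>

lemma gbirth_bisect:
 assumes "(a, b, c) \<in> F" and m: "m = midpoint a b"
 shows "gbirth (midpoint a m) = gbirth (midpoint a b)" "gbirth (midpoint b m) = gbirth (midpoint a b)"
  "gbirth (midpoint c m) = crg (a, b, c)"
proof -
 have n: "nd (a, b, c)" using F_nd assms by blast
 have e: "midpoint a b = (1 - 1/2) *R a + (1/2) *R b" "midpoint a m = (1 - 1/4) *R a + (1/4) *R b"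
  "midpoint b m = (1 - 3/4) *R a + (3/4) *R b"
  by (simp_all add: m midpoint_def algebra_simps flip: scaleR_add_left)
 show "gbirth (midpoint a m) = gbirth (midpoint a b)" "gbirth (midpoint b m) = gbirth (midpoint a b)"
  by (rule gbirth_edge[OF assms(1) _ _ e(2) e(1)]; simp) (rule gbirth_edge[OF assms(1) _ _ e(3) e(1)]; simp)
 have r: "midpoint c m = (1/4) *R a + (1/4) *R b + (1/2) *R c"
  by (simp add: m midpoint_def algebra_simps flip: scaleR_add_left)
 have r2: "midpoint c m = (1/4) *R b + (1/2) *R c + (1/4) *R a" "midpoint c m = (1/2) *R c + (1/4) *R a + (1/4) *R b"
  using r by (simp_all add: add_ac)
 have "lam a b c (midpoint c m) = 1/4" by (subst r, rule lam_comb[OF n]) simp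
 moreover have "lam b c a (midpoint c m) = 1/4" by (subst r2(1), rule lam_comb[OF nd_rot(1)[OF n]]) simp
 moreover have "lam c a b (midpoint c m) = 1/2" by (subst r2(2), rule lam_comb[OF nd_rot(2)[OF n]]) simp
 ultimately have o: "midpoint c m \<in> otri (a, b, c)" using tri_lam(2)[OF n] by simp
 show "gbirth (midpoint c m) = crg (a, b, c)"
 proof (rule gbirth_min[OF assms(1) o])
  fix \<tau> assume t: "\<tau> \<in> F" "midpoint c m \<in> otri \<tau>"
  have "desc \<tau> (a, b, c) | desc (a, b, c) \<tau>" using F_nested[OF t(1) assms(1)] t(2) o by blast
  moreover have "\<tau> = (a, b, c)" if d: "desc (a, b, c) \<tau>"
  proof (rule ccontr)
   assume "\<tau> ~= (a, b, c)"
   then obtain u where u: "child (a, b, c) u" "desc u \<tau>" using desc_step[OF d] by blast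
   have nu: "nd u" using child_props(1)[OF u(1) n] .
   have "midpoint c m \<in> otri u" using desc_props[OF u(2) nu] t(2) by blast
   moreover have "c \<in> verts u" "m \<in> verts u" using u(1) unfolding child_def m by auto
   ultimately show False using edge_not_otri[OF nu, of c m] by simp
  qed
  ultimately show "desc \<tau> (a, b, c)" by blast
 qed
qed

lemma gbirth_child_edge:
 assumes "t \<in> F" "child t s" shows "\<exists>p\<in>verts s. \<exists>q\<in>verts s. p ~= q & gbirth (midpoint p q) = crg t"
proof -
 obtain a b c where t: "t = (a, b, c)" and s: "s = (a, c, midpoint a b) | s = (c, b, midpoint a b)"
  using assms(2) by (rule child_cases)
 have "gbirth (midpoint c (midpoint a b)) = crg t" using gbirth_bisect(3)[OF assms(1)[unfolded t] HOL.refl] t by simp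
 moreover have "c ~= midpoint a b" using nd_distinct nd_bisect(1) F_nd assms(1) t by blast
 ultimately show ?thesis using s by auto
qed

text \<open>Squared jumps against the birth gradients of the three edges. The refinement edge has
  weight 3, the others 2, because bisection halves the area, passes the jump of ab to both children
  with weight 2, and makes ac and bc the refinement edge of one child each. The total weights shrink
  by the factors 2/3 and 3/4; with equal weights the jump of ab would not shrink at all.\<close>

fun Phi :: "ltri => real" where
 "Phi (a, b, c) = ar (a, b, c) * (3 * (norm (crg (a, b, c) - gbirth (midpoint a b)))^2 +
  2 * (norm (crg (a, b, c) - gbirth (midpoint b c)))^2 + 2 * (norm (crg (a, b, c) - gbirth (midpoint a c)))^2)"

lemma Phi_nonneg: "Phi t >= 0"
 by (cases t) (simp only: Phi.simps, intro mult_nonneg_nonneg add_nonneg_nonneg, auto)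

lemma Phi_edge:
 assumes "p \<in> verts t" "q \<in> verts t" "p ~= q" shows "2 * ar t * (norm (crg t - gbirth (midpoint p q)))^2 <= Phi t"
proof -
 obtain a b c where t: "t = (a, b, c)" by (cases t)
 define A B C where "A = (norm (crg t - gbirth (midpoint a b)))^2" and "B = (norm (crg t - gbirth (midpoint b c)))^2"
  and "C = (norm (crg t - gbirth (midpoint a c)))^2"
 have nn: "0 <= A" "0 <= B" "0 <= C" by (simp_all add: A_def B_def C_def)
 have P: "Phi t = ar t * (3 * A + 2 * B + 2 * C)" unfolding t A_def B_def C_def Phi.simps ..
 have "(norm (crg t - gbirth (midpoint p q)))^2 \<in> {A, B, C}"
  using assms unfolding t verts.simps A_def B_def C_def by (auto simp: midpoint_sym simp del: crg.simps)
 hence "2 * (norm (crg t - gbirth (midpoint p q)))^2 <= 3 * A + 2 * B + 2 * C" using nn by auto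
 hence "ar t * (2 * (norm (crg t - gbirth (midpoint p q)))^2) <= Phi t" unfolding P by (intro mult_left_mono) auto
 thus ?thesis by (simp add: mult_ac)
qed

lemma Phi_child: assumes "t \<in> F" "child t s" shows "2 * ar s * (norm (crg s - crg t))^2 <= Phi s"
 using gbirth_child_edge[OF assms] Phi_edge[of _ s] by metis

text \<open>Young's inequality, weighted so that 6/5 times the shrinking factor 3/4 is still
  9/10.\<close>

lemma norm_add_weighted: "(norm (x + y :: point))^2 <= 6/5 * (norm x)^2 + 6 * (norm y)^2"
proof -
 have "0 <= (norm (x - 5 *R y))^2" by simp
 also have "... = (norm x)^2 - 10 * (x \<bullet> y) + 25 * (norm y)^2"
  unfolding power2_norm_eq_inner by (simp add: algebra_simps inner_commute)
 finally have a: "10 * (x \<bullet> y) <= (norm x)^2 + 25 * (norm y)^2" by simp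
 have "(norm (x + y))^2 = (norm x)^2 + 2 * (x \<bullet> y) + (norm y)^2"
  unfolding power2_norm_eq_inner by (simp add: algebra_simps inner_commute)
 thus ?thesis using a by simp
qed

lemma martingale_step: assumes "g1 + g2 = 2 *R (g :: point)"
 shows "(norm (g1 - g))^2 + (norm (g2 - g))^2 = (norm g1)^2 + (norm g2)^2 - 2 * (norm g)^2"
proof -
 have g2: "g2 = 2 *R g - g1" using assms by (simp add: algebra_simps)
 show ?thesis unfolding g2 power2_norm_eq_inner by (simp add: inner_diff_left inner_diff_right inner_commute)
qed

text \<open>Old jumps change by the increment of the gradient. The constant 32 is 3 * 6 + 2 + 2 * 6:
  in each child the Young remainders of the two old edges, with weights 3 and 2, and the jump across
  the new edge. By orthogonality the increments sum up to the gain of energy in the last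
  bracket.\<close>

lemma Phi_contraction:
 assumes "(a, b, c) \<in> F" and m: "m = midpoint a b" and t: "t = (a, b, c)" "t1 = (a, c, m)" "t2 = (c, b, m)"
 shows "Phi t1 + Phi t2 <= 9/10 * Phi t
  + 32 * (ar t1 * (norm (crg t1))^2 + ar t2 * (norm (crg t2))^2 - ar t * (norm (crg t))^2)"
proof -
 have n: "nd (a, b, c)" using F_nd assms by blast
 define R where "R = ar t"
 have R0: "R >= 0" by (simp add: R_def)
 have art: "ar t1 = R / 2" "ar t2 = R / 2" using nd_bisect(3,4)[OF n] unfolding R_def t m by auto
 define g g1 g2 where "g = crg t" and "g1 = crg t1" and "g2 = crg t2"
 define Jab Jbc Jac where "Jab = g - gbirth (midpoint a b)" and "Jbc = g - gbirth (midpoint b c)" and "Jac = g - gbirth (midpoint a c)"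
 note gb = gbirth_bisect[OF assms(1) m]
 have P: "Phi t = R * (3 * (norm Jab)^2 + 2 * (norm Jbc)^2 + 2 * (norm Jac)^2)"
  unfolding R_def t Jab_def Jbc_def Jac_def g_def by simp
 have j: "Jac + (g1 - g) = g1 - gbirth (midpoint a c)" "Jab + (g1 - g) = g1 - gbirth (midpoint a b)"
  "Jbc + (g2 - g) = g2 - gbirth (midpoint b c)" "Jab + (g2 - g) = g2 - gbirth (midpoint a b)"
  by (simp_all add: Jac_def Jab_def Jbc_def)
 have P1: "Phi t1 = R / 2 * (3 * (norm (Jac + (g1 - g)))^2 + 2 * (norm (g1 - g))^2 + 2 * (norm (Jab + (g1 - g)))^2)"
  unfolding j unfolding t(2) Phi.simps gb(1,3) art(1)[unfolded t(2)] g1_def g_def t ..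
 have P2: "Phi t2 = R / 2 * (3 * (norm (Jbc + (g2 - g)))^2 + 2 * (norm (Jab + (g2 - g)))^2 + 2 * (norm (g2 - g))^2)"
  unfolding j unfolding t(3) Phi.simps gb(2,3) art(2)[unfolded t(3)] g2_def g_def t midpoint_sym[of c b] ..
 have "3 * (norm (Jac + (g1 - g)))^2 + 2 * (norm (g1 - g))^2 + 2 * (norm (Jab + (g1 - g)))^2
  + (3 * (norm (Jbc + (g2 - g)))^2 + 2 * (norm (Jab + (g2 - g)))^2 + 2 * (norm (g2 - g))^2)
  <= 2 * (9/10 * (3 * (norm Jab)^2 + 2 * (norm Jbc)^2 + 2 * (norm Jac)^2)) + 32 * ((norm (g1 - g))^2 + (norm (g2 - g))^2)"
  using norm_add_weighted[of Jac "g1 - g"] norm_add_weighted[of Jab "g1 - g"]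
   norm_add_weighted[of Jbc "g2 - g"] norm_add_weighted[of Jab "g2 - g"] zero_le_power2[of "norm Jab"]
  unfolding distrib_left by linarith
 from mult_left_mono[OF this, of "R / 2"] R0
 have "Phi t1 + Phi t2 <= 9/10 * Phi t + 32 * (R / 2 * ((norm (g1 - g))^2 + (norm (g2 - g))^2))"
  unfolding P P1 P2 by (simp add: algebra_simps)
 also have "(norm (g1 - g))^2 + (norm (g2 - g))^2 = (norm g1)^2 + (norm g2)^2 - 2 * (norm g)^2"
  using crg_bisect[OF assms(1) m] unfolding g_def g1_def g2_def t by (intro martingale_step)
 also have "R / 2 * ((norm g1)^2 + (norm g2)^2 - 2 * (norm g)^2) = ar t1 * (norm g1)^2 + ar t2 * (norm g2)^2 - ar t * (norm g)^2"
  unfolding art R_def[symmetric] by (simp add: algebra_simps)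
 finally show ?thesis unfolding g_def g1_def g2_def .
qed

definition cre :: "ltri set => real" where "cre T = (\<Sum>t\<in>T. ar t * (norm (crg t))^2)"

text \<open>Edges of the initial mesh lie in the interior of no forest triangle and get the default
  value 0. So \<open>Phi\<close> of a root controls its full gradient and not merely jumps.\<close>

lemma gbirth_root:
 assumes "conforming T0" "t \<in> T0" "p \<in> verts t" "q \<in> verts t" shows "gbirth (midpoint p q) = 0"
proof -
 have "midpoint p q \<notin> otri \<tau>" if tF: "\<tau> \<in> F" for \<tau>
 proof
  assume x: "midpoint p q \<in> otri \<tau>"
  obtain r where r: "r \<in> T0" "desc r \<tau>" using tF unfolding F_def by blast
  have n: "nd t" "nd r" using meshD(2)[OF mesh0] assms r by blast+
  have xr: "midpoint p q \<in> otri r" using desc_props[OF r(2) n(2)] x by blast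
  have "midpoint p q \<in> tri t" using assms(3,4) verts_tri[of _ t] convex_tri[of t]
   by (meson closed_segment_subset midpoint_in_closed_segment subsetD)
  hence "r = t" using mesh_otri_tri[OF mesh0 r(1) assms(2) xr] by blast
  thus False using edge_not_otri[OF n(1) assms(3,4), of "midpoint p q"] xr by simp
 qed
 thus ?thesis unfolding gbirth_def by auto
qed

text \<open>Summing the contraction over the forest: every square function contribution is absorbed by the increase of
 energy under bisection.\<close>

theorem Phi_sum:
 assumes "nvb_ref T0 T" and c0: "conforming T0"
 shows "finite (anc T) & (\<Sum>s\<in>anc T. Phi s) + 9 * (\<Sum>s\<in>T. Phi s) <= 320 * cre T"
 using assms(1)
proof (induction rule: nvb_ref.induct)
 case refl
 have fin: "finite T0" using meshD(1)[OF mesh0] .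
 have "Phi t = 7 * (ar t * (norm (crg t))^2)" if "t \<in> T0" for t
 proof (cases t)
  case (fields a b c)
  have "gbirth (midpoint a b) = 0" "gbirth (midpoint b c) = 0" "gbirth (midpoint a c) = 0"
   by (rule gbirth_root[OF c0 that]; simp add: fields)+
  thus ?thesis unfolding fields Phi.simps by (simp del: crg.simps ar.simps)
 qed
 hence "(\<Sum>s\<in>T0. Phi s) = 7 * cre T0" unfolding cre_def sum_distrib_left by (intro sum.cong) auto
 moreover have "cre T0 >= 0" unfolding cre_def by (intro sum_nonneg) simp
 ultimately show ?case unfolding anc_T0 using fin by simp
next
 case (step T t)
 have m: "mesh T" using nvb_ref_mesh[OF step(1) mesh0] by blast
 have TF: "T \<subseteq> F" using F_ref[OF step(1) T0_F] .
 obtain a b c where t: "t = (a, b, c)" by (cases t)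
 define t1 t2 where "t1 = (a, c, midpoint a b)" and "t2 = (c, b, midpoint a b)"
 have b: "bisect t = {t1, t2}" unfolding t t1_def t2_def by simp
 have tF: "(a, b, c) \<in> F" using step(2) TF t by blast
 have n: "nd t" using F_nd tF t by blast
 have ne: "t1 ~= t2" using bisect_distinct n unfolding t t1_def t2_def by blast
 have nin: "s \<notin> T - {t}" if "s \<in> bisect t" for s
 proof
  assume s: "s \<in> T - {t}"
  have "otri s \<subseteq> otri t" using child_props(5)[OF _ n] that unfolding child_def by blast
  thus False using meshD(3)[OF m, of s t] s step(2) otri_nonempty[OF meshD(2)[OF m, of s]] by blast
 qed
 have fT: "finite T" using meshD(1)[OF m] .
 have split: "(\<Sum>s\<in>T - {t} \<union> bisect t. f s) = (\<Sum>s\<in>T. f s) - f t + f t1 + f t2" for f :: "ltri => real"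
 proof -
  have "(\<Sum>s\<in>T - {t} \<union> bisect t. f s) = (\<Sum>s\<in>T - {t}. f s) + (\<Sum>s\<in>bisect t. f s)"
   using fT nin by (intro sum.union_disjoint) auto
  moreover have "(\<Sum>s\<in>T - {t}. f s) = (\<Sum>s\<in>T. f s) - f t" using fT step(2) by (simp add: sum_diff1)
  moreover have "(\<Sum>s\<in>bisect t. f s) = f t1 + f t2" unfolding b using ne by simp
  ultimately show ?thesis by simp
 qed
 note con = Phi_contraction[OF tF HOL.refl t t1_def t2_def]
 have fa: "finite (anc T)" and IH: "(\<Sum>s\<in>anc T. Phi s) + 9 * (\<Sum>s\<in>T. Phi s) <= 320 * cre T" using step.IH by auto
 have sub: "anc (T - {t} \<union> bisect t) \<subseteq> anc T \<union> {t1, t2}" using anc_step[OF TF step(2)] unfolding b by blast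
 have fin': "finite (anc (T - {t} \<union> bisect t))" by (rule finite_subset[OF sub]) (use fa in simp)
 have "(\<Sum>s\<in>anc (T - {t} \<union> bisect t). Phi s) <= (\<Sum>s\<in>anc T \<union> {t1, t2}. Phi s)"
  using fa Phi_nonneg by (intro sum_mono2 sub) auto
 also have "... <= (\<Sum>s\<in>anc T. Phi s) + (\<Sum>s\<in>{t1, t2}. Phi s)"
  using sum.union_inter[of "anc T" "{t1, t2}" Phi] fa sum_nonneg[of "anc T \<inter> {t1, t2}" Phi] Phi_nonneg by simp
 also have "(\<Sum>s\<in>{t1, t2}. Phi s) = Phi t1 + Phi t2" using ne by simp
 finally have A: "(\<Sum>s\<in>anc (T - {t} \<union> bisect t). Phi s) <= (\<Sum>s\<in>anc T. Phi s) + (Phi t1 + Phi t2)" .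
 \<comment> \<open>The ancestors gain at most the two children, the leaves exchange t for them: the
   left side grows by at most \<open>10 * (Phi t1 + Phi t2) - 9 * Phi t\<close>. The contraction
   bounds this by 320 times the gain of energy, which explains the weights 9 and 320.\<close>
 show ?case
  using fin' A IH con split[of Phi] split[of "%t. ar t * (norm (crg t))^2", folded cre_def]
  by (simp del: Phi.simps crg.simps ar.simps)
qed

end

section \<open>Uniform refinement and the depth of minimal refinements\<close>

definition gc :: "ltri => ltri set" where "gc t = \<Union> (bisect ` bisect t)"

lemma gc_simps: "gc (a, b, c) = {(a, midpoint a b, midpoint a c), (midpoint a b, c, midpoint a c),
  (c, midpoint a b, midpoint c b), (midpoint a b, b, midpoint c b)}"
 by (auto simp: gc_def)

lemma gc_coords:
 assumes n: "nd (a, b, c)" and e: "m = midpoint a b" "p = midpoint a c" "q = midpoint c b"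
  "\<alpha> = lam a b c x" "\<beta> = lam b c a x" "\<gamma> = lam c a b x"
 shows "x \<in> tri (a, m, p) \<longleftrightarrow> \<alpha> >= \<beta> + \<gamma> & \<beta> >= 0 & \<gamma> >= 0"
  "x \<in> tri (m, c, p) \<longleftrightarrow> \<beta> <= \<alpha> & \<alpha> <= \<beta> + \<gamma> & \<beta> >= 0"
  "x \<in> tri (c, m, q) \<longleftrightarrow> \<alpha> <= \<beta> & \<beta> <= \<alpha> + \<gamma> & \<alpha> >= 0"
  "x \<in> tri (m, b, q) \<longleftrightarrow> \<beta> >= \<alpha> + \<gamma> & \<alpha> >= 0 & \<gamma> >= 0"
  "bary (a, m, p) a x = \<alpha> - \<beta> - \<gamma>" "bary (a, m, p) m x = 2 * \<beta>" "bary (a, m, p) p x = 2 * \<gamma>"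
  "bary (m, c, p) m x = 2 * \<beta>" "bary (m, c, p) c x = \<gamma> - \<alpha> + \<beta>" "bary (m, c, p) p x = 2 * (\<alpha> - \<beta>)"
  "bary (c, m, q) c x = \<gamma> - \<beta> + \<alpha>" "bary (c, m, q) m x = 2 * \<alpha>" "bary (c, m, q) q x = 2 * (\<beta> - \<alpha>)"
  "bary (m, b, q) m x = 2 * \<alpha>" "bary (m, b, q) b x = \<beta> - \<alpha> - \<gamma>" "bary (m, b, q) q x = 2 * \<gamma>"
proof -
 note n1 = nd_bisect(1)[OF n, folded e(1)] and n2 = nd_bisect(2)[OF n, folded e(1)]
 note l = lam_bisect[OF n e(1), of x, folded e(4-6)]
 note l1 = lam_bisect[OF n1 e(2), of x, unfolded l] and l2 = lam_bisect[OF n2 e(3), of x, unfolded l]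
 note n3 = nd_bisect(1,2)[OF n1, folded e(2)] and n4 = nd_bisect(1,2)[OF n2, folded e(3)]
 show "x \<in> tri (a, m, p) \<longleftrightarrow> \<alpha> >= \<beta> + \<gamma> & \<beta> >= 0 & \<gamma> >= 0"
  "x \<in> tri (m, c, p) \<longleftrightarrow> \<beta> <= \<alpha> & \<alpha> <= \<beta> + \<gamma> & \<beta> >= 0"
  "x \<in> tri (c, m, q) \<longleftrightarrow> \<alpha> <= \<beta> & \<beta> <= \<alpha> + \<gamma> & \<alpha> >= 0"
  "x \<in> tri (m, b, q) \<longleftrightarrow> \<beta> >= \<alpha> + \<gamma> & \<alpha> >= 0 & \<gamma> >= 0"
  using n3 n4 by (auto simp: tri_lam l1 l2 simp del: nd.simps)
 show "bary (a, m, p) a x = \<alpha> - \<beta> - \<gamma>" "bary (a, m, p) m x = 2 * \<beta>" "bary (a, m, p) p x = 2 * \<gamma>"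
  "bary (m, c, p) m x = 2 * \<beta>" "bary (m, c, p) c x = \<gamma> - \<alpha> + \<beta>" "bary (m, c, p) p x = 2 * (\<alpha> - \<beta>)"
  "bary (c, m, q) c x = \<gamma> - \<beta> + \<alpha>" "bary (c, m, q) m x = 2 * \<alpha>" "bary (c, m, q) q x = 2 * (\<beta> - \<alpha>)"
  "bary (m, b, q) m x = 2 * \<alpha>" "bary (m, b, q) b x = \<beta> - \<alpha> - \<gamma>" "bary (m, b, q) q x = 2 * \<gamma>"
  using n3 n4 by (simp_all add: bary_simps l1 l2 del: nd.simps bary.simps)
qed

lemma gc_local:
 assumes n: "nd t" and s: "s \<in> gc t" "s' \<in> gc t" "x \<in> tri s" "x \<in> tri s'" "y \<in> verts s" "bary s y x > 0"
 shows "y \<in> verts s'"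
proof -
 obtain a b c where t: "t = (a, b, c)" by (cases t)
 define m p q \<alpha> \<beta> \<gamma> where e: "m = midpoint a b" "p = midpoint a c" "q = midpoint c b"
  "\<alpha> = lam a b c x" "\<beta> = lam b c a x" "\<gamma> = lam c a b x"
 note g = gc_coords[OF n[unfolded t] e]
 have s1: "s = (a, m, p) | s = (m, c, p) | s = (c, m, q) | s = (m, b, q)" using s(1) unfolding t gc_simps e by simp
 have s2: "s' = (a, m, p) | s' = (m, c, p) | s' = (c, m, q) | s' = (m, b, q)" using s(2) unfolding t gc_simps e by simp
 show ?thesis using s(3-6) s1 s2 by (elim disjE) (auto simp: g simp del: bary.simps)
qed

text \<open>For x on the boundary of t, the vertices with positive coordinate at x of a grandchild
  containing x are read off from the coordinates of x in t: old vertices with coordinate above 1/2,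
  and midpoints of two vertices with positive coordinates. Such points are, conversely, vertices of
  every grandchild containing x. Both descriptions depend only on the edge through x, so neighbours
  agree.\<close>

lemma gc_face:
 assumes n: "nd t" and s: "s \<in> gc t" "x \<in> tri s"
 shows "y \<in> verts s ==> bary s y x > 0 ==> z0 \<in> verts t ==> bary t z0 x = 0 ==>
   y \<in> verts t & bary t y x > 1/2 | (\<exists>z\<in>verts t. \<exists>w\<in>verts t. z ~= w & y = midpoint z w & bary t z x > 0 & bary t w x > 0)"
  and "z \<in> verts t ==> bary t z x > 1/2 ==> z \<in> verts s"
  and "z \<in> verts t ==> w \<in> verts t ==> z0 \<in> verts t ==> z ~= w ==> bary t z0 x = 0 ==> bary t z x > 0 ==> bary t w x > 0 ==> midpoint z w \<in> verts s"
proof -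
 obtain a b c where t: "t = (a, b, c)" by (cases t)
 note nt = n[unfolded t]
 define m p q \<alpha> \<beta> \<gamma> where e: "m = midpoint a b" "p = midpoint a c" "q = midpoint c b"
  "\<alpha> = lam a b c x" "\<beta> = lam b c a x" "\<gamma> = lam c a b x"
 note g = gc_coords[OF nt e]
 note bt = bary_simps(1-3)[OF nt, of x, folded e(4-6)]
 have one: "\<alpha> + \<beta> + \<gamma> = 1" unfolding e by (rule lam_sum[OF nt])
 have mm: "midpoint a b = m" "midpoint b a = m" "midpoint a c = p" "midpoint c a = p" "midpoint c b = q" "midpoint b c = q"
  by (simp_all add: e midpoint_sym)
 have d: "a ~= b" "b ~= c" "a ~= c" using nd_distinct[OF nt] by auto
 have s1: "s = (a, m, p) | s = (m, c, p) | s = (c, m, q) | s = (m, b, q)" using s(1) unfolding t gc_simps e by simp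
 {
  assume y: "y \<in> verts s" "bary s y x > 0" and z0: "z0 \<in> verts t" "bary t z0 x = 0"
  have z: "\<alpha> = 0 | \<beta> = 0 | \<gamma> = 0" using z0 unfolding t verts.simps by (auto simp: bt simp del: bary.simps)
  have pt: "bary t a x = \<alpha>" "bary t b x = \<beta>" "bary t c x = \<gamma>" "a \<in> verts t" "b \<in> verts t" "c \<in> verts t"
   unfolding t using bt by auto
  have M: "\<exists>z\<in>verts t. \<exists>w\<in>verts t. z ~= w & m = midpoint z w & bary t z x > 0 & bary t w x > 0" if "\<alpha> > 0" "\<beta> > 0"
   using that pt d mm by metis
  have P: "\<exists>z\<in>verts t. \<exists>w\<in>verts t. z ~= w & p = midpoint z w & bary t z x > 0 & bary t w x > 0" if "\<alpha> > 0" "\<gamma> > 0"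
   using that pt d mm by metis
  have Q: "\<exists>z\<in>verts t. \<exists>w\<in>verts t. z ~= w & q = midpoint z w & bary t z x > 0 & bary t w x > 0" if "\<beta> > 0" "\<gamma> > 0"
   using that pt d mm by metis
  consider "y = a" "\<alpha> > 1/2" | "y = b" "\<beta> > 1/2" | "y = c" "\<gamma> > 1/2" | "y = m" "\<alpha> > 0" "\<beta> > 0"
   | "y = p" "\<alpha> > 0" "\<gamma> > 0" | "y = q" "\<beta> > 0" "\<gamma> > 0"
  proof -
   have "(y = a & \<alpha> > 1/2) | (y = b & \<beta> > 1/2) | (y = c & \<gamma> > 1/2) | (y = m & \<alpha> > 0 & \<beta> > 0)
    | (y = p & \<alpha> > 0 & \<gamma> > 0) | (y = q & \<beta> > 0 & \<gamma> > 0)"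
    using s1
   proof (elim disjE)
    assume S: "s = (a, m, p)"
    hence "\<alpha> >= \<beta> + \<gamma>" "\<beta> >= 0" "\<gamma> >= 0" using s(2) g by auto
    moreover have "(y = a & \<alpha> - \<beta> - \<gamma> > 0) | (y = m & \<beta> > 0) | (y = p & \<gamma> > 0)"
     using y unfolding S verts.simps by (auto simp: g simp del: bary.simps)
    ultimately show ?thesis using one z by argo
   next
    assume S: "s = (m, c, p)"
    hence "\<beta> <= \<alpha>" "\<alpha> <= \<beta> + \<gamma>" "\<beta> >= 0" using s(2) g by auto
    moreover have "(y = m & \<beta> > 0) | (y = c & \<gamma> - \<alpha> + \<beta> > 0) | (y = p & \<alpha> - \<beta> > 0)"
     using y unfolding S verts.simps by (auto simp: g simp del: bary.simps)
    ultimately show ?thesis using one z by argo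
   next
    assume S: "s = (c, m, q)"
    hence "\<alpha> <= \<beta>" "\<beta> <= \<alpha> + \<gamma>" "\<alpha> >= 0" using s(2) g by auto
    moreover have "(y = m & \<alpha> > 0) | (y = c & \<gamma> - \<beta> + \<alpha> > 0) | (y = q & \<beta> - \<alpha> > 0)"
     using y unfolding S verts.simps by (auto simp: g simp del: bary.simps)
    ultimately show ?thesis using one z by argo
   next
    assume S: "s = (m, b, q)"
    hence "\<beta> >= \<alpha> + \<gamma>" "\<alpha> >= 0" "\<gamma> >= 0" using s(2) g by auto
    moreover have "(y = m & \<alpha> > 0) | (y = b & \<beta> - \<alpha> - \<gamma> > 0) | (y = q & \<gamma> > 0)"
     using y unfolding S verts.simps by (auto simp: g simp del: bary.simps)
    ultimately show ?thesis using one z by argo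
   qed
   thus ?thesis using that by blast
  qed
  thus "y \<in> verts t & bary t y x > 1/2 | (\<exists>z\<in>verts t. \<exists>w\<in>verts t. z ~= w & y = midpoint z w & bary t z x > 0 & bary t w x > 0)"
   using pt M P Q by cases auto
 }
 {
  assume z: "z \<in> verts t" "bary t z x > 1/2"
  hence c: "(z = a & \<alpha> > 1/2) | (z = b & \<beta> > 1/2) | (z = c & \<gamma> > 1/2)"
   unfolding t verts.simps by (auto simp: bt simp del: bary.simps)
  show "z \<in> verts s" using s1 s(2) c one by (elim disjE) (auto simp: g)
 }
 {
  assume z: "z \<in> verts t" "w \<in> verts t" "z0 \<in> verts t" "z ~= w" "bary t z0 x = 0" "bary t z x > 0" "bary t w x > 0"
  have zz: "\<alpha> = 0 | \<beta> = 0 | \<gamma> = 0" using z(3,5) unfolding t verts.simps by (auto simp: bt simp del: bary.simps)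
  have c: "(midpoint z w = m & \<alpha> > 0 & \<beta> > 0) | (midpoint z w = p & \<alpha> > 0 & \<gamma> > 0) | (midpoint z w = q & \<beta> > 0 & \<gamma> > 0)"
   using z unfolding t verts.simps by (auto simp: bt mm simp del: bary.simps)
  show "midpoint z w \<in> verts s" using s1 s(2) c one zz by (elim disjE; simp add: g; argo?)
 }
qed

lemma nvb_ref_many:
 assumes "mesh T" "S \<subseteq> T" shows "nvb_ref T (T - S \<union> \<Union> (bisect ` S))"
proof -
 have "finite S" using assms meshD(1) finite_subset by blast
 thus ?thesis using assms(2)
 proof (induction S rule: finite_induct)
  case empty
  thus ?case by (simp add: nvb_ref.refl)
 next
  case (insert s S)
  let ?U = "T - S \<union> \<Union> (bisect ` S)"
  have "s \<notin> bisect r" if "r \<in> S" for r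
  proof
   assume b: "s \<in> bisect r"
   have "nd r" using meshD(2)[OF assms(1)] insert that by blast
   hence "otri s \<subseteq> otri r" using child_props(5) b unfolding child_def by blast
   moreover obtain x where "x \<in> otri s" using otri_nonempty meshD(2)[OF assms(1)] insert by blast
   ultimately have "s = r" using meshD(3)[OF assms(1), of s r x] insert that by blast
   thus False using insert that by blast
  qed
  hence e: "?U - {s} \<union> bisect s = T - insert s S \<union> \<Union> (bisect ` insert s S)" by blast
  have "nvb_ref T ?U" using insert by blast
  hence "nvb_ref T (?U - {s} \<union> bisect s)" by (rule nvb_ref.step) (use insert in blast)
  thus ?case unfolding e .
 qed
qed

text \<open>Two rounds of bisection halve every edge whatever the labels are; after a single round
  neighbours with different refinement edges would leave hanging nodes.\<close>

definition unif :: "ltri set => ltri set" where "unif T = \<Union> (gc ` T)"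

lemma nvb_ref_unif: assumes "mesh T" shows "nvb_ref T (unif T)"
proof -
 let ?T1 = "\<Union> (bisect ` T)"
 have 1: "nvb_ref T ?T1" using nvb_ref_many[OF assms order_refl] by simp
 hence "mesh ?T1" using nvb_ref_mesh assms by blast
 hence "nvb_ref ?T1 (\<Union> (bisect ` ?T1))" using nvb_ref_many[of ?T1 ?T1] by simp
 moreover have "\<Union> (bisect ` ?T1) = unif T" unfolding unif_def gc_def by blast
 ultimately show ?thesis using nvb_ref_trans 1 by metis
qed

lemma gc_props: assumes "nd t" "s \<in> gc t" shows "desc t s" "4 * ar s = ar t" "tri s \<subseteq> tri t" "nd s"
proof -
 obtain u where u: "child t u" "child u s" using assms(2) unfolding gc_def child_def by blast
 have nu: "nd u" by (rule child_props(1)[OF u(1) assms(1)])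
 show "desc t s" using u by (meson converse_rtranclp_into_rtranclp r_into_rtranclp)
 thus "tri s \<subseteq> tri t" "nd s" using desc_props assms(1) by blast+
 show "4 * ar s = ar t" using child_props(2)[OF u(1) assms(1)] child_props(2)[OF u(2) nu] by simp
qed

text \<open>It suffices that a vertex of s with positive coordinate at a common point is also a
  vertex of s'. Inside one triangle this is \<open>gc_local\<close>, across an edge
  \<open>gc_face\<close> carries the description of the vertex over.\<close>

lemma conforming_unif: assumes c: "conforming T" shows "conforming (unif T)"
proof -
 have mT: "mesh T" by (rule conforming_mesh[OF c])
 have mU: "mesh (unif T)" using nvb_ref_mesh[OF nvb_ref_unif[OF mT] mT] by blast
 have key: "y \<in> verts s'" if h: "s \<in> unif T" "s' \<in> unif T" "x \<in> tri s" "x \<in> tri s'" "y \<in> verts s" "bary s y x > 0" for s s' x y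
 proof -
  obtain t t' where t: "t \<in> T" "s \<in> gc t" "t' \<in> T" "s' \<in> gc t'" using h unfolding unif_def by blast
  note n = conformingD(3)[OF c t(1)] conformingD(3)[OF c t(3)]
  have x: "x \<in> tri t" "x \<in> tri t'" using gc_props(3) n t h by blast+
  show ?thesis
  proof (cases "t = t'")
   case True
   thus ?thesis using gc_local[OF n(1)] t h by blast
  next
   case False
   obtain z0 where z0: "z0 \<in> verts t" "z0 \<notin> verts t'" using conforming_verts_neq[OF c t(1,3) False] by blast
   obtain z1 where z1: "z1 \<in> verts t'" "z1 \<notin> verts t" using conforming_verts_neq[OF c t(3,1)] False by blast
   have b0: "bary t z0 x = 0" using conforming_bary_zero[OF c t(1,3) x z0] .
   have b1: "bary t' z1 x = 0" using conforming_bary_zero[OF c t(3,1) x(2,1) z1] .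
   have tr: "z \<in> verts t' & bary t' z x = bary t z x" if "z \<in> verts t" "bary t z x > 0" for z
    using conforming_bary_zero[OF c t(1,3) x that(1)] conforming_bary_eq[OF c t(1,3) x that(1)] that(2) by fastforce
   from gc_face(1)[OF n(1) t(2) h(3,5,6) z0(1) b0]
   show ?thesis
   proof
    assume y: "y \<in> verts t & bary t y x > 1/2"
    hence "y \<in> verts t' & bary t' y x > 1/2" using tr[of y] by auto
    thus ?thesis using gc_face(2)[OF n(2) t(4) h(4)] by blast
   next
    assume "\<exists>z\<in>verts t. \<exists>w\<in>verts t. z ~= w & y = midpoint z w & bary t z x > 0 & bary t w x > 0"
    then obtain z w where zw: "z \<in> verts t" "w \<in> verts t" "z ~= w" "y = midpoint z w" "bary t z x > 0" "bary t w x > 0" by blast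
    thus ?thesis using gc_face(3)[OF n(2) t(4) h(4), of z w z1] tr z1(1) b1 by auto
   qed
  qed
 qed
 have nU: "nd s" if "s \<in> unif T" for s using meshD(2)[OF mU that] .
 have "inj_on verts (unif T)"
 proof (rule inj_onI)
  fix s s' assume s: "s \<in> unif T" "s' \<in> unif T" "verts s = verts s'"
  obtain x where x: "x \<in> otri s" using otri_nonempty[OF nU[OF s(1)]] by blast
  have "x \<in> tri s'" using otri_sub[OF nU[OF s(1)]] x s(3) unfolding tri_def by auto
  thus "s = s'" using mesh_otri_tri[OF mU s(1,2) x] by blast
 qed
 moreover have "tri s \<inter> tri s' = convex hull (verts s \<inter> verts s')" if s: "s \<in> unif T" "s' \<in> unif T" for s s'
 proof
  show "convex hull (verts s \<inter> verts s') \<subseteq> tri s \<inter> tri s'" unfolding tri_def by (simp add: hull_mono)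
  show "tri s \<inter> tri s' \<subseteq> convex hull (verts s \<inter> verts s')"
  proof
   fix x assume x: "x \<in> tri s \<inter> tri s'"
   have "bary s z x = 0" if "z \<in> verts s - (verts s \<inter> verts s')" for z
    using key[OF s, of x z] x that tri_iff[OF nU[OF s(1)], of x] by fastforce
   thus "x \<in> convex hull (verts s \<inter> verts s')"
    using hull_sub_iff[OF nU[OF s(1)], of "verts s \<inter> verts s'" x] x by blast
  qed
 qed
 moreover have "unif T ~= {}"
 proof -
  obtain t where "t \<in> T" using conformingD(2)[OF c] by blast
  moreover have "gc t ~= {}" by (cases t) (simp add: gc_simps)
  ultimately show ?thesis unfolding unif_def by blast
 qed
 ultimately show ?thesis unfolding conforming_def using mU nU unfolding mesh_def nd_iff by blast
qed

text \<open>The uniform refinement is conforming and contains no marked element, hence it is a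
  competitor in the minimality condition and refines T'. So no element is bisected more than twice,
  which is an area factor of 4.\<close>

lemma nvb_refine_depth:
 assumes r: "nvb_refine T M T'" and c: "conforming T" and M: "M \<subseteq> T" and t: "t \<in> T" "ka \<in> T'" "desc t ka"
 shows "ar t <= 4 * ar ka"
proof -
 have mT: "mesh T" by (rule conforming_mesh[OF c])
 have "M \<inter> unif T = {}"
 proof (rule ccontr)
  assume "M \<inter> unif T ~= {}"
  then obtain s u where s: "s \<in> M" "u \<in> T" "s \<in> gc u" unfolding unif_def by blast
  have su: "s \<in> T" using s M by blast
  note g = gc_props[OF meshD(2)[OF mT s(2)] s(3)]
  have "otri s \<subseteq> otri u" using desc_props[OF g(1)] meshD(2)[OF mT s(2)] by blast
  hence "s = u" using meshD(3)[OF mT su s(2)] otri_nonempty[OF g(4)] by blast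
  thus False using g(2) ar_pos[OF g(4)] by simp
 qed
 hence "nvb_ref T' (unif T)" using r nvb_ref_unif[OF mT] conforming_unif[OF c] unfolding nvb_refine_def by blast
 then obtain s where s: "s \<in> unif T" "desc ka s" using nvb_ref_desc t(2) by blast
 obtain u where u: "u \<in> T" "s \<in> gc u" using s unfolding unif_def by blast
 note g = gc_props[OF meshD(2)[OF mT u(1)] u(2)]
 note nt = meshD(2)[OF mT t(1)]
 have nk: "nd ka" using desc_props[OF t(3) nt] by blast
 have "otri s \<subseteq> otri u" using desc_props[OF g(1)] meshD(2)[OF mT u(1)] by blast
 moreover have "otri s \<subseteq> otri t" using desc_props[OF s(2) nk] desc_props[OF t(3) nt] by blast
 ultimately have "t = u" using meshD(3)[OF mT t(1) u(1)] otri_nonempty[OF g(4)] by blast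
 thus ?thesis using g(2) desc_props[OF s(2) nk] by simp
qed

section \<open>Patches\<close>

lemma node_in_tri:
 assumes "conforming T" "z \<in> nodes T" "t \<in> T" "z \<in> tri t" shows "z \<in> verts t"
proof -
 obtain s where s: "s \<in> T" "z \<in> verts s" using assms(2) unfolding nodes_def by blast
 show ?thesis by (rule conforming_vertex[OF assms(1) s(1) assms(3) s(2) assms(4)])
qed

lemma patch_mono:
 assumes "nvb_ref T T'" "mesh T" shows "patch T' z \<subseteq> patch T z"
proof
 fix x assume "x \<in> patch T' z"
 then obtain s where s: "s \<in> T'" "z \<in> tri s" "x \<in> tri s" unfolding patch_def by blast
 obtain t where t: "t \<in> T" "desc t s" using nvb_ref_anc[OF assms(1) s(1)] by blast
 have "tri s \<subseteq> tri t" using desc_props[OF t(2)] meshD(2)[OF assms(2) t(1)] by blast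
 thus "x \<in> patch T z" using s t unfolding patch_def by blast
qed

lemma nodes_mono: assumes "nvb_ref T T'" "mesh T" shows "nodes T \<subseteq> nodes T'"
 using assms(1)
proof (induction rule: nvb_ref.induct)
 case (step T' t)
 obtain a b c where t: "t = (a, b, c)" by (cases t)
 have "verts t \<subseteq> \<Union> (verts ` bisect t)" unfolding t by auto
 hence "nodes T' \<subseteq> nodes (T' - {t} \<union> bisect t)" unfolding nodes_def by blast
 thus ?case using step by blast
qed simp

context forest begin

definition fmesh :: "ltri set => bool" where
 "fmesh T \<longleftrightarrow> conforming T & T \<subseteq> F & \<Union> (tri ` T) = \<Union> (tri ` T0)"

lemma fmeshD: "fmesh T ==> conforming T" "fmesh T ==> T \<subseteq> F" "fmesh T ==> \<Union> (tri ` T) = \<Union> (tri ` T0)" "fmesh T ==> mesh T"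
 by (simp_all add: fmesh_def conforming_mesh)

lemma fmesh_ref: assumes "fmesh T" "nvb_ref T T'" "conforming T'" shows "fmesh T'"
 unfolding fmesh_def
 using nvb_ref_mesh[OF assms(2) fmeshD(4)[OF assms(1)]] F_ref[OF assms(2) fmeshD(2)[OF assms(1)]] assms(3) fmeshD(3)[OF assms(1)]
 by simp

lemma fmesh_desc_eq:
 assumes "fmesh T" "t \<in> T" "s \<in> T" "desc t s" shows "s = t"
proof -
 have n: "nd t" "nd s" using meshD(2)[OF fmeshD(4)[OF assms(1)]] assms by blast+
 have "otri s \<subseteq> otri t" using desc_props[OF assms(4) n(1)] by blast
 thus ?thesis using meshD(3)[OF fmeshD(4)[OF assms(1)] assms(3,2)] otri_nonempty[OF n(2)] by blast
qed

text \<open>If the patch of z is unchanged, every new element below t still contains z. Then a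
  bisection of t must have z as newest vertex, and no further one is possible: one of the children
  of each half would miss z.\<close>

lemma patch_persist:
 assumes T: "fmesh T" "fmesh T'" "nvb_ref T T'" and z: "patch T' z = patch T z" and t: "t \<in> T" "z \<in> verts t"
 shows "t \<in> T' | (\<exists>a b. t = (a, b, z) & bisect t \<subseteq> T')"
proof -
 note mT = fmeshD(4)[OF T(1)] and mT' = fmeshD(4)[OF T(2)]
 have H: "z \<in> tri ka" if k: "ka \<in> T'" "desc t ka" for ka
 proof -
  obtain x where x: "x \<in> otri ka" using otri_nonempty[OF meshD(2)[OF mT' k(1)]] by blast
  have "x \<in> tri t" using x otri_sub[OF meshD(2)[OF mT' k(1)]] desc_props[OF k(2) meshD(2)[OF mT t(1)]] by blast
  hence "x \<in> patch T' z" unfolding z using t verts_tri unfolding patch_def by blast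
  then obtain ka' where k': "ka' \<in> T'" "z \<in> tri ka'" "x \<in> tri ka'" unfolding patch_def by blast
  thus ?thesis using mesh_otri_tri[OF mT' k(1) k'(1) x] by blast
 qed
 obtain a b c where abc: "t = (a, b, c)" by (cases t)
 have tF: "t \<in> F" using fmeshD(2)[OF T(1)] t by blast
 have n: "nd (a, b, c)" using F_nd tF abc by blast
 define m where "m = midpoint a b"
 define u1 u2 where "u1 = (a, c, m)" and "u2 = (c, b, m)"
 note nu = nd_bisect(1,2)[OF n, folded m_def, folded u1_def u2_def]
 have ch: "child t u1" "child t u2" unfolding child_def abc u1_def u2_def m_def by auto
 have uF: "u1 \<in> F" "u2 \<in> F" using F_desc[OF tF] ch by blast+
 note BD = branch_desc[OF mT' fmeshD(2,3)[OF T(2)]]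
 have sub: "z \<in> tri u" if "ka \<in> T'" "desc u ka" "desc t u" for u ka
 proof -
  have "desc t ka" using that by (meson rtranclp_trans)
  moreover have "tri ka \<subseteq> tri u" using desc_props[OF that(2)] F_nd[OF F_desc[OF tF that(3)]] by blast
  ultimately show ?thesis using H that by blast
 qed
 obtain ka where k: "ka \<in> T'" "desc t ka" using nvb_ref_desc[OF T(3) t(1)] by blast
 show ?thesis
 proof (cases "ka = t")
  case False
  obtain k1 where k1: "k1 \<in> T'" "desc u1 k1" using BD[OF tF k False ch(1)] by blast
  obtain k2 where k2: "k2 \<in> T'" "desc u2 k2" using BD[OF tF k False ch(2)] by blast
  have z12: "z \<in> tri u1" "z \<in> tri u2" using sub[OF k1] sub[OF k2] ch by blast+
  note la = lam_at[OF n] lam_at[OF nd_rot(1)[OF n]] lam_at[OF nd_rot(2)[OF n]]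
  have zc: "z = c" using t(2) z12 unfolding abc u1_def u2_def verts.simps
   by (auto simp: tri_bisect[OF n m_def] la simp del: nd.simps)
  have "k1 = u1"
  proof (rule ccontr)
   assume ne: "k1 ~= u1"
   define v where "v = (a, m, midpoint a c)"
   have cv: "child u1 v" unfolding child_def u1_def v_def by simp
   obtain k' where "k' \<in> T'" "desc v k'" using BD[OF uF(1) k1 ne cv] by blast
   hence "z \<in> tri v" using sub[of k' v] ch cv by (meson converse_rtranclp_into_rtranclp r_into_rtranclp)
   thus False unfolding zc v_def
    using tri_bisect(1)[OF nu(1)[unfolded u1_def] HOL.refl, of c] lam_at[OF nd_rot(1)[OF nu(1)[unfolded u1_def]]] lam_at[OF nu(1)[unfolded u1_def]]
    by simp
  qed
  moreover have "k2 = u2"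
  proof (rule ccontr)
   assume ne: "k2 ~= u2"
   define v where "v = (m, b, midpoint c b)"
   have cv: "child u2 v" unfolding child_def u2_def v_def by simp
   obtain k' where "k' \<in> T'" "desc v k'" using BD[OF uF(2) k2 ne cv] by blast
   hence "z \<in> tri v" using sub[of k' v] ch cv by (meson converse_rtranclp_into_rtranclp r_into_rtranclp)
   thus False unfolding zc v_def
    using tri_bisect(2)[OF nu(2)[unfolded u2_def] HOL.refl, of c] lam_at[OF nd_rot(1)[OF nu(2)[unfolded u2_def]]] lam_at[OF nu(2)[unfolded u2_def]]
    by simp
  qed
  ultimately have "bisect t \<subseteq> T'" using k1 k2 unfolding abc u1_def u2_def m_def by auto
  thus ?thesis using abc zc by blast
 qed (use k in blast)
qed

text \<open>The only bisections around z cut edges opposite to z, where the hat vanishes, so its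
  restriction to each half is again the coordinate of z.\<close>

lemma hat_persist:
 assumes T: "fmesh T" "fmesh T'" "nvb_ref T T'" and z: "z \<in> nodes T" "patch T' z = patch T z"
 shows "hat T' z = hat T z"
proof
 fix x
 note cT = fmeshD(1)[OF T(1)] and cT' = fmeshD(1)[OF T(2)] and mT = fmeshD(4)[OF T(1)] and mT' = fmeshD(4)[OF T(2)]
 have eqU: "\<Union> (tri ` T') = \<Union> (tri ` T)" using nvb_ref_mesh[OF T(3) mT] by blast
 show "hat T' z x = hat T z x"
 proof (cases "x \<in> \<Union> (tri ` T')")
  case True
  then obtain ka where k: "ka \<in> T'" "x \<in> tri ka" by blast
  obtain t where t: "t \<in> T" "desc t ka" using nvb_ref_anc[OF T(3) k(1)] by blast
  have nt: "nd t" using meshD(2)[OF mT t(1)] .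
  have kt: "tri ka \<subseteq> tri t" using desc_props[OF t(2) nt] by blast
  have h1: "hat T' z x = (if z \<in> verts ka then bary ka z x else 0)" using hat_eq[OF cT' k] .
  have h2: "hat T z x = (if z \<in> verts t then bary t z x else 0)" using hat_eq[OF cT t(1)] kt k(2) by blast
  show ?thesis
  proof (cases "z \<in> verts t")
   case True
   from patch_persist[OF T z(2) t(1) True] show ?thesis
   proof
    assume "t \<in> T'"
    hence "ka = t" using fmesh_desc_eq[OF T(2) _ k(1) t(2)] by blast
    thus ?thesis using h1 h2 by simp
   next
    assume "\<exists>a b. t = (a, b, z) & bisect t \<subseteq> T'"
    then obtain a b where ab: "t = (a, b, z)" "bisect t \<subseteq> T'" by blast
    have "t ~= ka"
    proof
     assume e: "t = ka"
     obtain u where u: "u \<in> bisect t" using bisect_ne by blast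
     hence "desc t u" unfolding child_def[symmetric] by blast
     hence "u = t" using fmesh_desc_eq[OF T(2)] e k ab u by blast
     thus False using child_props(2)[OF _ nt, of u] u ar_pos[OF nt] unfolding child_def by simp
    qed
    then obtain u where u: "child t u" "desc u ka" using desc_step[OF t(2)] by blast
    hence "ka = u" using fmesh_desc_eq[OF T(2) _ k(1) u(2)] ab unfolding child_def by blast
    hence kk: "ka = (a, z, midpoint a b) | ka = (z, b, midpoint a b)" using u(1) unfolding ab child_def by auto
    have nab: "nd (a, b, z)" using nt ab by simp
    note nn = nd_bisect(1,2)[OF nab]
    have "bary ka z x = bary t z x"
     using kk unfolding ab
     by (auto simp: bary_simps[OF nab] bary_simps[OF nn(1)] bary_simps[OF nn(2)] lam_bisect[OF nab HOL.refl] simp del: bary.simps nd.simps)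
    moreover have "z \<in> verts ka" using kk by auto
    ultimately show ?thesis using h1 h2 True by simp
   qed
  next
   case False
   have "z \<notin> verts ka"
   proof
    assume "z \<in> verts ka"
    hence "z \<in> tri t" using verts_tri kt by blast
    thus False using node_in_tri[OF cT z(1) t(1)] False by blast
   qed
   thus ?thesis using h1 h2 False by simp
  qed
 next
  case False
  thus ?thesis using eqU hat_outside by metis
 qed
qed

text \<open>A new vertex lies on an element that was bisected, and a patch shrinks only if one of
  its elements is removed. This attaches every new node to a triangle leaving the mesh, which is
  what makes counting possible.\<close>

lemma newnodes_bisected:
 assumes T: "fmesh T" "fmesh T'" "nvb_ref T T'"
  and z: "z \<in> (nodes T' - nodes T) \<union> {z \<in> nodes T. patch T' z \<subset> patch T z}"
 shows "\<exists>r\<in>T - T'. z \<in> tri r"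
proof (cases "z \<in> nodes T")
 case False
 then obtain ka where k: "ka \<in> T'" "z \<in> verts ka" using z unfolding nodes_def by blast
 obtain t where t: "t \<in> T" "desc t ka" using nvb_ref_anc[OF T(3) k(1)] by blast
 have "t \<notin> T'" using fmesh_desc_eq[OF T(2) _ k(1) t(2)] k False t by (auto simp: nodes_def)
 moreover have "z \<in> tri t" using verts_tri[OF k(2)] desc_props[OF t(2) meshD(2)[OF fmeshD(4)[OF T(1)] t(1)]] by blast
 ultimately show ?thesis using t by blast
next
 case True
 then obtain x where x: "x \<in> patch T z" "x \<notin> patch T' z" using z by blast
 thus ?thesis unfolding patch_def by blast
qed

lemma notnew:
 assumes T: "fmesh T" "fmesh T'" "nvb_ref T T'" and z: "z \<in> nodes T'"
  and "z \<notin> (nodes T' - nodes T) \<union> {z \<in> nodes T. patch T' z \<subset> patch T z}"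
 shows "z \<in> nodes T" "patch T' z = patch T z"
 using assms patch_mono[OF T(3) fmeshD(4)[OF T(1)], of z] by blast+

section \<open>Counting\<close>

lemma area_sum_le:
 assumes "mesh S" "\<And>s. s \<in> S ==> tri s \<subseteq> ball x R" "R >= 0" shows "(\<Sum>s\<in>S. ar s) <= pi * R^2"
proof -
 have fin: "finite S" using meshD(1)[OF assms(1)] .
 have "(\<Sum>s\<in>S. ar s) = (\<Sum>s\<in>S. measure lebesgue (otri s))"
  using measure_otri(1) meshD(2)[OF assms(1)] by (intro sum.cong) auto
 also have "... = measure lebesgue (\<Union>s\<in>S. otri s)"
  by (rule measure_UNION_AE[symmetric, OF fin])
   (use measure_otri(2) meshD(2,3)[OF assms(1)] in \<open>auto simp: pairwise_def\<close>)
 also have "... <= measure lebesgue (ball x R)"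
 proof (rule measure_mono_fmeasurable)
  show "(\<Union>s\<in>S. otri s) \<subseteq> ball x R" using assms(2) otri_sub meshD(2)[OF assms(1)] by blast
  show "(\<Union>s\<in>S. otri s) \<in> sets lebesgue" using open_otri by (simp add: borel_open open_UN)
  show "ball x R \<in> lmeasurable" by simp
 qed
 also have "... = pi * R^2" using circle_area[OF assms(3), of x] by (simp add: measure_completion)
 finally show ?thesis .
qed

text \<open>Generations count bisections from the root. Since roots have different areas, generation
  and area determine each other only up to constants of the initial mesh.\<close>

definition Fk :: "nat => ltri set" where "Fk k = {s. \<exists>r\<in>T0. (child ^^ k) r s}"

lemma relpow_ar: "(child ^^ k) r s ==> nd r ==> ar s * 2 ^ k = ar r & nd s"
proof (induction k arbitrary: s)
 case (Suc k)
 then obtain u where u: "(child ^^ k) r u" "child u s" by auto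
 hence "ar u * 2 ^ k = ar r" "nd u" using Suc by auto
 moreover have "ar u = 2 * ar s" "nd s" using child_props(1,2)[OF u(2)] \<open>nd u\<close> by auto
 ultimately show ?case by (simp add: mult_ac)
qed simp

lemma F_Fk: "F = (\<Union>k. Fk k)"
 unfolding F_def Fk_def by (auto simp: rtranclp_power)

lemma Fk_mesh: assumes "G \<subseteq> Fk k" "finite G" shows "mesh G"
 unfolding mesh_def
proof (intro conjI ballI impI)
 have sub: "Fk k \<subseteq> F" unfolding F_Fk by blast
 show "finite G" by fact
 show "nd t" if "t \<in> G" for t using F_nd that assms sub by blast
 fix s s' assume s: "s \<in> G" "s' \<in> G" "s ~= s'"
 show "otri s \<inter> otri s' = {}"
 proof (rule ccontr)
  assume o: "otri s \<inter> otri s' ~= {}"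
  have sF: "s \<in> F" "s' \<in> F" using s assms sub by blast+
  have d: "desc s s' | desc s' s" using F_nested[OF sF o] .
  obtain r r' where r: "r \<in> T0" "(child ^^ k) r s" "r' \<in> T0" "(child ^^ k) r' s'" using s assms unfolding Fk_def by blast
  have n: "nd r" "nd r'" using meshD(2)[OF mesh0] r by blast+
  have dr: "desc r s" "desc r' s'" using r by (meson relpowp_imp_rtranclp)+
  have "otri s \<subseteq> otri r" "otri s' \<subseteq> otri r'" using desc_props dr n by blast+
  hence "r = r'" using meshD(3)[OF mesh0 r(1,3)] o by blast
  hence "ar s * 2 ^ k = ar s' * 2 ^ k" using relpow_ar[OF r(2) n(1)] relpow_ar[OF r(4) n(2)] by simp
  hence "ar s = ar s'" by simp
  thus False using d desc_eq_ar F_nd sF s(3) by (metis order_refl)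
 qed
qed

lemma pow2_window:
 fixes A :: real assumes "A > 0"
 shows "finite {k::nat. A <= 2 ^ k & 2 ^ k <= 2 ^ w * A} & card {k::nat. A <= 2 ^ k & 2 ^ k <= 2 ^ w * A} <= Suc w"
proof -
 let ?K = "{k::nat. A <= 2 ^ k & 2 ^ k <= 2 ^ w * A}"
 define k0 where "k0 = (LEAST k. k \<in> ?K)"
 have "?K \<subseteq> {k0..k0 + w}"
 proof
  fix k assume k: "k \<in> ?K"
  have k0: "k0 \<in> ?K" "k0 <= k" unfolding k0_def using LeastI[of "%k. k \<in> ?K" k] Least_le[of "%k. k \<in> ?K" k] k by blast+
  have "(2::real) ^ k <= 2 ^ w * A" using k by simp
  also have "... <= 2 ^ w * 2 ^ k0" using k0 by simp
  finally have "(2::real) ^ k <= 2 ^ (w + k0)" by (simp add: power_add)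
  hence "k <= w + k0" by simp
  thus "k \<in> {k0..k0 + w}" using k0 by simp
 qed
 thus ?thesis using finite_subset card_mono[of "{k0..k0 + w}" ?K] by auto
qed

end

locale sforest = forest +
 fixes sg :: real
 assumes ne0: "T0 ~= {}" and sig1: "sg >= 1" and sig: "\<And>t. t \<in> T0 ==> Qs t <= sg * ar t"
begin

lemma Qs_le: "s \<in> F ==> Qs s <= sg * ar s" using F_ratio[OF sig] .

text \<open>Packing: the interiors are disjoint, the areas are at least h^2/C, and shape regularity
  keeps all triangles in a ball of radius proportional to h.\<close>

lemma card_ball_bound:
 assumes G: "mesh G" "G \<subseteq> F" and C: "C > 0" "h > 0" and g: "\<And>s. s \<in> G ==> h\<^sup>2 <= C * ar s & ar s <= C * h^2 & tri s \<inter> ball x (C * h) ~= {}"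
 shows "real (card G) <= C * pi * (C + sg * C + 1)^2"
proof -
 define R where "R = (C + sg * C + 1) * h"
 have R0: "R >= 0" unfolding R_def using C sig1 by simp
 have sub: "tri s \<subseteq> ball x R" if s: "s \<in> G" for s
 proof
  fix y assume y: "y \<in> tri s"
  obtain w where w: "w \<in> tri s" "dist x w < C * h" using g[OF s] by auto
  have "Qs s <= sg * (C * h^2)" using Qs_le[of s] G s g[OF s] sig1 by (meson landau_o.R_mult_left_mono mult_left_mono order_trans subsetD zero_le_one)
  also have "... <= ((sg * C + 1) * h)^2"
  proof -
   have "sg * C <= (sg * C + 1)^2" using C sig1 by (simp add: power2_eq_square algebra_simps)
   from mult_right_mono[OF this, of "h^2"] show ?thesis by (simp add: power_mult_distrib mult_ac)
  qed
  finally have "sqrt (Qs s) <= (sg * C + 1) * h" using C sig1 by (intro real_le_lsqrt) auto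
  hence "dist w y <= (sg * C + 1) * h" using tri_dist[OF w(1) y] by linarith
  thus "y \<in> ball x R" using w(2) dist_triangle[of x y w] unfolding R_def by (simp add: algebra_simps)
 qed
 have "real (card G) * (h^2 / C) = (\<Sum>s\<in>G. h^2 / C)" by simp
 also have "... <= (\<Sum>s\<in>G. ar s)" using g C by (intro sum_mono) (simp add: field_simps)
 also have "... <= pi * R^2" by (rule area_sum_le[OF G(1) sub R0])
 finally have "real (card G) * h^2 <= C * (pi * R^2)" using C by (simp add: field_simps)
 hence "real (card G) * h^2 <= (C * pi * (C + sg * C + 1)^2) * h^2"
  unfolding R_def power_mult_distrib by (simp only: mult_ac)
 thus ?thesis using C by simp
qed

definition near :: "real => ltri => ltri set" where
 "near C ka = {s\<in>F. ar s <= C * ar ka & ar ka <= C * ar s & (\<exists>x\<in>tri ka. \<exists>y\<in>tri s. dist x y < C * sqrt (ar ka))}"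

text \<open>Comparable area confines the generation to a window of w + 1 exponents, w accounting for
  the spread of the root areas, and within one generation the packing bound applies.\<close>

lemma near_card: assumes C1: "C >= 1" shows "\<exists>N. \<forall>ka\<in>F. finite (near C ka) & card (near C ka) <= N"
proof -
 define rmin rmax where "rmin = Min (ar ` T0)" and "rmax = Max (ar ` T0)"
 have fin: "finite T0" using meshD(1)[OF mesh0] .
 have rm: "rmin <= ar r & ar r <= rmax" if "r \<in> T0" for r unfolding rmin_def rmax_def using fin that by auto
 have rmin0: "rmin > 0" unfolding rmin_def using fin ne0 ar_pos meshD(2)[OF mesh0] by simp
 have "\<exists>w::nat. C^2 * rmax / rmin < 2 ^ w" by (rule real_arch_pow) simp
 then obtain w :: nat where w: "C^2 * rmax / rmin < 2 ^ w" by blast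
 define C' where "C' = C + sg"
 have C'0: "C' > 0" "C <= C'" unfolding C'_def using C1 sig1 by auto
 define N1 where "N1 = nat \<lfloor>C' * pi * (C' + sg * C' + 1)^2\<rfloor>"
 have main: "finite (near C ka) & card (near C ka) <= Suc w * N1" if k: "ka \<in> F" for ka
 proof -
  have ak: "ar ka > 0" using ar_pos F_nd k by blast
  define h where "h = sqrt (ar ka)"
  have h: "h > 0" "h^2 = ar ka" unfolding h_def using ak by auto
  have nk: "nd ka" using F_nd k by blast
  obtain x0 where x0: "x0 \<in> tri ka" using otri_nonempty otri_sub nk by blast
  let ?A = "rmin / (C * ar ka)"
  let ?K = "{k::nat. ?A <= 2 ^ k & 2 ^ k <= 2 ^ w * ?A}"
  have A0: "?A > 0" using rmin0 C1 ak by simp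
  note pw = pow2_window[OF A0, of w]
  have each: "finite (near C ka \<inter> Fk j) & card (near C ka \<inter> Fk j) <= N1" for j
  proof (rule finite_if_finite_subsets_card_bdd)
   fix G assume G: "G \<subseteq> near C ka \<inter> Fk j" "finite G"
   have GF: "G \<subseteq> F" using G unfolding near_def by blast
   have mG: "mesh G" using Fk_mesh[of G j] G by blast
   have "real (card G) <= C' * pi * (C' + sg * C' + 1)^2"
   proof (rule card_ball_bound[OF mG GF C'0(1) h(1), of x0])
    fix s assume "s \<in> G"
    hence "s \<in> near C ka" using G by blast
    then obtain x y where s: "ar s <= C * ar ka" "ar ka <= C * ar s" "x \<in> tri ka" "y \<in> tri s" "dist x y < C * h"
     unfolding near_def h_def by blast
    have "sqrt (Qs ka) <= sg * h"
    proof (rule real_le_lsqrt)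
     have "Qs ka <= sg * h^2" using Qs_le[OF k] h by simp
     also have "... <= sg^2 * h^2" using sig1 by (intro mult_right_mono) (auto simp: power2_eq_square)
     finally show "Qs ka <= (sg * h)^2" by (simp add: power_mult_distrib)
    qed (use h sig1 in auto)
    hence "dist x0 x <= sg * h" using tri_dist[OF x0 s(3)] by linarith
    hence "dist x0 y < C' * h" using s(5) dist_triangle[of x0 y x] unfolding C'_def by (simp add: algebra_simps)
    hence i: "tri s \<inter> ball x0 (C' * h) ~= {}" using s(4) by auto
    have "ar ka <= C' * ar s" using s(2) C'0 by (meson ar_nonneg mult_right_mono order_trans)
    moreover have "ar s <= C' * ar ka" using s(1) C'0 by (meson ar_nonneg mult_right_mono order_trans)
    ultimately show "h^2 <= C' * ar s & ar s <= C' * h^2 & tri s \<inter> ball x0 (C' * h) ~= {}" using i h by simp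
   qed
   thus "card G <= N1" unfolding N1_def by linarith
  qed
  have cover: "near C ka \<subseteq> (\<Union>j\<in>?K. near C ka \<inter> Fk j)"
  proof
   fix s assume s: "s \<in> near C ka"
   hence "s \<in> F" unfolding near_def by blast
   then obtain j where j: "s \<in> Fk j" unfolding F_Fk by blast
   then obtain r where r: "r \<in> T0" "(child ^^ j) r s" unfolding Fk_def by blast
   have e: "ar s * 2 ^ j = ar r" using relpow_ar[OF r(2)] meshD(2)[OF mesh0 r(1)] by blast
   have s': "ar s <= C * ar ka" "ar ka <= C * ar s" using s unfolding near_def by auto
   have "rmin <= ar s * 2 ^ j" using rm[OF r(1)] e by simp
   also have "... <= C * ar ka * 2 ^ j" using s' by (intro mult_right_mono) auto
   finally have 1: "?A <= 2 ^ j" using C1 ak by (simp add: divide_le_eq mult_ac)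
   have "ar ka * 2 ^ j <= C * (ar s * 2 ^ j)" using s'(2) mult_right_mono[of "ar ka" "C * ar s" "2 ^ j"] by (simp add: mult_ac)
   also have "... <= C * rmax" unfolding e using rm[OF r(1)] C1 by simp
   also have "... <= 2 ^ w * rmin / C"
   proof -
    have "C^2 * rmax < 2 ^ w * rmin" using w rmin0 by (simp add: divide_less_eq)
    thus ?thesis using C1 by (simp add: field_simps power2_eq_square)
   qed
   finally have 2: "2 ^ j <= 2 ^ w * ?A" using C1 ak by (simp add: field_simps)
   show "s \<in> (\<Union>j\<in>?K. near C ka \<inter> Fk j)" using 1 2 j s by blast
  qed
  have fU: "finite (\<Union>j\<in>?K. near C ka \<inter> Fk j)" using pw each by blast
  have "card (near C ka) <= card (\<Union>j\<in>?K. near C ka \<inter> Fk j)" by (rule card_mono[OF fU cover])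
  also have "... <= (\<Sum>j\<in>?K. card (near C ka \<inter> Fk j))" using pw by (intro card_UN_le) blast
  also have "... <= (\<Sum>j\<in>?K. N1)" using each by (intro sum_mono) blast
  also have "... = card ?K * N1" by simp
  also have "... <= Suc w * N1" by (rule mult_right_mono) (use pw in auto)
  finally show ?thesis using finite_subset[OF cover fU] by blast
 qed
 thus ?thesis by blast
qed

end

section \<open>Vertex fans\<close>

text \<open>An open connected planar set stays connected without the finitely many nodes. Triangles
  reachable through shared edges and the other ones would form two closed sets covering it; a common
  point is no node, hence lies on a common edge.\<close>

lemma conforming_graph_connected:
 assumes c: "conforming T" and U: "open U" "connected U" "U \<subseteq> \<Union> (tri ` T)"
  and t: "t \<in> T" "t' \<in> T" "U \<inter> otri t ~= {}" "U \<inter> otri t' ~= {}"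
 shows "(t, t') \<in> {(s, s'). s \<in> T & s' \<in> T & tri s \<inter> U ~= {} & tri s' \<inter> U ~= {} \<and>
  (\<exists>p q. p ~= q & p \<in> verts s \<inter> verts s' & q \<in> verts s \<inter> verts s')}\<^sup>*" (is "_ \<in> ?R\<^sup>*")
proof (rule ccontr)
 assume neg: "(t, t') \<notin> ?R\<^sup>*"
 define A B where "A = \<Union> (tri ` {s\<in>T. (t, s) \<in> ?R\<^sup>*})" and "B = \<Union> (tri ` {s\<in>T. (t, s) \<notin> ?R\<^sup>*})"
 note fin = conformingD(1)[OF c] and mT = conforming_mesh[OF c]
 have cA: "closed A" "closed B" unfolding A_def B_def using fin closed_tri by (auto intro!: closed_UN)
 define V where "V = U - nodes T"
 have "connected V" unfolding V_def
  by (rule connected_open_diff_countable) (use U finite_nodes[OF fin] in \<open>auto intro: countable_finite\<close>)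
 have cov: "V \<subseteq> A \<union> B" using U(3) unfolding V_def A_def B_def by blast
 have disj: "A \<inter> B \<inter> V = {}"
 proof (rule ccontr)
  assume "A \<inter> B \<inter> V ~= {}"
  then obtain x s s' where x: "x \<in> U" "x \<notin> nodes T" "s \<in> T" "(t, s) \<in> ?R\<^sup>*" "x \<in> tri s" "s' \<in> T" "(t, s') \<notin> ?R\<^sup>*" "x \<in> tri s'"
   unfolding A_def B_def V_def by blast
  have ne: "s ~= s'" using x by blast
  have h: "x \<in> convex hull (verts s \<inter> verts s')" using conformingD(5)[OF c x(3,6) ne] x by blast
  have "\<exists>p q. p ~= q & p \<in> verts s \<inter> verts s' & q \<in> verts s \<inter> verts s'"
  proof (rule ccontr)
   assume "\<not> ?thesis"
   hence "verts s \<inter> verts s' = {} | (\<exists>p. verts s \<inter> verts s' = {p})" by blast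
   then obtain p where "verts s \<inter> verts s' = {p}" using h by auto
   hence "x \<in> verts s" using h by auto
   thus False using x(2,3) nodesI by blast
  qed
  hence "(s, s') \<in> ?R" using x by blast
  thus False using x(4,7) by (meson rtrancl.rtrancl_into_rtrancl)
 qed
 have meet: "V \<inter> otri s ~= {}" if s: "s \<in> T" "U \<inter> otri s ~= {}" for s
 proof -
  have "otri s \<inter> nodes T = {}"
  proof (rule ccontr)
   assume "otri s \<inter> nodes T ~= {}"
   then obtain y u where y: "y \<in> otri s" "u \<in> T" "y \<in> verts u" unfolding nodes_def by blast
   hence "s = u" using mesh_otri_tri[OF mT s(1) y(2,1)] verts_tri by blast
   note n = conformingD(3)[OF c s(1)]
   have "card (verts s - {y}) = 2" using y(3) \<open>s = u\<close> card_verts[OF n] by simp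
   then obtain w where "w \<in> verts s" "w ~= y" by (metis Diff_iff card.empty ex_in_conv singletonI zero_neq_numeral)
   thus False using y \<open>s = u\<close> bary_vertex[OF n, of w y] unfolding otri_def by auto
  qed
  thus ?thesis using s unfolding V_def by blast
 qed
 have "A \<inter> V ~= {}" using meet[OF t(1,3)] t(1) otri_sub[OF conformingD(3)[OF c t(1)]] unfolding A_def by blast
 moreover have "B \<inter> V ~= {}" using meet[OF t(2,4)] t(2) neg otri_sub[OF conformingD(3)[OF c t(2)]] unfolding B_def by blast
 ultimately show False using \<open>connected V\<close> cA cov disj unfolding connected_closed by blast
qed

text \<open>The last hypothesis excludes that the domain touches itself at a boundary point;
  otherwise the triangles around a boundary node could form several fans meeting only in that
  node.\<close>

locale dom = sforest +
 fixes \<Omega> :: "point set"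
 assumes conf0: "conforming T0" and cl: "\<Union> (tri ` T0) = closure \<Omega>" and opn: "open \<Omega>" and conn: "connected \<Omega>"
  and loc: "\<And>z. z \<in> closure \<Omega> ==> \<exists>r0>0. \<forall>r. 0 < r & r < r0 --> connected (\<Omega> \<inter> ball z r)"
begin

lemma otri_meets_dom: assumes "fmesh T" "t \<in> T" "open V" "V \<inter> tri t ~= {}" shows "\<Omega> \<inter> V \<inter> otri t ~= {}"
proof -
 have n: "nd t" using conformingD(3)[OF fmeshD(1)[OF assms(1)] assms(2)] .
 have ne: "V \<inter> otri t ~= {}" using otri_meets[OF n assms(3,4)] .
 have "V \<inter> otri t \<subseteq> closure \<Omega>" using otri_sub[OF n] fmeshD(3)[OF assms(1)] assms(2) cl by blast
 hence "V \<inter> otri t \<inter> closure \<Omega> ~= {}" using ne by blast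
 hence "(V \<inter> otri t) \<inter> \<Omega> ~= {}" using open_Int_closure_eq_empty[of "V \<inter> otri t" \<Omega>] assms(3) open_otri by blast
 thus ?thesis by blast
qed

definition adjr :: "ltri set => point => (ltri \<times> ltri) set" where
 "adjr T z = {(s, s'). s \<in> T & s' \<in> T & z \<in> verts s & z \<in> verts s' & (\<exists>p. p ~= z & p \<in> verts s & p \<in> verts s')}"

text \<open>A small ball around z meets the domain in an open connected set that touches only
  triangles with vertex z, so the chain of edge neighbours stays in the fan.\<close>

lemma fan_connected:
 assumes T: "fmesh T" and t: "t \<in> T" "t' \<in> T" "z \<in> verts t" "z \<in> verts t'" shows "(t, t') \<in> (adjr T z)\<^sup>*"
proof -
 note c = fmeshD(1)[OF T]
 have zc: "z \<in> closure \<Omega>" using verts_tri[OF t(3)] t fmeshD(3)[OF T] cl by blast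
 obtain r0 where r0: "r0 > 0" "\<forall>r. 0 < r & r < r0 --> connected (\<Omega> \<inter> ball z r)" using loc[OF zc] by blast
 define D where "D = \<Union> (tri ` {s\<in>T. z \<notin> tri s})"
 have "closed D" unfolding D_def using conformingD(1)[OF c] closed_tri by (auto intro!: closed_UN)
 moreover have "z \<notin> D" unfolding D_def by blast
 ultimately obtain r1 where r1: "r1 > 0" "ball z r1 \<inter> D = {}"
  using open_contains_ball[of "- D"] by (metis ComplI Compl_disjoint2 disjoint_eq_subset_Compl inf_commute open_Compl)
 define r where "r = min (r0 / 2) r1"
 have r: "r > 0" "r < r0" "r <= r1" unfolding r_def using r0 r1 by auto
 define U where "U = \<Omega> \<inter> ball z r"
 have U: "open U" "connected U" "U \<subseteq> \<Union> (tri ` T)"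
  unfolding U_def using opn r0(2) r fmeshD(3)[OF T] cl closure_subset[of \<Omega>] by auto
 have zs: "z \<in> verts s" if "s \<in> T" "tri s \<inter> U ~= {}" for s
 proof -
  have "z \<in> tri s"
  proof (rule ccontr)
   assume "z \<notin> tri s"
   hence "tri s \<subseteq> D" using that unfolding D_def by blast
   thus False using r1(2) r(3) that(2) subset_ball[OF r(3), of z] unfolding U_def by blast
  qed
  thus ?thesis using node_in_tri[OF c nodesI[OF t(1,3)] that(1)] by blast
 qed
 have m: "U \<inter> otri s ~= {}" if "s \<in> T" "z \<in> verts s" for s
 proof -
  have "z \<in> ball z r \<inter> tri s" using verts_tri[OF that(2)] r by simp
  hence "ball z r \<inter> tri s ~= {}" by blast
  from otri_meets_dom[OF T that(1) open_ball this] show ?thesis unfolding U_def .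
 qed
 let ?R = "{(s, s'). s \<in> T & s' \<in> T & tri s \<inter> U ~= {} & tri s' \<inter> U ~= {} \<and>
  (\<exists>p q. p ~= q & p \<in> verts s \<inter> verts s' & q \<in> verts s \<inter> verts s')}"
 have "(t, t') \<in> ?R\<^sup>*"
  by (rule conforming_graph_connected[OF c U t(1,2) m[OF t(1,3)] m[OF t(2,4)]])
 moreover have "?R \<subseteq> adjr T z"
 proof
  fix x assume "x \<in> ?R"
  then obtain s s' p q where x: "x = (s, s')" "s \<in> T" "s' \<in> T" "tri s \<inter> U ~= {}" "tri s' \<inter> U ~= {}" "p ~= q"
   "p \<in> verts s" "p \<in> verts s'" "q \<in> verts s" "q \<in> verts s'" by blast
  have "\<exists>y. y ~= z & y \<in> verts s & y \<in> verts s'" using x(6-10) by metis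
  thus "x \<in> adjr T z" unfolding adjr_def x(1) using zs[OF x(2,4)] zs[OF x(3,5)] x(2,3) by simp
 qed
 ultimately show ?thesis using rtrancl_mono by blast
qed

lemma global_connected:
 assumes t: "t \<in> T0" "t' \<in> T0"
 shows "(t, t') \<in> {(s, s'). s \<in> T0 & s' \<in> T0 & (\<exists>p q. p ~= q & p \<in> verts s \<inter> verts s' & q \<in> verts s \<inter> verts s')}\<^sup>*"
proof -
 have f0: "fmesh T0" unfolding fmesh_def using conf0 T0_F by blast
 have m: "\<Omega> \<inter> otri s ~= {}" if "s \<in> T0" for s
  using otri_meets_dom[OF f0 that, of UNIV] otri_nonempty[OF conformingD(3)[OF conf0 that]] otri_sub[OF conformingD(3)[OF conf0 that]] by auto
 have "(t, t') \<in> {(s, s'). s \<in> T0 & s' \<in> T0 & tri s \<inter> \<Omega> ~= {} & tri s' \<inter> \<Omega> ~= {} \<and>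
  (\<exists>p q. p ~= q & p \<in> verts s \<inter> verts s' & q \<in> verts s \<inter> verts s')}\<^sup>*"
  by (rule conforming_graph_connected[OF conf0 opn conn _ t m[OF t(1)] m[OF t(2)]]) (use cl closure_subset in blast)
 thus ?thesis by (rule rtrancl_mono[THEN subsetD, rotated]) blast
qed

definition sct :: "point => real => ltri => ltri" where
 "sct z k t = (case t of (a, b, c) => (z + k *R (a - z), z + k *R (b - z), z + k *R (c - z)))"

lemma sct_props:
 assumes "nd t" "z \<in> verts t" "0 < k" "k <= 1"
 shows "nd (sct z k t)" "ar (sct z k t) = k^2 * ar t" "tri (sct z k t) \<subseteq> tri t" "tri (sct z k t) \<subseteq> cball z (k * sqrt (Qs t))"
  "otri (sct z k t) \<subseteq> otri t"
proof -
 obtain a b c where t: "t = (a, b, c)" by (cases t)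
 have d: "z + k *R (b - z) - (z + k *R (a - z)) = k *R (b - a)" "z + k *R (c - z) - (z + k *R (a - z)) = k *R (c - a)"
  by (simp_all add: algebra_simps)
 have s: "sct z k t = (z + k *R (a - z), z + k *R (b - z), z + k *R (c - z))" unfolding t sct_def by simp
 show 1: "nd (sct z k t)" using assms(1,3) unfolding s unfolding nd.simps d det2_simps(5,6) t by simp
 show "ar (sct z k t) = k^2 * ar t" unfolding s unfolding ar.simps d det2_simps(5,6) t by (simp add: abs_mult power2_eq_square)
 have v: "\<exists>y\<in>verts t. w = z + k *R (y - z)" if "w \<in> verts (sct z k t)" for w
  using that unfolding t sct_def by auto
 have "w \<in> tri t" if w: "w \<in> verts (sct z k t)" for w
 proof -
  obtain y where y: "y \<in> verts t" "w = z + k *R (y - z)" using v[OF w] by blast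
  have "w = (1 - k) *R z + k *R y" unfolding y(2) by (simp add: algebra_simps)
  thus ?thesis using convexD_alt[OF convex_tri[of t] verts_tri[OF assms(2)] verts_tri[OF y(1)], of k] assms(3,4) by simp
 qed
 thus 2: "tri (sct z k t) \<subseteq> tri t" unfolding tri_def[of "sct z k t"] by (intro hull_minimal) (auto simp: convex_tri)
 have "w \<in> cball z (k * sqrt (Qs t))" if w: "w \<in> verts (sct z k t)" for w
 proof -
  obtain y where y: "y \<in> verts t" "w = z + k *R (y - z)" using v[OF w] by blast
  have "dist z y <= sqrt (Qs t)" using tri_dist verts_tri[OF assms(2)] verts_tri[OF y(1)] by blast
  hence "k * norm (y - z) <= k * sqrt (Qs t)" using assms(3) by (simp add: dist_norm norm_minus_commute)
  thus ?thesis unfolding y(2) using assms(3) by (simp add: dist_norm)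
 qed
 thus "tri (sct z k t) \<subseteq> cball z (k * sqrt (Qs t))" unfolding tri_def by (intro hull_minimal) auto
 have "otri (sct z k t) \<subseteq> interior (tri t)" using open_otri otri_sub[OF 1] 2 by (intro interior_maximal) auto
 thus "otri (sct z k t) \<subseteq> otri t" using interior_tri_sub[OF assms(1)] by blast
qed

definition Dn :: nat where "Dn = nat \<lfloor>4 * pi * sg\<rfloor>"

text \<open>The sizes within a fan are not yet known to be comparable, so each triangle is first
  shrunk towards z to the size r of the smallest one. The copies have disjoint interiors, area at
  least r^2/sg, and fit into a ball of radius 2r.\<close>

lemma degree_bound: assumes T: "fmesh T" shows "finite {t\<in>T. z \<in> verts t}" "card {t\<in>T. z \<in> verts t} <= Dn"
proof -
 let ?S = "{t\<in>T. z \<in> verts t}"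
 note c = fmeshD(1)[OF T] and mT = fmeshD(4)[OF T]
 show fin: "finite ?S" using conformingD(1)[OF c] by simp
 show "card ?S <= Dn"
 proof (cases "?S = {}")
  case False
  have nS: "nd t" "t \<in> F" if "t \<in> ?S" for t using that conformingD(3)[OF c] fmeshD(2)[OF T] by blast+
  have Q0: "Qs t > 0" if "t \<in> ?S" for t
   using norm_bgr_ge[OF nS(1)[OF that], of z] that Qs_nonneg[of t] by (cases "Qs t = 0") (auto simp: less_le simp del: Qs_nonneg)
  define r where "r = sqrt (Min (Qs ` ?S))"
  have M: "Min (Qs ` ?S) > 0" "\<And>t. t \<in> ?S ==> Min (Qs ` ?S) <= Qs t" using Q0 fin False by auto
  have r: "r > 0" unfolding r_def using M by simp
  define k where "k = (%t. r / sqrt (Qs t))"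
  have k: "0 < k t" "k t <= 1" "k t * sqrt (Qs t) = r" if "t \<in> ?S" for t
   unfolding k_def using r Q0[OF that] M(2)[OF that] by (auto simp: r_def)
  define g where "g = (%t. sct z (k t) t)"
  have g: "nd (g t)" "ar (g t) = (k t)^2 * ar t" "tri (g t) \<subseteq> cball z r" "otri (g t) \<subseteq> otri t" if "t \<in> ?S" for t
   using sct_props[OF nS(1)[OF that], of z "k t"] k[OF that] that unfolding g_def by auto
  have dj: "t = t'" if h: "t \<in> ?S" "t' \<in> ?S" "x \<in> otri (g t)" "x \<in> otri (g t')" for t t' x
  proof -
   have "x \<in> otri t" "x \<in> otri t'" using g(4)[OF h(1)] g(4)[OF h(2)] h(3,4) by blast+
   thus ?thesis using meshD(3)[OF mT, of t t' x] h by blast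
  qed
  have inj: "inj_on g ?S"
  proof (rule inj_onI)
   fix t t' assume h: "t \<in> ?S" "t' \<in> ?S" "g t = g t'"
   obtain x where "x \<in> otri (g t)" using otri_nonempty[OF g(1)[OF h(1)]] by blast
   thus "t = t'" using dj[OF h(1,2)] h(3) by simp
  qed
  have mg: "mesh (g ` ?S)"
   unfolding mesh_def
  proof (intro conjI ballI impI)
   show "finite (g ` ?S)" using fin by simp
   show "nd s" if "s \<in> g ` ?S" for s using that g(1) by blast
   fix s s' assume "s \<in> g ` ?S" "s' \<in> g ` ?S" "s ~= s'"
   then obtain t t' where "t \<in> ?S" "t' \<in> ?S" "s = g t" "s' = g t'" by blast
   thus "otri s \<inter> otri s' = {}" using dj[of t t'] \<open>s ~= s'\<close> by blast
  qed
  have low: "r^2 / sg <= ar (g t)" if "t \<in> ?S" for t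
  proof -
   have "r^2 = (k t)^2 * Qs t" using k(3)[OF that] Q0[OF that] by (metis power_mult_distrib real_sqrt_pow2 less_imp_le)
   also have "... <= (k t)^2 * (sg * ar t)" using Qs_le[OF nS(2)[OF that]] by (intro mult_left_mono) auto
   finally have "r^2 <= sg * ar (g t)" unfolding g(2)[OF that] by (simp add: mult_ac)
   thus ?thesis using sig1 by (simp add: field_simps)
  qed
  have "real (card ?S) * (r^2 / sg) = (\<Sum>t\<in>?S. r^2 / sg)" by simp
  also have "... <= (\<Sum>t\<in>?S. ar (g t))" using low by (intro sum_mono)
  also have "... = (\<Sum>s\<in>g ` ?S. ar s)" by (simp add: sum.reindex[OF inj])
  also have "... <= pi * (2 * r)^2"
  proof (rule area_sum_le[OF mg])
   fix s assume "s \<in> g ` ?S"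
   hence "tri s \<subseteq> cball z r" using g(3) by blast
   also have "... \<subseteq> ball z (2 * r)" using r by auto
   finally show "tri s \<subseteq> ball z (2 * r)" .
  qed (use r in simp)
  finally have "real (card ?S) * r^2 <= (4 * pi * sg) * r^2" using sig1 by (simp add: field_simps)
  hence "real (card ?S) <= 4 * pi * sg" using r by simp
  thus ?thesis unfolding Dn_def by linarith
 next
  case True
  show ?thesis unfolding True by simp
 qed
qed

lemma fan_path:
 assumes T: "fmesh T" and t: "t \<in> T" "t' \<in> T" "z \<in> verts t" "z \<in> verts t'"
 shows "\<exists>n\<le>Dn * Dn. (t, t') \<in> adjr T z ^^ n"
proof -
 let ?S = "{t\<in>T. z \<in> verts t}"
 have sub: "adjr T z \<subseteq> ?S \<times> ?S" unfolding adjr_def by blast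
 note db = degree_bound[OF T, of z]
 have f: "finite (adjr T z)" using finite_subset[OF sub] db(1) by blast
 have "card (adjr T z) <= card (?S \<times> ?S)" using db(1) by (intro card_mono sub) blast
 also have "... <= Dn * Dn" using db(2) by (simp add: card_cartesian_product mult_le_mono)
 finally have "card (adjr T z) <= Dn * Dn" .
 thus ?thesis using fan_connected[OF T t] unfolding rtrancl_finite_eq_relpow[OF f] by (auto intro: order_trans)
qed

lemma ar_edge_le:
 assumes "nd t" "p \<in> verts t" "q \<in> verts t" "p ~= q" shows "(2 * ar t)^2 <= (norm (p - q))^2 * Qs t"
proof -
 obtain a b c where t: "t = (a, b, c)" by (cases t)
 have e: "\<exists>r\<in>verts t. 2 * ar t = \<bar>det2 (q - p) (r - p)\<bar>"
 proof -
  have rot: "det2 (c - b) (a - b) = det2 (b - a) (c - a)" "det2 (a - c) (b - c) = det2 (b - a) (c - a)"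
   "det2 (a - b) (c - b) = - det2 (b - a) (c - a)" "det2 (c - a) (b - a) = - det2 (b - a) (c - a)" "det2 (b - c) (a - c) = - det2 (b - a) (c - a)"
   by (simp_all add: det2_def algebra_simps)
  have "\<not> verts t \<subseteq> {p, q}"
   using card_mono[of "{p, q}" "verts t"] card_verts[OF assms(1)] assms(4) by auto
  then obtain r where r: "r \<in> verts t" "r ~= p" "r ~= q" by blast
  have "p = a | p = b | p = c" "q = a | q = b | q = c" "r = a | r = b | r = c" using assms(2,3) r(1) unfolding t by auto
  hence "2 * ar t = \<bar>det2 (q - p) (r - p)\<bar>" using r(2,3) assms(4) unfolding t ar.simps
   by (elim disjE) (simp_all add: rot del: verts.simps)
  thus ?thesis using r(1) by blast
 qed
 then obtain r where r: "r \<in> verts t" "2 * ar t = \<bar>det2 (q - p) (r - p)\<bar>" by blast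
 have "(2 * ar t)^2 <= (norm (q - p) * norm (r - p))^2" unfolding r(2) using det2_le_norm by (intro power_mono) auto
 also have "... <= (norm (p - q))^2 * Qs t" unfolding power_mult_distrib norm_minus_commute[of p q]
  by (intro mult_left_mono edge_le_Qs r assms) simp
 finally show ?thesis .
qed

text \<open>The common edge is at most \<open>sqrt (Qs t)\<close> long, while an area is at most
  half the product of two edges; shape regularity turns both into a comparison of areas.\<close>

lemma adj_ratio:
 assumes "t \<in> F" "t' \<in> F" "p \<in> verts t" "q \<in> verts t" "p \<in> verts t'" "q \<in> verts t'" "p ~= q" shows "ar t' <= sg^2 * ar t"
proof -
 have n: "nd t" "nd t'" using F_nd assms by blast+
 have a: "ar t' > 0" using ar_pos n by blast
 have "4 * (ar t')^2 <= (norm (p - q))^2 * Qs t'" using ar_edge_le[OF n(2) assms(5,6,7)] by (simp add: power_mult_distrib)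
 also have "... <= Qs t * (sg * ar t')" using edge_le_Qs[OF assms(3,4)] Qs_le[OF assms(2)] by (intro mult_mono) auto
 also have "... <= (sg * ar t) * (sg * ar t')" using Qs_le[OF assms(1)] sig1 a by (intro mult_right_mono) auto
 finally have "(4 * ar t') * ar t' <= (sg^2 * ar t) * ar t'" by (simp add: power2_eq_square mult_ac)
 hence "4 * ar t' <= sg^2 * ar t" using a by simp
 thus ?thesis using a by linarith
qed

text \<open>Each crossing of an edge changes the area by at most sg^2, and a path in the fan can be
  chosen with at most Dn * Dn crossings, the number of pairs.\<close>

definition Kc :: real where "Kc = (sg^2) ^ (Dn * Dn)"

lemma Kc1: "Kc >= 1" unfolding Kc_def using sig1 by (simp add: one_le_power)

lemma fan_ratio:
 assumes T: "fmesh T" and t: "t \<in> T" "t' \<in> T" "z \<in> verts t" "z \<in> verts t'" shows "ar t' <= Kc * ar t"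
proof -
 have step: "ar s' <= sg^2 * ar s" if "(s, s') \<in> adjr T z" for s s'
  using that adj_ratio[of s s' z] fmeshD(2)[OF T] unfolding adjr_def by blast
 have pow: "ar s' <= (sg^2) ^ n * ar s" if "(s, s') \<in> adjr T z ^^ n" for n s s'
  using that
 proof (induction n arbitrary: s')
  case (Suc n)
  then obtain u where u: "(s, u) \<in> adjr T z ^^ n" "(u, s') \<in> adjr T z" by auto
  have "ar s' <= sg^2 * ar u" using step[OF u(2)] .
  also have "... <= sg^2 * ((sg^2) ^ n * ar s)" using Suc.IH[OF u(1)] by (intro mult_left_mono) auto
  finally show ?case by (simp add: mult_ac)
 qed auto
 obtain n where n: "n <= Dn * Dn" "(t, t') \<in> adjr T z ^^ n" using fan_path[OF T t] by blast
 have "ar t' <= (sg^2) ^ n * ar t" using pow[OF n(2)] .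
 also have "... <= Kc * ar t" unfolding Kc_def using sig1 n(1) by (intro mult_right_mono power_increasing) (auto simp: one_le_power)
 finally show ?thesis .
qed

lemma fan_diff:
 fixes v :: "ltri => real"
 assumes T: "fmesh T" and t: "t \<in> T" "t' \<in> T" "z \<in> verts t" "z \<in> verts t'"
  and step: "\<And>s s'. (s, s') \<in> adjr T z ==> \<bar>v s - v s'\<bar> <= \<delta>" and "\<delta> >= 0"
 shows "\<bar>v t - v t'\<bar> <= real (Dn * Dn) * \<delta>"
proof -
 have pow: "\<bar>v s - v s'\<bar> <= real n * \<delta>" if "(s, s') \<in> adjr T z ^^ n" for n s s'
  using that
 proof (induction n arbitrary: s')
  case (Suc n)
  then obtain u where u: "(s, u) \<in> adjr T z ^^ n" "(u, s') \<in> adjr T z" by auto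
  thus ?case using Suc.IH[OF u(1)] step[OF u(2)] by (simp add: algebra_simps)
 qed auto
 obtain n where n: "n <= Dn * Dn" "(t, t') \<in> adjr T z ^^ n" using fan_path[OF T t] by blast
 have "real n * \<delta> <= real (Dn * Dn) * \<delta>" using n(1) assms(7) by (intro mult_right_mono) (simp_all only: of_nat_le_iff)
 thus ?thesis using pow[OF n(2)] by linarith
qed

lemma touch_vertex:
 assumes T: "fmesh T" and t: "t \<in> T" "t' \<in> T" "tri t \<inter> tri t' ~= {}" shows "\<exists>z. z \<in> verts t & z \<in> verts t'"
proof (cases "t = t'")
 case True
 thus ?thesis by (cases t) auto
next
 case False
 hence "convex hull (verts t \<inter> verts t') ~= {}" using conformingD(5)[OF fmeshD(1)[OF T] t(1,2)] t(3) by simp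
 thus ?thesis by auto
qed

lemma touch_ratio:
 assumes T: "fmesh T" and t: "t \<in> T" "t' \<in> T" "tri t \<inter> tri t' ~= {}" shows "ar t' <= Kc * ar t"
 using touch_vertex[OF assms] fan_ratio[OF T t(1,2)] by blast

end

section \<open>Refinement sequences and charges\<close>

context dom begin

text \<open>All that is kept of minimal refinement: each mesh is a conforming refinement of the
  previous one in which areas drop by at most 4. Marked sets are no longer visible.\<close>

definition seqT :: "(nat => ltri set) => nat => bool" where
 "seqT T L \<longleftrightarrow> T 0 = T0 & (\<forall>l<L. nvb_ref (T l) (T (Suc l)) & conforming (T (Suc l)) \<and>
  (\<forall>t\<in>T l. \<forall>ka\<in>T (Suc l). desc t ka --> ar t <= 4 * ar ka))"

lemma f0: "fmesh T0" unfolding fmesh_def using conf0 T0_F by blast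

lemma seq_fmesh: "seqT T L ==> l <= L ==> fmesh (T l)"
proof (induction l)
 case 0
 thus ?case using f0 unfolding seqT_def by simp
next
 case (Suc l)
 hence "fmesh (T l)" "nvb_ref (T l) (T (Suc l))" "conforming (T (Suc l))" unfolding seqT_def by auto
 thus ?case by (rule fmesh_ref)
qed

lemma seq_ref: "seqT T L ==> k <= l ==> l <= L ==> nvb_ref (T k) (T l)"
proof (induction l)
 case 0
 thus ?case using nvb_ref.refl by simp
next
 case (Suc l)
 show ?case
 proof (cases "k = Suc l")
  case True
  thus ?thesis using nvb_ref.refl by simp
 next
  case False
  hence "nvb_ref (T k) (T l)" using Suc by simp
  moreover have "nvb_ref (T l) (T (Suc l))" using Suc unfolding seqT_def by simp
  ultimately show ?thesis using nvb_ref_trans by blast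
 qed
qed

lemma seq_depth: "seqT T L ==> l < L ==> t \<in> T l ==> ka \<in> T (Suc l) ==> desc t ka ==> ar t <= 4 * ar ka"
 unfolding seqT_def by blast

lemma seq_ref0: "seqT T L ==> l <= L ==> nvb_ref T0 (T l)"
 using seq_ref[of T L 0 l] unfolding seqT_def by simp

lemma newnodes_Suc: "newnodes T (Suc k) = (nodes (T (Suc k)) - nodes (T k)) \<union> {z \<in> nodes (T k). patch (T (Suc k)) z \<subset> patch (T k) z}"
 unfolding newnodes_def by simp

lemma newnodes_sub: assumes "seqT T L" "l <= L" shows "newnodes T l \<subseteq> nodes (T l)"
proof (cases l)
 case 0
 thus ?thesis by (simp add: newnodes_def)
next
 case (Suc k)
 have "nodes (T k) \<subseteq> nodes (T l)"
  by (rule nodes_mono[OF seq_ref[OF assms(1)] fmeshD(4)[OF seq_fmesh[OF assms(1)]]]) (use assms Suc in auto)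
 thus ?thesis unfolding Suc newnodes_Suc by blast
qed

lemma finite_newnodes: assumes "seqT T L" "l <= L" shows "finite (newnodes T l)"
 using finite_subset[OF newnodes_sub[OF assms]] finite_nodes conformingD(1)[OF fmeshD(1)[OF seq_fmesh[OF assms]]] by blast

text \<open>The triangles that may pay for the node z in step k: those between the two meshes, ends
  included, below a triangle touching one that contains z. They carry all jumps passed when nodal
  averages of the two meshes near z are compared.\<close>

definition charge :: "(nat => ltri set) => nat => point => ltri set" where
 "charge T k z = {s\<in>F. \<exists>t\<in>T k. \<exists>t'\<in>T k. \<exists>ka\<in>T (Suc k). z \<in> tri t & desc t' s & desc s ka & tri t \<inter> tri t' ~= {}}"

text \<open>If r came back, it would lie below some q of the next mesh, which in turn lies below an
  element of \<open>T k\<close>. That element can only be r, so q = r was never removed.\<close>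

lemma removed_once:
 assumes S: "seqT T L" and r: "r \<in> T k - T (Suc k)" "r \<in> T k'" "k < k'" "k' <= L" shows False
proof -
 have a: "nvb_ref (T (Suc k)) (T k')" "nvb_ref (T k) (T (Suc k))" using seq_ref[OF S] r by auto
 obtain q where q: "q \<in> T (Suc k)" "desc q r" using nvb_ref_anc[OF a(1) r(2)] by blast
 obtain r' where r': "r' \<in> T k" "desc r' q" using nvb_ref_anc[OF a(2) q(1)] by blast
 have fk: "fmesh (T k)" using seq_fmesh[OF S] r by simp
 have "desc r' r" using r' q by (meson rtranclp_trans)
 hence "r = r'" using fmesh_desc_eq[OF fk r'(1)] r by blast
 hence "q = r" using desc_antisym[OF r'(2)] q conformingD(3)[OF fmeshD(1)[OF fk] r'(1)] by blast
 thus False using q r by blast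
qed

text \<open>The first term bounds area ratios: two passages within a mesh, Kc each, and the depth
  factor 4. The second term dominates the distance from s to z through two touching
  triangles.\<close>

definition Cn :: real where "Cn = 4 * Kc^2 + 8 * sg * Kc"

text \<open>Touching triangles of one mesh have comparable areas, and s and v lie only a factor 4
  below them, so area and distance compare with constants of the initial mesh.\<close>

lemma touch_near:
 assumes T: "fmesh T" and t: "t \<in> T" "t' \<in> T" "u \<in> T" "z \<in> tri t" "z \<in> tri u" "tri t \<inter> tri t' ~= {}"
  and s: "desc t' s" "ar t' <= 4 * ar s" and v: "desc u v" "ar u <= 4 * ar v" "z \<in> tri v"
 shows "v \<in> near Cn s"
proof -
 have TF: "t \<in> F" "t' \<in> F" "u \<in> F" using fmeshD(2)[OF T] t by blast+
 have vF: "v \<in> F" using F_desc TF v by blast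
 have sF: "s \<in> F" using F_desc TF s by blast
 have K: "Kc >= 1" by (rule Kc1)
 have r1: "ar t <= Kc * ar t'" "ar t' <= Kc * ar t" using touch_ratio[OF T] t by (auto simp: Int_commute)
 have "tri t \<inter> tri u ~= {}" using t by blast
 hence r2: "ar u <= Kc * ar t" "ar t <= Kc * ar u" using touch_ratio[OF T] t by (auto simp: Int_commute)
 have d1: "ar s <= ar t'" "tri s \<subseteq> tri t'" using desc_props[OF s(1)] F_nd[OF TF(2)] by blast+
 have d2: "ar v <= ar u" using desc_props[OF v(1)] F_nd[OF TF(3)] by blast
 have "ar v <= Kc * (Kc * (4 * ar s))"
 proof -
  have "ar v <= Kc * ar t" using d2 r2 by linarith
  also have "... <= Kc * (Kc * ar t')" using r1 K by (intro mult_left_mono) auto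
  also have "... <= Kc * (Kc * (4 * ar s))" using s(2) K by (intro mult_left_mono) auto
  finally show ?thesis .
 qed
 also have "... <= Cn * ar s" unfolding Cn_def power2_eq_square using sig1 K by (simp add: algebra_simps)
 finally have 1: "ar v <= Cn * ar s" .
 have "ar s <= Kc * (Kc * (4 * ar v))"
 proof -
  have "ar s <= Kc * ar t" using d1 r1 by linarith
  also have "... <= Kc * (Kc * ar u)" using r2 K by (intro mult_left_mono) auto
  also have "... <= Kc * (Kc * (4 * ar v))" using v(2) K by (intro mult_left_mono) auto
  finally show ?thesis .
 qed
 also have "... <= Cn * ar v" unfolding Cn_def power2_eq_square using sig1 K by (simp add: algebra_simps)
 finally have 2: "ar s <= Cn * ar v" .
 define h where "h = sqrt (ar s)"
 have h: "h > 0" "h^2 = ar s" unfolding h_def using ar_pos[OF F_nd[OF sF]] by auto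
 have sq: "sqrt (Qs t') <= 2 * sg * h"
 proof (rule real_le_lsqrt)
  have "Qs t' <= sg * ar t'" using Qs_le TF by blast
  also have "... <= sg * (4 * h^2)" using s(2) h sig1 by (intro mult_left_mono) auto
  also have "... <= sg * (sg * (4 * h^2))"
   using sig1 mult_right_mono[of 1 sg "4 * h^2"] by (intro mult_left_mono) auto
  finally show "Qs t' <= (2 * sg * h)^2" by (simp add: power_mult_distrib power2_eq_square mult_ac)
 qed (use h sig1 in auto)
 have sq2: "sqrt (Qs t) <= 2 * sg * Kc * h"
 proof (rule real_le_lsqrt)
  have "Qs t <= sg * ar t" using Qs_le TF by blast
  also have "... <= sg * (Kc * ar t')" using r1 sig1 by (intro mult_left_mono) auto
  also have "... <= sg * (Kc * (4 * h^2))" using s(2) h sig1 K by (intro mult_left_mono) auto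
  also have "... = sg * Kc * (4 * h^2)" by simp
  also have "... <= (sg * sg) * (Kc * Kc) * (4 * h^2)"
   using sig1 K mult_left_mono[of 1 sg sg] mult_left_mono[of 1 Kc Kc]
   by (intro mult_mono mult_right_mono) auto
  finally show "Qs t <= (2 * sg * Kc * h)^2" by (simp add: power_mult_distrib power2_eq_square mult_ac)
 qed (use h sig1 K in auto)
 obtain x where x: "x \<in> tri s" using otri_nonempty otri_sub F_nd[OF sF] by blast
 obtain y where y: "y \<in> tri t" "y \<in> tri t'" using t by blast
 have "dist x z <= dist x y + dist y z" by (rule dist_triangle)
 also have "... <= 2 * sg * h + 2 * sg * Kc * h"
  using tri_dist[of x t' y] tri_dist[of y t z] x d1 y t sq sq2 by (intro add_mono) (auto intro: order_trans)
 also have "... < Cn * h"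
 proof -
  have "2 * sg + 2 * sg * Kc < Cn"
  proof -
   have "2 * sg <= 2 * sg * Kc" using sig1 K by simp
   moreover have "sg * Kc >= 1" using sig1 K mult_mono[of 1 sg 1 Kc] by simp
   moreover have "Kc^2 >= 0" by simp
   ultimately show ?thesis unfolding Cn_def by linarith
  qed
  from mult_strict_right_mono[OF this h(1)] show ?thesis by (simp add: algebra_simps)
 qed
 finally have "dist x z < Cn * sqrt (ar s)" unfolding h_def .
 thus ?thesis unfolding near_def using 1 2 vF x v(3) by blast
qed

lemma Cn1: "Cn >= 1"
proof -
 have "Kc^2 >= 1" using Kc1 by (simp add: one_le_power)
 moreover have "sg * Kc >= 0" using Kc1 sig1 by simp
 ultimately show ?thesis unfolding Cn_def by linarith
qed

text \<open>An event (k, z) charging s is encoded by a triangle near s that leaves the mesh in step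
  k, together with z, a vertex of a triangle near s. A triangle leaves only once, so the code
  determines k and the map is injective into a set of bounded size.\<close>

lemma multiplicity:
 "\<exists>N::nat. \<forall>T L s. seqT T L --> s \<in> F -->
  finite {(k, z). k < L & z \<in> newnodes T (Suc k) & s \<in> charge T k z} \<and>
  card {(k, z). k < L & z \<in> newnodes T (Suc k) & s \<in> charge T k z} <= N"
proof -
 obtain N where N: "\<And>ka. ka \<in> F ==> finite (near Cn ka) & card (near Cn ka) <= N" using near_card[OF Cn1] by blast
 have "finite E & card E <= N * (3 * N)" if S: "seqT T L" and sF: "s \<in> F" and E: "E = {(k, z). k < L & z \<in> newnodes T (Suc k) & s \<in> charge T k z}"
  for T L s E
 proof -
  define V where "V = \<Union> (verts ` near Cn s)"
  note Ns = N[OF sF]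
  have fV: "finite V" unfolding V_def using Ns by simp
  have "card V <= (\<Sum>v\<in>near Cn s. card (verts v))" unfolding V_def using Ns by (intro card_UN_le) blast
  also have "... = (\<Sum>v\<in>near Cn s. 3)" using card_verts F_nd unfolding near_def by (intro sum.cong) auto
  also have "... <= 3 * N" using Ns by simp
  finally have cV: "card V <= 3 * N" .
  have ex: "\<exists>r. r \<in> T k - T (Suc k) & r \<in> near Cn s & z \<in> V" if kz: "(k, z) \<in> E" for k z
  proof -
   have k: "k < L" "z \<in> newnodes T (Suc k)" "s \<in> charge T k z" using kz unfolding E by auto
   have fk: "fmesh (T k)" "fmesh (T (Suc k))" "nvb_ref (T k) (T (Suc k))" using seq_fmesh[OF S] seq_ref[OF S] k by auto
   obtain t t' ka where c: "t \<in> T k" "t' \<in> T k" "ka \<in> T (Suc k)" "z \<in> tri t" "desc t' s" "desc s ka" "tri t \<inter> tri t' ~= {}"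
    using k(3) unfolding charge_def by blast
   have "ar t' <= 4 * ar ka" using seq_depth[OF S k(1) c(2,3)] c by (meson rtranclp_trans)
   moreover have "ar ka <= ar s" using desc_props[OF c(6)] F_nd[OF sF] by blast
   ultimately have d: "ar t' <= 4 * ar s" by linarith
   obtain r where r: "r \<in> T k - T (Suc k)" "z \<in> tri r" using newnodes_bisected[OF fk] k(2) unfolding newnodes_Suc by blast
   have rn: "r \<in> near Cn s"
    by (rule touch_near[OF fk(1) c(1,2) _ c(4) r(2) c(7,5) d rtranclp.rtrancl_refl _ r(2)]) (use r in auto)
   have "z \<in> nodes (T (Suc k))" using newnodes_sub[OF S, of "Suc k"] k by auto
   then obtain v where v: "v \<in> T (Suc k)" "z \<in> verts v" unfolding nodes_def by blast
   obtain u where u: "u \<in> T k" "desc u v" using nvb_ref_anc[OF fk(3) v(1)] by blast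
   have zu: "z \<in> tri u" using desc_props[OF u(2)] conformingD(3)[OF fmeshD(1)[OF fk(1)] u(1)] verts_tri[OF v(2)] by blast
   have "v \<in> near Cn s"
    by (rule touch_near[OF fk(1) c(1,2) u(1) c(4) zu c(7,5) d u(2) seq_depth[OF S k(1) u(1) v(1) u(2)] verts_tri[OF v(2)]])
   hence "z \<in> V" unfolding V_def using v by blast
   thus ?thesis using r rn by blast
  qed
  define f where "f = (%(k, z). (SOME r. r \<in> T k - T (Suc k) & r \<in> near Cn s & z \<in> V, z))"
  have f: "fst (f (k, z)) \<in> T k - T (Suc k) & fst (f (k, z)) \<in> near Cn s & z \<in> V & snd (f (k, z)) = z" if kz: "(k, z) \<in> E" for k z
   using someI_ex[OF ex[OF kz]] unfolding f_def prod.case fst_conv snd_conv by blast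
  have inj: "inj_on f E"
  proof (rule inj_onI)
   fix e e' assume e: "e \<in> E" "e' \<in> E" "f e = f e'"
   obtain k z k' z' where kz: "e = (k, z)" "e' = (k', z')" by (cases e, cases e')
   note g = f[OF e(1)[unfolded kz]] f[OF e(2)[unfolded kz]]
   have "z = z'" using g e(3) kz by simp
   have r: "fst (f e) \<in> T k - T (Suc k)" "fst (f e) \<in> T k' - T (Suc k')" using g e(3) kz by auto
   have "k < L" "k' < L" using e kz unfolding E by auto
   hence "k = k'" using removed_once[OF S r(1), of k'] removed_once[OF S r(2), of k] r
    by (metis DiffD1 less_imp_le linorder_neqE_nat)
   thus "e = e'" using kz \<open>z = z'\<close> by simp
  qed
  have im: "f ` E \<subseteq> near Cn s \<times> V"
  proof
   fix y assume "y \<in> f ` E"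
   then obtain k z where kz: "(k, z) \<in> E" "y = f (k, z)" by (metis imageE surj_pair)
   show "y \<in> near Cn s \<times> V" unfolding kz(2) mem_Times_iff using f[OF kz(1)] by simp
  qed
  have fin: "finite (near Cn s \<times> V)" using Ns fV by blast
  have "card E = card (f ` E)" using card_image[OF inj] by simp
  also have "... <= card (near Cn s \<times> V)" by (rule card_mono[OF fin im])
  also have "... <= N * (3 * N)" using Ns cV by (simp add: card_cartesian_product mult_le_mono)
  finally show ?thesis using finite_imageD[OF finite_subset[OF im fin] inj] by blast
 qed
 thus ?thesis by blast
qed

lemma charge_anc: assumes "seqT T L" "k < L" shows "charge T k z \<subseteq> anc (T L)"
proof
 fix s assume "s \<in> charge T k z"
 then obtain ka where k: "s \<in> F" "ka \<in> T (Suc k)" "desc s ka" unfolding charge_def by blast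
 obtain v where "v \<in> T L" "desc ka v" using nvb_ref_desc[OF seq_ref[OF assms(1), of "Suc k" L] k(2)] assms by auto
 thus "s \<in> anc (T L)" unfolding anc_def using k by (auto intro: rtranclp_trans)
qed

text \<open>Double counting: after exchanging the sums, each ancestor occurs at most as often as
  \<open>multiplicity\<close> allows.\<close>

lemma charge_sum:
 "\<exists>N::real. N >= 0 & (\<forall>T L \<Psi>. seqT T L --> (\<forall>s. \<Psi> s >= 0) -->
  (\<Sum>(k, z)\<in>(SIGMA k:{..<L}. newnodes T (Suc k)). \<Sum>s\<in>charge T k z. \<Psi> s) <= N * (\<Sum>s\<in>anc (T L). \<Psi> s))"
proof -
 obtain N :: nat where N: "\<And>T L s. seqT T L ==> s \<in> F ==>
  finite {(k, z). k < L & z \<in> newnodes T (Suc k) & s \<in> charge T k z} \<and>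
  card {(k, z). k < L & z \<in> newnodes T (Suc k) & s \<in> charge T k z} <= N" using multiplicity by blast
 have "(\<Sum>(k, z)\<in>(SIGMA k:{..<L}. newnodes T (Suc k)). \<Sum>s\<in>charge T k z. \<Psi> s) <= real N * (\<Sum>s\<in>anc (T L). \<Psi> s)"
  if S: "seqT T L" and P: "\<forall>s. \<Psi> s >= 0" for T L and \<Psi> :: "ltri => real"
 proof -
  let ?E = "SIGMA k:{..<L}. newnodes T (Suc k)"
  have fE: "finite ?E" using finite_newnodes[OF S] by auto
  have fa: "finite (anc (T L))" using finite_anc[OF seq_ref0[OF S order_refl]] .
  have "(\<Sum>(k, z)\<in>?E. \<Sum>s\<in>charge T k z. \<Psi> s) = (\<Sum>e\<in>?E. \<Sum>s\<in>anc (T L). if s \<in> charge T (fst e) (snd e) then \<Psi> s else 0)"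
  proof (rule sum.cong)
   fix e assume e: "e \<in> ?E"
   obtain k z where kz: "e = (k, z)" by (cases e)
   have c: "charge T k z \<subseteq> anc (T L)" using charge_anc[OF S] e kz by auto
   have "(\<Sum>s\<in>anc (T L). if s \<in> charge T k z then \<Psi> s else 0) = (\<Sum>s\<in>anc (T L) \<inter> charge T k z. \<Psi> s)"
    using fa by (simp add: sum.inter_restrict)
   also have "anc (T L) \<inter> charge T k z = charge T k z" using c by blast
   finally show "(case e of (k, z) => \<Sum>s\<in>charge T k z. \<Psi> s) = (\<Sum>s\<in>anc (T L). if s \<in> charge T (fst e) (snd e) then \<Psi> s else 0)"
    unfolding kz by simp
  qed simp
  also have "... = (\<Sum>s\<in>anc (T L). \<Sum>e\<in>?E. if s \<in> charge T (fst e) (snd e) then \<Psi> s else 0)" by (rule sum.swap)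
  also have "... <= (\<Sum>s\<in>anc (T L). real N * \<Psi> s)"
  proof (rule sum_mono)
   fix s assume "s \<in> anc (T L)"
   hence sF: "s \<in> F" unfolding anc_def by blast
   have "(\<Sum>e\<in>?E. if s \<in> charge T (fst e) (snd e) then \<Psi> s else 0) = (\<Sum>e\<in>{e\<in>?E. s \<in> charge T (fst e) (snd e)}. \<Psi> s)"
    by (rule sum.inter_filter[symmetric, OF fE])
   also have "{e\<in>?E. s \<in> charge T (fst e) (snd e)} = {(k, z). k < L & z \<in> newnodes T (Suc k) & s \<in> charge T k z}" by auto
   also have "(\<Sum>e\<in>\<dots>. \<Psi> s) <= real N * \<Psi> s"
    unfolding sum_constant by (rule mult_right_mono) (use N[OF S sF] P in \<open>simp_all only: of_nat_le_iff\<close>)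
   finally show "(\<Sum>e\<in>?E. if s \<in> charge T (fst e) (snd e) then \<Psi> s else 0) <= real N * \<Psi> s" .
  qed
  finally show ?thesis by (simp add: sum_distrib_left)
 qed
 thus ?thesis by (intro exI[of _ "real N"]) auto
qed

end

section \<open>Edge means of piecewise affine functions\<close>

definition emean :: "(point => real) => point => point => real" where
 "emean w p q = integral {0..1} (%s. w (p + s *R (q - p)))"

text \<open>No integrability is assumed, since the locale wants symmetry for all pairs of points,
  also where the segment leaves the domain. If one of the two integrands is not integrable, neither
  is the other, and both integrals are 0.\<close>

lemma emean_sym: "emean w p q = emean w q p"
proof -
 have "{0..1} = (%s. - s + 1) ` {0..1::real}"
 proof
  show "{0..1} \<subseteq> (%s. - s + 1) ` {0..1::real}"
  proof
   fix x :: real assume "x \<in> {0..1}"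
   thus "x \<in> (%s. - s + 1) ` {0..1}" by (intro image_eqI[of _ _ "1 - x"]) auto
  qed
 qed auto
 have "integral ((%s. - s + 1) ` {0..1}) (%s. w (p + (- s + 1) *R (q - p))) = integral {0..1} (%s. w (p + s *R (q - p)))"
 proof (cases "(%s. w (p + s *R (q - p))) integrable_on {0..1}")
  case True
  have "((%s. w (p + ((-1) *R s + 1) *R (q - p))) has_integral (1 / \<bar>-1\<bar>^DIM(real)) *R integral {0..1} (%s. w (p + s *R (q - p))))
   ((%s. (1 / (-1)) *R s + - ((1 / (-1)) *R 1)) ` cbox 0 1)"
   by (rule has_integral_affinity) (use True in \<open>auto simp: integrable_integral\<close>)
  thus ?thesis by (simp add: integral_unique)
 next
  case False
  have "\<not> (%s. w (p + (- s + 1) *R (q - p))) integrable_on {0..1}"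
  proof
   assume a: "(%s. w (p + (- s + 1) *R (q - p))) integrable_on {0..1}"
   have "((%s. w (p + (- ((-1) *R s + 1) + 1) *R (q - p))) has_integral (1 / \<bar>-1\<bar>^DIM(real)) *R integral {0..1} (%s. w (p + (- s + 1) *R (q - p))))
    ((%s. (1 / (-1)) *R s + - ((1 / (-1)) *R 1)) ` cbox 0 1)"
    by (rule has_integral_affinity[where f = "%s. w (p + (- s + 1) *R (q - p))"]) (use a in \<open>auto simp: integrable_integral\<close>)
   hence "(%s. w (p + s *R (q - p))) integrable_on ((%s. - s + 1) ` {0..1})"
    unfolding integrable_on_def by auto
   thus False using False \<open>{0..1} = (%s. - s + 1) ` {0..1::real}\<close> by simp
  qed
  thus ?thesis using False \<open>{0..1} = (%s. - s + 1) ` {0..1::real}\<close> by (simp add: not_integrable_integral)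
 qed
 moreover have "(%s. w (p + (- s + 1) *R (q - p))) = (%s. w (q + s *R (p - q)))"
  by (intro ext arg_cong[where f = w]) (simp add: algebra_simps)
 ultimately show ?thesis unfolding emean_def using \<open>{0..1} = (%s. - s + 1) ` {0..1::real}\<close> by simp
qed

lemma segment_point: "0 <= s ==> s <= 1 ==> p + s *R (q - p) \<in> closed_segment p q"
 by (auto simp: closed_segment_def algebra_simps intro!: exI[of _ s])

lemma continuous_on_segment_param:
 fixes w :: "point => real"
 assumes "continuous_on A w" "closed_segment p q \<subseteq> A" shows "continuous_on {0..1} (%s. w (p + s *R (q - p)))"
proof (rule continuous_on_compose2[OF assms(1)])
 show "continuous_on {0..1} (%s. p + s *R (q - p))" by (intro continuous_intros)
 show "(%s. p + s *R (q - p)) ` {0..1} \<subseteq> A" using assms(2) segment_point[of _ p q] by auto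
qed

lemma emean_half:
 assumes "continuous_on A w" "closed_segment p q \<subseteq> A"
 shows "emean w p q = (emean w p (midpoint p q) + emean w (midpoint p q) q) / 2"
proof -
 let ?f = "%s. w (p + s *R (q - p))"
 have c: "continuous_on {0..1} ?f" by (rule continuous_on_segment_param[OF assms])
 hence i: "?f integrable_on {0..1}" by (rule integrable_continuous_real)
 have i1: "?f integrable_on {0..1/2}" "?f integrable_on {1/2..1}" using integrable_on_subinterval[OF i] by auto
 have "integral {0..1/2} ?f + integral {1/2..1} ?f = integral {0..1} ?f"
  by (rule Henstock_Kurzweil_Integration.integral_combine[OF _ _ i]) auto
 moreover have "integral {0..1/2} ?f = emean w p (midpoint p q) / 2"
 proof -
  have "((%s. ?f ((1/2) *R s + 0)) has_integral (1 / \<bar>1/2\<bar>^DIM(real)) *R integral {0..1/2} ?f) ((%s. (1 / (1/2)) *R s + - ((1 / (1/2)) *R 0)) ` cbox 0 (1/2))"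
   by (rule has_integral_affinity) (use i1 in \<open>auto simp: integrable_integral\<close>)
  moreover have "(%s. (1 / (1/2)) *R s + - ((1 / (1/2)) *R 0)) ` cbox 0 (1/2) = {0..1::real}"
  proof
   show "{0..1::real} \<subseteq> (%s. (1 / (1/2)) *R s + - ((1 / (1/2)) *R 0)) ` cbox 0 (1/2)"
   proof
    fix x :: real assume "x \<in> {0..1}"
    thus "x \<in> (%s. (1 / (1/2)) *R s + - ((1 / (1/2)) *R 0)) ` cbox 0 (1/2)" by (intro image_eqI[of _ _ "x/2"]) auto
   qed
  qed auto
  ultimately have "((%s. ?f (s / 2)) has_integral 2 * integral {0..1/2} ?f) {0..1}" by simp
  hence "integral {0..1} (%s. ?f (s / 2)) = 2 * integral {0..1/2} ?f" by (rule integral_unique)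
  moreover have "integral {0..1} (%s. ?f (s / 2)) = emean w p (midpoint p q)"
   unfolding emean_def
   by (intro arg_cong2[where f = integral] HOL.refl ext arg_cong[where f = w]) (intro point_eqI; simp add: midpoint_def field_simps)
  ultimately show ?thesis by simp
 qed
 moreover have "integral {1/2..1} ?f = emean w (midpoint p q) q / 2"
 proof -
  have "((%s. ?f ((1/2) *R s + 1/2)) has_integral (1 / \<bar>1/2\<bar>^DIM(real)) *R integral {1/2..1} ?f) ((%s. (1 / (1/2)) *R s + - ((1 / (1/2)) *R (1/2))) ` cbox (1/2) 1)"
   by (rule has_integral_affinity) (use i1 in \<open>auto simp: integrable_integral\<close>)
  moreover have "(%s. (1 / (1/2)) *R s + - ((1 / (1/2)) *R (1/2))) ` cbox (1/2) 1 = {0..1::real}"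
  proof
   show "{0..1::real} \<subseteq> (%s. (1 / (1/2)) *R s + - ((1 / (1/2)) *R (1/2))) ` cbox (1/2) 1"
   proof
    fix x :: real assume "x \<in> {0..1}"
    thus "x \<in> (%s. (1 / (1/2)) *R s + - ((1 / (1/2)) *R (1/2))) ` cbox (1/2) 1" by (intro image_eqI[of _ _ "x/2 + 1/2"]) auto
   qed
  qed auto
  ultimately have "((%s. ?f (s / 2 + 1/2)) has_integral 2 * integral {1/2..1} ?f) {0..1}" by simp
  hence "integral {0..1} (%s. ?f (s / 2 + 1/2)) = 2 * integral {1/2..1} ?f" by (rule integral_unique)
  moreover have "integral {0..1} (%s. ?f (s / 2 + 1/2)) = emean w (midpoint p q) q"
   unfolding emean_def
   by (intro arg_cong2[where f = integral] HOL.refl ext arg_cong[where f = w]) (intro point_eqI; simp add: midpoint_def field_simps)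
  ultimately show ?thesis by simp
 qed
 ultimately show ?thesis unfolding emean_def by simp
qed

lemma emean_affine:
 assumes "\<And>s. 0 <= s ==> s <= 1 ==> w (p + s *R (q - p)) = w p + s * (w q - w p)"
 shows "emean w p q = (w p + w q) / 2"
proof -
 have "emean w p q = integral {0..1} (%s. w p + s * (w q - w p))"
  unfolding emean_def using assms by (intro Henstock_Kurzweil_Integration.integral_cong) auto
 also have "((%s. w p + s * (w q - w p)) has_integral (w p * 1 + 1^2 / 2 * (w q - w p)) - (w p * 0 + 0^2 / 2 * (w q - w p))) {0..1::real}"
  by (rule fundamental_theorem_of_calculus) (auto intro!: derivative_eq_intros simp flip: has_real_derivative_iff_has_vector_derivative)
 hence "integral {0..1} (%s. w p + s * (w q - w p)) = (w p + w q) / 2" by (simp add: integral_unique field_simps)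
 finally show ?thesis .
qed

lemma tgrad_inner:
 assumes "nd t" "x \<in> tri t" "y \<in> tri t" and f: "\<And>x. x \<in> tri t ==> f x = (\<Sum>z\<in>verts t. f z * bary t z x)"
 shows "f y - f x = tgrad f t \<bullet> (y - x)"
 using f[OF assms(2)] f[OF assms(3)] bary_sum_affine[of f t y x] unfolding tgrad_def by simp

lemma nd_orthogonal: assumes "nd s" "\<And>p q. p \<in> verts s ==> q \<in> verts s ==> v \<bullet> (q - p) = 0" shows "v = 0"
proof -
 obtain a b c where s: "s = (a, b, c)" by (cases s)
 have "v \<bullet> (b - a) = 0" "v \<bullet> (c - a) = 0" using assms(2) unfolding s by auto
 hence "det2 (b - a) (c - a) * v $ 1 = 0" "det2 (b - a) (c - a) * v $ 2 = 0"
  unfolding det2_def inner_2 by algebra+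
 thus ?thesis using assms(1) unfolding s by (intro point_eqI) auto
qed

lemma tgrad_child:
 assumes "nd t" "desc t s" and f: "\<And>x. x \<in> tri t ==> f x = (\<Sum>z\<in>verts t. f z * bary t z x)"
 shows "tgrad f s = tgrad f t"
proof -
 have s: "nd s" "tri s \<subseteq> tri t" using desc_props[OF assms(2,1)] by auto
 have "(tgrad f s - tgrad f t) \<bullet> (q - p) = 0" if "p \<in> verts s" "q \<in> verts s" for p q
 proof -
  have ps: "p \<in> tri s" "q \<in> tri s" by (rule verts_tri, rule that)+
  hence pt: "p \<in> tri t" "q \<in> tri t" using s(2) by blast+
  show ?thesis
   using tgrad_inner[OF s(1) ps affine_on_sub[OF assms(1) s(1) s(2) f]] tgrad_inner[OF assms(1) pt f]
   by (simp add: inner_diff_left)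
 qed
 thus ?thesis using nd_orthogonal[OF s(1)] by fastforce
qed

lemma bg_sum: assumes "nd (a, b, c)" shows "bg a b c + bg b c a + bg c a b = 0"
proof -
 have "(bg a b c + bg b c a + bg c a b) \<bullet> (y - x) = 0" for x y
  using lam_sum[OF assms, of x] lam_sum[OF assms, of y] lam_affine[of a b c y x] lam_affine[of b c a y x] lam_affine[of c a b y x]
  by (simp add: inner_add_left)
 thus ?thesis using nd_orthogonal[OF assms] by blast
qed

lemma pwaff_segment:
 assumes "nd t" "p \<in> tri t" "q \<in> tri t" and f: "\<And>x. x \<in> tri t ==> f x = (\<Sum>z\<in>verts t. f z * bary t z x)"
  and "0 <= s" "s <= 1"
 shows "f (p + s *R (q - p)) = f p + s * (f q - f p)"
proof -
 have "p + s *R (q - p) \<in> tri t"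
  using closed_segment_subset[OF assms(2,3) convex_tri] segment_point[OF assms(5,6), of p q] by blast
 thus ?thesis using tgrad_inner[OF assms(1,2) _ f, of "p + s *R (q - p)"] tgrad_inner[OF assms(1-3) f] by simp
qed

lemma (in forest) cr_emean:
 assumes "finite T" "pwaff T w" "\<Union> (tri ` T) = \<Union> (tri ` T0)" shows "cr T0 (emean w)"
proof unfold_locales
 show "emean w p q = emean w q p" for p q by (rule emean_sym)
 show "emean w p q = (emean w p (midpoint p q) + emean w (midpoint p q) q) / 2" if "closed_segment p q \<subseteq> \<Union> (tri ` T0)" for p q
  by (rule emean_half[OF pwaff_continuous_on[OF assms(1,2), unfolded assms(3)] that])
qed

text \<open>Where the function is affine, its edge means are its midpoint values, so the averages
  reproduce it. On the leaves they therefore carry its whole energy.\<close>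

lemma (in cr) cr_pwaff:
 assumes "nd t" and f: "\<And>x. x \<in> tri t ==> f x = (\<Sum>z\<in>verts t. f z * bary t z x)" and m: "\<mu> = emean f"
 shows "crg t = tgrad f t" "x \<in> tri t ==> crp t x = f x"
proof -
 obtain a b c where t: "t = (a, b, c)" by (cases t)
 have n: "nd (a, b, c)" using assms t by simp
 have e: "\<mu> p q = (f p + f q) / 2" if "p \<in> verts t" "q \<in> verts t" for p q
  unfolding m by (rule emean_affine, rule pwaff_segment[OF assms(1) verts_tri[OF that(1)] verts_tri[OF that(2)] f])
 have e3: "\<mu> b c = (f b + f c) / 2" "\<mu> a c = (f a + f c) / 2" "\<mu> a b = (f a + f b) / 2" using e unfolding t by auto
 have c: "bg c a b = - bg a b c - bg b c a" using bg_sum[OF n] by (simp add: algebra_simps eq_neg_iff_add_eq_0)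
 have "crg t = f a *R bg a b c + f b *R bg b c a + f c *R bg c a b"
  unfolding t crg.simps e3 c by (intro point_eqI; simp add: field_simps)
 thus g: "crg t = tgrad f t" unfolding tgrad_def t verts.simps verts_sum[OF n] bary_simps[OF n] .
 show "crp t x = f x" if x: "x \<in> tri t"
 proof -
  have v: "a \<in> tri t" "b \<in> tri t" using verts_tri[of _ t] unfolding t by auto
  have mt: "midpoint a b \<in> tri t" using closed_segment_subset[OF v convex_tri] by auto
  have "f (a + (1/2) *R (b - a)) = f a + (1/2) * (f b - f a)" by (rule pwaff_segment[OF assms(1) v f]) auto
  moreover have "a + (1/2) *R (b - a) = midpoint a b" by (intro point_eqI; simp add: midpoint_def field_simps)
  ultimately have "f (midpoint a b) = \<mu> a b" unfolding e3 by (simp add: field_simps)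
  thus ?thesis using tgrad_inner[OF assms(1) mt x f] g unfolding t crp.simps by simp
 qed
qed

section \<open>Interaction of a fine function with a coarse hat function\<close>

definition perp :: "point => point" where "perp v = vector [v $ 2, - v $ 1]"

lemma perp_nth [simp]: "perp v $ 1 = v $ 2" "perp v $ 2 = - v $ 1" by (simp_all add: perp_def)

lemma norm_perp: "norm (perp v) = norm v"
 by (simp add: norm_eq_sqrt_inner inner_2 algebra_simps)

text \<open>Twice the signed area relative to the edge zp: the terms of z and p vanish, so only the
  third vertex contributes and no case distinction on labels arises. The sign tells on which side of
  the edge the triangle lies.\<close>

definition sd :: "ltri => point => point => real" where "sd t z p = (\<Sum>q\<in>verts t. det2 (p - z) (q - z))"

text \<open>Outward normal of the edge zp, scaled by the edge length; it is 0 for p = z.\<close>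

definition nrm :: "ltri => point => point => point" where "nrm t z p = sgn (sd t z p) *R perp (p - z)"

lemma norm_nrm: "norm (nrm t z p) <= norm (p - z)"
 unfolding nrm_def norm_scaleR norm_perp by (cases "sd t z p = 0") (auto simp: abs_sgn_eq)

text \<open>The divergence theorem for a coordinate function, with the normal of the opposite edge
  replaced by those of the two edges at z, since all three normals add up to 0.\<close>

lemma ar_bgr:
 assumes n: "nd t" and z: "z \<in> verts t" shows "ar t *R bgr t z = (1/2) *R (\<Sum>p\<in>verts t. nrm t z p)"
proof -
 have main: "(\<bar>det2 (q - p) (r - p)\<bar> / 2) *R bg p q r = (1/2) *R (sgn (det2 (q - p) (r - p)) *R perp (q - p) + sgn (det2 (r - p) (q - p)) *R perp (r - p))"
  if "det2 (q - p) (r - p) ~= 0" for p q r :: point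
 proof -
  have e: "bg p q r = (1 / det2 (q - p) (r - p)) *R (perp (q - p) - perp (r - p))"
   unfolding bg_def by (intro arg_cong2[where f = scaleR] HOL.refl point_eqI) simp_all
  have "\<bar>det2 (q - p) (r - p)\<bar> / 2 * (1 / det2 (q - p) (r - p)) = sgn (det2 (q - p) (r - p)) / 2"
   using that by (simp add: sgn_if)
  thus ?thesis unfolding e det2_swap[of "r - p" "q - p"] scaleR_scaleR sgn_minus
   by (simp add: algebra_simps)
 qed
 obtain a b c where t: "t = (a, b, c)" by (cases t)
 have nt: "nd (a, b, c)" using n t by simp
 have D: "det2 (c - b) (a - b) = det2 (b - a) (c - a)" "det2 (a - c) (b - c) = det2 (b - a) (c - a)"
  by (simp_all add: det2_def algebra_simps)
 have D0: "det2 (b - a) (c - a) ~= 0" using nt by simp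
 have p0: "perp 0 = 0" by (intro point_eqI) auto
 note S = verts_sum[OF nt]
 show ?thesis
  using z main[of b a c] main[of c b a] main[of a c b] D0
  unfolding t verts.simps nrm_def sd_def S ar.simps
  by (auto simp: bary_simps[OF nt] det2_simps(9,11) D p0 add.commute simp del: bgr.simps)
qed

lemma third_vertex:
 assumes n: "nd t" and v: "z \<in> verts t" "p \<in> verts t" "z ~= p"
 shows "\<exists>q. verts t = {z, p, q} & q ~= z & q ~= p & sd t z p = det2 (p - z) (q - z) & sd t z p ~= 0"
proof -
 have "\<not> verts t \<subseteq> {z, p}" using card_mono[of "{z, p}" "verts t"] card_verts[OF n] v(3) by auto
 then obtain q where q: "q \<in> verts t" "q ~= z" "q ~= p" by blast
 have e: "{z, p, q} = verts t" by (rule card_subset_eq) (use q v card_verts[OF n] in auto)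
 have s: "sd t z p = det2 (p - z) (q - z)"
  unfolding sd_def e[symmetric] using v(3) q by (simp add: det2_simps(9,11))
 have "det2 (p - z) (q - z) ~= 0"
 proof
  assume "det2 (p - z) (q - z) = 0"
  hence "collinear {z, p, q}" by (simp add: collinear_det2)
  thus False using n unfolding nd_iff e by blast
 qed
 thus ?thesis using e q s by auto
qed

lemma bary_midpoint:
 assumes n: "nd t" and v: "z \<in> verts t" "p \<in> verts t" "z ~= p" "y \<in> verts t"
 shows "bary t y (midpoint z p) = (if y = z | y = p then 1/2 else 0)"
proof -
 have e: "midpoint z p = (1 - 1/2) *R z + (1/2) *R p" by (intro point_eqI; simp add: midpoint_def field_simps)
 show ?thesis unfolding e bary_convex using bary_vertex[OF n v(4)] v by auto
qed

lemma side_coord: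
 assumes n: "nd t" and v: "z \<in> verts t" "p \<in> verts t" "z ~= p" and q: "verts t = {z, p, q}" "q ~= z" "q ~= p"
 shows "det2 (p - z) (x - z) = bary t q x * sd t z p"
proof -
 have b: "(\<Sum>y\<in>verts t. bary t y x *R y) = x" "(\<Sum>y\<in>verts t. bary t y x) = 1" using bary_rep[OF n] bary_sum[OF n] by auto
 have x: "x = bary t z x *R z + bary t p x *R p + bary t q x *R q" and o: "bary t z x = 1 - bary t p x - bary t q x"
  using b q v unfolding q(1) by (auto simp: algebra_simps)
 have "x - z = bary t p x *R (p - z) + bary t q x *R (q - z)"
  by (subst x, subst o) (simp add: algebra_simps)
 hence "det2 (p - z) (x - z) = bary t q x * det2 (p - z) (q - z)" by (simp add: det2_simps(2,6,9))
 moreover have "sd t z p = det2 (p - z) (q - z)" unfolding sd_def q(1) using v q by (simp add: det2_simps(9,11))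
 ultimately show ?thesis by simp
qed

lemma det2_perp: "det2 v (- perp v) = (norm v)^2"
 unfolding power2_norm_eq_inner by (simp add: det2_def inner_2 algebra_simps)

lemma side_point:
 assumes n: "nd t" and v: "z \<in> verts t" "p \<in> verts t" "z ~= p" and s: "s * sd t z p > 0"
 shows "\<exists>e0>0. \<forall>e. 0 < e & e < e0 --> midpoint z p + (e * s) *R (- perp (p - z)) \<in> otri t"
proof -
 obtain q where q: "verts t = {z, p, q}" "q ~= z" "q ~= p" using third_vertex[OF n v] by blast
 let ?w = "- perp (p - z)" and ?x = "midpoint z p"
 define B where "B = (%y. \<bar>s * (bgr t y \<bullet> ?w)\<bar>)"
 define e0 where "e0 = 1 / (2 * (B z + B p + 1))"
 have B0: "B y >= 0" for y unfolding B_def by simp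
 have e0: "e0 > 0" unfolding e0_def using B0[of z] B0[of p] by simp
 have "?x + (e * s) *R ?w \<in> otri t" if e: "0 < e" "e < e0" for e
  unfolding otri_def mem_Collect_eq
 proof
  fix y assume "y \<in> verts t"
  then consider "y = z | y = p" | "y = q" using q by blast
  thus "bary t y (?x + (e * s) *R ?w) > 0"
  proof cases
   case 1
   have "bary t y (?x + (e * s) *R ?w) = bary t y ?x + e * (s * (bgr t y \<bullet> ?w))"
    by (subst bary_affine[of _ _ _ ?x]) simp
   moreover have "bary t y ?x = 1/2" using bary_midpoint[OF n v \<open>y \<in> verts t\<close>] 1 by simp
   moreover have "\<bar>e * (s * (bgr t y \<bullet> ?w))\<bar> < 1/2"
   proof -
    have "\<bar>e * (s * (bgr t y \<bullet> ?w))\<bar> = e * B y" unfolding B_def using e by (simp add: abs_mult)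
    also have "... <= e * (B z + B p + 1)" using 1 B0 e by (intro mult_left_mono) (auto simp: add_nonneg_nonneg)
    also have "... < e0 * (B z + B p + 1)" using e B0[of z] B0[of p] by (intro mult_strict_right_mono) auto
    also have "... = 1/2" unfolding e0_def using B0[of z] B0[of p] by (simp add: field_simps)
    finally show ?thesis .
   qed
   ultimately show ?thesis by linarith
  next
   case 2
   have "?x + (e * s) *R ?w - z = (1/2) *R (p - z) + (e * s) *R ?w" by (intro point_eqI; simp add: midpoint_def field_simps)
   hence "det2 (p - z) (?x + (e * s) *R ?w - z) = e * s * (norm (p - z))^2" by (simp only: det2_simps(2,6,9) det2_perp mult_zero_right add_0_left)
   hence eq: "bary t q (?x + (e * s) *R ?w) * sd t z p = e * s * (norm (p - z))^2" using side_coord[OF n v q, of "?x + (e * s) *R ?w"] by simp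
   have np: "(norm (p - z))^2 > 0" using v by simp
   have sd0: "sd t z p ~= 0" using s by auto
   have "bary t q (?x + (e * s) *R ?w) * (sd t z p)^2 = e * (s * sd t z p) * (norm (p - z))^2"
    using eq by (simp add: power2_eq_square mult_ac)
   also have "... > 0" using e s np by simp
   finally have "bary t q (?x + (e * s) *R ?w) > 0" using sd0 by (simp add: zero_less_mult_iff)
   thus ?thesis using 2 by simp
  qed
 qed
 thus ?thesis using e0 by blast
qed

text \<open>If the mesh covers a neighbourhood of the midpoint, an edge of some triangle has exactly
  one triangle on each side: two on the same side would overlap just beside the midpoint, and an
  empty side would leave points uncovered.\<close>

lemma edge_normals_cancel:
 assumes c: "conforming T" and zp: "z ~= p" and U: "open U" "midpoint z p \<in> U" "U \<subseteq> \<Union> (tri ` T)"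
 shows "(\<Sum>t\<in>{t\<in>T. z \<in> verts t & p \<in> verts t}. nrm t z p) = 0"
proof -
 define S where "S = {t\<in>T. z \<in> verts t & p \<in> verts t}"
 let ?x = "midpoint z p" and ?w = "- perp (p - z)"
 note mT = conforming_mesh[OF c]
 have nS: "nd t" if "t \<in> S" for t using that conformingD(3)[OF c] unfolding S_def by blast
 have uniq: "t = t'" if t: "t \<in> S" "t' \<in> S" "s * sd t z p > 0" "s * sd t' z p > 0" for t t' s
 proof -
  obtain e1 where e1: "e1 > 0" "\<forall>e. 0 < e & e < e1 --> ?x + (e * s) *R ?w \<in> otri t"
   using side_point[OF nS[OF t(1)], of z p s] t zp unfolding S_def by blast
  obtain e2 where e2: "e2 > 0" "\<forall>e. 0 < e & e < e2 --> ?x + (e * s) *R ?w \<in> otri t'"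
   using side_point[OF nS[OF t(2)], of z p s] t zp unfolding S_def by blast
  define e where "e = min e1 e2 / 2"
  have "0 < e" "e < e1" "e < e2" unfolding e_def using e1 e2 by auto
  thus ?thesis using e1 e2 meshD(3)[OF mT, of t t'] t unfolding S_def by blast
 qed
 have other: "\<exists>t'\<in>S. s * sd t' z p > 0" if t: "t \<in> S" "s = - sgn (sd t z p)" for t s
 proof -
  have s0: "s ~= 0" using third_vertex[OF nS[OF t(1)], of z p] t zp unfolding S_def by (auto simp: sgn_eq_0_iff)
  define D where "D = \<Union> (tri ` {u\<in>T. ?x \<notin> tri u})"
  have "closed D" unfolding D_def using conformingD(1)[OF c] closed_tri by (auto intro!: closed_UN)
  hence "open (U - D)" by (rule open_Diff[OF U(1)])
  moreover have "?x \<in> U - D" using U(2) unfolding D_def by blast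
  ultimately obtain r where r: "r > 0" "ball ?x r \<subseteq> U - D" by (meson openE)
  have nw: "norm ?w > 0" using zp by (simp add: norm_perp)
  define e where "e = r / (2 * \<bar>s\<bar> * norm ?w)"
  have e0: "e > 0" unfolding e_def using r nw s0 by (intro divide_pos_pos mult_pos_pos) auto
  let ?y = "?x + (e * s) *R ?w"
  have "norm ((e * s) *R ?w) = r / 2" using r(1) nw s0 e0 unfolding norm_scaleR abs_mult e_def by (simp add: field_simps)
  hence "?y \<in> ball ?x r" using r by (simp add: dist_norm)
  hence y: "?y \<in> U" "?y \<notin> D" using r by blast+
  then obtain u where u: "u \<in> T" "?y \<in> tri u" using U(3) by blast
  have xu: "?x \<in> tri u" using y(2) u unfolding D_def by blast
  have tT: "t \<in> T" "z \<in> verts t" "p \<in> verts t" using t unfolding S_def by auto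
  have xt: "?x \<in> tri t" using closed_segment_subset[OF verts_tri[OF tT(2)] verts_tri[OF tT(3)] convex_tri] by auto
  have zu: "z \<in> verts u" "p \<in> verts u"
   using conforming_bary_zero[OF c tT(1) u(1) xt xu tT(2)] conforming_bary_zero[OF c tT(1) u(1) xt xu tT(3)]
    bary_midpoint[OF nS[OF t(1)] tT(2,3) zp tT(2)] bary_midpoint[OF nS[OF t(1)] tT(2,3) zp tT(3)] by auto
  have uS: "u \<in> S" using u zu unfolding S_def by blast
  obtain q where q: "verts u = {z, p, q}" "q ~= z" "q ~= p" using third_vertex[OF nS[OF uS] zu zp] by blast
  have "?y - z = (1/2) *R (p - z) + (e * s) *R ?w" by (intro point_eqI; simp add: midpoint_def field_simps)
  hence "det2 (p - z) (?y - z) = e * s * (norm (p - z))^2" by (simp only: det2_simps(2,6,9) det2_perp mult_zero_right add_0_left)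
  hence eq: "bary u q ?y * sd u z p = e * s * (norm (p - z))^2" using side_coord[OF nS[OF uS] zu zp q, of ?y] by simp
  have "bary u q ?y >= 0" using u(2) tri_iff[OF nS[OF uS]] q by blast
  moreover have "bary u q ?y * (s * sd u z p) = e * s^2 * (norm (p - z))^2" using eq by (simp add: power2_eq_square mult_ac)
  moreover have "e * s^2 * (norm (p - z))^2 > 0" using e0 s0 zp by simp
  ultimately have "s * sd u z p > 0" by (metis zero_less_mult_pos mult_eq_0_iff less_le)
  thus ?thesis using uS by blast
 qed
 have "(\<Sum>t\<in>S. nrm t z p) = 0"
 proof (cases "S = {}")
  case False
  then obtain t where t: "t \<in> S" by blast
  have sd0: "sd t z p ~= 0" using third_vertex[OF nS[OF t], of z p] t zp unfolding S_def by auto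
  obtain t' where t': "t' \<in> S" "(- sgn (sd t z p)) * sd t' z p > 0" using other[OF t HOL.refl] by blast
  have "S = {t, t'}"
  proof
   show "S \<subseteq> {t, t'}"
   proof
    fix u assume u: "u \<in> S"
    have "sd u z p ~= 0" using third_vertex[OF nS[OF u], of z p] u zp unfolding S_def by auto
    hence "sgn (sd t z p) * sd u z p > 0 | (- sgn (sd t z p)) * sd u z p > 0" using sd0 by (auto simp: sgn_if)
    moreover have "sgn (sd t z p) * sd t z p > 0" using sd0 by (auto simp: sgn_if)
    ultimately show "u \<in> {t, t'}" using uniq[OF u t] uniq[OF u t'(1)] t'(2) by blast
   qed
  qed (use t t' in blast)
  moreover have "t ~= t'" using t'(2) sd0 by (auto simp: sgn_if split: if_splits)
  moreover have "sgn (sd t' z p) = - sgn (sd t z p)" using t'(2) sd0 by (auto simp: sgn_if zero_less_mult_iff split: if_splits)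
  ultimately show ?thesis by (simp add: nrm_def)
 qed simp
 thus ?thesis unfolding S_def .
qed

context cr begin

text \<open>By the martingale property a gradient that is constant on coarse triangles does not see
  the refinement. So a fine function can be tested with a coarse hat on the mesh of the hat.\<close>

lemma bilinear_invariant:
 assumes "nvb_ref T T'" "mesh T" "T \<subseteq> F" "pwaff T g"
 shows "(\<Sum>ka\<in>T'. ar ka * (crg ka \<bullet> tgrad g ka)) = (\<Sum>t\<in>T. ar t * (crg t \<bullet> tgrad g t))"
 using assms(1)
proof (induction rule: nvb_ref.induct)
 case (step T' t)
 have m: "mesh T'" using nvb_ref_mesh[OF step(1) assms(2)] by blast
 have TF: "T' \<subseteq> F" using F_ref[OF step(1) assms(3)] .
 have pw: "pwaff T' g" using pwaff_refine[OF step(1) assms(2,4)] .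
 obtain a b c where t: "t = (a, b, c)" by (cases t)
 define t1 t2 where "t1 = (a, c, midpoint a b)" and "t2 = (c, b, midpoint a b)"
 have b: "bisect t = {t1, t2}" unfolding t t1_def t2_def by simp
 have tF: "(a, b, c) \<in> F" using step(2) TF t by blast
 have n: "nd (a, b, c)" using F_nd tF by blast
 have ne: "t1 ~= t2" using bisect_distinct n unfolding t1_def t2_def by blast
 have nin: "s \<notin> T' - {t}" if "s \<in> bisect t" for s
 proof
  assume s: "s \<in> T' - {t}"
  have "otri s \<subseteq> otri t" using child_props(5)[of t s] n t that unfolding child_def by blast
  thus False using meshD(3)[OF m, of s t] s step(2) otri_nonempty[OF meshD(2)[OF m, of s]] by blast
 qed
 let ?f = "%t. ar t * (crg t \<bullet> tgrad g t)"
 have ch: "desc t t1" "desc t t2" using b unfolding child_def[symmetric] by (auto simp: child_def)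
 have tg: "tgrad g t1 = tgrad g t" "tgrad g t2 = tgrad g t"
  using tgrad_child[OF _ ch(1) pwaffD(1)[OF pw step(2)]] tgrad_child[OF _ ch(2) pwaffD(1)[OF pw step(2)]] n t by blast+
 have "?f t1 + ?f t2 = ar t / 2 * ((crg t1 + crg t2) \<bullet> tgrad g t)"
  unfolding tg inner_add_left
  unfolding nd_bisect(3)[OF n, folded t1_def, folded t] nd_bisect(4)[OF n, folded t2_def, folded t] by (simp add: algebra_simps)
 also have "... = ?f t" using crg_bisect[OF tF HOL.refl] unfolding t1_def t2_def t by (simp del: crg.simps ar.simps)
 finally have 2: "?f t1 + ?f t2 = ?f t" .
 have "(\<Sum>s\<in>T' - {t} \<union> bisect t. ?f s) = (\<Sum>s\<in>T' - {t}. ?f s) + (\<Sum>s\<in>bisect t. ?f s)"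
  using meshD(1)[OF m] nin by (intro sum.union_disjoint) auto
 also have "(\<Sum>s\<in>bisect t. ?f s) = ?f t1 + ?f t2" unfolding b using ne by simp
 also have "(\<Sum>s\<in>T' - {t}. ?f s) = (\<Sum>s\<in>T'. ?f s) - ?f t" using meshD(1)[OF m] step(2) by (simp add: sum_diff1)
 finally show ?case using 2 step.IH by simp
qed simp

lemma gbirth_nonzero: "gbirth x ~= 0 ==> \<exists>\<tau>\<in>F. x \<in> otri \<tau>"
 unfolding gbirth_def by (auto split: if_splits)

text \<open>On every edge at z the birth gradient may be subtracted: inside a forest triangle the
  normals of the two sides cancel, and elsewhere the birth gradient is 0. What remains are the jumps
  in \<open>Phi\<close>. The factor 3/2 is the 1/2 of \<open>ar_bgr\<close> times the number of
  vertices.\<close>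

lemma hat_interaction:
 assumes T: "fmesh T" and sig: "\<And>t. t \<in> F ==> Qs t <= sg * ar t" and "sg >= 0"
 shows "\<bar>\<Sum>t\<in>T. ar t * (crg t \<bullet> tgrad (hat T z) t)\<bar> <= 3/2 * (\<Sum>t\<in>{t\<in>T. z \<in> verts t}. sqrt (sg * Phi t))"
proof -
 note c = fmeshD(1)[OF T]
 let ?S = "{t\<in>T. z \<in> verts t}"
 have fT: "finite T" using conformingD(1)[OF c] .
 have tg: "tgrad (hat T z) t = (if z \<in> verts t then bgr t z else 0)" if "t \<in> T" for t
 proof -
  have "tgrad (hat T z) t = (\<Sum>y\<in>verts t. if y = z then bgr t y else 0)"
   unfolding tgrad_def using hat_node[OF c nodesI[OF that]] by (intro sum.cong) auto
  thus ?thesis by simp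
 qed
 have "(\<Sum>t\<in>T. ar t * (crg t \<bullet> tgrad (hat T z) t)) = (\<Sum>t\<in>T. if z \<in> verts t then ar t * (crg t \<bullet> bgr t z) else 0)"
  using tg by (intro sum.cong) auto
 also have "... = (\<Sum>t\<in>?S. ar t * (crg t \<bullet> bgr t z))" by (rule sum.inter_filter[symmetric, OF fT])
 also have "... = (\<Sum>t\<in>?S. 1/2 * (\<Sum>p\<in>verts t. crg t \<bullet> nrm t z p))"
 proof (rule sum.cong)
  fix t assume t: "t \<in> ?S"
  have "ar t * (crg t \<bullet> bgr t z) = crg t \<bullet> (ar t *R bgr t z)" by simp
  also have "... = crg t \<bullet> ((1/2) *R (\<Sum>p\<in>verts t. nrm t z p))" using ar_bgr[of t z] conformingD(3)[OF c] t by simp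
  finally show "ar t * (crg t \<bullet> bgr t z) = 1/2 * (\<Sum>p\<in>verts t. crg t \<bullet> nrm t z p)" by (simp add: inner_sum_right)
 qed simp
 also have "... = 1/2 * (\<Sum>t\<in>?S. \<Sum>p\<in>verts t. crg t \<bullet> nrm t z p)" by (simp add: sum_distrib_left)
 also have "(\<Sum>t\<in>?S. \<Sum>p\<in>verts t. crg t \<bullet> nrm t z p) = (\<Sum>t\<in>?S. \<Sum>p\<in>verts t. (crg t - gbirth (midpoint z p)) \<bullet> nrm t z p)"
 proof -
  have "(\<Sum>t\<in>?S. \<Sum>p\<in>verts t. gbirth (midpoint z p) \<bullet> nrm t z p) = (\<Sum>t\<in>?S. \<Sum>p\<in>nodes T. if p \<in> verts t then gbirth (midpoint z p) \<bullet> nrm t z p else 0)"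
  proof (rule sum.cong)
   fix t assume t: "t \<in> ?S"
   have "nodes T \<inter> verts t = verts t" using t nodesI by blast
   thus "(\<Sum>p\<in>verts t. gbirth (midpoint z p) \<bullet> nrm t z p) = (\<Sum>p\<in>nodes T. if p \<in> verts t then gbirth (midpoint z p) \<bullet> nrm t z p else 0)"
    using sum.inter_restrict[OF finite_nodes[OF fT], of "%p. gbirth (midpoint z p) \<bullet> nrm t z p" "verts t"] by simp
  qed simp
  also have "... = (\<Sum>p\<in>nodes T. \<Sum>t\<in>?S. if p \<in> verts t then gbirth (midpoint z p) \<bullet> nrm t z p else 0)" by (rule sum.swap)
  also have "... = 0"
  proof (rule sum.neutral, rule ballI)
   fix p assume "p \<in> nodes T"
   have "(\<Sum>t\<in>?S. if p \<in> verts t then gbirth (midpoint z p) \<bullet> nrm t z p else 0) = (\<Sum>t\<in>{t\<in>?S. p \<in> verts t}. gbirth (midpoint z p) \<bullet> nrm t z p)"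
    using fT by (intro sum.inter_filter[symmetric]) simp
   also have "{t\<in>?S. p \<in> verts t} = {t\<in>T. z \<in> verts t & p \<in> verts t}" by blast
   also have "(\<Sum>t\<in>\<dots>. gbirth (midpoint z p) \<bullet> nrm t z p) = gbirth (midpoint z p) \<bullet> (\<Sum>t\<in>{t\<in>T. z \<in> verts t & p \<in> verts t}. nrm t z p)"
    by (simp add: inner_sum_right)
   also have "... = 0"
   proof (cases "gbirth (midpoint z p) = 0 | z = p")
    case True
    have "perp 0 = 0" by (intro point_eqI) auto
    thus ?thesis using True by (auto simp: nrm_def)
   next
    case False
    then obtain \<tau> where tau: "\<tau> \<in> F" "midpoint z p \<in> otri \<tau>" using gbirth_nonzero by blast
    have "otri \<tau> \<subseteq> \<Union> (tri ` T)" using F_sub[OF tau(1)] otri_sub[OF F_nd[OF tau(1)]] fmeshD(3)[OF T] by blast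
    thus ?thesis using edge_normals_cancel[OF c _ open_otri tau(2)] False by simp
   qed
   finally show "(\<Sum>t\<in>?S. if p \<in> verts t then gbirth (midpoint z p) \<bullet> nrm t z p else 0) = 0" .
  qed
  finally show ?thesis by (simp add: inner_diff_left sum_subtractf)
 qed
 finally have eq: "(\<Sum>t\<in>T. ar t * (crg t \<bullet> tgrad (hat T z) t)) = 1/2 * (\<Sum>t\<in>?S. \<Sum>p\<in>verts t. (crg t - gbirth (midpoint z p)) \<bullet> nrm t z p)" .
 have trm: "\<bar>(crg t - gbirth (midpoint z p)) \<bullet> nrm t z p\<bar> <= sqrt (sg * Phi t)" if t: "t \<in> ?S" "p \<in> verts t" for t p
 proof (cases "p = z")
  case True
  have "perp 0 = 0" by (intro point_eqI) auto
  thus ?thesis using True Phi_nonneg[of t] assms(3) by (simp add: nrm_def)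
 next
  case False
  let ?J = "crg t - gbirth (midpoint z p)"
  have tF: "t \<in> F" using t fmeshD(2)[OF T] by blast
  have "\<bar>?J \<bullet> nrm t z p\<bar> <= norm ?J * norm (nrm t z p)" by (rule Cauchy_Schwarz_ineq2)
  also have "... <= norm ?J * norm (p - z)" by (intro mult_left_mono norm_nrm) simp
  also have "... <= sqrt (sg * Phi t)"
  proof (rule real_le_rsqrt)
   have "(norm ?J * norm (p - z))^2 <= (norm ?J)^2 * (sg * ar t)" unfolding power_mult_distrib
    using edge_le_Qs[of p t z] t sig[OF tF] by (intro mult_left_mono) (auto intro: order_trans)
   also have "... = sg * (ar t * (norm ?J)^2)" by (simp add: mult_ac)
   also have "... <= sg * Phi t"
   proof (rule mult_left_mono[OF _ assms(3)])
    have "2 * ar t * (norm ?J)^2 <= Phi t" using Phi_edge[of z t p] t False by auto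
    moreover have "ar t * (norm ?J)^2 >= 0" by simp
    ultimately show "ar t * (norm ?J)^2 <= Phi t" by linarith
   qed
   finally show "(norm ?J * norm (p - z))^2 <= sg * Phi t" .
  qed
  finally show ?thesis .
 qed
 have "\<bar>\<Sum>t\<in>?S. \<Sum>p\<in>verts t. (crg t - gbirth (midpoint z p)) \<bullet> nrm t z p\<bar> <= (\<Sum>t\<in>?S. \<Sum>p\<in>verts t. sqrt (sg * Phi t))"
  by (rule order_trans[OF sum_abs], rule sum_mono, rule order_trans[OF sum_abs], rule sum_mono) (use trm in blast)
 also have "... = (\<Sum>t\<in>?S. 3 * sqrt (sg * Phi t))" using card_verts conformingD(3)[OF c] by (intro sum.cong) auto
 also have "... = 3 * (\<Sum>t\<in>?S. sqrt (sg * Phi t))" by (simp only: sum_distrib_left)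
 finally have b: "\<bar>\<Sum>t\<in>?S. \<Sum>p\<in>verts t. (crg t - gbirth (midpoint z p)) \<bullet> nrm t z p\<bar> <= 3 * (\<Sum>t\<in>?S. sqrt (sg * Phi t))" .
 have "\<bar>1/2 * x\<bar> = 1/2 * \<bar>x\<bar>" for x :: real by (simp add: abs_mult)
 thus ?thesis unfolding eq using b by linarith
qed

end

section \<open>Stability of the multilevel splitting in the energy seminorm\<close>

definition events :: "(nat => ltri set) => nat => (nat \<times> point) set" where
 "events T L = (SIGMA l:{..L}. newnodes T l)"

lemma abs_le_sq: "\<bar>x::real\<bar> <= y ==> x\<^sup>2 <= y^2"
 using power_mono[of "\<bar>x\<bar>" y 2] by simp

lemma sum_le_sqrt_card:
 fixes f :: "'a => real" assumes "finite S" "\<And>s. s \<in> S ==> f s >= 0" "card S <= n"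
 shows "(\<Sum>s\<in>S. sqrt (f s))^2 <= real n * (\<Sum>s\<in>S. f s)"
proof -
 have "(\<Sum>s\<in>S. 1 * sqrt (f s))^2 <= (\<Sum>s\<in>S. 1^2) * (\<Sum>s\<in>S. (sqrt (f s))^2)" by (rule Cauchy_Schwarz_ineq_sum)
 also have "... = real (card S) * (\<Sum>s\<in>S. f s)" using assms(2) by simp
 also have "... <= real n * (\<Sum>s\<in>S. f s)" using assms by (intro mult_right_mono sum_nonneg) auto
 finally show ?thesis by simp
qed

context dom begin

lemma finite_events: "seqT T L ==> finite (events T L)"
 unfolding events_def using finite_newnodes by auto

lemma sum_events:
 fixes f :: "nat => point => real"
 assumes S: "seqT T L"
 shows "(\<Sum>(l, z)\<in>events T L. f l z) = (\<Sum>z\<in>nodes T0. f 0 z) + (\<Sum>(k, z)\<in>(SIGMA k:{..<L}. newnodes T (Suc k)). f (Suc k) z)"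
proof -
 have "(\<Sum>(l, z)\<in>events T L. f l z) = (\<Sum>l\<le>L. \<Sum>z\<in>newnodes T l. f l z)"
  unfolding events_def by (rule sum.Sigma[symmetric]) (use finite_newnodes[OF S] in auto)
 also have "... = (\<Sum>z\<in>newnodes T 0. f 0 z) + (\<Sum>k<L. \<Sum>z\<in>newnodes T (Suc k). f (Suc k) z)"
  by (rule sum.atMost_shift)
 also have "newnodes T 0 = nodes T0" using S unfolding newnodes_def seqT_def by simp
 also have "(\<Sum>k<L. \<Sum>z\<in>newnodes T (Suc k). f (Suc k) z) = (\<Sum>(k, z)\<in>(SIGMA k:{..<L}. newnodes T (Suc k)). f (Suc k) z)"
  by (rule sum.Sigma) (use finite_newnodes[OF S] in auto)
 finally show ?thesis .
qed

lemma T0_anc: assumes "seqT T L" shows "T0 \<subseteq> anc (T L)"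
 using nvb_ref_desc[OF seq_ref0[OF assms order_refl]] T0_F unfolding anc_def by blast

lemma T_anc: assumes "seqT T L" shows "T L \<subseteq> anc (T L)"
 using fmeshD(2)[OF seq_fmesh[OF assms order_refl]] unfolding anc_def by blast

lemma finite_ancL: "seqT T L ==> finite (anc (T L))"
 using finite_anc seq_ref0 by blast

lemma fan_charge: assumes S: "seqT T L" "k < L" and t: "t \<in> T (Suc k)" "z \<in> verts t" shows "t \<in> charge T k z"
proof -
 have fk: "fmesh (T k)" "fmesh (T (Suc k))" "nvb_ref (T k) (T (Suc k))" using seq_fmesh[OF S(1)] seq_ref[OF S(1)] S by auto
 obtain u where u: "u \<in> T k" "desc u t" using nvb_ref_anc[OF fk(3) t(1)] by blast
 have "z \<in> tri u" using desc_props[OF u(2)] conformingD(3)[OF fmeshD(1)[OF fk(1)] u(1)] verts_tri[OF t(2)] by blast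
 moreover have "t \<in> F" using t fmeshD(2)[OF fk(2)] by blast
 ultimately show ?thesis unfolding charge_def using u t by blast
qed

lemma event_sum:
 "\<exists>N::real. N >= 0 & (\<forall>T L \<Psi>. seqT T L --> (\<forall>s. \<Psi> s >= 0) -->
  (\<Sum>(l, z)\<in>events T L. \<Sum>s\<in>{t\<in>T l. z \<in> verts t}. \<Psi> s) <= N * (\<Sum>s\<in>anc (T L). \<Psi> s))"
proof -
 obtain N :: real where N0: "N >= 0 & (\<forall>T L \<Psi>. seqT T L --> (\<forall>s. \<Psi> s >= 0) -->
  (\<Sum>(k, z)\<in>(SIGMA k:{..<L}. newnodes T (Suc k)). \<Sum>s\<in>charge T k z. \<Psi> s) <= N * (\<Sum>s\<in>anc (T L). \<Psi> s))"
  by (rule exE[OF charge_sum]) (rule that)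
 note N = conjunct1[OF N0] conjunct2[OF N0, rule_format]
 have "(\<Sum>(l, z)\<in>events T L. \<Sum>s\<in>{t\<in>T l. z \<in> verts t}. \<Psi> s) <= (real (card (nodes T0)) + N) * (\<Sum>s\<in>anc (T L). \<Psi> s)"
  if S: "seqT T L" and P: "\<forall>s. \<Psi> s >= 0" for T L and \<Psi> :: "ltri => real"
 proof -
  have P': "\<And>s. \<Psi> s >= 0" using P by blast
  have fa: "finite (anc (T L))" using finite_ancL[OF S] .
  have "(\<Sum>z\<in>nodes T0. \<Sum>s\<in>{t\<in>T 0. z \<in> verts t}. \<Psi> s) <= (\<Sum>z\<in>nodes T0. \<Sum>s\<in>anc (T L). \<Psi> s)"
  proof (rule sum_mono, rule sum_mono2[OF fa])
   fix z show "{t \<in> T 0. z \<in> verts t} \<subseteq> anc (T L)" using T0_anc[OF S] S unfolding seqT_def by blast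
  qed (use P' in simp)
  moreover have "(\<Sum>(k, z)\<in>(SIGMA k:{..<L}. newnodes T (Suc k)). \<Sum>s\<in>{t\<in>T (Suc k). z \<in> verts t}. \<Psi> s)
   <= (\<Sum>(k, z)\<in>(SIGMA k:{..<L}. newnodes T (Suc k)). \<Sum>s\<in>charge T k z. \<Psi> s)"
  proof (rule sum_mono)
   fix e assume e: "e \<in> (SIGMA k:{..<L}. newnodes T (Suc k))"
   obtain k z where kz: "e = (k, z)" "k < L" using e by auto
   have "(\<Sum>s\<in>{t\<in>T (Suc k). z \<in> verts t}. \<Psi> s) <= (\<Sum>s\<in>charge T k z. \<Psi> s)"
    by (rule sum_mono2) (use finite_subset[OF charge_anc[OF S kz(2)] fa] fan_charge[OF S kz(2)] P' in auto)
   thus "(case e of (k, z) => \<Sum>s\<in>{t\<in>T (Suc k). z \<in> verts t}. \<Psi> s) <= (case e of (k, z) => \<Sum>s\<in>charge T k z. \<Psi> s)"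
    using kz by simp
  qed
  moreover note N(2)[of T L \<Psi>, OF S P']
  ultimately show ?thesis unfolding sum_events[OF S] by (simp add: algebra_simps)
 qed
 thus ?thesis using N(1) by (intro exI[of _ "real (card (nodes T0)) + N"]) auto
qed

lemma hat_pwaff_L: assumes "seqT T L" "l <= L" shows "pwaff (T L) (hat (T l) z)"
 by (rule pwaff_refine[OF seq_ref[OF assms order_refl] fmeshD(4)[OF seq_fmesh[OF assms]] pwaff_hat[OF fmeshD(1)[OF seq_fmesh[OF assms]]]])

lemma cr_of_pwaff: assumes S: "seqT T L" and w: "pwaff (T L) w" shows "cr T0 (emean w)"
 using cr_emean[OF _ w] conformingD(1) fmeshD(1,3)[OF seq_fmesh[OF S order_refl]] by blast

lemma energy_cre: assumes S: "seqT T L" and w: "pwaff (T L) w" shows "cr.cre (emean w) (T L) = energy (T L) w"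
proof -
 interpret cr T0 "emean w" by (rule cr_of_pwaff[OF assms])
 show ?thesis unfolding cre_def energy_def
  using cr_pwaff(1)[OF conformingD(3)[OF fmeshD(1)[OF seq_fmesh[OF S order_refl]]] pwaffD(1)[OF w] HOL.refl]
  by (intro sum.cong) auto
qed

lemma Phi_sum_L: assumes S: "seqT T L" and w: "pwaff (T L) w"
 shows "(\<Sum>s\<in>anc (T L). cr.Phi T0 (emean w) s) <= 320 * energy (T L) w"
proof -
 interpret cr T0 "emean w" by (rule cr_of_pwaff[OF assms])
 have "(\<Sum>s\<in>T L. Phi s) >= 0" by (intro sum_nonneg Phi_nonneg)
 thus ?thesis using Phi_sum[OF seq_ref0[OF S order_refl] conf0] energy_cre[OF S w] by simp
qed

text \<open>The energy of w is the pairing of its coefficients with the interactions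
  \<open>b i\<close> of w and the single hats. Their squares are summable with the energy of w
  itself as bound, by the square function, so Cauchy--Schwarz leaves one factor of the energy to
  cancel.\<close>

lemma energy_upper:
 "\<exists>C::real. C >= 0 & (\<forall>T L c. seqT T L -->
  energy (T L) (%x. \<Sum>(l, z)\<in>events T L. c l z * hat (T l) z x) <= C * (\<Sum>(l, z)\<in>events T L. (c l z)^2))"
proof -
 obtain N :: real where N0: "N >= 0 & (\<forall>T L \<Psi>. seqT T L --> (\<forall>s. \<Psi> s >= 0) -->
  (\<Sum>(l, z)\<in>events T L. \<Sum>s\<in>{t\<in>T l. z \<in> verts t}. \<Psi> s) <= N * (\<Sum>s\<in>anc (T L). \<Psi> s))" by (rule exE[OF event_sum]) (rule that)
 note N = conjunct1[OF N0] conjunct2[OF N0, rule_format]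
 define C where "C = 3 * sg * real Dn * N * 320"
 have C0: "C >= 0" unfolding C_def using N sig1 by simp
 have "energy (T L) (%x. \<Sum>(l, z)\<in>events T L. c l z * hat (T l) z x) <= C * (\<Sum>(l, z)\<in>events T L. (c l z)^2)" if S: "seqT T L" for T L c
 proof -
  let ?I = "events T L"
  have fI: "finite ?I" using finite_events[OF S] .
  define cc where "cc = (%i. c (fst i) (snd i))"
  define et where "et = (%i. hat (T (fst i)) (snd i))"
  define w where "w = (%x. \<Sum>i\<in>?I. cc i * et i x)"
  have wE: "(%x. \<Sum>(l, z)\<in>?I. c l z * hat (T l) z x) = w" unfolding w_def cc_def et_def by (simp add: case_prod_beta)
  have fL: "fmesh (T L)" using seq_fmesh[OF S order_refl] .
  have pe: "pwaff (T L) (et i)" if "i \<in> ?I" for i using hat_pwaff_L[OF S] that unfolding et_def events_def by auto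
  have pw: "pwaff (T L) w" unfolding w_def by (rule pwaff_sum[OF pe])
  interpret cr T0 "emean w" by (rule cr_of_pwaff[OF S pw])
  have crg_tg: "crg ka = tgrad w ka" if "ka \<in> T L" for ka
   using cr_pwaff(1)[OF conformingD(3)[OF fmeshD(1)[OF fL] that] pwaffD(1)[OF pw that] HOL.refl] .
  define b where "b = (%i. \<Sum>ka\<in>T L. ar ka * (tgrad w ka \<bullet> tgrad (et i) ka))"
  have E: "energy (T L) w = (\<Sum>i\<in>?I. cc i * b i)"
  proof -
   have "energy (T L) w = (\<Sum>ka\<in>T L. ar ka * (tgrad w ka \<bullet> tgrad w ka))" unfolding energy_def by (simp add: power2_norm_eq_inner)
   also have "... = (\<Sum>ka\<in>T L. \<Sum>i\<in>?I. cc i * (ar ka * (tgrad w ka \<bullet> tgrad (et i) ka)))"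
   proof (rule sum.cong)
    fix ka assume "ka \<in> T L"
    have "tgrad w ka = (\<Sum>i\<in>?I. cc i *R tgrad (et i) ka)" unfolding w_def by (rule tgrad_sum)
    hence "tgrad w ka \<bullet> tgrad w ka = (\<Sum>i\<in>?I. cc i * (tgrad w ka \<bullet> tgrad (et i) ka))"
     by (metis (no_types, lifting) inner_sum_right inner_scaleR_right sum.cong)
    thus "ar ka * (tgrad w ka \<bullet> tgrad w ka) = (\<Sum>i\<in>?I. cc i * (ar ka * (tgrad w ka \<bullet> tgrad (et i) ka)))"
     by (simp add: sum_distrib_left mult.left_commute)
   qed simp
   also have "... = (\<Sum>i\<in>?I. cc i * b i)" unfolding b_def sum_distrib_left by (rule sum.swap)
   finally show ?thesis .
  qed
  have bb: "(b i)^2 <= 3 * sg * real Dn * (\<Sum>s\<in>{t\<in>T (fst i). snd i \<in> verts t}. Phi s)" if i: "i \<in> ?I" for i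
  proof -
   obtain l z where lz: "i = (l, z)" "l <= L" using i unfolding events_def by auto
   have fl: "fmesh (T l)" using seq_fmesh[OF S lz(2)] .
   let ?S = "{t\<in>T l. z \<in> verts t}"
   have "b i = (\<Sum>ka\<in>T L. ar ka * (crg ka \<bullet> tgrad (hat (T l) z) ka))" unfolding b_def et_def lz using crg_tg by (intro sum.cong) auto
   also have "... = (\<Sum>t\<in>T l. ar t * (crg t \<bullet> tgrad (hat (T l) z) t))"
    by (rule bilinear_invariant[OF seq_ref[OF S lz(2) order_refl] fmeshD(4,2)[OF fl] pwaff_hat[OF fmeshD(1)[OF fl]]])
   finally have "\<bar>b i\<bar> <= 3/2 * (\<Sum>t\<in>?S. sqrt (sg * Phi t))" using hat_interaction[OF fl Qs_le, of z] sig1 by simp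
   hence "(b i)^2 <= (3/2 * (\<Sum>t\<in>?S. sqrt (sg * Phi t)))^2" by (rule abs_le_sq)
   also have "... = 9/4 * (\<Sum>t\<in>?S. sqrt (sg * Phi t))^2" by (simp add: power_mult_distrib power2_eq_square)
   also have "... <= 9/4 * (real Dn * (\<Sum>t\<in>?S. sg * Phi t))"
    using degree_bound[OF fl, of z] Phi_nonneg sig1
    by (intro mult_left_mono sum_le_sqrt_card mult_nonneg_nonneg) (simp_all del: Phi.simps)
   also have "... = 9/4 * (sg * real Dn * (\<Sum>t\<in>?S. Phi t))" by (simp add: sum_distrib_left mult_ac)
   also have "... <= 3 * (sg * real Dn * (\<Sum>t\<in>?S. Phi t))"
    using sig1 Phi_nonneg by (intro mult_right_mono mult_nonneg_nonneg sum_nonneg) (simp_all del: Phi.simps)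
   finally show ?thesis unfolding lz by (simp add: mult_ac)
  qed
  have "(\<Sum>i\<in>?I. (b i)^2) <= (\<Sum>i\<in>?I. 3 * sg * real Dn * (\<Sum>s\<in>{t\<in>T (fst i). snd i \<in> verts t}. Phi s))" by (intro sum_mono bb)
  also have "... = 3 * sg * real Dn * (\<Sum>(l, z)\<in>?I. \<Sum>s\<in>{t\<in>T l. z \<in> verts t}. Phi s)" by (simp add: sum_distrib_left case_prod_beta)
  also have "... <= 3 * sg * real Dn * (N * (\<Sum>s\<in>anc (T L). Phi s))"
   using N(2)[OF S, of Phi] Phi_nonneg sig1 by (intro mult_left_mono) (simp_all del: Phi.simps)
  also have "... <= 3 * sg * real Dn * (N * (320 * energy (T L) w))"
   using Phi_sum_L[OF S pw] sig1 N(1) by (intro mult_left_mono) auto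
  finally have B: "(\<Sum>i\<in>?I. (b i)^2) <= C * energy (T L) w" unfolding C_def by (simp add: mult_ac)
  \<comment> \<open>Both sides now contain the energy; dividing by it, with the case of energy 0
    trivial, gives a bound by the coefficients alone.\<close>
  have "(energy (T L) w)^2 <= (\<Sum>i\<in>?I. (cc i)^2) * (\<Sum>i\<in>?I. (b i)^2)" unfolding E by (rule Cauchy_Schwarz_ineq_sum)
  also have "... <= (\<Sum>i\<in>?I. (cc i)^2) * (C * energy (T L) w)" using B by (intro mult_left_mono sum_nonneg) auto
  finally have "energy (T L) w * energy (T L) w <= (C * (\<Sum>i\<in>?I. (cc i)^2)) * energy (T L) w" by (simp add: power2_eq_square mult_ac)
  moreover have e0: "energy (T L) w >= 0" unfolding energy_def by (intro sum_nonneg) simp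
  moreover have "C * (\<Sum>i\<in>?I. (cc i)^2) >= 0" using C0 by (intro mult_nonneg_nonneg sum_nonneg) auto
  ultimately have "energy (T L) w <= C * (\<Sum>i\<in>?I. (cc i)^2)" by (metis less_eq_real_def mult_le_cancel_right not_le)
  thus ?thesis unfolding wE by (simp add: cc_def case_prod_beta)
 qed
 thus ?thesis using C0 by blast
qed

end

text \<open>The triangle on which the average at z is sampled. It is renewed only when z is a new
  node, so consecutive quasi-interpolants have different nodal values only at new nodes. The price
  is that the sampled triangle need not belong to the current mesh.\<close>

primrec pk :: "(nat => ltri set) => nat => point => ltri" where
 "pk T 0 = (%z. SOME t. t \<in> T 0 & z \<in> verts t)"
| "pk T (Suc l) = (%z. if z \<in> newnodes T (Suc l) then SOME t. t \<in> T (Suc l) & z \<in> verts t else pk T l z)"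

lemma some_tri: "z \<in> nodes T ==> (SOME t. t \<in> T & z \<in> verts t) \<in> T & z \<in> verts (SOME t. t \<in> T & z \<in> verts t)"
 by (rule someI_ex) (unfold nodes_def, blast)

context dom begin

text \<open>One bisection between the sampled triangle and the current mesh costs sg, a walk of at
  most Dn * Dn crossings in the fan costs the second term; the factors 2 come from the square of a
  sum.\<close>

definition Cf :: real where "Cf = 2 * sg + 2 * (real (Dn * Dn))^2 * sg"

lemma Cf0: "Cf >= 0" unfolding Cf_def using sig1 by simp


lemma seq_notnew:
 assumes S: "seqT T L" "l < L" and z: "z \<in> nodes (T (Suc l))" "z \<notin> newnodes T (Suc l)"
 shows "z \<in> nodes (T l)" "patch (T (Suc l)) z = patch (T l) z"
proof -
 have f: "fmesh (T l)" "fmesh (T (Suc l))" "nvb_ref (T l) (T (Suc l))" using seq_fmesh[OF S(1)] seq_ref[OF S(1)] S(2) by simp_all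
 show "z \<in> nodes (T l)" "patch (T (Suc l)) z = patch (T l) z"
  by (rule notnew[OF f z(1) z(2)[unfolded newnodes_Suc]])+
qed

text \<open>While the patch persists, elements at z can be bisected only with z as newest vertex.
  Were this to happen also to a child of the sampled triangle, z would be the midpoint of an edge of
  that triangle, of which it is already a vertex.\<close>

lemma pk_inv:
 assumes S: "seqT T L" shows "l <= L ==> z \<in> nodes (T l) ==>
  pk T l z \<in> F & z \<in> verts (pk T l z) & (\<exists>ka\<in>T l. z \<in> verts ka & (ka = pk T l z | child (pk T l z) ka))"
proof (induction l)
 case 0
 hence "pk T 0 z \<in> T 0 & z \<in> verts (pk T 0 z)" using some_tri by simp
 thus ?case using fmeshD(2)[OF seq_fmesh[OF S 0(1)]] by blast
next
 case (Suc l)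
 have f: "fmesh (T l)" "fmesh (T (Suc l))" "nvb_ref (T l) (T (Suc l))" using seq_fmesh[OF S] seq_ref[OF S] Suc(2) by auto
 show ?case
 proof (cases "z \<in> newnodes T (Suc l)")
  case True
  hence "pk T (Suc l) z \<in> T (Suc l) & z \<in> verts (pk T (Suc l) z)" using some_tri[OF Suc(3)] by simp
  thus ?thesis using fmeshD(2)[OF f(2)] by blast
 next
  case False
  hence e: "pk T (Suc l) z = pk T l z" by simp
  note nn = seq_notnew[OF S _ Suc(3) False]
  have zl: "z \<in> nodes (T l)" and pe: "patch (T (Suc l)) z = patch (T l) z" using nn Suc(2) by auto
  obtain ka where IH: "pk T l z \<in> F" "z \<in> verts (pk T l z)" "ka \<in> T l" "z \<in> verts ka" "ka = pk T l z | child (pk T l z) ka"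
   using Suc.IH[OF _ zl] Suc(2) by auto
  from patch_persist[OF f pe IH(3,4)] show ?thesis
  proof
   assume "ka \<in> T (Suc l)"
   thus ?thesis unfolding e using IH by blast
  next
   assume "\<exists>a b. ka = (a, b, z) & bisect ka \<subseteq> T (Suc l)"
   then obtain a b where ab: "ka = (a, b, z)" "bisect ka \<subseteq> T (Suc l)" by blast
   have "\<not> child (pk T l z) ka"
   proof
    assume c: "child (pk T l z) ka"
    obtain a' b' c' where t: "pk T l z = (a', b', c')" and s: "ka = (a', c', midpoint a' b') | ka = (c', b', midpoint a' b')"
     using c by (rule child_cases)
    have zm: "z = midpoint a' b'" using s ab by auto
    have n: "nd (a', b', c')" using F_nd[OF IH(1)] t by metis
    note nn = nd_distinct[OF nd_bisect(1)[OF n]] nd_distinct[OF nd_bisect(2)[OF n]]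
    have "midpoint a' b' \<in> verts (a', b', c')" using IH(2) t zm by metis
    thus False using nn by auto
   qed
   hence k: "ka = pk T l z" using IH by blast
   define u where "u = (a, z, midpoint a b)"
   have "u \<in> bisect ka" "z \<in> verts u" unfolding u_def ab(1) by auto
   thus ?thesis unfolding e using IH ab(2) k unfolding child_def by blast
  qed
 qed
qed

text \<open>Unchanged patches keep their hats, so every hat of a mesh is the hat of some
  event.\<close>

lemma last_event:
 assumes S: "seqT T L" shows "M <= L ==> z \<in> nodes (T M) ==> \<exists>l\<le>M. z \<in> newnodes T l & hat (T M) z = hat (T l) z"
proof (induction M)
 case 0
 thus ?case by (auto simp: newnodes_def)
next
 case (Suc M)
 have f: "fmesh (T M)" "fmesh (T (Suc M))" "nvb_ref (T M) (T (Suc M))" using seq_fmesh[OF S] seq_ref[OF S] Suc(2) by auto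
 show ?case
 proof (cases "z \<in> newnodes T (Suc M)")
  case False
  have lt: "M < L" using Suc(2) by simp
  note nn = seq_notnew[OF S lt Suc(3) False]
  obtain l where "l <= M" "z \<in> newnodes T l" "hat (T M) z = hat (T l) z" using Suc.IH nn Suc(2) by auto
  thus ?thesis using hat_persist[OF f nn] by (intro exI[of _ l]) auto
 qed blast
qed

end

lemma (in cr) crp_bary: assumes "nd t" shows "crp t x = (\<Sum>y\<in>verts t. bary t y x * crp t y)"
proof -
 have "(\<Sum>y\<in>verts t. bary t y x * crp t y) = (\<Sum>y\<in>verts t. bary t y x * (crp t x + crg t \<bullet> (y - x)))"
  by (intro sum.cong HOL.refl) (metis crp_affine)
 also have "... = crp t x * (\<Sum>y\<in>verts t. bary t y x) + crg t \<bullet> ((\<Sum>y\<in>verts t. bary t y x *R y) - (\<Sum>y\<in>verts t. bary t y x) *R x)"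
  unfolding sum_distrib_left inner_diff_right inner_sum_right inner_scaleR_right scaleR_sum_left sum_subtractf[symmetric] sum.distrib[symmetric]
  by (intro sum.cong) (auto simp: algebra_simps)
 also have "... = crp t x" by (simp add: bary_sum[OF assms] bary_rep[OF assms])
 finally show ?thesis by simp
qed

lemma (in cr) crp_child_Phi:
 assumes sig: "Qs s <= sg * ar s" and t: "t \<in> F" "child t s" "x \<in> tri t" shows "(crp s x - crp t x)^2 <= sg * Phi s"
proof -
 have n: "nd t" "nd s" using F_nd[OF t(1)] child_props(1)[OF t(2)] by auto
 have a: "ar s > 0" by (rule ar_pos[OF n(2)])
 have s0: "sg >= 0" using sig a Qs_nonneg[of s] by (meson dual_order.trans mult_less_0_iff not_le)
 have "(crp s x - crp t x)^2 <= (norm (crg s - crg t) * sqrt (Qs t))^2"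
  by (rule abs_le_sq[OF crp_child[OF t]])
 also have "... = (norm (crg s - crg t))^2 * (2 * Qs s)" using child_props(3)[OF t(2) n(1)] by (simp add: power_mult_distrib)
 also have "... <= (norm (crg s - crg t))^2 * (2 * (sg * ar s))" using sig by (intro mult_left_mono) auto
 also have "... = sg * (2 * ar s * (norm (crg s - crg t))^2)" by (simp add: mult_ac)
 also have "... <= sg * Phi s" by (intro mult_left_mono Phi_child[OF t(1,2)] s0)
 finally show ?thesis .
qed

lemma sq_sum_le: "(x::real)^2 <= a ==> y\<^sup>2 <= b ==> (x + y)\<^sup>2 <= 2 * a + 2 * b"
 using sum_squares_bound[of x y] by (simp add: power2_sum)

locale domcr = dom + cr
begin

text \<open>Edge neighbours in the fan agree at the midpoint of the common edge, and both gradients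
  are compared with the birth gradient of that edge. One crossing thus costs at most
  \<open>sqrt (sg * Sg)\<close>.\<close>

lemma fan_crp:
 assumes T: "fmesh T" and t: "t \<in> T" "t' \<in> T" "z \<in> verts t" "z \<in> verts t'"
 shows "(crp t z - crp t' z)^2 <= (real (Dn * Dn))^2 * sg * (\<Sum>ka\<in>{ka\<in>T. z \<in> verts ka}. Phi ka)"
proof -
 define Sg where "Sg = (\<Sum>ka\<in>{ka\<in>T. z \<in> verts ka}. Phi ka)"
 have fin: "finite {ka\<in>T. z \<in> verts ka}" using degree_bound(1)[OF T] .
 have S0: "Sg >= 0" unfolding Sg_def by (intro sum_nonneg Phi_nonneg)
 have le: "Phi s <= Sg" if "s \<in> T" "z \<in> verts s" for s
  unfolding Sg_def by (rule member_le_sum) (use that fin Phi_nonneg in \<open>auto simp del: Phi.simps\<close>)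
 have J: "norm (crg s - gbirth (midpoint z p)) * norm (z - p) <= sqrt (sg * Sg)" if s: "s \<in> T" "z \<in> verts s" "p \<in> verts s" "p ~= z" for s p
 proof (rule real_le_rsqrt)
  let ?J = "crg s - gbirth (midpoint z p)"
  have sF: "s \<in> F" using s fmeshD(2)[OF T] by blast
  have "(norm ?J * norm (z - p))^2 <= (norm ?J)^2 * (sg * ar s)" unfolding power_mult_distrib
   using edge_le_Qs[of z s p] s Qs_le[OF sF] by (intro mult_left_mono) (auto intro: order_trans)
  also have "... = sg * (ar s * (norm ?J)^2)" by (simp add: mult_ac)
  also have "... <= sg * Sg"
  proof (rule mult_left_mono)
   have "2 * ar s * (norm ?J)^2 <= Phi s" using Phi_edge[of z s p] s by auto
   moreover have "ar s * (norm ?J)^2 >= 0" by simp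
   ultimately show "ar s * (norm ?J)^2 <= Sg" using le[OF s(1,2)] by linarith
  qed (use sig1 in simp)
  finally show "(norm ?J * norm (z - p))^2 <= sg * Sg" .
 qed
 have step: "\<bar>crp s z - crp s' z\<bar> <= sqrt (sg * Sg)" if ss: "(s, s') \<in> adjr T z" for s s'
 proof -
  obtain p where p: "s \<in> T" "s' \<in> T" "z \<in> verts s" "z \<in> verts s'" "p ~= z" "p \<in> verts s" "p \<in> verts s'" using ss unfolding adjr_def by blast
  have n: "nd s" "nd s'" using p fmeshD(1)[OF T] conformingD(3) by blast+
  let ?g = "gbirth (midpoint z p)"
  have "crp s z - crp s' z = (crg s - crg s') \<bullet> (z - midpoint z p)" by (rule crp_adj[OF n p(3,6,4,7)]) (use p in simp)
  also have "... = ((crg s - ?g) - (crg s' - ?g)) \<bullet> ((1/2) *R (z - p))"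
   by (intro arg_cong2[where f = inner] point_eqI; simp add: midpoint_def field_simps)
  finally have "\<bar>crp s z - crp s' z\<bar> <= norm ((crg s - ?g) - (crg s' - ?g)) * norm ((1/2) *R (z - p))"
   using Cauchy_Schwarz_ineq2 by metis
  also have "... <= (norm (crg s - ?g) + norm (crg s' - ?g)) * norm ((1/2) *R (z - p))" by (intro mult_right_mono norm_triangle_ineq4) simp
  also have "... = (norm (crg s - ?g) * norm (z - p) + norm (crg s' - ?g) * norm (z - p)) / 2"
   unfolding norm_scaleR by (simp add: distrib_right add_divide_distrib)
  also have "... <= sqrt (sg * Sg)" using J[OF p(1,3,6,5)] J[OF p(2,4,7,5)] by simp
  finally show ?thesis .
 qed
 have "\<bar>crp t z - crp t' z\<bar> <= real (Dn * Dn) * sqrt (sg * Sg)"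
  by (rule fan_diff[OF T t, of "%s. crp s z"]) (use step S0 sig1 in auto)
 hence "(crp t z - crp t' z)^2 <= (real (Dn * Dn) * sqrt (sg * Sg))^2" by (rule abs_le_sq)
 also have "... = (real (Dn * Dn))^2 * sg * Sg" using S0 sig1 by (simp add: power_mult_distrib)
 finally show ?thesis unfolding Sg_def .
qed

lemma pk_crp:
 assumes S: "seqT T L" "l <= L" and t: "t \<in> T l" "z \<in> verts t"
 shows "(crp (pk T l z) z - crp t z)^2 <= Cf * (\<Sum>ka\<in>{ka\<in>T l. z \<in> verts ka}. Phi ka)"
proof -
 define Sg where "Sg = (\<Sum>ka\<in>{ka\<in>T l. z \<in> verts ka}. Phi ka)"
 have fl: "fmesh (T l)" using seq_fmesh[OF S] .
 obtain ka where k: "pk T l z \<in> F" "z \<in> verts (pk T l z)" "ka \<in> T l" "z \<in> verts ka" "ka = pk T l z | child (pk T l z) ka"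
  using pk_inv[OF S nodesI[OF t]] by blast
 have Phk: "Phi ka <= Sg"
  unfolding Sg_def by (rule member_le_sum) (use k degree_bound(1)[OF fl] Phi_nonneg in \<open>auto simp del: Phi.simps\<close>)
 have kF: "ka \<in> F" using k fmeshD(2)[OF fl] by blast
 have 1: "(crp (pk T l z) z - crp ka z)^2 <= sg * Sg"
  using k(5)
 proof
  assume "ka = pk T l z"
  moreover have "sg * Sg >= 0" using sig1 Phk Phi_nonneg[of ka] by (intro mult_nonneg_nonneg) linarith+
  ultimately show ?thesis by simp
 next
  assume c: "child (pk T l z) ka"
  have "(crp ka z - crp (pk T l z) z)^2 <= sg * Phi ka" by (rule crp_child_Phi[OF Qs_le[OF kF] k(1) c verts_tri[OF k(2)]])
  also have "... <= sg * Sg" using Phk sig1 by (intro mult_left_mono) auto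
  finally show ?thesis by (simp add: power2_commute)
 qed
 have "(crp (pk T l z) z - crp t z)^2 = ((crp (pk T l z) z - crp ka z) + (crp ka z - crp t z))^2" by simp
 also have "... <= 2 * (sg * Sg) + 2 * ((real (Dn * Dn))^2 * sg * Sg)"
  by (rule sq_sum_le[OF 1]) (use fan_crp[OF fl k(3) t(1) k(4) t(2)] in \<open>simp add: Sg_def\<close>)
 also have "... = Cf * Sg" unfolding Cf_def by (simp add: algebra_simps)
 finally show ?thesis unfolding Sg_def .
qed

text \<open>A discrete Poincare inequality on the initial mesh. Each root oscillates by at most
  \<delta>, as \<open>Phi\<close> controls its full gradient; a walk through shared edges costs
  2\<delta> per step and 2\<delta> at the ends.\<close>

lemma root_crp:
 assumes t: "t \<in> T0" "t' \<in> T0" "x \<in> tri t" "x' \<in> tri t'"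
 shows "(crp t x - crp t' x')^2 <= (2 * real (card (T0 \<times> T0)) + 2)^2 * sg * (\<Sum>s\<in>T0. Phi s)"
proof -
 define Sg where "Sg = (\<Sum>s\<in>T0. Phi s)"
 have fin: "finite T0" using conformingD(1)[OF conf0] .
 have S0: "Sg >= 0" unfolding Sg_def by (intro sum_nonneg Phi_nonneg)
 define \<delta> where "\<delta> = sqrt (sg * Sg)"
 have d0: "\<delta> >= 0" unfolding \<delta>_def using S0 sig1 by simp
 have osc: "\<bar>crp s x - crp s y\<bar> <= \<delta>" if s: "s \<in> T0" "x \<in> tri s" "y \<in> tri s" for s x y
 proof -
  have sF: "s \<in> F" using s T0_F by blast
  obtain a b c where abc: "s = (a, b, c)" by (cases s)
  have ab: "a \<in> verts s" "b \<in> verts s" "a ~= b" using abc nd_distinct F_nd[OF sF] by auto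
  have "2 * ar s * (norm (crg s - gbirth (midpoint a b)))^2 <= Phi s" by (rule Phi_edge[OF ab])
  hence P: "2 * (ar s * (norm (crg s))^2) <= Phi s" using gbirth_root[OF conf0 s(1) ab(1,2)] by simp
  have "Phi s <= Sg" unfolding Sg_def by (rule member_le_sum) (use s fin Phi_nonneg in \<open>auto simp del: Phi.simps\<close>)
  moreover have "ar s * (norm (crg s))^2 >= 0" by simp
  ultimately have P2: "ar s * (norm (crg s))^2 <= Sg" using P by linarith
  have "\<bar>crp s x - crp s y\<bar> = \<bar>crg s \<bullet> (x - y)\<bar>" using crp_affine[of s x y] by simp
  also have "... <= norm (crg s) * norm (x - y)" by (rule Cauchy_Schwarz_ineq2)
  also have "... <= norm (crg s) * sqrt (Qs s)" using tri_dist[OF s(2,3)] by (intro mult_left_mono) (auto simp: dist_norm)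
  also have "... <= \<delta>" unfolding \<delta>_def
  proof (rule real_le_rsqrt)
   have "(norm (crg s) * sqrt (Qs s))^2 = (norm (crg s))^2 * Qs s" by (simp add: power_mult_distrib)
   also have "... <= (norm (crg s))^2 * (sg * ar s)" using Qs_le[OF sF] by (intro mult_left_mono) auto
   also have "... = sg * (ar s * (norm (crg s))^2)" by (simp add: mult_ac)
   also have "... <= sg * Sg" using P2 sig1 by (intro mult_left_mono) auto
   finally show "(norm (crg s) * sqrt (Qs s))^2 <= sg * Sg" .
  qed
  finally show ?thesis .
 qed
 let ?R = "{(s, s'). s \<in> T0 & s' \<in> T0 & (\<exists>p q. p ~= q & p \<in> verts s \<inter> verts s' & q \<in> verts s \<inter> verts s')}"
 define f where "f = (%s. crp s (fst s))"
 have fs: "fst s \<in> tri s" for s by (cases s) (auto intro: verts_tri)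
 have step: "\<bar>f s - f s'\<bar> <= 2 * \<delta>" if ss: "(s, s') \<in> ?R" for s s'
 proof -
  obtain p q where p: "s \<in> T0" "s' \<in> T0" "p ~= q" "p \<in> verts s" "p \<in> verts s'" "q \<in> verts s" "q \<in> verts s'" using ss by blast
  have n: "nd s" "nd s'" using p conformingD(3)[OF conf0] by blast+
  have m: "midpoint p q \<in> tri s" "midpoint p q \<in> tri s'"
   using closed_segment_subset[OF verts_tri[OF p(4)] verts_tri[OF p(6)] convex_tri] closed_segment_subset[OF verts_tri[OF p(5)] verts_tri[OF p(7)] convex_tri] by auto
  have "crp s (midpoint p q) = crp s' (midpoint p q)" using crp_edge[OF n(1) p(4,6,3)] crp_edge[OF n(2) p(5,7,3)] by simp
  thus ?thesis unfolding f_def using osc[OF p(1) fs m(1)] osc[OF p(2) fs m(2)] by linarith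
 qed
 have sub: "?R \<subseteq> T0 \<times> T0" by blast
 have fR: "finite ?R" using finite_subset[OF sub] fin by blast
 have cR: "card ?R <= card (T0 \<times> T0)" by (rule card_mono[OF _ sub]) (use fin in blast)
 have pow: "\<bar>f s - f s'\<bar> <= real n * (2 * \<delta>)" if "(s, s') \<in> ?R ^^ n" for n s s'
  using that
 proof (induction n arbitrary: s')
  case (Suc n)
  obtain u where u: "(s, u) \<in> ?R ^^ n" "(u, s') \<in> ?R" using Suc.prems by (rule relpow_Suc_E)
  thus ?case using Suc.IH[OF u(1)] step[OF u(2)] by (simp add: algebra_simps)
 qed auto
 have "(t, t') \<in> ?R\<^sup>*" by (rule global_connected[OF t(1,2)])
 then obtain n where n: "n <= card ?R" "(t, t') \<in> ?R ^^ n" unfolding rtrancl_finite_eq_relpow[OF fR] by blast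
 have "\<bar>f t - f t'\<bar> <= real (card (T0 \<times> T0)) * (2 * \<delta>)"
 proof (rule order_trans[OF pow[OF n(2)]])
  show "real n * (2 * \<delta>) <= real (card (T0 \<times> T0)) * (2 * \<delta>)" using n(1) cR d0 by (intro mult_right_mono) auto
 qed
 moreover have "\<bar>crp t x - f t\<bar> <= \<delta>" "\<bar>f t' - crp t' x'\<bar> <= \<delta>" unfolding f_def using osc t fs by blast+
 ultimately have "\<bar>crp t x - crp t' x'\<bar> <= real (card (T0 \<times> T0)) * (2 * \<delta>) + 2 * \<delta>" by linarith
 hence "\<bar>crp t x - crp t' x'\<bar> <= (2 * real (card (T0 \<times> T0)) + 2) * \<delta>" by (simp add: algebra_simps)
 hence "(crp t x - crp t' x')^2 <= ((2 * real (card (T0 \<times> T0)) + 2) * \<delta>)^2" by (rule abs_le_sq)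
 also have "... = (2 * real (card (T0 \<times> T0)) + 2)^2 * sg * Sg" unfolding \<delta>_def using S0 sig1 by (simp add: power_mult_distrib)
 finally show ?thesis unfolding Sg_def .
qed

end

text \<open>At most two bisections separate t from \<open>ka\<close>; each costs one term, and
  squaring the sum of two gives the factor 4.\<close>

lemma (in domcr) between_crp:
 assumes t: "t \<in> F" "desc t ka" "ar t <= 4 * ar ka" "x \<in> tri ka" and fin: "finite A"
  and A: "\<And>s. desc t s ==> desc s ka ==> s \<in> A"
 shows "(crp ka x - crp t x)^2 <= 4 * sg * (\<Sum>s\<in>A. Phi s)"
proof -
 define Sg where "Sg = (\<Sum>s\<in>A. Phi s)"
 have P: "sg * Phi s <= sg * Sg" if "desc t s" "desc s ka" for s
  unfolding Sg_def using sig1 member_le_sum[OF A[OF that], of Phi] fin Phi_nonneg by (intro mult_left_mono) (auto simp del: Phi.simps)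
 have S0: "sg * Sg >= 0" unfolding Sg_def using sig1 by (intro mult_nonneg_nonneg sum_nonneg Phi_nonneg) auto
 have nt: "nd t" using F_nd t by blast
 have xt: "x \<in> tri t" using desc_props[OF t(2) nt] t(4) by blast
 show ?thesis
 proof (cases "ka = t")
  case True
  thus ?thesis using S0 unfolding Sg_def by simp
 next
  case False
  then obtain s where s: "child t s" "desc s ka" using desc_step[OF t(2)] by blast
  have sF: "s \<in> F" using F_desc[OF t(1)] s(1) by blast
  have ds: "desc t s" using s(1) by blast
  have "(crp s x - crp t x)^2 <= sg * Phi s" by (rule crp_child_Phi[OF Qs_le[OF sF] t(1) s(1) xt])
  hence 1: "(crp s x - crp t x)^2 <= sg * Sg" using P[OF ds s(2)] by linarith
  show ?thesis
  proof (cases "ka = s")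
   case True
   thus ?thesis using 1 S0 unfolding Sg_def by simp
  next
   case False
   then obtain s' where s': "child s s'" "desc s' ka" using desc_step[OF s(2)] by blast
   have ns: "nd s" "nd s'" using F_nd[OF sF] child_props(1)[OF s'(1)] by auto
   have "ar t = 4 * ar s'" using child_props(2)[OF s(1) nt] child_props(2)[OF s'(1) ns(1)] by simp
   hence "ka = s'" using desc_eq_ar[OF s'(2) ns(2)] t(3) by simp
   have xs: "x \<in> tri s" using desc_props[OF s(2) ns(1)] t(4) by blast
   have kF: "ka \<in> F" using F_desc[OF t(1,2)] .
   have "(crp ka x - crp s x)^2 <= sg * Phi ka"
    by (rule crp_child_Phi[OF Qs_le[OF kF] sF _ xs]) (use s' \<open>ka = s'\<close> in simp)
   hence 2: "(crp ka x - crp s x)^2 <= sg * Sg" using P[OF t(2) rtranclp.rtrancl_refl] by linarith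
   have "(crp ka x - crp t x)^2 = ((crp ka x - crp s x) + (crp s x - crp t x))^2" by simp
   also have "... <= 2 * (sg * Sg) + 2 * (sg * Sg)" by (rule sq_sum_le[OF 2 1])
   finally show ?thesis unfolding Sg_def by simp
  qed
 qed
qed

lemma weighted_sq:
 fixes c a :: "'i => real"
 assumes "finite S" "\<And>i. i \<in> S ==> c i >= 0" "sum c S = 1" "\<And>i. i \<in> S ==> (a i)\<^sup>2 <= B" "B >= 0"
 shows "(\<Sum>i\<in>S. c i * a i)^2 <= B"
proof -
 have "\<bar>\<Sum>i\<in>S. c i * a i\<bar> <= (\<Sum>i\<in>S. c i * sqrt B)"
 proof (rule order_trans[OF sum_abs], rule sum_mono)
  fix i assume i: "i \<in> S"
  have "\<bar>a i\<bar> <= sqrt B" using assms(4)[OF i] real_le_rsqrt[of "\<bar>a i\<bar>" B] by simp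
  thus "\<bar>c i * a i\<bar> <= c i * sqrt B" using assms(2)[OF i] by (simp add: abs_mult mult_left_mono)
 qed
 also have "... = sqrt B" using assms(3) by (simp flip: sum_distrib_right)
 finally have "(\<Sum>i\<in>S. c i * a i)^2 <= (sqrt B)^2" by (rule abs_le_sq)
 thus ?thesis using assms(5) by simp
qed

context dom begin

lemma closure_T: assumes "seqT T L" "l <= L" shows "\<Union> (tri ` T l) = closure \<Omega>"
 using fmeshD(3)[OF seq_fmesh[OF assms]] cl by simp

text \<open>The quasi-interpolant of a level takes at each node the average sampled on its
  \<open>pk\<close> triangle; consecutive ones differ only at new nodes, so the differences
  telescope into events. The last interpolant is not yet v, and this remainder is attached to one
  event for each finest node. The constant m is split off because the energy does not see
  constants.\<close>

lemma energy_lower: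
 "\<exists>C::real. C >= 0 & (\<forall>T L v. seqT T L --> pwaff (T L) v -->
  (\<exists>m c. (\<forall>x. v x = m * (if x \<in> closure \<Omega> then 1 else 0) + (\<Sum>(l, z)\<in>events T L. c l z * hat (T l) z x)) \<and>
    (\<Sum>(l, z)\<in>events T L. (c l z)^2) <= C * energy (T L) v))"
proof -
 obtain N :: real where N0: "N >= 0 & (\<forall>T L \<Psi>. seqT T L --> (\<forall>s. \<Psi> s >= 0) -->
  (\<Sum>(k, z)\<in>(SIGMA k:{..<L}. newnodes T (Suc k)). \<Sum>s\<in>charge T k z. \<Psi> s) <= N * (\<Sum>s\<in>anc (T L). \<Psi> s))"
  by (rule exE[OF charge_sum]) (rule that)
 note N = conjunct1[OF N0] conjunct2[OF N0, rule_format]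
 define C0 where "C0 = (2 * real (card (T0 \<times> T0)) + 2)^2 * sg"
 define C1 where "C1 = 8 * sg + 2 * Cf"
 \<comment> \<open>Initial nodes, later nodes and the final correction. The 6 is 2 from squaring a
   sum times the 3 vertices of each leaf; 320 comes from the bound on the square function.\<close>
 define CC where "CC = (2 * (real (card (nodes T0)) * C0 + C1 * N) + 6 * Cf) * 320"
 have nn: "C0 >= 0" "C1 >= 0" unfolding C0_def C1_def using sig1 Cf0 by auto
 have CC0: "CC >= 0" unfolding CC_def using nn N(1) Cf0 by simp
 have main: "\<exists>m c. (\<forall>x. v x = m * (if x \<in> closure \<Omega> then 1 else 0) + (\<Sum>(l, z)\<in>events T L. c l z * hat (T l) z x)) \<and>
    (\<Sum>(l, z)\<in>events T L. (c l z)^2) <= CC * energy (T L) v" if S: "seqT T L" and v: "pwaff (T L) v" for T L v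
 proof -
  interpret domcr T0 sg \<Omega> "emean v" by (rule domcr.intro[OF dom_axioms cr_of_pwaff[OF S v]])
  have fl: "fmesh (T l)" if "l <= L" for l using seq_fmesh[OF S that] .
  have cf: "conforming (T l)" if "l <= L" for l using fmeshD(1)[OF fl[OF that]] .
  have T00: "T 0 = T0" using S unfolding seqT_def by simp
  define SP where "SP = (\<Sum>s\<in>anc (T L). Phi s)"
  have fa: "finite (anc (T L))" using finite_ancL[OF S] .
  have SP0: "SP >= 0" unfolding SP_def by (intro sum_nonneg Phi_nonneg)
  have SP_le: "SP <= 320 * energy (T L) v" unfolding SP_def by (rule Phi_sum_L[OF S v])
  obtain z0 where z0: "z0 \<in> nodes T0"
  proof -
   obtain t where "t \<in> T0" using ne0 by blast
   moreover have "fst t \<in> verts t" by (cases t) auto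
   ultimately have "fst t \<in> nodes T0" by (rule nodesI)
   thus ?thesis using that by blast
  qed
  define vv where "vv = (%l z. crp (pk T l z) z)"
  define m where "m = vv 0 z0"
  define u where "u = (%l x. \<Sum>z\<in>nodes (T l). (vv l z - m) * hat (T l) z x)"
  have pu: "pwaff (T l) (u l)" if "l <= L" for l unfolding u_def by (rule pwaff_of_nodes[OF cf[OF that]])
  have un: "u l z = vv l z - m" if "l <= L" "z \<in> nodes (T l)" for l z unfolding u_def by (rule of_nodes_node[OF cf[OF that(1)] that(2)])
  \<comment> \<open>New nodal value minus the prediction of the previous interpolant at z, a
    hierarchical surplus.\<close>
  define d where "d = (%l z. case l of 0 => vv 0 z - m | Suc k => vv (Suc k) z - m - u k z)"
  have tele: "u (Suc k) x = u k x + (\<Sum>z\<in>newnodes T (Suc k). d (Suc k) z * hat (T (Suc k)) z x)" if k: "k < L" for k x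
  proof -
   have ks: "Suc k <= L" "k <= L" using k by auto
   have "pwaff (T (Suc k)) (u k)"
    by (rule pwaff_refine[OF seq_ref[OF S, of k "Suc k"] fmeshD(4)[OF fl[OF ks(2)]] pu[OF ks(2)]]) (use k in auto)
   hence "u k x = (\<Sum>z\<in>nodes (T (Suc k)). u k z * hat (T (Suc k)) z x)" by (rule pwaff_rep[OF cf[OF ks(1)]])
   hence "u (Suc k) x - u k x = (\<Sum>z\<in>nodes (T (Suc k)). (vv (Suc k) z - m - u k z) * hat (T (Suc k)) z x)"
    by (simp add: u_def left_diff_distrib sum_subtractf)
   also have "... = (\<Sum>z\<in>newnodes T (Suc k). (vv (Suc k) z - m - u k z) * hat (T (Suc k)) z x)"
   proof (rule sum.mono_neutral_right)
    show "finite (nodes (T (Suc k)))" using finite_nodes[OF conformingD(1)[OF cf[OF ks(1)]]] .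
    show "newnodes T (Suc k) \<subseteq> nodes (T (Suc k))" by (rule newnodes_sub[OF S ks(1)])
    show "\<forall>z\<in>nodes (T (Suc k)) - newnodes T (Suc k). (vv (Suc k) z - m - u k z) * hat (T (Suc k)) z x = 0"
    proof
     fix z assume z: "z \<in> nodes (T (Suc k)) - newnodes T (Suc k)"
     hence "z \<in> nodes (T k)" using seq_notnew(1)[OF S k] by blast
     thus "(vv (Suc k) z - m - u k z) * hat (T (Suc k)) z x = 0" using un[OF ks(2)] z by (simp add: vv_def)
    qed
   qed
   finally show ?thesis by (simp add: d_def)
  qed
  have uL: "M <= L ==> u M x = (\<Sum>l\<le>M. \<Sum>z\<in>newnodes T l. d l z * hat (T l) z x)" for M x
  proof (induction M)
   case 0
   thus ?case by (simp add: u_def d_def newnodes_def)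
  next
   case (Suc M)
   thus ?case using tele[of M x] by simp
  qed
  have fN: "finite (newnodes T l)" if "l <= L" for l using finite_newnodes[OF S that] .
  have uE: "u L x = (\<Sum>(l, z)\<in>events T L. d l z * hat (T l) z x)" for x
   unfolding uL[OF order_refl] events_def by (rule sum.Sigma) (use fN in auto)
  \<comment> \<open>A level at which z is new and where its hat already is the one of the finest
    mesh.\<close>
  define la where "la = (%z. SOME l. l <= L & z \<in> newnodes T l & hat (T L) z = hat (T l) z)"
  have la: "la z <= L & z \<in> newnodes T (la z) & hat (T L) z = hat (T (la z)) z" if z: "z \<in> nodes (T L)" for z
   unfolding la_def by (rule someI_ex) (use last_event[OF S order_refl z] in blast)
  define e where "e = (%z. v z - vv L z)"
  define g where "g = (%l z. if z \<in> nodes (T L) & la z = l then e z else 0)"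
  have fI: "finite (events T L)" by (rule finite_events[OF S])
  have gsum: "(\<Sum>(l, z)\<in>events T L. g l z * h l z) = (\<Sum>z\<in>nodes (T L). e z * h (la z) z)" for h :: "nat => point => real"
  proof -
   let ?im = "(%z. (la z, z)) ` nodes (T L)"
   have sub: "?im \<subseteq> events T L" using la unfolding events_def by auto
   have "(\<Sum>(l, z)\<in>events T L. g l z * h l z) = (\<Sum>(l, z)\<in>?im. g l z * h l z)"
    by (rule sum.mono_neutral_right[OF fI sub]) (auto simp: g_def)
   also have "... = (\<Sum>z\<in>nodes (T L). g (la z) z * h (la z) z)" by (subst sum.reindex) (auto simp: inj_on_def)
   also have "... = (\<Sum>z\<in>nodes (T L). e z * h (la z) z)" by (intro sum.cong) (auto simp: g_def)
   finally show ?thesis .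
  qed
  define c where "c = (%l z. d l z + g l z)"
  have rep: "v x = m * (if x \<in> closure \<Omega> then 1 else 0) + (\<Sum>(l, z)\<in>events T L. c l z * hat (T l) z x)" for x
  proof -
   have one: "(\<Sum>z\<in>nodes (T L). hat (T L) z x) = (if x \<in> closure \<Omega> then 1 else 0)"
    using of_nodes_one[OF cf[OF order_refl]] hat_outside[of x "T L"] closure_T[OF S order_refl] by auto
   have "v x = (\<Sum>z\<in>nodes (T L). v z * hat (T L) z x)" by (rule pwaff_rep[OF cf[OF order_refl] v])
   also have "... = (\<Sum>z\<in>nodes (T L). m * hat (T L) z x + (vv L z - m) * hat (T L) z x + e z * hat (T L) z x)"
    by (intro sum.cong) (auto simp: e_def algebra_simps)
   also have "... = m * (\<Sum>z\<in>nodes (T L). hat (T L) z x) + u L x + (\<Sum>z\<in>nodes (T L). e z * hat (T L) z x)"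
    by (simp add: sum.distrib sum_distrib_left u_def)
   also have "(\<Sum>z\<in>nodes (T L). e z * hat (T L) z x) = (\<Sum>z\<in>nodes (T L). e z * hat (T (la z)) z x)"
    using la by (intro sum.cong) auto
   also have "... = (\<Sum>(l, z)\<in>events T L. g l z * hat (T l) z x)" by (rule gsum[symmetric])
   finally show ?thesis unfolding one uE c_def by (simp add: case_prod_beta sum.distrib distrib_right)
  qed
  have eb: "(e z)^2 <= Cf * (\<Sum>ka\<in>{ka\<in>T L. z \<in> verts ka}. Phi ka)" if z: "z \<in> nodes (T L)" for z
  proof -
   obtain t where t: "t \<in> T L" "z \<in> verts t" using z unfolding nodes_def by blast
   have "crp t z = v z" by (rule cr_pwaff(2)[OF conformingD(3)[OF cf[OF order_refl] t(1)] pwaffD(1)[OF v t(1)] HOL.refl verts_tri[OF t(2)]])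
   thus ?thesis using pk_crp[OF S order_refl t] unfolding e_def vv_def by (simp add: power2_commute)
  qed
  have db: "(d (Suc k) z)^2 <= C1 * (\<Sum>s\<in>charge T k z. Phi s)" if k: "k < L" and z: "z \<in> newnodes T (Suc k)" for k z
  proof -
   define Sg where "Sg = (\<Sum>s\<in>charge T k z. Phi s)"
   have ks: "Suc k <= L" "k <= L" using k by auto
   have fc: "finite (charge T k z)" using finite_subset[OF charge_anc[OF S k] fa] .
   have Sg0: "Sg >= 0" unfolding Sg_def by (intro sum_nonneg Phi_nonneg)
   have zn: "z \<in> nodes (T (Suc k))" using newnodes_sub[OF S ks(1)] z by blast
   define ka where "ka = pk T (Suc k) z"
   have kk: "ka \<in> T (Suc k)" "z \<in> verts ka" unfolding ka_def using some_tri[OF zn] z by auto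
   have ref: "nvb_ref (T k) (T (Suc k))" using seq_ref[OF S, of k "Suc k"] k by simp
   obtain t where t: "t \<in> T k" "desc t ka" using nvb_ref_anc[OF ref kk(1)] by blast
   have tF: "t \<in> F" using t fmeshD(2)[OF fl[OF ks(2)]] by blast
   have nt: "nd t" using F_nd[OF tF] .
   have zt: "z \<in> tri t" using desc_props[OF t(2) nt] verts_tri[OF kk(2)] by blast
   have a1: "(crp ka z - crp t z)^2 <= 4 * sg * Sg" unfolding Sg_def
   proof (rule between_crp[OF tF t(2) seq_depth[OF S k t(1) kk(1) t(2)] verts_tri[OF kk(2)] fc])
    fix s assume s: "desc t s" "desc s ka"
    thus "s \<in> charge T k z" unfolding charge_def using t kk zt F_desc[OF tF] by blast
   qed
   have a2: "(\<Sum>y\<in>verts t. bary t y z * (crp t y - vv k y))^2 <= Cf * Sg"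
   proof (rule weighted_sq)
    show "bary t y z >= 0" if "y \<in> verts t" for y using tri_iff[OF nt] zt that by blast
    show "(\<Sum>y\<in>verts t. bary t y z) = 1" by (rule bary_sum[OF nt])
    fix y assume y: "y \<in> verts t"
    have "(vv k y - crp t y)^2 <= Cf * (\<Sum>ka\<in>{ka\<in>T k. y \<in> verts ka}. Phi ka)" unfolding vv_def by (rule pk_crp[OF S ks(2) t(1) y])
    also have "... <= Cf * Sg" unfolding Sg_def
    proof (intro mult_left_mono sum_mono2 fc Cf0)
     show "{ka\<in>T k. y \<in> verts ka} \<subseteq> charge T k z"
     proof
      fix s assume s: "s \<in> {ka\<in>T k. y \<in> verts ka}"
      obtain s' where "s' \<in> T (Suc k)" "desc s s'" using nvb_ref_desc[OF ref, of s] s by blast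
      moreover have "s \<in> F" using s fmeshD(2)[OF fl[OF ks(2)]] by blast
      moreover have "tri t \<inter> tri s ~= {}" using verts_tri[OF y] verts_tri[of y s] s by blast
      ultimately show "s \<in> charge T k z" unfolding charge_def using t(1) s zt by blast
     qed
    qed (rule Phi_nonneg)
    finally show "(crp t y - vv k y)^2 <= Cf * Sg" by (simp add: power2_commute)
   qed (use Cf0 Sg0 in auto)
   \<comment> \<open>Both values are compared with the affine average on the old triangle t
     containing z: the first term is the drift along at most two bisections, the second compares
     that average with the sampled values at the vertices of t, weighted by the coordinates of
     z.\<close>
   have a3: "d (Suc k) z = (crp ka z - crp t z) + (\<Sum>y\<in>verts t. bary t y z * (crp t y - vv k y))"
   proof -
    have "u k z = (\<Sum>y\<in>verts t. u k y * bary t y z)" by (rule pwaffD(1)[OF pu[OF ks(2)] t(1) zt])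
    also have "... = (\<Sum>y\<in>verts t. (vv k y - m) * bary t y z)" using un[OF ks(2) nodesI[OF t(1)]] by (intro sum.cong) auto
    also have "... = (\<Sum>y\<in>verts t. bary t y z * vv k y) - m * (\<Sum>y\<in>verts t. bary t y z)"
     unfolding left_diff_distrib sum_subtractf sum_distrib_left by (simp add: mult.commute)
    also have "... = (\<Sum>y\<in>verts t. bary t y z * vv k y) - m" using bary_sum[OF nt, of z] by simp
    finally have "u k z = (\<Sum>y\<in>verts t. bary t y z * vv k y) - m" .
    moreover have "vv (Suc k) z = crp ka z" unfolding vv_def ka_def ..
    ultimately show ?thesis unfolding d_def using crp_bary[OF nt, of z] by (simp add: right_diff_distrib sum_subtractf)
   qed
   have "(d (Suc k) z)^2 <= 2 * (4 * sg * Sg) + 2 * (Cf * Sg)" unfolding a3 by (rule sq_sum_le[OF a1 a2])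
   also have "... = C1 * Sg" unfolding C1_def by (simp add: algebra_simps)
   finally show ?thesis unfolding Sg_def .
  qed
  have d0b: "(d 0 z)^2 <= C0 * SP" if z: "z \<in> nodes T0" for z
  proof -
   have a: "pk T 0 z \<in> T0 & z \<in> verts (pk T 0 z)" "pk T 0 z0 \<in> T0 & z0 \<in> verts (pk T 0 z0)" using some_tri[OF z] some_tri[OF z0] T00 by auto
   have "(d 0 z)^2 = (crp (pk T 0 z) z - crp (pk T 0 z0) z0)^2" unfolding d_def m_def vv_def by simp
   also have "... <= C0 * (\<Sum>s\<in>T0. Phi s)" unfolding C0_def
    by (rule root_crp[OF conjunct1[OF a(1)] conjunct1[OF a(2)] verts_tri[OF conjunct2[OF a(1)]] verts_tri[OF conjunct2[OF a(2)]]])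
   also have "... <= C0 * SP" unfolding SP_def
    by (intro mult_left_mono sum_mono2 fa T0_anc[OF S] nn Phi_nonneg)
   finally show ?thesis .
  qed
  have "(\<Sum>(l, z)\<in>events T L. (d l z)^2) <= (real (card (nodes T0)) * C0 + C1 * N) * SP"
  proof -
   have "(\<Sum>z\<in>nodes T0. (d 0 z)^2) <= (\<Sum>z\<in>nodes T0. C0 * SP)" by (intro sum_mono d0b)
   moreover have "(\<Sum>(k, z)\<in>(SIGMA k:{..<L}. newnodes T (Suc k)). (d (Suc k) z)^2) <= (\<Sum>(k, z)\<in>(SIGMA k:{..<L}. newnodes T (Suc k)). C1 * (\<Sum>s\<in>charge T k z. Phi s))"
    by (rule sum_mono) (use db in auto)
   moreover have "... = C1 * (\<Sum>(k, z)\<in>(SIGMA k:{..<L}. newnodes T (Suc k)). \<Sum>s\<in>charge T k z. Phi s)"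
    by (simp add: sum_distrib_left case_prod_beta)
   moreover have "... <= C1 * (N * SP)" unfolding SP_def by (intro mult_left_mono N(2)[OF S] nn Phi_nonneg)
   ultimately show ?thesis unfolding sum_events[OF S, of "%l z. (d l z)^2"] by (simp add: algebra_simps)
  qed
  moreover have "(\<Sum>(l, z)\<in>events T L. (g l z)^2) <= 3 * Cf * SP"
  proof -
   have "(\<Sum>(l, z)\<in>events T L. (g l z)^2) = (\<Sum>(l, z)\<in>events T L. g l z * g l z)" by (simp add: power2_eq_square)
   also have "... = (\<Sum>z\<in>nodes (T L). e z * g (la z) z)" by (rule gsum)
   also have "... = (\<Sum>z\<in>nodes (T L). (e z)^2)" by (intro sum.cong) (auto simp: g_def power2_eq_square)
   also have "... <= (\<Sum>z\<in>nodes (T L). Cf * (\<Sum>ka\<in>{ka\<in>T L. z \<in> verts ka}. Phi ka))" by (intro sum_mono eb)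
   also have "... = Cf * (\<Sum>z\<in>nodes (T L). \<Sum>ka\<in>{ka\<in>T L. z \<in> verts ka}. Phi ka)" by (simp only: sum_distrib_left)
   also have "(\<Sum>z\<in>nodes (T L). \<Sum>ka\<in>{ka\<in>T L. z \<in> verts ka}. Phi ka) = (\<Sum>z\<in>nodes (T L). \<Sum>ka\<in>T L. if z \<in> verts ka then Phi ka else 0)"
    by (intro sum.cong HOL.refl sum.inter_filter conformingD(1)[OF cf[OF order_refl]])
   also have "(\<Sum>z\<in>nodes (T L). \<Sum>ka\<in>T L. if z \<in> verts ka then Phi ka else 0) = (\<Sum>ka\<in>T L. \<Sum>z\<in>nodes (T L). if z \<in> verts ka then Phi ka else 0)" by (rule sum.swap)
   also have "... = (\<Sum>ka\<in>T L. 3 * Phi ka)"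
   proof (rule sum.cong)
    fix ka assume k: "ka \<in> T L"
    have "(\<Sum>z\<in>nodes (T L). if z \<in> verts ka then Phi ka else 0) = (\<Sum>z\<in>nodes (T L) \<inter> verts ka. Phi ka)"
     by (rule sum.inter_restrict[symmetric, OF finite_nodes[OF conformingD(1)[OF cf[OF order_refl]]]])
    also have "nodes (T L) \<inter> verts ka = verts ka" using k nodesI by blast
    finally show "(\<Sum>z\<in>nodes (T L). if z \<in> verts ka then Phi ka else 0) = 3 * Phi ka"
     using card_verts[OF conformingD(3)[OF cf[OF order_refl] k]] by simp
   qed simp
   also have "... = 3 * (\<Sum>ka\<in>T L. Phi ka)" by (simp only: sum_distrib_left)
   also have "Cf * \<dots> <= Cf * (3 * SP)" unfolding SP_def
    by (intro mult_left_mono sum_mono2 fa T_anc[OF S] Cf0 Phi_nonneg) simp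
   finally show ?thesis by simp
  qed
  moreover have "(\<Sum>(l, z)\<in>events T L. (c l z)^2) <= 2 * (\<Sum>(l, z)\<in>events T L. (d l z)^2) + 2 * (\<Sum>(l, z)\<in>events T L. (g l z)^2)"
   unfolding sum_distrib_left sum.distrib[symmetric] c_def by (rule sum_mono) (auto intro!: sq_sum_le)
  ultimately have "(\<Sum>(l, z)\<in>events T L. (c l z)^2) <= (2 * (real (card (nodes T0)) * C0 + C1 * N) + 6 * Cf) * SP"
   unfolding distrib_right distrib_left by linarith
  also have "... <= (2 * (real (card (nodes T0)) * C0 + C1 * N) + 6 * Cf) * (320 * energy (T L) v)"
   by (rule mult_left_mono[OF SP_le]) (use nn N(1) Cf0 in simp)
  finally have "(\<Sum>(l, z)\<in>events T L. (c l z)^2) <= CC * energy (T L) v" unfolding CC_def by (simp only: mult.assoc)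
  thus ?thesis using rep by blast
 qed
 show ?thesis by (rule exI[of _ CC]) (use CC0 main in blast)
qed

end

section \<open>Summability of a boundary functional over all hat functions\<close>

definition thin :: "point set => bool" where
 "thin \<Gamma> \<longleftrightarrow> (\<exists>N\<ge>0. \<forall>h. 0 < h & h <= 1 --> (\<exists>X. finite X & real (card X) <= N / h & \<Gamma> \<subseteq> (\<Union>x\<in>X. ball x h)))"

context sforest begin

text \<open>At the scale h = 2^(-k/2) of generation k the set is covered by O(1/h) balls, and by
  packing each ball meets boundedly many triangles of that generation.\<close>

lemma generation_boundary_card:
 assumes "thin \<Gamma>"
 shows "\<exists>C>0. \<forall>k G. finite G --> G \<subseteq> Fk k --> (\<forall>s\<in>G. tri s \<inter> \<Gamma> ~= {}) -->
  real (card G) <= C * 2 powr (real k / 2) & (\<forall>s\<in>G. ar s <= C * 2 powr (- real k))"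
proof -
 obtain N where N: "N >= 0" "\<And>h. 0 < h ==> h <= 1 ==> \<exists>X. finite X & real (card X) <= N / h & \<Gamma> \<subseteq> (\<Union>x\<in>X. ball x h)"
  using assms unfolding thin_def by blast
 define rmin rmax where "rmin = Min (ar ` T0)" and "rmax = Max (ar ` T0)"
 have fin: "finite T0" using meshD(1)[OF mesh0] .
 have rm: "rmin <= ar r & ar r <= rmax" if "r \<in> T0" for r unfolding rmin_def rmax_def using fin that by auto
 have rmin0: "rmin > 0" unfolding rmin_def using fin ne0 ar_pos meshD(2)[OF mesh0] by simp
 define C where "C = max 1 (max (1 / rmin) rmax)"
 have C: "C >= 1" "1 / rmin <= C" "rmax <= C" unfolding C_def by auto
 define K where "K = C * pi * (C + sg * C + 1)^2"
 have K0: "K >= 0" unfolding K_def using C by simp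
 have "real (card G) <= (C + K * N) * 2 powr (real k / 2) & (\<forall>s\<in>G. ar s <= (C + K * N) * 2 powr (- real k))"
  if fG: "finite G" and G: "G \<subseteq> Fk k" and m: "\<forall>s\<in>G. tri s \<inter> \<Gamma> ~= {}" for k G
 proof -
  define h where "h = 2 powr (- (real k / 2))"
  have h: "h > 0" "h <= 1" unfolding h_def by (auto simp: powr_le_one_le powr_minus divide_simps ge_one_powr_ge_zero)
  have h2: "h^2 = 2 powr (- real k)" unfolding h_def power2_eq_square by (simp flip: powr_add)
  have hk: "h^2 * 2 ^ k = 1" unfolding h2 by (simp add: powr_minus powr_realpow)
  have a: "h^2 <= C * ar s & ar s <= C * h^2" if s: "s \<in> G" for s
  proof -
   obtain r where r: "r \<in> T0" "(child ^^ k) r s" using s G unfolding Fk_def by blast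
   have "ar s * 2 ^ k = ar r" using relpow_ar[OF r(2)] meshD(2)[OF mesh0 r(1)] by blast
   hence e: "ar s = ar r * h^2" using hk by (metis mult.assoc mult.commute mult.right_neutral)
   have "1 <= C * rmin" using C(2) rmin0 by (simp add: field_simps)
   also have "... <= C * ar r" using rm[OF r(1)] C(1) by (intro mult_left_mono) auto
   finally have "1 * h^2 <= (C * ar r) * h^2" by (intro mult_right_mono) auto
   moreover have "ar r * h^2 <= C * h^2" using rm[OF r(1)] C(3) by (intro mult_right_mono) auto
   ultimately show ?thesis unfolding e by (simp add: mult.assoc)
  qed
  obtain X where X: "finite X" "real (card X) <= N / h" "\<Gamma> \<subseteq> (\<Union>x\<in>X. ball x h)" using N(2)[OF h] by blast
  define Gx where "Gx = (%x. {s\<in>G. tri s \<inter> ball x h ~= {}})"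
  have "G \<subseteq> (\<Union>x\<in>X. Gx x)"
  proof
   fix s assume s: "s \<in> G"
   then obtain y where y: "y \<in> tri s" "y \<in> \<Gamma>" using m by blast
   then obtain x where "x \<in> X" "y \<in> ball x h" using X(3) by blast
   thus "s \<in> (\<Union>x\<in>X. Gx x)" unfolding Gx_def using s y by blast
  qed
  hence "card G <= card (\<Union>x\<in>X. Gx x)" unfolding Gx_def using X(1) fG by (intro card_mono) auto
  also have "... <= (\<Sum>x\<in>X. card (Gx x))" by (rule card_UN_le[OF X(1)])
  finally have "real (card G) <= (\<Sum>x\<in>X. real (card (Gx x)))" by (metis of_nat_le_iff of_nat_sum)
  also have "... <= (\<Sum>x\<in>X. K)"
  proof (rule sum_mono)
   fix x assume "x \<in> X"
   show "real (card (Gx x)) <= K" unfolding K_def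
   proof (rule card_ball_bound)
    have sub: "Gx x \<subseteq> G" unfolding Gx_def by blast
    show "mesh (Gx x)" by (rule Fk_mesh[of _ k]) (use sub G fG finite_subset in auto)
    show "Gx x \<subseteq> F" using sub G F_Fk by blast
    show "C > 0" "h > 0" using C h by auto
    fix s assume s: "s \<in> Gx x"
    have "ball x h \<subseteq> ball x (C * h)" using C(1) h by (intro subset_ball) simp
    thus "h^2 <= C * ar s & ar s <= C * h^2 & tri s \<inter> ball x (C * h) ~= {}" using a[of s] s unfolding Gx_def by blast
   qed
  qed
  also have "... = K * real (card X)" by simp
  also have "... <= K * (N / h)" using X(2) K0 by (rule mult_left_mono)
  also have "... = (K * N) * 2 powr (real k / 2)" unfolding h_def by (simp add: powr_minus_divide)
  also have "... <= (C + K * N) * 2 powr (real k / 2)" using C by (intro mult_right_mono) auto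
  finally have 1: "real (card G) <= (C + K * N) * 2 powr (real k / 2)" .
  have "ar s <= (C + K * N) * 2 powr (- real k)" if "s \<in> G" for s
  proof -
   have "C * h^2 <= (C + K * N) * h^2" using K0 N(1) by (intro mult_right_mono) auto
   thus ?thesis using a[OF that] unfolding h2 by linarith
  qed
  thus ?thesis using 1 by blast
 qed
 moreover have "C + K * N > 0" using C K0 N(1) by (simp add: add_pos_nonneg)
 ultimately show ?thesis by blast
qed

text \<open>Generation k contributes O(2^(k/2)) terms of size 2^(-5k/8), a geometric series with
  ratio 2^(-1/8).\<close>

lemma boundary_sum:
 assumes "thin \<Gamma>"
 shows "\<exists>C\<ge>0. \<forall>G. finite G --> G \<subseteq> F --> (\<forall>s\<in>G. tri s \<inter> \<Gamma> ~= {}) --> (\<Sum>s\<in>G. ar s powr (5/8)) <= C"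
proof -
 obtain C where C: "C > 0" "\<And>k G. finite G ==> G \<subseteq> Fk k ==> (\<forall>s\<in>G. tri s \<inter> \<Gamma> ~= {}) ==>
  real (card G) <= C * 2 powr (real k / 2) & (\<forall>s\<in>G. ar s <= C * 2 powr (- real k))" using generation_boundary_card[OF assms] by blast
 define \<rho> :: real where "\<rho> = 2 powr (-1/8)"
 have \<rho>: "0 < \<rho>" "\<rho> < 1" unfolding \<rho>_def by (auto simp: powr_less_one)
 define D where "D = C * C powr (5/8)"
 have D0: "D >= 0" unfolding D_def using C(1) by simp
 have gen: "(\<Sum>s\<in>G. ar s powr (5/8)) <= D * \<rho> ^ k" if G: "finite G" "G \<subseteq> Fk k" "\<forall>s\<in>G. tri s \<inter> \<Gamma> ~= {}" for k G
 proof -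
  note c = C(2)[OF G]
  have "(\<Sum>s\<in>G. ar s powr (5/8)) <= (\<Sum>s\<in>G. (C * 2 powr (- real k)) powr (5/8))"
   using c by (intro sum_mono powr_mono2) auto
  also have "... = real (card G) * (C * 2 powr (- real k)) powr (5/8)" by simp
  also have "... <= (C * 2 powr (real k / 2)) * (C * 2 powr (- real k)) powr (5/8)" using c by (intro mult_right_mono) auto
  also have "... = D * (2 powr (real k / 2) * 2 powr (- real k * (5/8)))" unfolding D_def using C(1) by (simp add: powr_mult powr_powr)
  also have "2 powr (real k / 2) * 2 powr (- real k * (5/8)) = \<rho> powr (real k)" unfolding \<rho>_def powr_powr by (simp flip: powr_add)
  also have "... = \<rho> ^ k" using \<rho>(1) by (rule powr_realpow)
  finally show ?thesis .
 qed
 have "(\<Sum>s\<in>G. ar s powr (5/8)) <= D * (1 / (1 - \<rho>))" if G: "finite G" "G \<subseteq> F" "\<forall>s\<in>G. tri s \<inter> \<Gamma> ~= {}" for G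
 proof -
  define kk where "kk = (%s. SOME k. s \<in> Fk k)"
  have kk: "s \<in> Fk (kk s)" if "s \<in> G" for s unfolding kk_def by (rule someI_ex) (use that G(2) F_Fk in blast)
  have "(\<Sum>s\<in>G. ar s powr (5/8)) = (\<Sum>k\<in>kk ` G. \<Sum>s\<in>{s\<in>G. kk s = k}. ar s powr (5/8))" by (rule sum.image_gen[OF G(1)])
  also have "... <= (\<Sum>k\<in>kk ` G. D * \<rho> ^ k)" 
  proof (rule sum_mono)
   fix k
   have "{s\<in>G. kk s = k} \<subseteq> Fk k" using kk by blast
   thus "(\<Sum>s\<in>{s\<in>G. kk s = k}. ar s powr (5/8)) <= D * \<rho> ^ k" by (rule gen[rotated]) (use G in simp_all)
  qed
  also have "... = D * (\<Sum>k\<in>kk ` G. \<rho> ^ k)" by (simp add: sum_distrib_left)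
  also have "... <= D * (\<Sum>k. \<rho> ^ k)" using D0 \<rho> G(1) by (intro mult_left_mono sum_le_suminf summable_geometric) auto
  also have "(\<Sum>k. \<rho> ^ k) = 1 / (1 - \<rho>)" using \<rho> by (intro suminf_geometric) auto
  finally show ?thesis .
 qed
 thus ?thesis using D0 \<rho> by (intro exI[of _ "D * (1 / (1 - \<rho>))"]) auto
qed

end

context dom begin

text \<open>The hat of z lives within distance \<open>sqrt (sg * Kc * ar t)\<close> of z for any
  triangle t of its fan, so its squared functional value is a multiple of
  \<open>ar t powr (5/8)\<close>. If the hat is not zero on the boundary, t can be taken to meet the
  boundary, and these terms are charged to the forest.\<close>

lemma events_functional:
 fixes B :: "(point => real) => real"
 assumes thin: "thin \<Gamma>" and sub: "\<Gamma> \<subseteq> closure \<Omega>" and CB: "CB >= 0"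
  and loc: "\<And>u z h. continuous_on \<Gamma> u ==> h > 0 ==> (\<forall>x\<in>\<Gamma>. \<bar>u x\<bar> <= 1) ==> (\<forall>x\<in>\<Gamma>. h < dist x z --> u x = 0) ==> \<bar>B u\<bar> <= CB * h powr (5/8)"
  and zero: "\<And>u. (\<forall>x\<in>\<Gamma>. u x = 0) ==> B u = 0"
 shows "\<exists>C::real. C >= 0 & (\<forall>T L. seqT T L --> (\<Sum>(l, z)\<in>events T L. (B (hat (T l) z))^2) <= C)"
proof -
 obtain N :: real where N0: "N >= 0 & (\<forall>T L \<Psi>. seqT T L --> (\<forall>s. \<Psi> s >= 0) -->
  (\<Sum>(l, z)\<in>events T L. \<Sum>s\<in>{t\<in>T l. z \<in> verts t}. \<Psi> s) <= N * (\<Sum>s\<in>anc (T L). \<Psi> s))" by (rule exE[OF event_sum]) (rule that)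
 note N = conjunct1[OF N0] conjunct2[OF N0, rule_format]
 obtain M where M: "M >= 0" "\<forall>G. finite G --> G \<subseteq> F --> (\<forall>s\<in>G. tri s \<inter> \<Gamma> ~= {}) --> (\<Sum>s\<in>G. ar s powr (5/8)) <= M"
  using boundary_sum[OF thin] by blast
 define \<Psi> where "\<Psi> = (%s. if tri s \<inter> \<Gamma> ~= {} then ar s powr (5/8) else 0)"
 have P0: "\<Psi> s >= 0" for s unfolding \<Psi>_def by simp
 define K where "K = CB^2 * (sg * Kc) powr (5/8)"
 have K0: "K >= 0" unfolding K_def by simp
 have sk: "sg * Kc > 0" using sig1 Kc1 by simp
 have one: "(B (hat (T l) z))^2 <= K * (\<Sum>s\<in>{t\<in>T l. z \<in> verts t}. \<Psi> s)" if S: "seqT T L" and e: "(l, z) \<in> events T L" for T L l z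
 proof -
  have l: "l <= L" using e unfolding events_def by auto
  note fm = seq_fmesh[OF S l]
  note c = fmeshD(1)[OF fm]
  let ?S = "{t\<in>T l. z \<in> verts t}"
  have supp: "\<exists>t\<in>?S. x \<in> tri t" if "hat (T l) z x ~= 0" for x
  proof -
   have "\<exists>t\<in>T l. x \<in> tri t & z \<in> verts t" using that unfolding hat_def by presburger
   thus ?thesis by blast
  qed
  have S0: "(\<Sum>s\<in>?S. \<Psi> s) >= 0" using P0 by (rule sum_nonneg)
  show ?thesis
  proof (cases "\<exists>t\<in>?S. tri t \<inter> \<Gamma> ~= {}")
   case False
   have "\<forall>x\<in>\<Gamma>. hat (T l) z x = 0"
   proof
    fix x assume x: "x \<in> \<Gamma>"
    show "hat (T l) z x = 0"
    proof (rule ccontr)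
     assume "hat (T l) z x ~= 0"
     from supp[OF this] show False using False x by blast
    qed
   qed
   hence "B (hat (T l) z) = 0" by (rule zero)
   thus ?thesis using S0 K0 by simp
  next
   case True
   then obtain t where t: "t \<in> T l" "z \<in> verts t" "tri t \<inter> \<Gamma> ~= {}" by blast
   have art: "ar t > 0" using ar_pos conformingD(3)[OF c t(1)] by blast
   define h where "h = sqrt (sg * Kc * ar t)"
   have h0: "h > 0" unfolding h_def using sk art by simp
   have "continuous_on (closure \<Omega>) (hat (T l) z)" using pwaff_continuous_on[OF conformingD(1)[OF c] pwaff_hat[OF c]] closure_T[OF S l] by simp
   hence cont: "continuous_on \<Gamma> (hat (T l) z)" using sub by (rule continuous_on_subset)
   have "hat (T l) z x = 0" if "h < dist x z" for x
   proof (rule ccontr)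
    assume "hat (T l) z x ~= 0"
    from supp[OF this] obtain s where s: "s \<in> T l" "z \<in> verts s" "x \<in> tri s" by blast
    have "Qs s <= sg * ar s" using Qs_le fmeshD(2)[OF fm] s(1) by blast
    also have "... <= sg * (Kc * ar t)" using fan_ratio[OF fm t(1) s(1) t(2) s(2)] sig1 by (intro mult_left_mono) auto
    finally have "sqrt (Qs s) <= h" unfolding h_def by (simp add: mult.assoc)
    thus False using tri_dist[OF s(3) verts_tri[OF s(2)]] that by linarith
   qed
   hence "\<bar>B (hat (T l) z)\<bar> <= CB * h powr (5/8)" using loc[OF cont h0, of z] hat_bounds[OF c] by (simp add: abs_le_iff)
   hence "(B (hat (T l) z))^2 <= (CB * h powr (5/8))^2" by (rule abs_le_sq)
   also have "... = CB^2 * (h^2) powr (5/8)" using h0 by (simp add: power_mult_distrib power2_eq_square powr_mult)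
   also have "h^2 = sg * Kc * ar t" unfolding h_def using sk art by simp
   also have "CB^2 * (sg * Kc * ar t) powr (5/8) = K * \<Psi> t" unfolding K_def \<Psi>_def using t(3) sk art by (simp add: powr_mult)
   also have "... <= K * (\<Sum>s\<in>?S. \<Psi> s)" using K0 t P0 conformingD(1)[OF c] by (intro mult_left_mono member_le_sum) auto
   finally show ?thesis .
  qed
 qed
 have "(\<Sum>(l, z)\<in>events T L. (B (hat (T l) z))^2) <= K * (N * M)" if S: "seqT T L" for T L
 proof -
  have "(\<Sum>(l, z)\<in>events T L. (B (hat (T l) z))^2) <= (\<Sum>(l, z)\<in>events T L. K * (\<Sum>s\<in>{t\<in>T l. z \<in> verts t}. \<Psi> s))"
  proof (rule sum_mono)
   fix e assume e: "e \<in> events T L"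
   show "(case e of (l, z) => (B (hat (T l) z))\<^sup>2) <= (case e of (l, z) => K * (\<Sum>s\<in>{t\<in>T l. z \<in> verts t}. \<Psi> s))"
    using one[OF S, of "fst e" "snd e"] e by (simp add: case_prod_beta)
  qed
  also have "... = K * (\<Sum>(l, z)\<in>events T L. \<Sum>s\<in>{t\<in>T l. z \<in> verts t}. \<Psi> s)" by (simp add: sum_distrib_left case_prod_beta)
  also have "... <= K * (N * (\<Sum>s\<in>anc (T L). \<Psi> s))" using N(2)[OF S, of \<Psi>] P0 K0 by (intro mult_left_mono) auto
  also have "... <= K * (N * M)"
  proof -
   let ?G = "{s\<in>anc (T L). tri s \<inter> \<Gamma> ~= {}}"
   have "(\<Sum>s\<in>anc (T L). \<Psi> s) = (\<Sum>s\<in>?G. ar s powr (5/8))" unfolding \<Psi>_def using finite_ancL[OF S] by (intro sum.mono_neutral_cong_right) auto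
   also have "... <= M"
   proof (rule M(2)[rule_format])
    show "finite ?G" using finite_ancL[OF S] by simp
    show "?G \<subseteq> F" by (rule subsetI) (simp add: anc_def del: verts.simps)
    show "tri s \<inter> \<Gamma> ~= {}" if "s \<in> ?G" for s using that by simp
   qed
   finally show ?thesis using N(1) K0 by (intro mult_left_mono) auto
  qed
  finally show ?thesis .
 qed
 thus ?thesis using K0 N(1) M(1) by (intro exI[of _ "K * (N * M)"]) auto
qed

end

section \<open>Elliptic coefficients and the energy of finite element functions\<close>

lemma psd2:
 fixes a b d x y :: real
 assumes "a + d >= 0" "b^2 <= a * d" shows "0 <= a * x^2 + 2 * b * x * y + d * y^2"
proof -
 have "a * d >= 0" using assms(2) zero_le_power2[of b] by linarith
 hence ad: "a >= 0" "d >= 0" using assms(1) by (auto simp: zero_le_mult_iff)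
 have "\<bar>b\<bar> <= sqrt (a * d)" using assms(2) by (metis real_sqrt_abs real_sqrt_le_iff)
 hence "\<bar>b\<bar> * \<bar>x * y\<bar> <= (sqrt a * sqrt d) * \<bar>x * y\<bar>" by (intro mult_right_mono) (simp_all add: real_sqrt_mult)
 moreover have "- (b * (x * y)) <= \<bar>b\<bar> * \<bar>x * y\<bar>" by (metis abs_ge_minus_self abs_mult)
 moreover have "0 <= (sqrt a * \<bar>x\<bar> - sqrt d * \<bar>y\<bar>)^2" by simp
 moreover have "(sqrt a * \<bar>x\<bar> - sqrt d * \<bar>y\<bar>)^2 = a * x^2 - 2 * (sqrt a * sqrt d * \<bar>x * y\<bar>) + d * y^2"
  using ad by (simp add: power2_diff power_mult_distrib abs_mult)
 ultimately show ?thesis by (simp add: mult.assoc)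
qed

lemma eigval_of_char:
 fixes M :: "real^2^2"
 assumes m: "M $ 1 $ 1 = a" "M $ 1 $ 2 = b" "M $ 2 $ 1 = b" "M $ 2 $ 2 = d" and ch: "(a - \<mu>) * (d - \<mu>) = b^2"
 shows "eigval M \<mu>"
proof (cases "b = 0 & a = \<mu>")
 case True
 thus ?thesis unfolding eigval_def using m
  by (intro exI[of _ "vector [1, 0]"]) (auto simp: vec_eq_iff forall_2 matrix_vector_mult_def sum_2)
next
 case False
 have "b * b + d * (\<mu> - a) = \<mu> * (\<mu> - a)" using ch by (simp add: power2_eq_square algebra_simps)
 thus ?thesis unfolding eigval_def using m False
  by (intro exI[of _ "vector [b, \<mu> - a]"]) (auto simp: vec_eq_iff forall_2 matrix_vector_mult_def sum_2 algebra_simps)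
qed

lemma mv_inner2:
 fixes M :: "real^2^2" and p q :: "real^2"
 shows "(M *v p) \<bullet> q = (\<Sum>i\<in>UNIV. \<Sum>j\<in>UNIV. M $ i $ j * (p $ j * q $ i))"
 by (simp add: inner_2 matrix_vector_mult_def sum_2 algebra_simps)

text \<open>The eigenvalues are m + r and m - r with half the trace m. Their bounds make trace and
  determinant of both shifted matrices, M - c and C - M, nonnegative, which is semidefiniteness in
  dimension two.\<close>

lemma elliptic2:
 fixes M :: "real^2^2"
 assumes s: "transpose M = M" and e: "\<And>mu. eigval M mu ==> c <= mu & mu <= C"
 shows "c * (norm p)^2 <= (M *v p) \<bullet> p" "(M *v p) \<bullet> p <= C * (norm p)^2"
proof -
 define a b d where "a = M $ 1 $ 1" and "b = M $ 1 $ 2" and "d = M $ 2 $ 2"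
 have s': "M $ 2 $ 1 = b" using arg_cong[OF s, of "%M::real^2^2. M $ 1 $ 2"] unfolding b_def by (simp add: transpose_def)
 define m r where "m = (a + d) / 2" and "r = sqrt (((a - d) / 2)^2 + b^2)"
 have r: "r >= 0" "r^2 = ((a - d) / 2)^2 + b^2" unfolding r_def by auto
 have mm: "m^2 - ((a - d) / 2)^2 = a * d" unfolding m_def by (simp add: power2_eq_square field_simps)
 have ch: "(a - (m + k)) * (d - (m + k)) = b^2" if "k = r | k = - r" for k
 proof -
  have "k^2 = r^2" using that by auto
  moreover have "(a - (m + k)) * (d - (m + k)) = a * d - m^2 + k^2" unfolding m_def by (simp add: power2_eq_square field_simps)
  ultimately show ?thesis using r mm by simp
 qed
 have ev: "eigval M (m + k)" if "k = r | k = - r" for k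
  by (rule eigval_of_char[OF a_def[symmetric] b_def[symmetric] s' d_def[symmetric] ch[OF that]])
 have c: "c <= m - r" "m + r <= C" using e[OF ev[of "- r"]] e[OF ev[of r]] by auto
 have q: "(M *v p) \<bullet> p = a * (p $ 1)^2 + 2 * b * p $ 1 * p $ 2 + d * (p $ 2)^2"
  unfolding mv_inner2 sum_2 s' a_def[symmetric] b_def[symmetric] d_def[symmetric] by (simp add: power2_eq_square algebra_simps)
 have n: "(norm p)^2 = (p $ 1)^2 + (p $ 2)^2" unfolding power2_norm_eq_inner inner_2 by (simp add: power2_eq_square)
 have "r^2 <= (m - c)^2" "r^2 <= (C - m)^2" using c r(1) by (auto intro: power_mono)
 moreover have "(a - c) * (d - c) = (m - c)^2 - (m^2 - a * d)" "(C - a) * (C - d) = (C - m)^2 - (m^2 - a * d)"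
  unfolding m_def by (simp_all add: power2_eq_square field_simps)
 ultimately have b2: "b^2 <= (a - c) * (d - c)" "(- b)^2 <= (C - a) * (C - d)" using r mm by simp_all
 have t1: "(a - c) + (d - c) >= 0" using c(1) r(1) unfolding m_def by (simp add: field_simps)
 have t2: "(C - a) + (C - d) >= 0" using c(2) r(1) unfolding m_def by (simp add: field_simps)
 from psd2[OF t1 b2(1), of "p $ 1" "p $ 2"] psd2[OF t2 b2(2), of "p $ 1" "p $ 2"]
 show "c * (norm p)^2 <= (M *v p) \<bullet> p" "(M *v p) \<bullet> p <= C * (norm p)^2" unfolding q n by (simp_all add: algebra_simps)
qed

text \<open>Test vectors (1, 0), (0, 1), (1, 1) and (1, -1). Bounded entries make the coefficient
  integrable on triangles.\<close>

lemma elliptic2_entry: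
 fixes M :: "real^2^2"
 assumes s: "transpose M = M" and e: "\<And>mu. eigval M mu ==> c <= mu & mu <= C" and c0: "c >= 0" and C0: "C >= 0"
 shows "\<bar>M $ i $ j\<bar> <= 2 * C"
proof -
 note E = elliptic2[of M c C, OF s e]
 have a: "0 <= (M *v p) \<bullet> p" for p using E(1)[of p] c0 by (meson mult_nonneg_nonneg order_trans zero_le_power2)
 have s': "M $ 2 $ 1 = M $ 1 $ 2" using arg_cong[OF s, of "%M::real^2^2. M $ 1 $ 2"] by (simp add: transpose_def)
 have nn: "(norm (vector [x, y] :: point))^2 = x^2 + y^2" for x y unfolding power2_norm_eq_inner inner_2 by (simp add: power2_eq_square)
 have v: "0 <= M $ 1 $ 1" "M $ 1 $ 1 <= C" "0 <= M $ 2 $ 2" "M $ 2 $ 2 <= C"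
  using a[of "vector [1, 0]"] E(2)[of "vector [1, 0]"] a[of "vector [0, 1]"] E(2)[of "vector [0, 1]"] by (simp_all add: mv_inner2 sum_2 nn)
 have "0 <= M $ 1 $ 1 + 2 * M $ 1 $ 2 + M $ 2 $ 2" "0 <= M $ 1 $ 1 - 2 * M $ 1 $ 2 + M $ 2 $ 2"
  using a[of "vector [1, 1]"] a[of "vector [1, -1]"] by (simp_all add: mv_inner2 sum_2 s')
 hence "\<bar>M $ 1 $ 2\<bar> <= 2 * C" using v by linarith
 hence "\<forall>i j. \<bar>M $ i $ j\<bar> <= 2 * C" unfolding forall_2 using v C0 s' by auto
 thus ?thesis by blast
qed

lemma admissible_obtain:
 fixes A :: "point => real^2^2"
 assumes "admissible_coeff \<Omega> A"
 obtains c C where "0 < c" "0 < C"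
  "AE x in lebesgue. x \<in> \<Omega> --> (\<forall>p. c * (norm p)^2 <= (A x *v p) \<bullet> p & (A x *v p) \<bullet> p <= C * (norm p)^2) & (\<forall>i j. \<bar>A x $ i $ j\<bar> <= 2 * C)"
  "\<And>i j. (%x. A x $ i $ j) \<in> borel_measurable (lebesgue_on \<Omega>)"
proof -
 obtain c C where c: "0 < c" and AE1: "AE x in lebesgue. x \<in> \<Omega> --> (\<forall>mu. eigval (A x) mu --> c <= mu & mu <= C)"
  using assms unfolding admissible_coeff_def by blast
 have AE2: "AE x in lebesgue. x \<in> \<Omega> --> transpose (A x) = A x" and me: "\<And>i j. (%x. A x $ i $ j) \<in> borel_measurable (lebesgue_on \<Omega>)"
  using assms unfolding admissible_coeff_def by blast+
 \<comment> \<open>The hypothesis supplies no sign for the upper bound, so it is enlarged to be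
   positive.\<close>
 define C' where "C' = max C 1"
 have C': "C' > 0" "C <= C'" unfolding C'_def by auto
 have "AE x in lebesgue. x \<in> \<Omega> --> (\<forall>p. c * (norm p)^2 <= (A x *v p) \<bullet> p & (A x *v p) \<bullet> p <= C' * (norm p)^2) & (\<forall>i j. \<bar>A x $ i $ j\<bar> <= 2 * C')"
  using AE1 AE2
 proof eventually_elim
  case (elim x)
  show ?case
  proof
   assume x: "x \<in> \<Omega>"
   have s: "transpose (A x) = A x" and e: "c <= mu & mu <= C'" if "eigval (A x) mu" for mu
    using elim x that C'(2) by force+
   have s: "transpose (A x) = A x" using elim x by blast
   show "(\<forall>p. c * (norm p)^2 <= (A x *v p) \<bullet> p & (A x *v p) \<bullet> p <= C' * (norm p)^2) & (\<forall>i j. \<bar>A x $ i $ j\<bar> <= 2 * C')"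
    using elliptic2[OF s e] elliptic2_entry[OF s e] c C'(1) by simp
  qed
 qed
 thus thesis using that c C'(1) me by blast
qed

text \<open>Gradients are constant on triangles, so the form sees the coefficient only through this
  integrated matrix.\<close>

definition imat :: "(point => real^2^2) => point set => real^2^2" where
 "imat A S = (\<chi> i j. LINT x:S|lebesgue. A x $ i $ j)"

lemma imat_props:
 fixes A :: "point => real^2^2"
 assumes Om: "\<Omega> \<in> sets lebesgue" and S: "S \<in> lmeasurable" "S \<subseteq> \<Omega>"
  and AE: "AE x in lebesgue. x \<in> \<Omega> --> (\<forall>p. c * (norm p)^2 <= (A x *v p) \<bullet> p & (A x *v p) \<bullet> p <= C * (norm p)^2) & (\<forall>i j. \<bar>A x $ i $ j\<bar> <= 2 * C)"
  and me: "\<And>i j. (%x. A x $ i $ j) \<in> borel_measurable (lebesgue_on \<Omega>)"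
 shows "set_integrable lebesgue S (%x. (A x *v p) \<bullet> q)" "(LINT x:S|lebesgue. (A x *v p) \<bullet> q) = (imat A S *v p) \<bullet> q"
  "c * measure lebesgue S * (norm p)^2 <= (imat A S *v p) \<bullet> p" "(imat A S *v p) \<bullet> p <= C * measure lebesgue S * (norm p)^2"
proof -
 have int: "set_integrable lebesgue S (%x. A x $ i $ j)" for i j
 proof -
  have 1: "(%x. indicator \<Omega> x *R A x $ i $ j) \<in> borel_measurable lebesgue"
   using me[of i j] borel_measurable_restrict_space_iff[of \<Omega> lebesgue "%x. A x $ i $ j"] Om by simp
  have "integrable lebesgue (%x. indicator S x *R (indicator \<Omega> x *R A x $ i $ j))"
  proof (rule integrableI_bounded_set_indicator[OF _ 1, of S "2 * C"])
   show "S \<in> sets lebesgue" "emeasure lebesgue S < \<infinity>" using S(1) by (auto simp: fmeasurable_def)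
   show "AE x in lebesgue. x \<in> S --> norm (indicator \<Omega> x *R A x $ i $ j) <= 2 * C"
    using AE by eventually_elim (use S(2) in auto)
  qed
  moreover have "indicator S x *R (indicator \<Omega> x *R A x $ i $ j) = indicator S x *R A x $ i $ j" for x
   using S(2) by (auto simp: indicator_def)
  ultimately show ?thesis unfolding set_integrable_def by (simp only:)
 qed
 have e: "(A x *v p) \<bullet> q = (\<Sum>i\<in>UNIV. \<Sum>j\<in>UNIV. A x $ i $ j * (p $ j * q $ i))" for x p q by (rule mv_inner2)
 have I: "integrable lebesgue (%x. indicator S x *R (A x $ i $ j * k))" for i j k
  using set_integrable_mult_left[OF int] unfolding set_integrable_def .
 show ip: "set_integrable lebesgue S (%x. (A x *v p) \<bullet> q)" for p q
  unfolding e set_integrable_def scaleR_sum_right by (intro Bochner_Integration.integrable_sum I)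
 show eq: "(LINT x:S|lebesgue. (A x *v p) \<bullet> q) = (imat A S *v p) \<bullet> q" for p q
 proof -
  have "(LINT x:S|lebesgue. (A x *v p) \<bullet> q) = (\<Sum>i\<in>UNIV. \<Sum>j\<in>UNIV. LINT x|lebesgue. indicator S x *R (A x $ i $ j * (p $ j * q $ i)))"
   unfolding e set_lebesgue_integral_def scaleR_sum_right
   by (subst Bochner_Integration.integral_sum, intro Bochner_Integration.integrable_sum I, intro sum.cong HOL.refl Bochner_Integration.integral_sum I)
  also have "... = (\<Sum>i\<in>UNIV. \<Sum>j\<in>UNIV. imat A S $ i $ j * (p $ j * q $ i))"
   by (intro sum.cong HOL.refl) (simp add: imat_def set_lebesgue_integral_def flip: integral_mult_left_zero mult.assoc)
  finally show ?thesis unfolding mv_inner2 .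
 qed
 have K: "integrable lebesgue (%x. indicator S x *R (k::real))" for k using S(1) by (intro integrable_scaleR_left) (auto simp: integrable_indicator_iff fmeasurable_def)
 have Kv: "(LINT x|lebesgue. indicator S x *R (k::real)) = measure lebesgue S * k" for k by (simp add: S(1) fmeasurableD)
 have "(LINT x|lebesgue. indicator S x *R (c * (norm p)^2)) <= (LINT x|lebesgue. indicator S x *R ((A x *v p) \<bullet> p))"
  by (rule integral_mono_AE[OF K ip[unfolded set_integrable_def]])
   (use AE in eventually_elim, use S(2) in \<open>auto simp: indicator_def\<close>)
 thus "c * measure lebesgue S * (norm p)^2 <= (imat A S *v p) \<bullet> p" unfolding Kv eq[symmetric] set_lebesgue_integral_def by (simp add: algebra_simps)
 have "(LINT x|lebesgue. indicator S x *R ((A x *v p) \<bullet> p)) <= (LINT x|lebesgue. indicator S x *R (C * (norm p)^2))"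
  by (rule integral_mono_AE[OF ip[unfolded set_integrable_def] K])
   (use AE in eventually_elim, use S(2) in \<open>auto simp: indicator_def\<close>)
 thus "(imat A S *v p) \<bullet> p <= C * measure lebesgue S * (norm p)^2" unfolding Kv eq[symmetric] set_lebesgue_integral_def by (simp add: algebra_simps)
qed

context dom begin

text \<open>The form integrates over \<Omega> while the triangles fill its closure. The difference
  is negligible, so each open triangle counts with its full area and the integral becomes a finite
  sum comparable to \<open>energy\<close>.\<close>

lemma form_energy:
 fixes A :: "point => real^2^2"
 assumes A: "admissible_coeff \<Omega> A" and neg: "negligible (closure \<Omega> - \<Omega>)"
 shows "\<exists>c C::real. 0 < c & 0 < C & (\<forall>T. fmesh T --> (\<exists>m :: ltri => real^2^2.
  (\<forall>u v. pwaff T u --> pwaff T v --> (LINT x:\<Omega>|lebesgue. (A x *v grad u x) \<bullet> grad v x) = (\<Sum>t\<in>T. (m t *v tgrad u t) \<bullet> tgrad v t)) \<and>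
  (\<forall>t\<in>T. \<forall>p. c * ar t * (norm p)^2 <= (m t *v p) \<bullet> p & (m t *v p) \<bullet> p <= C * ar t * (norm p)^2)))"
proof -
 obtain c C where c: "0 < c" "0 < C"
  and AE: "AE x in lebesgue. x \<in> \<Omega> --> (\<forall>p. c * (norm p)^2 <= (A x *v p) \<bullet> p & (A x *v p) \<bullet> p <= C * (norm p)^2) & (\<forall>i j. \<bar>A x $ i $ j\<bar> <= 2 * C)"
  and me: "\<And>i j. (%x. A x $ i $ j) \<in> borel_measurable (lebesgue_on \<Omega>)" by (rule admissible_obtain[OF A]) (rule that)
 have Om: "\<Omega> \<in> sets lebesgue" using opn by (simp add: borel_open)
 have main: "(\<forall>u v. pwaff T u --> pwaff T v --> (LINT x:\<Omega>|lebesgue. (A x *v grad u x) \<bullet> grad v x) = (\<Sum>t\<in>T. (imat A (otri t \<inter> \<Omega>) *v tgrad u t) \<bullet> tgrad v t)) \<and>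
  (\<forall>t\<in>T. \<forall>p. c * ar t * (norm p)^2 <= (imat A (otri t \<inter> \<Omega>) *v p) \<bullet> p & (imat A (otri t \<inter> \<Omega>) *v p) \<bullet> p <= C * ar t * (norm p)^2)"
  if T: "fmesh T" for T
 proof -
  note m = fmeshD(4)[OF T] and fin = meshD(1)[OF fmeshD(4)[OF T]]
  have cov: "\<Union> (tri ` T) = closure \<Omega>" using fmeshD(3)[OF T] cl by simp
  have S: "otri t \<inter> \<Omega> \<in> lmeasurable" "otri t \<inter> \<Omega> \<subseteq> \<Omega>" "measure lebesgue (otri t \<inter> \<Omega>) = ar t" if t: "t \<in> T" for t
  proof -
   note n = meshD(2)[OF m t]
   show "otri t \<inter> \<Omega> \<in> lmeasurable" using measure_otri(2)[OF n] Om by (rule fmeasurable_Int_fmeasurable)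
   show "otri t \<inter> \<Omega> \<subseteq> \<Omega>" by blast
   have "otri t \<subseteq> closure \<Omega>" using otri_sub[OF n] t cov by blast
   hence "(otri t - otri t \<inter> \<Omega>) \<union> (otri t \<inter> \<Omega> - otri t) \<subseteq> closure \<Omega> - \<Omega>" by blast
   hence "negligible ((otri t - otri t \<inter> \<Omega>) \<union> (otri t \<inter> \<Omega> - otri t))" using neg negligible_subset by blast
   hence "measure lebesgue (otri t \<inter> \<Omega>) = measure lebesgue (otri t)" by (rule measure_negligible_symdiff[OF measure_otri(2)[OF n]])
   thus "measure lebesgue (otri t \<inter> \<Omega>) = ar t" using measure_otri(1)[OF n] by simp
  qed
  note P = imat_props[OF Om S(1,2) AE me]
  have "(LINT x:\<Omega>|lebesgue. (A x *v grad u x) \<bullet> grad v x) = (\<Sum>t\<in>T. (imat A (otri t \<inter> \<Omega>) *v tgrad u t) \<bullet> tgrad v t)"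
   if uv: "pwaff T u" "pwaff T v" for u v
  proof -
   define g where "g = (%x. (A x *v grad u x) \<bullet> grad v x)"
   define H where "H = (%x. \<Sum>t\<in>T. indicator (otri t \<inter> \<Omega>) x *R ((A x *v tgrad u t) \<bullet> tgrad v t))"
   define Z where "Z = (\<Union>t\<in>T. tri t - otri t)"
   have Z: "negligible Z" unfolding Z_def using fin negligible_tri_boundary meshD(2)[OF m] by (intro negligible_Union finite_imageI) auto
   have gH: "g x = H x" if x: "x \<in> \<Omega> - Z" for x
   proof -
    have "x \<in> closure \<Omega>" using x closure_subset by blast
    then obtain t where t: "t \<in> T" "x \<in> tri t" using cov by blast
    hence xo: "x \<in> otri t" using x unfolding Z_def by blast
    note n = meshD(2)[OF m t(1)]
    have "x \<notin> otri s" if "s \<in> T" "s ~= t" for s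
     using mesh_otri_tri[OF m that(1) t(1) _ t(2)] that(2) by blast
    hence "H x = (\<Sum>s\<in>T. if s = t then (A x *v tgrad u t) \<bullet> tgrad v t else 0)"
     unfolding H_def using xo x by (intro sum.cong) (auto simp: indicator_def)
    also have "... = (A x *v tgrad u t) \<bullet> tgrad v t" using fin t(1) by simp
    finally show ?thesis unfolding g_def grad_pwaff[OF uv(1) t(1) n xo] grad_pwaff[OF uv(2) t(1) n xo] by simp
   qed
   have Hi: "integrable lebesgue (%x. indicator (otri t \<inter> \<Omega>) x *R ((A x *v tgrad u t) \<bullet> tgrad v t))" if "t \<in> T" for t
    using P(1)[OF that that] unfolding set_integrable_def .
   have H1: "indicator \<Omega> x *R H x = H x" for x unfolding H_def by (auto simp: indicator_def scaleR_sum_right intro!: sum.cong)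
   have Ha: "H absolutely_integrable_on \<Omega>" unfolding set_integrable_def H1 unfolding H_def using Hi by (intro Bochner_Integration.integrable_sum)
   have ga: "g absolutely_integrable_on \<Omega>" by (rule absolutely_integrable_spike[OF Ha Z]) (rule gH)
   have "(LINT x:\<Omega>|lebesgue. g x) = integral \<Omega> g" by (rule set_lebesgue_integral_eq_integral(2)[OF ga])
   also have "... = integral \<Omega> H" by (rule integral_spike[OF Z]) (simp add: gH)
   also have "... = (LINT x:\<Omega>|lebesgue. H x)" by (rule set_lebesgue_integral_eq_integral(2)[OF Ha, symmetric])
   also have "... = (LINT x|lebesgue. H x)" unfolding set_lebesgue_integral_def H1 ..
   also have "... = (\<Sum>t\<in>T. LINT x:otri t \<inter> \<Omega>|lebesgue. (A x *v tgrad u t) \<bullet> tgrad v t)"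
    unfolding H_def set_lebesgue_integral_def using Hi by (rule Bochner_Integration.integral_sum)
   also have "... = (\<Sum>t\<in>T. (imat A (otri t \<inter> \<Omega>) *v tgrad u t) \<bullet> tgrad v t)" by (intro sum.cong P(2)) auto
   finally show ?thesis unfolding g_def .
  qed
  moreover have "c * ar t * (norm p)^2 <= (imat A (otri t \<inter> \<Omega>) *v p) \<bullet> p & (imat A (otri t \<inter> \<Omega>) *v p) \<bullet> p <= C * ar t * (norm p)^2" if t: "t \<in> T" for t p
   using P(3,4)[OF t t] S(3)[OF t] by simp
  ultimately show ?thesis by blast
 qed
 show ?thesis
  by (rule exI[of _ c], rule exI[of _ C], intro conjI c allI impI, rule exI[of _ "%t. imat A (otri t \<inter> \<Omega>)"], erule main)
qed

end

section \<open>Simple polygons\<close>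

text \<open>Winding numbers and the Jordan curve theorem are available in the complex plane; this is
  the isometric identification with it.\<close>

definition cx :: "point => complex" where "cx x = Complex (x $ 1) (x $ 2)"
definition rc :: "complex => point" where "rc z = vector [Re z, Im z]"

lemma rc_nth [simp]: "rc z $ 1 = Re z" "rc z $ 2 = Im z" by (simp_all add: rc_def)
lemma cx_rc [simp]: "cx (rc z) = z" by (simp add: cx_def)
lemma rc_cx [simp]: "rc (cx x) = x" by (intro point_eqI) (simp_all add: cx_def)
lemma cx_add: "cx (x + y) = cx x + cx y" and cx_diff: "cx (x - y) = cx x - cx y" and cx_scale: "cx (k *R x) = k *R cx x"
 by (simp_all add: cx_def complex_eq_iff)
lemma norm_cx: "norm (cx x) = norm x"
 unfolding cx_def complex_norm by (simp add: norm_eq_sqrt_inner inner_2 power2_eq_square)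
lemma bounded_linear_cx: "bounded_linear cx"
 by (rule bounded_linear_intro[of _ 1]) (simp_all add: cx_add cx_scale norm_cx)
lemma bounded_linear_rc: "bounded_linear rc"
proof (rule bounded_linear_intro[of _ 1])
 show "rc (x + y) = rc x + rc y" for x y by (intro point_eqI) auto
 show "rc (k *R x) = k *R rc x" for k x by (intro point_eqI) auto
 show "norm (rc x) <= norm x * 1" for x using norm_cx[of "rc x"] by simp
qed
lemma inj_cx: "inj cx" by (rule inj_on_inverseI[of _ rc]) simp
lemma surj_cx: "surj cx" by (metis cx_rc surj_def)
lemma bij_cx: "bij cx" using inj_cx surj_cx by (rule bijI)

lemma homeo_cx: "homeomorphism S (cx ` S) cx rc"
 by (rule homeomorphismI) (auto intro: linear_continuous_on bounded_linear_cx bounded_linear_rc)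

lemma cx_Compl: "cx ` (- S) = - cx ` S" using bij_image_Compl_eq[OF bij_cx] by blast

lemma bounded_cx: "bounded (cx ` S) \<longleftrightarrow> bounded S"
 unfolding bounded_iff by (simp add: norm_cx)

lemma cc_cx: assumes "x \<notin> S" shows "connected_component_set (- cx ` S) (cx x) = cx ` connected_component_set (- S) x"
 using connected_component_set_homeomorphism[OF homeo_cx[of "- S"], of x] assms unfolding cx_Compl by simp

lemma inside_outside_cx:
 "cx x \<in> inside (cx ` S) \<longleftrightarrow> x \<in> inside S" "cx x \<in> outside (cx ` S) \<longleftrightarrow> x \<in> outside S"
proof -
 have m: "cx x \<in> cx ` S \<longleftrightarrow> x \<in> S" by (rule inj_image_mem_iff[OF inj_cx])
 have b: "bounded (connected_component_set (- cx ` S) (cx x)) \<longleftrightarrow> bounded (connected_component_set (- S) x)" if "x \<notin> S"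
  unfolding cc_cx[OF that] by (rule bounded_cx)
 show "cx x \<in> inside (cx ` S) \<longleftrightarrow> x \<in> inside S" unfolding inside_def mem_Collect_eq m using b by blast
 show "cx x \<in> outside (cx ` S) \<longleftrightarrow> x \<in> outside S" unfolding outside_def Int_iff Compl_iff mem_Collect_eq m using b by blast
qed

lemma inside_cx: "inside (cx ` S) = cx ` inside S" and outside_cx: "outside (cx ` S) = cx ` outside S"
proof -
 have "z \<in> cx ` A \<longleftrightarrow> rc z \<in> A" for z A using inj_image_mem_iff[OF inj_cx, of "rc z" A] by simp
 thus "inside (cx ` S) = cx ` inside S" "outside (cx ` S) = cx ` outside S"
  using inside_outside_cx[of "rc _" S] by auto
qed

fun ppath :: "complex list => real => complex" where
 "ppath (a # b # c # xs) = linepath a b +++ ppath (b # c # xs)"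
| "ppath [a, b] = linepath a b"
| "ppath xs = linepath 0 0"

lemma ppath_basic:
 "length xs >= 2 ==> pathstart (ppath xs) = hd xs & pathfinish (ppath xs) = last xs & path (ppath xs) & valid_path (ppath xs) \<and>
  path_image (ppath xs) = (\<Union>i<length xs - 1. closed_segment (xs ! i) (xs ! Suc i))"
proof (induction xs rule: ppath.induct)
 case (1 a b c xs)
 hence IH: "pathstart (ppath (b # c # xs)) = b" "pathfinish (ppath (b # c # xs)) = last (b # c # xs)" "path (ppath (b # c # xs))"
  "valid_path (ppath (b # c # xs))"
  "path_image (ppath (b # c # xs)) = (\<Union>i<length xs + 1. closed_segment ((b # c # xs) ! i) ((b # c # xs) ! Suc i))" by auto
 have "{..<length (a # b # c # xs) - 1} = insert 0 (Suc ` {..<length xs + 1})"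
  by (simp add: lessThan_Suc_eq_insert_0)
 hence "(\<Union>i<length (a # b # c # xs) - 1. closed_segment ((a # b # c # xs) ! i) ((a # b # c # xs) ! Suc i))
  = closed_segment a b \<union> (\<Union>i<length xs + 1. closed_segment ((b # c # xs) ! i) ((b # c # xs) ! Suc i))"
  by simp
 thus ?case using IH by (simp add: path_image_join valid_path_join)
next
 case (2 a b)
 thus ?case by (simp add: lessThan_Suc)
qed auto

lemma ppath_arc:
 "length xs >= 2 ==> (\<And>i j. i < j ==> j < length xs - 1 ==>
   closed_segment (xs ! i) (xs ! Suc i) \<inter> closed_segment (xs ! j) (xs ! Suc j) \<subseteq> (if j = Suc i then {xs ! j} else {})) ==>
 (\<And>i. i < length xs - 1 ==> xs ! i ~= xs ! Suc i) ==> arc (ppath xs)"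
proof (induction xs rule: ppath.induct)
 case (1 a b c xs)
 have "arc (ppath (b # c # xs))"
 proof (rule "1.IH")
  show "2 <= length (b # c # xs)" by simp
  show "closed_segment ((b # c # xs) ! i) ((b # c # xs) ! Suc i) \<inter> closed_segment ((b # c # xs) ! j) ((b # c # xs) ! Suc j) \<subseteq> (if j = Suc i then {(b # c # xs) ! j} else {})"
   if "i < j" "j < length (b # c # xs) - 1" for i j
  proof -
   have "Suc i < Suc j" "Suc j < length (a # b # c # xs) - 1" using that by auto
   from "1.prems"(2)[OF this] show ?thesis by (simp only: nth_Cons_Suc nat.inject)
  qed
  show "(b # c # xs) ! i ~= (b # c # xs) ! Suc i" if "i < length (b # c # xs) - 1" for i
  proof -
   have "Suc i < length (a # b # c # xs) - 1" using that by auto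
   from "1.prems"(3)[OF this] show ?thesis by (simp only: nth_Cons_Suc not_False_eq_True)
  qed
 qed
 moreover have "a ~= b" using "1.prems"(3)[of 0] by simp
 moreover have "path_image (linepath a b) \<inter> path_image (ppath (b # c # xs)) \<subseteq> {b}"
 proof -
  have "closed_segment a b \<inter> closed_segment ((b # c # xs) ! j) ((b # c # xs) ! Suc j) \<subseteq> {b}" if "j < length xs + 1" for j
   using "1.prems"(2)[of 0 "Suc j"] that by (auto split: if_splits)
  thus ?thesis using ppath_basic[of "b # c # xs"] by auto
 qed
 ultimately show ?case using ppath_basic[of "b # c # xs"] by (simp add: arc_join)
qed auto

lemma ppath_winding:
 "length xs >= 2 ==> z \<notin> path_image (ppath xs) ==>
  winding_number (ppath xs) z = (\<Sum>i<length xs - 1. winding_number (linepath (xs ! i) (xs ! Suc i)) z)"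
proof (induction xs rule: ppath.induct)
 case (1 a b c xs)
 note B = ppath_basic[of "b # c # xs"]
 have z: "z \<notin> closed_segment a b" "z \<notin> path_image (ppath (b # c # xs))" using 1(3) B by (auto simp: path_image_join)
 have "winding_number (ppath (a # b # c # xs)) z = winding_number (linepath a b) z + winding_number (ppath (b # c # xs)) z"
  using z B by (simp add: winding_number_join)
 also have "winding_number (ppath (b # c # xs)) z = (\<Sum>i<length xs + 1. winding_number (linepath ((b # c # xs) ! i) ((b # c # xs) ! Suc i)) z)"
  using "1.IH" z by simp
 moreover have "length (a # b # c # xs) - 1 = Suc (length xs + 1)" by simp
 ultimately show ?case by (simp only: sum.lessThan_Suc_shift nth_Cons_Suc nth_Cons_0)
qed auto

text \<open>The signed angle under which the edge is seen from x, that is, the imaginary part of the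
  contour integral of 1/(w - x). Up to a factor it is also the double-layer potential of the
  constant 1 on the edge; this links K to winding numbers.\<close>

definition fl :: "point => point => point => real" where
 "fl a b x = integral {0..1} (%t. det2 (a + t *R (b - a) - x) (b - a) / (norm (a + t *R (b - a) - x))^2)"

lemma fl_continuous: "continuous_on (- closed_segment a b) (fl a b)"
proof -
 let ?g = "%(x, t). det2 (a + t *R (b - a) - x) (b - a) / (norm (a + t *R (b - a) - x))^2"
 have nz: "a + t *R (b - a) - x ~= 0" if "x \<in> - closed_segment a b" "t \<in> {0..1}" for x t
 proof
  assume "a + t *R (b - a) - x = 0"
  hence "x = (1 - t) *R a + t *R b" by (simp add: algebra_simps)
  thus False using that by (auto simp: closed_segment_def)
 qed
 have "continuous_on ((- closed_segment a b) \<times> cbox 0 1) ?g"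
  unfolding case_prod_beta det2_def
  by (intro continuous_intros) (use nz in auto)
 hence "continuous_on (- closed_segment a b) (%x. integral (cbox 0 1) (%t. det2 (a + t *R (b - a) - x) (b - a) / (norm (a + t *R (b - a) - x))^2))"
  by (rule integral_continuous_on_param)
 thus ?thesis by (simp add: fl_def[abs_def])
qed

lemma winding_fl:
 assumes "x \<notin> closed_segment a b"
 shows "Re (winding_number (linepath (cx a) (cx b)) (cx x)) = fl a b x / (2 * pi)"
proof -
 have seg: "closed_segment (cx a) (cx b) = cx ` closed_segment a b"
  using closed_segment_linear_image[OF bounded_linear.linear[OF bounded_linear_cx]] by blast
 have xc: "cx x \<notin> closed_segment (cx a) (cx b)" unfolding seg using assms by (simp add: inj_image_mem_iff[OF inj_cx])
 define I where "I = contour_integral (linepath (cx a) (cx b)) (%w. 1 / (w - cx x))"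
 have "((%w. 1 / (w - cx x)) has_contour_integral I) (linepath (cx a) (cx b))"
  unfolding I_def by (rule has_contour_integral_integral, rule contour_integrable_inversediff) (use xc in auto)
 hence "((%t. 1 / (linepath (cx a) (cx b) t - cx x) * (cx b - cx a)) has_integral I) {0..1}"
  by (simp add: has_contour_integral_linepath)
 hence "((%t. Im (1 / (linepath (cx a) (cx b) t - cx x) * (cx b - cx a))) has_integral Im I) {0..1}"
  using has_integral_linear[OF _ bounded_linear_Im] by (simp add: o_def)
 moreover have "Im (1 / (linepath (cx a) (cx b) t - cx x) * (cx b - cx a)) = det2 (a + t *R (b - a) - x) (b - a) / (norm (a + t *R (b - a) - x))^2" for t
 proof -
  have e: "linepath (cx a) (cx b) t - cx x = cx (a + t *R (b - a) - x)"
   by (simp add: linepath_def cx_diff cx_add cx_scale algebra_simps)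
  have g: "Im (1 / cx p * cx q) = det2 p q / (norm p)^2" for p q
   unfolding power2_norm_eq_inner by (simp add: cx_def det2_def inner_2 Im_divide Re_divide power2_eq_square add_divide_distrib diff_divide_distrib mult.commute)
  show ?thesis unfolding e cx_diff[symmetric] g ..
 qed
 ultimately have "Im I = fl a b x" unfolding fl_def by (simp add: integral_unique)
 moreover have "winding_number (linepath (cx a) (cx b)) (cx x) = 1 / (2 * pi * \<i>) * I"
  unfolding I_def by (rule winding_number_valid_path) (use xc in auto)
 ultimately show ?thesis by (simp add: Re_divide power2_eq_square)
qed

text \<open>With s measured along the edge and d along its right normal, the integrand is the
  derivative of an arctangent.\<close>

lemma fl_jump_value:
 assumes "a ~= b" and x: "x = a + s *R (b - a) + d *R vector [(b - a) $ 2, - (b - a) $ 1]" and "d ~= 0"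
 shows "fl a b x = - (arctan ((1 - s) / d) + arctan (s / d))"
proof -
 define q where "q = b - a"
 have q0: "(norm q)^2 > 0" using assms by (simp add: q_def)
 have e: "det2 (a + t *R (b - a) - x) (b - a) / (norm (a + t *R (b - a) - x))^2 = - d / ((t - s)^2 + d^2)" for t
 proof -
  have y: "a + t *R (b - a) - x = (t - s) *R q - d *R vector [q $ 2, - q $ 1]" unfolding x q_def[symmetric] by (simp add: algebra_simps)
  have D: "det2 (a + t *R (b - a) - x) (b - a) = - d * (norm q)^2"
   unfolding y unfolding q_def[symmetric] power2_norm_eq_inner by (simp add: det2_def inner_2 algebra_simps)
  have E: "(norm (a + t *R (b - a) - x))^2 = ((t - s)^2 + d^2) * (norm q)^2"
   unfolding y power2_norm_eq_inner by (simp add: inner_2 algebra_simps power2_eq_square)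
  show ?thesis unfolding D E using q0 by simp
 qed
 have "((%t. - d / ((t - s)^2 + d^2)) has_integral (- arctan ((1 - s) / d)) - (- arctan ((0 - s) / d))) {0..1}"
 proof (rule fundamental_theorem_of_calculus)
  fix t :: real
  have "((%t. - arctan ((t - s) / d)) has_real_derivative - (1 / d / (1 + ((t - s) / d)^2))) (at t within {0..1})"
   using assms(3) by (auto intro!: derivative_eq_intros simp: divide_simps)
  moreover have "1 / d / (1 + ((t - s) / d)^2) = d / ((t - s)^2 + d^2)"
  proof -
   have "(t - s)^2 + d^2 > 0" using assms(3) by (simp add: add_nonneg_pos)
   thus ?thesis using assms(3) by (simp add: field_simps power2_eq_square)
  qed
  ultimately show "((%t. - arctan ((t - s) / d)) has_vector_derivative - d / ((t - s)^2 + d^2)) (at t within {0..1})"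
   by (simp add: has_real_derivative_iff_has_vector_derivative)
 qed simp
 from integral_unique[OF this]
 have "integral {0..1} (%t. - d / ((t - s)^2 + d^2)) = - arctan ((1 - s) / d) + arctan (- (s / d))" by simp
 thus ?thesis unfolding fl_def e by (simp add: arctan_minus)
qed

lemma fl_jump:
 assumes "a ~= b" "0 < s" "s < 1"
 shows "((%d. fl a b (a + s *R (b - a) + d *R vector [(b - a) $ 2, - (b - a) $ 1])) \<longlongrightarrow> - pi) (at_right 0)"
  "((%d. fl a b (a + s *R (b - a) + d *R vector [(b - a) $ 2, - (b - a) $ 1])) \<longlongrightarrow> pi) (at_left 0)"
proof -
 have ev: "eventually (%d. - (arctan ((1 - s) / d) + arctan (s / d)) = fl a b (a + s *R (b - a) + d *R vector [(b - a) $ 2, - (b - a) $ 1])) (at 0)"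
  unfolding eventually_at_filter using fl_jump_value[OF assms(1)] by (auto intro!: always_eventually)
 have evr: "eventually (%d. - (arctan ((1 - s) / d) + arctan (s / d)) = fl a b (a + s *R (b - a) + d *R vector [(b - a) $ 2, - (b - a) $ 1])) (at_right 0)"
  and evl: "eventually (%d. - (arctan ((1 - s) / d) + arctan (s / d)) = fl a b (a + s *R (b - a) + d *R vector [(b - a) $ 2, - (b - a) $ 1])) (at_left 0)"
  using ev filter_leD[OF at_le] by (meson subset_UNIV)+
 have tr: "((%d. arctan (k / d)) \<longlongrightarrow> pi / 2) (at_right 0)" if "k > 0" for k :: real
 proof (rule filterlim_compose[OF tendsto_arctan_at_top])
  show "filterlim (%d. k / d) at_top (at_right 0)"
   unfolding divide_inverse by (rule filterlim_tendsto_pos_mult_at_top[OF tendsto_const that filterlim_inverse_at_top_right])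
 qed
 have tl: "((%d. arctan (k / d)) \<longlongrightarrow> - (pi / 2)) (at_left 0)" if "k > 0" for k :: real
 proof -
  have "((%d. - arctan (k / d)) \<longlongrightarrow> - (pi / 2)) (at_right 0)" by (intro tendsto_minus tr that)
  hence "((%d. arctan (k / (- d))) \<longlongrightarrow> - (pi / 2)) (at_right 0)" by (simp add: arctan_minus)
  thus ?thesis using filterlim_at_left_to_right[of "%d. arctan (k / d)" "nhds (- (pi / 2))" 0] by simp
 qed
 have "((%d. - (arctan ((1 - s) / d) + arctan (s / d))) \<longlongrightarrow> - (pi / 2 + pi / 2)) (at_right 0)"
  by (intro tendsto_intros tr) (use assms in auto)
 thus "((%d. fl a b (a + s *R (b - a) + d *R vector [(b - a) $ 2, - (b - a) $ 1])) \<longlongrightarrow> - pi) (at_right 0)"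
  using evr by (simp add: tendsto_cong)
 have "((%d. - (arctan ((1 - s) / d) + arctan (s / d))) \<longlongrightarrow> - (- (pi / 2) + - (pi / 2))) (at_left 0)"
  by (intro tendsto_intros tl) (use assms in auto)
 thus "((%d. fl a b (a + s *R (b - a) + d *R vector [(b - a) $ 2, - (b - a) $ 1])) \<longlongrightarrow> pi) (at_left 0)"
  using evl by (simp add: tendsto_cong)
qed

locale polygon =
 fixes ps :: "point list"
 assumes sp: "simple_polygon ps"
begin

abbreviation "n \<equiv> length ps"
abbreviation "\<Gamma> \<equiv> polygon_image ps"
abbreviation "\<Omega> \<equiv> inside (polygon_image ps)"

lemma n3: "n >= 3" using sp unfolding simple_polygon_def by blast

lemma n0: "0 < n" "ps ~= []" using n3 by auto

lemma pedge_inter: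
 assumes "i < n" "j < n" "i ~= j"
 shows "pedge ps i \<inter> pedge ps j = (if Suc i mod n = j then {pv ps j} else if Suc j mod n = i then {pv ps i} else {})"
 using sp assms unfolding simple_polygon_def by blast

lemma pv_neq: "i < n ==> pv ps i ~= pv ps (Suc i)"
proof -
 assume i: "i < n"
 have "Suc i mod n ~= i"
 proof (cases "Suc i = n")
  case True
  thus ?thesis using n3 by simp
 next
  case False
  thus ?thesis using i by simp
 qed
 moreover have "Suc i mod n < n" using n0(1) by (rule mod_less_divisor)
 moreover have "distinct ps" using sp unfolding simple_polygon_def by blast
 ultimately show ?thesis using i unfolding pv_def by (simp add: nth_eq_iff_index_eq)
qed

definition xs :: "complex list" where "xs = map cx (ps @ [hd ps])"

lemma xs_length: "length xs = Suc n" by (simp add: xs_def)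

lemma xs_nth: "i <= n ==> xs ! i = cx (pv ps i)"
 using n0 by (cases "i = n") (auto simp: xs_def pv_def nth_append hd_conv_nth)

lemma seg_cx: "closed_segment (cx a) (cx b) = cx ` closed_segment a b"
 using closed_segment_linear_image[OF bounded_linear.linear[OF bounded_linear_cx]] by blast

lemma xs_seg: "i < n ==> closed_segment (xs ! i) (xs ! Suc i) = cx ` pedge ps i"
 by (simp add: xs_nth seg_cx pedge_def)

lemma path_image_xs: "path_image (ppath xs) = cx ` \<Gamma>"
proof -
 have "path_image (ppath xs) = (\<Union>i<n. closed_segment (xs ! i) (xs ! Suc i))" using ppath_basic[of xs] xs_length n3 by simp
 also have "... = (\<Union>i<n. cx ` pedge ps i)" using xs_seg by (intro SUP_cong) auto
 finally show ?thesis unfolding polygon_image_def by (simp add: image_UN)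
qed

text \<open>The first edge and the path of the remaining edges are arcs that meet only in their two
  common endpoints. The cyclic index wraps around only at the last edge, which is met by the first
  one.\<close>

lemma xs_simple: "simple_path (ppath xs)" and xs_closed: "pathfinish (ppath xs) = pathstart (ppath xs)"
proof -
 obtain a b c ys where x: "xs = a # b # c # ys"
  using xs_length n3 by (cases xs; cases "tl xs"; cases "tl (tl xs)") auto
 have ly: "length (b # c # ys) = n" "length (b # c # ys) - 1 = n - 1" using xs_length x by auto
 have nt: "(b # c # ys) ! i = xs ! Suc i" for i unfolding x by simp
 have ab: "a = xs ! 0" "b = xs ! 1" unfolding x by auto
 have la: "last (b # c # ys) = a"
 proof -
  have "last (b # c # ys) = (b # c # ys) ! (n - 1)" using last_conv_nth[of "b # c # ys"] ly by (simp only: list.distinct not_False_eq_True simp_thms)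
  also have "... = xs ! n" unfolding nt using n0(1) by simp
  finally have "last (b # c # ys) = xs ! n" .
  also have "... = xs ! 0" using xs_nth[of n] xs_nth[of 0] n3 by (simp add: pv_def)
  finally show ?thesis using ab by simp
 qed
 have "arc (ppath (b # c # ys))"
 proof (rule ppath_arc)
  show "2 <= length (b # c # ys)" by simp
  fix i j assume ij: "i < j" "j < length (b # c # ys) - 1"
  hence ij': "Suc i < n" "Suc j < n" "Suc i ~= Suc j" using ly by auto
  have "closed_segment ((b # c # ys) ! i) ((b # c # ys) ! Suc i) \<inter> closed_segment ((b # c # ys) ! j) ((b # c # ys) ! Suc j) = cx ` (pedge ps (Suc i) \<inter> pedge ps (Suc j))"
   unfolding nt xs_seg[OF ij'(1)] xs_seg[OF ij'(2)] by (simp add: image_Int[OF inj_cx])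
  also have "... \<subseteq> (if j = Suc i then {(b # c # ys) ! j} else {})"
  proof -
   have "Suc (Suc j) mod n ~= Suc i"
    using ij ij' n3 by (cases "Suc (Suc j) = n") auto
   moreover have "Suc (Suc i) mod n = Suc (Suc i)" using ij ij' by simp
   ultimately show ?thesis unfolding pedge_inter[OF ij'] nt using xs_nth[of "Suc j"] ij' by auto
  qed
  finally show "closed_segment ((b # c # ys) ! i) ((b # c # ys) ! Suc i) \<inter> closed_segment ((b # c # ys) ! j) ((b # c # ys) ! Suc j) \<subseteq> (if j = Suc i then {(b # c # ys) ! j} else {})" .
 next
  fix i assume "i < length (b # c # ys) - 1"
  hence "Suc i < n" using ly by auto
  thus "(b # c # ys) ! i ~= (b # c # ys) ! Suc i" unfolding nt using xs_nth[of "Suc i"] xs_nth[of "Suc (Suc i)"] pv_neq[of "Suc i"] inj_cx by (auto simp: inj_eq)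
 qed
 moreover have "arc (linepath a b)"
 proof (rule arc_linepath)
  have "cx (pv ps 0) ~= cx (pv ps 1)" using pv_neq[of 0] n0 inj_eq[OF inj_cx] by simp
  thus "a ~= b" using xs_nth[of 0] xs_nth[of 1] n3 ab by simp
 qed
 moreover have "path_image (linepath a b) \<inter> path_image (ppath (b # c # ys)) \<subseteq> {a, b}"
 proof -
  have "closed_segment a b \<inter> closed_segment ((b # c # ys) ! j) ((b # c # ys) ! Suc j) \<subseteq> {a, b}" if "j < n - 1" for j
  proof -
   have j: "0 < n" "Suc j < n" "0 ~= Suc j" using that by auto
   have "closed_segment a b \<inter> closed_segment ((b # c # ys) ! j) ((b # c # ys) ! Suc j) = cx ` (pedge ps 0 \<inter> pedge ps (Suc j))"
    unfolding nt xs_seg[OF j(2)] using xs_seg[OF j(1)] ab by (simp add: image_Int[OF inj_cx])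
   also have "... \<subseteq> {a, b}" unfolding pedge_inter[OF j] using ab xs_nth[of 0] xs_nth[of 1] n3 by auto
   finally show ?thesis .
  qed
  moreover have "path_image (ppath (b # c # ys)) = (\<Union>j<n - 1. closed_segment ((b # c # ys) ! j) ((b # c # ys) ! Suc j))"
  proof -
   have "2 <= length (b # c # ys)" by simp
   from ppath_basic[OF this] show ?thesis unfolding ly(2) by blast
  qed
  ultimately show ?thesis unfolding path_image_linepath by blast
 qed
 ultimately show "simple_path (ppath xs)" unfolding x using ppath_basic[of "b # c # ys"] la by (simp add: simple_path_join_loop)
 show "pathfinish (ppath xs) = pathstart (ppath xs)" using ppath_basic[of xs] xs_length n3 la unfolding x by simp
qed

lemma jordan:
 "open \<Omega>" "connected \<Omega>" "bounded \<Omega>" "\<Omega> ~= {}" "frontier \<Omega> = \<Gamma>" "frontier (outside \<Gamma>) = \<Gamma>" "\<Omega> \<inter> outside \<Gamma> = {}" "\<Omega> \<union> outside \<Gamma> = - \<Gamma>"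
proof -
 note J = Jordan_inside_outside[OF xs_simple xs_closed, unfolded path_image_xs inside_cx outside_cx]
 have lin: "linear cx" using bounded_linear.linear[OF bounded_linear_cx] .
 have op: "open S" if "open (cx ` S)" for S
 proof -
  have "open (cx -` (cx ` S))" using open_vimage[OF that linear_continuous_on[OF bounded_linear_cx]] by simp
  thus ?thesis by (simp add: inj_vimage_image_eq[OF inj_cx])
 qed
 have co: "connected S" if "connected (cx ` S)" for S
  using connected_continuous_image[OF linear_continuous_on[OF bounded_linear_rc] that] by (simp add: image_image)
 have fr: "frontier (cx ` S) = cx ` frontier S" for S
  unfolding frontier_closures cx_Compl[symmetric] closure_injective_linear_image[OF lin inj_cx, symmetric] by (simp add: image_Int[OF inj_cx])
 have ieq: "A = B" if "cx ` A = cx ` B" for A B using that inj_image_eq_iff[OF inj_cx] by blast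
 show "open \<Omega>" "connected \<Omega>" "bounded \<Omega>" "\<Omega> ~= {}" using J op co bounded_cx by auto
 show "frontier \<Omega> = \<Gamma>" "frontier (outside \<Gamma>) = \<Gamma>" using J fr ieq by auto
 show "\<Omega> \<inter> outside \<Gamma> = {}" by (rule inside_Int_outside)
 show "\<Omega> \<union> outside \<Gamma> = - \<Gamma>" by (rule inside_Un_outside)
qed

definition Wd :: "point => real" where "Wd x = (\<Sum>i<n. fl (pv ps i) (pv ps (Suc i)) x) / (2 * pi)"

lemma winding_Wd: assumes "x \<notin> \<Gamma>" shows "Re (winding_number (ppath xs) (cx x)) = Wd x"
proof -
 have "cx x \<notin> path_image (ppath xs)" unfolding path_image_xs using assms by (simp add: inj_image_mem_iff[OF inj_cx])
 hence "winding_number (ppath xs) (cx x) = (\<Sum>i<n. winding_number (linepath (xs ! i) (xs ! Suc i)) (cx x))"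
  using ppath_winding[of xs "cx x"] xs_length n3 by simp
 also have "... = (\<Sum>i<n. winding_number (linepath (cx (pv ps i)) (cx (pv ps (Suc i)))) (cx x))"
  using xs_nth by (intro sum.cong) auto
 finally have "Re (winding_number (ppath xs) (cx x)) = (\<Sum>i<n. Re (winding_number (linepath (cx (pv ps i)) (cx (pv ps (Suc i)))) (cx x)))" by simp
 also have "... = (\<Sum>i<n. fl (pv ps i) (pv ps (Suc i)) x / (2 * pi))"
 proof (rule sum.cong)
  fix i assume "i \<in> {..<n}"
  hence "x \<notin> closed_segment (pv ps i) (pv ps (Suc i))" using assms unfolding polygon_image_def pedge_def by blast
  thus "Re (winding_number (linepath (cx (pv ps i)) (cx (pv ps (Suc i)))) (cx x)) = fl (pv ps i) (pv ps (Suc i)) x / (2 * pi)" by (rule winding_fl)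
 qed simp
 finally show ?thesis unfolding Wd_def by (simp add: sum_divide_distrib)
qed

lemma Wd_outside: "x \<in> outside \<Gamma> ==> Wd x = 0"
proof -
 assume x: "x \<in> outside \<Gamma>"
 hence "cx x \<in> outside (path_image (ppath xs))" unfolding path_image_xs using inside_outside_cx by blast
 hence "winding_number (ppath xs) (cx x) = 0"
  using winding_number_zero_in_outside[of "ppath xs" "cx x"] xs_closed ppath_basic[of xs] xs_length n3 by simp
 moreover have "x \<notin> \<Gamma>" using x by (meson disjoint_iff outside_no_overlap)
 ultimately show ?thesis using winding_Wd[of x] by simp
qed

lemma Wd_inside: obtains W0 where "W0 = 1 | W0 = (-1::real)" "\<And>x. x \<in> \<Omega> ==> Wd x = W0"
proof -
 have ins: "cx x \<in> inside (path_image (ppath xs))" "x \<notin> \<Gamma>" if "x \<in> \<Omega>" for x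
  unfolding path_image_xs using that inside_outside_cx inside_no_overlap by blast+
 show thesis
 proof (rule simple_closed_path_winding_number_inside[OF xs_simple])
  assume a: "\<And>z. z \<in> inside (path_image (ppath xs)) ==> winding_number (ppath xs) z = 1"
  show thesis by (rule that[of 1]) (use a ins winding_Wd in \<open>auto simp flip: winding_Wd\<close>)
 next
  assume a: "\<And>z. z \<in> inside (path_image (ppath xs)) ==> winding_number (ppath xs) z = -1"
  show thesis by (rule that[of "-1"]) (use a ins winding_Wd in \<open>auto simp flip: winding_Wd\<close>)
 qed
qed

definition rn :: "nat => point" where
 "rn i = vector [(pv ps (Suc i) - pv ps i) $ 2, - (pv ps (Suc i) - pv ps i) $ 1]"

lemma rn_nth [simp]: "rn i $ 1 = (pv ps (Suc i) - pv ps i) $ 2" "rn i $ 2 = - (pv ps (Suc i) - pv ps i) $ 1"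
 by (simp_all add: rn_def)

lemma finite_values_limit:
 fixes f :: "real => real"
 assumes "(f \<longlongrightarrow> l) F" "F ~= bot" "eventually (%d. f d = a | f d = b) F" shows "l = a | l = b"
proof -
 have "l \<in> {a, b}" by (rule Lim_in_closed_set[OF _ _ assms(2,1)]) (use assms(3) in auto)
 thus ?thesis by blast
qed

lemma other_edges_open:
 assumes i: "i < n" and s: "0 < s" "s < 1"
 shows "\<forall>j<n. j ~= i --> pv ps i + s *R (pv ps (Suc i) - pv ps i) \<notin> pedge ps j"
proof (intro allI impI)
 fix j assume j: "j < n" "j ~= i"
 let ?x = "pv ps i + s *R (pv ps (Suc i) - pv ps i)"
 have ne: "pv ps i ~= pv ps (Suc i)" using pv_neq[OF i] .
 have xi: "?x \<in> pedge ps i" unfolding pedge_def closed_segment_def using s by (auto intro!: exI[of _ s] simp: algebra_simps)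
 have x1: "?x ~= pv ps i" using ne s by simp
 have x2: "?x ~= pv ps (Suc i)"
 proof
  assume "?x = pv ps (Suc i)"
  moreover have "pv ps (Suc i) - ?x = (1 - s) *R (pv ps (Suc i) - pv ps i)" by (simp add: algebra_simps)
  ultimately have "(1 - s) *R (pv ps (Suc i) - pv ps i) = 0" by (metis diff_self)
  thus False using ne s by auto
 qed
 have pj: "pv ps j = pv ps (Suc i)" if "Suc i mod n = j" using that by (auto simp: pv_def)
 show "?x \<notin> pedge ps j"
 proof
  assume "?x \<in> pedge ps j"
  hence "?x \<in> pedge ps i \<inter> pedge ps j" using xi by blast
  thus False unfolding pedge_inter[OF i j(1) j(2)[symmetric]] using x1 x2 pj by (auto split: if_splits)
 qed
qed

text \<open>Beside an inner edge point the winding number is 0 or W0, while the angle of the edge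
  itself jumps by 2 pi. With R the contribution of the other edges, the one-sided limits R - 1/2 and
  R + 1/2 are 0 and W0 in some order, so R = W0/2; the limits also tell on which side the interior
  lies. For the double-layer operator the first claim means K 1 = -1/2 at such points.\<close>

theorem edge_sides:
 assumes W: "W0 = 1 | W0 = (-1::real)" "\<And>x. x \<in> \<Omega> ==> Wd x = W0" and i: "i < n" and s: "0 < s" "s < 1"
  and x0: "x0 = pv ps i + s *R (pv ps (Suc i) - pv ps i)"
 shows "W0 * (\<Sum>j\<in>{..<n} - {i}. fl (pv ps j) (pv ps (Suc j)) x0) / (2 * pi) = 1 / 2"
  "eventually (%d. x0 + (d * W0) *R rn i \<notin> \<Omega>) (at_right 0)"
  "eventually (%d. x0 - (d * W0) *R rn i \<in> \<Omega>) (at_right 0)"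
proof -
 let ?R = "(\<Sum>j\<in>{..<n} - {i}. fl (pv ps j) (pv ps (Suc j)) x0) / (2 * pi)"
 note ne = pv_neq[OF i]
 note oth = other_edges_open[OF i s, folded x0]
 have cont: "((%d. x0 + d *R rn i) \<longlongrightarrow> x0) (at (0::real) within A)" for A
 proof -
  have "((%d. x0 + d *R rn i) \<longlongrightarrow> x0 + 0 *R rn i) (at 0 within A)" by (intro tendsto_intros)
  thus ?thesis by simp
 qed
 have off: "eventually (%d. x0 + d *R rn i \<notin> \<Gamma>) (at (0::real) within A)" for A
 proof -
  define D where "D = (\<Union>j\<in>{..<n} - {i}. pedge ps j)"
  have "closed D" unfolding D_def pedge_def by (intro closed_UN) auto
  hence "open (- D)" by blast
  moreover have "x0 \<in> - D" using oth unfolding D_def by blast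
  ultimately have "eventually (%d. x0 + d *R rn i \<in> - D) (at 0 within A)" using cont topological_tendstoD by blast
  moreover have "eventually (%d::real. d ~= 0) (at 0 within A)" by (simp add: eventually_at_filter)
  ultimately show ?thesis
  proof eventually_elim
   case (elim d)
   have "x0 + d *R rn i \<notin> pedge ps i"
   proof
    assume "x0 + d *R rn i \<in> pedge ps i"
    then obtain t where t: "x0 + d *R rn i = (1 - t) *R pv ps i + t *R pv ps (Suc i)" unfolding pedge_def closed_segment_def by blast
    define q where "q = pv ps (Suc i) - pv ps i"
    have "d *R rn i = (t - s) *R q" using t unfolding x0 q_def by (simp add: algebra_simps)
    hence "(d *R rn i) \<bullet> rn i = ((t - s) *R q) \<bullet> rn i" by simp
    hence "d * (q \<bullet> q) = 0" by (simp add: inner_2 q_def algebra_simps)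
    thus False using elim(2) ne by (simp add: q_def)
   qed
   thus ?case using elim(1) i unfolding polygon_image_def D_def by blast
  qed
 qed
 have Wlim: "((%d. Wd (x0 + d *R rn i)) \<longlongrightarrow> (l + (\<Sum>j\<in>{..<n} - {i}. fl (pv ps j) (pv ps (Suc j)) x0)) / (2 * pi)) (at 0 within A)"
  if l: "((%d. fl (pv ps i) (pv ps (Suc i)) (x0 + d *R rn i)) \<longlongrightarrow> l) (at (0::real) within A)" for l A
 proof -
  have "((%d. fl (pv ps j) (pv ps (Suc j)) (x0 + d *R rn i)) \<longlongrightarrow> fl (pv ps j) (pv ps (Suc j)) x0) (at 0 within A)" if j: "j \<in> {..<n} - {i}" for j
  proof -
   have x: "x0 \<in> - closed_segment (pv ps j) (pv ps (Suc j))" using oth j unfolding pedge_def by blast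
   have "open (- closed_segment (pv ps j) (pv ps (Suc j)))" by (simp add: open_Compl)
   hence "isCont (fl (pv ps j) (pv ps (Suc j))) x0" using fl_continuous continuous_on_eq_continuous_at x by blast
   thus ?thesis using isCont_tendsto_compose[OF _ cont] by blast
  qed
  hence "((%d. (fl (pv ps i) (pv ps (Suc i)) (x0 + d *R rn i) + (\<Sum>j\<in>{..<n} - {i}. fl (pv ps j) (pv ps (Suc j)) (x0 + d *R rn i))) / (2 * pi)) \<longlongrightarrow> (l + (\<Sum>j\<in>{..<n} - {i}. fl (pv ps j) (pv ps (Suc j)) x0)) / (2 * pi)) (at 0 within A)"
   by (intro tendsto_intros l tendsto_sum) auto
  moreover have "Wd y = (fl (pv ps i) (pv ps (Suc i)) y + (\<Sum>j\<in>{..<n} - {i}. fl (pv ps j) (pv ps (Suc j)) y)) / (2 * pi)" for y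
   unfolding Wd_def using sum.remove[of "{..<n}" i "%j. fl (pv ps j) (pv ps (Suc j)) y"] i by simp
  ultimately show ?thesis by simp
 qed
 have e: "(- pi + r) / (2 * pi) = r / (2 * pi) - 1/2" "(pi + r) / (2 * pi) = r / (2 * pi) + 1/2" for r
  by (simp_all add: field_simps)
 have jr: "((%d. Wd (x0 + d *R rn i)) \<longlongrightarrow> ?R - 1/2) (at_right 0)"
  using Wlim[OF fl_jump(1)[OF ne s, folded rn_def, folded x0]] unfolding e .
 have jl: "((%d. Wd (x0 + d *R rn i)) \<longlongrightarrow> ?R + 1/2) (at_left 0)"
  using Wlim[OF fl_jump(2)[OF ne s, folded rn_def, folded x0]] unfolding e .
 have dich: "y \<in> \<Omega> & Wd y = W0 | y \<notin> \<Omega> & Wd y = 0" if "y \<notin> \<Gamma>" for y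
  using that jordan(7,8) W(2) Wd_outside by blast
 have vr: "?R - 1/2 = 0 | ?R - 1/2 = W0"
  by (rule finite_values_limit[OF jr]) (use off[of "{0<..}"] dich in \<open>auto elim!: eventually_mono\<close>)
 have vl: "?R + 1/2 = 0 | ?R + 1/2 = W0"
  by (rule finite_values_limit[OF jl]) (use off[of "{..<0}"] dich in \<open>auto elim!: eventually_mono\<close>)
 have RW: "?R = W0 / 2" using vr vl W(1) by auto
 show "W0 * (\<Sum>j\<in>{..<n} - {i}. fl (pv ps j) (pv ps (Suc j)) x0) / (2 * pi) = 1 / 2"
 proof -
  have "W0 * ?R = 1 / 2" unfolding RW using W(1) by auto
  thus ?thesis by (simp only: times_divide_eq_right)
 qed
 have near: "eventually (%d. \<bar>Wd (x0 + d *R rn i) - (?R - 1/2)\<bar> < 1/2) (at_right 0)"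
  using jr[THEN tendstoD, of "1/2"] by (simp add: dist_real_def)
 have near': "eventually (%d. \<bar>Wd (x0 + d *R rn i) - (?R + 1/2)\<bar> < 1/2) (at_left 0)"
  using jl[THEN tendstoD, of "1/2"] by (simp add: dist_real_def)
 have nr: "eventually (%d. \<bar>Wd (x0 - d *R rn i) - (?R + 1/2)\<bar> < 1/2 & x0 - d *R rn i \<notin> \<Gamma>) (at_right 0)"
 proof -
  have "eventually (%d. \<bar>Wd (x0 + d *R rn i) - (?R + 1/2)\<bar> < 1/2 & x0 + d *R rn i \<notin> \<Gamma>) (at_left 0)"
   using near' off[of "{..<0}"] by (rule eventually_conj)
  thus ?thesis using eventually_at_left_to_right[of "%d. \<bar>Wd (x0 + d *R rn i) - (?R + 1/2)\<bar> < 1/2 & x0 + d *R rn i \<notin> \<Gamma>" 0] by simp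
 qed
 have nl: "eventually (%d. \<bar>Wd (x0 + d *R rn i) - (?R - 1/2)\<bar> < 1/2 & x0 + d *R rn i \<notin> \<Gamma>) (at_right 0)"
  using near off[of "{0<..}"] by (rule eventually_conj)
 show "eventually (%d. x0 + (d * W0) *R rn i \<notin> \<Omega>) (at_right 0)"
  using W(1)
 proof
  assume w: "W0 = 1"
  show ?thesis using nl unfolding RW
  proof eventually_elim
   case (elim d)
   thus ?case using dich[of "x0 + d *R rn i"] w by auto
  qed
 next
  assume w: "W0 = -1"
  show ?thesis using nr unfolding RW
  proof eventually_elim
   case (elim d)
   thus ?case using dich[of "x0 - d *R rn i"] w by auto
  qed
 qed
 show "eventually (%d. x0 - (d * W0) *R rn i \<in> \<Omega>) (at_right 0)"
  using W(1)
 proof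
  assume w: "W0 = 1"
  show ?thesis using nr unfolding RW
  proof eventually_elim
   case (elim d)
   thus ?case using dich[of "x0 - d *R rn i"] w by auto
  qed
 next
  assume w: "W0 = -1"
  show ?thesis using nl unfolding RW
  proof eventually_elim
   case (elim d)
   thus ?case using dich[of "x0 + d *R rn i"] w by auto
  qed
 qed
qed

end

text \<open>Opposite rays leave two half discs. Otherwise, in coordinates along the rays, one sector
  is an intersection of half discs, and the other is the union of two half discs with the common
  point z - e(u + u').\<close>

lemma sector_components:
 fixes u u' z :: point
 assumes "u ~= 0" "u' ~= 0" and np: "\<And>k. k > 0 ==> u' ~= k *R u" and "r > 0"
 shows "\<exists>P1 P2. connected P1 & connected P2 \<and>
  P1 \<union> P2 = ball z r - {y. (\<exists>\<alpha>\<ge>0. y = z + \<alpha> *R u) | (\<exists>\<alpha>\<ge>0. y = z + \<alpha> *R u')}"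
proof -
 define ro where "ro = (%v::point. vector [- v $ 2, v $ 1] :: point)"
 have ro: "det2 v (y - z) = ro v \<bullet> y - ro v \<bullet> z" for v y by (simp add: ro_def det2_def inner_2 algebra_simps)
 have cv1: "convex ({y. det2 v (y - z) > 0} \<inter> ball z r)" for v
  unfolding ro using convex_halfspace_gt[of "ro v \<bullet> z" "ro v"] by (intro convex_Int) (auto simp: algebra_simps)
 have cv2: "convex ({y. det2 v (y - z) < 0} \<inter> ball z r)" for v
  unfolding ro using convex_halfspace_lt[of "ro v" "ro v \<bullet> z"] by (intro convex_Int) (auto simp: algebra_simps)
 show ?thesis
 proof (cases "det2 u u' = 0")
  case True
  then obtain k where k: "u' = k *R u" using det2_zero_collinear assms(1) by blast
  have "\<not> k > 0" "k ~= 0" using np[of k] k assms(2) by auto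
  hence k0: "k < 0" by linarith
  have "({y. det2 u (y - z) > 0} \<inter> ball z r) \<union> ({y. det2 u (y - z) < 0} \<inter> ball z r) = ball z r - {y. (\<exists>\<alpha>\<ge>0. y = z + \<alpha> *R u) | (\<exists>\<alpha>\<ge>0. y = z + \<alpha> *R u')}"
  proof -
   have "det2 u (y - z) = 0 \<longleftrightarrow> (\<exists>\<alpha>\<ge>0. y = z + \<alpha> *R u) | (\<exists>\<alpha>\<ge>0. y = z + \<alpha> *R u')" for y
   proof
    assume "det2 u (y - z) = 0"
    then obtain c where c: "y - z = c *R u" using det2_zero_collinear assms(1) by blast
    hence y: "y = z + c *R u" by (simp add: algebra_simps)
    show "(\<exists>\<alpha>\<ge>0. y = z + \<alpha> *R u) | (\<exists>\<alpha>\<ge>0. y = z + \<alpha> *R u')"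
    proof (cases "c >= 0")
     case False
     hence "c / k >= 0" "y = z + (c / k) *R u'" using k k0 y by (auto simp: divide_nonpos_neg)
     thus ?thesis by blast
    qed (use y in blast)
   next
    assume "(\<exists>\<alpha>\<ge>0. y = z + \<alpha> *R u) | (\<exists>\<alpha>\<ge>0. y = z + \<alpha> *R u')"
    thus "det2 u (y - z) = 0" using k by (auto simp: det2_simps(6,9))
   qed
   hence "{y. (\<exists>\<alpha>\<ge>0. y = z + \<alpha> *R u) | (\<exists>\<alpha>\<ge>0. y = z + \<alpha> *R u')} = {y. det2 u (y - z) = 0}" by blast
   thus ?thesis by (simp only:) auto
  qed
  thus ?thesis using convex_connected[OF cv1[of u]] convex_connected[OF cv2[of u]] by blast
 next
  case False
  define D where "D = det2 u u'"
  define al where "al = (%y. - (det2 u' (y - z)) / D)"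
  define be where "be = (%y. det2 u (y - z) / D)"
  have D0: "D ~= 0" using False D_def by simp
  have rep: "y = z + al y *R u + be y *R u'" for y
  proof -
   have "D *R (y - z) = (- det2 u' (y - z)) *R u + det2 u (y - z) *R u'"
    unfolding D_def by (intro point_eqI) (simp_all add: det2_def algebra_simps)
   hence "(1 / D) *R (D *R (y - z)) = (1 / D) *R ((- det2 u' (y - z)) *R u + det2 u (y - z) *R u')" by simp
   hence "y - z = al y *R u + be y *R u'" unfolding al_def be_def using D0 by (simp add: scaleR_add_right scaleR_right_diff_distrib)
   thus ?thesis by (simp add: algebra_simps)
  qed
  have coord: "al (z + a *R u + b *R u') = a" "be (z + a *R u + b *R u') = b" for a b
  proof -
   have e: "z + a *R u + b *R u' - z = a *R u + b *R u'" by simp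
   have "det2 u' u = - D" unfolding D_def by (rule det2_swap)
   thus "al (z + a *R u + b *R u') = a" unfolding al_def e det2_simps(2,6,9) using D0 by simp
   show "be (z + a *R u + b *R u') = b" unfolding be_def e det2_simps(2,6,9) using D0 by (simp flip: D_def)
  qed
  have ray: "(\<exists>\<alpha>\<ge>0. y = z + \<alpha> *R u) \<longleftrightarrow> al y >= 0 & be y = 0" "(\<exists>\<alpha>\<ge>0. y = z + \<alpha> *R u') \<longleftrightarrow> al y = 0 & be y >= 0" for y
  proof -
   show "(\<exists>\<alpha>\<ge>0. y = z + \<alpha> *R u) \<longleftrightarrow> al y >= 0 & be y = 0" using rep[of y] coord[of _ 0] by (auto intro!: exI[of _ "al y"])
   show "(\<exists>\<alpha>\<ge>0. y = z + \<alpha> *R u') \<longleftrightarrow> al y = 0 & be y >= 0" using rep[of y] coord[of 0] by (auto intro!: exI[of _ "be y"])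
  qed
  have cxa: "convex ({y. s * al y > 0} \<inter> ball z r)" and cxb: "convex ({y. s * be y > 0} \<inter> ball z r)" for s
  proof -
   have "s * al y = det2 ((- s / D) *R u') (y - z)" "s * be y = det2 ((s / D) *R u) (y - z)" for y
    unfolding al_def be_def det2_simps(5) by auto
   thus "convex ({y. s * al y > 0} \<inter> ball z r)" "convex ({y. s * be y > 0} \<inter> ball z r)" using cv1 by simp_all
  qed
  define P1 where "P1 = ({y. al y > 0} \<inter> ball z r) \<inter> ({y. be y > 0} \<inter> ball z r)"
  define P2 where "P2 = ({y. al y < 0} \<inter> ball z r) \<union> ({y. be y < 0} \<inter> ball z r)"
  have "connected P1" unfolding P1_def using convex_connected[OF convex_Int[OF cxa[of 1] cxb[of 1]]] by simp
  moreover have "connected P2" unfolding P2_def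
  proof (rule connected_Un)
   show "connected ({y. al y < 0} \<inter> ball z r)" "connected ({y. be y < 0} \<inter> ball z r)" using cxa[of "-1"] cxb[of "-1"] by (auto intro: convex_connected)
   define e where "e = r / (2 * (norm (u + u') + 1))"
   have e0: "e > 0" unfolding e_def using assms(4) by (simp add: add_nonneg_pos)
   have "norm (e *R (u + u')) < r"
   proof -
    have "norm (e *R (u + u')) = e * norm (u + u')" using e0 by simp
    also have "... <= e * (norm (u + u') + 1)" using e0 by (intro mult_left_mono) auto
    also have "... = r / 2" unfolding e_def using norm_ge_zero[of "u + u'"] by (simp add: field_simps add_nonneg_eq_0_iff)
    finally show ?thesis using assms(4) by simp
   qed
   hence "z - e *R (u + u') \<in> ball z r" by (simp add: dist_norm)
   moreover have "z - e *R (u + u') = z + (- e) *R u + (- e) *R u'" by (simp add: algebra_simps)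
   ultimately have "z + (- e) *R u + (- e) *R u' \<in> ({y. al y < 0} \<inter> ball z r) \<inter> ({y. be y < 0} \<inter> ball z r)"
    using e0 coord[of "- e" "- e"] by simp
   thus "({y. al y < 0} \<inter> ball z r) \<inter> ({y. be y < 0} \<inter> ball z r) ~= {}" by blast
  qed
  moreover have "P1 \<union> P2 = ball z r - {y. (\<exists>\<alpha>\<ge>0. y = z + \<alpha> *R u) | (\<exists>\<alpha>\<ge>0. y = z + \<alpha> *R u')}"
   unfolding ray P1_def P2_def by auto
  ultimately show ?thesis by blast
 qed
qed

context polygon begin

lemma Gamma_closed: "closed \<Gamma>" unfolding polygon_image_def pedge_def by (intro closed_UN) auto

lemma pv_mod: "pv ps (i mod n) = pv ps i" by (simp add: pv_def)

lemma pedge_pv: "pv ps i \<in> pedge ps i" "pv ps (Suc i) \<in> pedge ps i" unfolding pedge_def by auto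

lemma edge_point_cases:
 assumes "z \<in> \<Gamma>"
 obtains (mid) i s where "i < n" "0 < s" "s < 1" "z = pv ps i + s *R (pv ps (Suc i) - pv ps i)" | (vertex) i where "i < n" "z = pv ps i"
proof -
 obtain i where i: "i < n" "z \<in> pedge ps i" using assms unfolding polygon_image_def by blast
 then obtain s where s: "0 <= s" "s <= 1" "z = (1 - s) *R pv ps i + s *R pv ps (Suc i)" unfolding pedge_def closed_segment_def by blast
 have z: "z = pv ps i + s *R (pv ps (Suc i) - pv ps i)" using s(3) by (simp add: algebra_simps)
 consider "s = 0" | "s = 1" | "0 < s" "s < 1" using s by linarith
 thus thesis
 proof cases
  case 1
  thus ?thesis using vertex[OF i(1)] z by simp
 next
  case 2
  hence "z = pv ps (Suc i mod n)" using z pv_mod by simp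
  thus ?thesis using vertex[of "Suc i mod n"] n0 by simp
 next
  case 3
  thus ?thesis using mid[OF i(1)] z by blast
 qed
qed

lemma avoid_edges:
 assumes "\<And>j. j \<in> A ==> z \<notin> pedge ps j" "finite A" shows "\<exists>r>0. \<forall>j\<in>A. ball z r \<inter> pedge ps j = {}"
proof -
 define D where "D = (\<Union>j\<in>A. pedge ps j)"
 have "closed D" unfolding D_def pedge_def using assms(2) by (intro closed_UN) auto
 hence "open (- D)" by blast
 moreover have "z \<in> - D" using assms(1) unfolding D_def by blast
 ultimately obtain r where "r > 0" "ball z r \<subseteq> - D" by (meson openE)
 thus ?thesis unfolding D_def by (intro exI[of _ r]) auto
qed

text \<open>Edges not containing z keep a positive distance. At an inner edge point two opposite
  rays remain; at a vertex there are the rays along its two edges, which have different directions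
  because these edges share only z.\<close>

lemma local_rays:
 assumes "z \<in> \<Gamma>"
 shows "\<exists>u u' r0. u ~= 0 & u' ~= 0 & (\<forall>k>0. u' ~= k *R u) & r0 > 0 \<and>
  (\<forall>y\<in>ball z r0. y \<in> \<Gamma> \<longleftrightarrow> (\<exists>\<alpha>\<ge>0. y = z + \<alpha> *R u) | (\<exists>\<alpha>\<ge>0. y = z + \<alpha> *R u'))"
 using assms
proof (cases rule: edge_point_cases)
 case (mid i s)
 define q where "q = pv ps (Suc i) - pv ps i"
 have q0: "q ~= 0" using pv_neq[OF mid(1)] unfolding q_def by simp
 have "\<And>j. j \<in> {..<n} - {i} ==> z \<notin> pedge ps j" using other_edges_open[OF mid(1-3)] mid(4) by blast
 then obtain r where r: "r > 0" "\<forall>j\<in>{..<n} - {i}. ball z r \<inter> pedge ps j = {}" using avoid_edges[of "{..<n} - {i}" z] by auto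
 define r0 where "r0 = min r (min s (1 - s) * norm q)"
 have r0: "r0 > 0" "r0 <= r" "r0 <= s * norm q" "r0 <= (1 - s) * norm q"
  unfolding r0_def using r mid q0 by (auto simp: min_def mult_right_mono intro: order_trans)
 have "y \<in> \<Gamma> \<longleftrightarrow> (\<exists>\<alpha>\<ge>0. y = z + \<alpha> *R q) | (\<exists>\<alpha>\<ge>0. y = z + \<alpha> *R (- q))" if y: "y \<in> ball z r0" for y
 proof
  assume "y \<in> \<Gamma>"
  then obtain j where j: "j < n" "y \<in> pedge ps j" unfolding polygon_image_def by blast
  have "j = i" using r(2) j y r0(2) subset_ball[OF r0(2), of z] by blast
  then obtain t where t: "y = (1 - t) *R pv ps i + t *R pv ps (Suc i)" using j unfolding pedge_def closed_segment_def by blast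
  have "y = z + (t - s) *R q" unfolding t mid(4) q_def by (simp add: algebra_simps)
  moreover have "y = z + (s - t) *R (- q)" unfolding t mid(4) q_def by (simp add: algebra_simps)
  ultimately show "(\<exists>\<alpha>\<ge>0. y = z + \<alpha> *R q) | (\<exists>\<alpha>\<ge>0. y = z + \<alpha> *R (- q))" by (metis diff_ge_0_iff_ge linear)
 next
  assume "(\<exists>\<alpha>\<ge>0. y = z + \<alpha> *R q) | (\<exists>\<alpha>\<ge>0. y = z + \<alpha> *R (- q))"
  then obtain c where c: "y = z + c *R q" by (metis scaleR_minus_left scaleR_minus_right)
  have "\<bar>c\<bar> * norm q < r0" using y c by (simp add: dist_norm)
  hence "\<bar>c\<bar> * norm q < s * norm q" "\<bar>c\<bar> * norm q < (1 - s) * norm q" using r0 by linarith+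
  hence "\<bar>c\<bar> < s" "\<bar>c\<bar> < 1 - s" using q0 by auto
  hence "0 <= s + c" "s + c <= 1" by linarith+
  moreover have "y = (1 - (s + c)) *R pv ps i + (s + c) *R pv ps (Suc i)" unfolding c mid(4) q_def by (simp add: algebra_simps)
  ultimately have "y \<in> pedge ps i" unfolding pedge_def closed_segment_def by blast
  thus "y \<in> \<Gamma>" using mid(1) unfolding polygon_image_def by blast
 qed
 moreover have "- q ~= k *R q" if "k > 0" for k
 proof
  assume "- q = k *R q"
  hence "(k + 1) *R q = 0" by (simp add: algebra_simps flip: \<open>- q = k *R q\<close>)
  thus False using q0 that by simp
 qed
 ultimately show ?thesis using q0 r0(1) by (intro exI[of _ q] exI[of _ "- q"] exI[of _ r0]) auto
next
 case (vertex i)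
 \<comment> \<open>The cyclic predecessor of i; adding n first avoids truncated subtraction at i =
   0.\<close>
 define i' where "i' = (i + n - 1) mod n"
 have i': "i' < n" "Suc i' mod n = i" "i' ~= i"
 proof -
  show "i' < n" unfolding i'_def using n0 by simp
  have "Suc (i + n - 1) = i + n" using n3 by simp
  thus s: "Suc i' mod n = i" unfolding i'_def mod_Suc_eq using vertex(1) by simp
  show "i' ~= i" using s n3 vertex(1) by (metis Suc_n_not_n mod_less mod_self not_less_eq_eq numeral_3_eq_3 Suc_lessI Suc_le_eq less_numeral_extra(3) zero_less_Suc lessI)
 qed
 have pvi': "pv ps (Suc i') = z" using vertex(2) i'(2) pv_mod[of "Suc i'"] by simp
 define u u' where "u = pv ps (Suc i) - z" and "u' = pv ps i' - z"
 have u0: "u ~= 0" "u' ~= 0" using pv_neq[OF vertex(1)] pv_neq[OF i'(1)] vertex(2) pvi' unfolding u_def u'_def by auto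
 have ei: "pedge ps i = {z + t *R u |t. 0 <= t & t <= 1}"
  unfolding pedge_def closed_segment_def vertex(2)[symmetric] u_def by (auto simp: algebra_simps)
 have ei': "pedge ps i' = {z + t *R u' |t. 0 <= t & t <= 1}"
 proof -
  have "pedge ps i' = closed_segment z (pv ps i')" unfolding pedge_def pvi' by (rule closed_segment_commute)
  thus ?thesis unfolding closed_segment_def u'_def by (auto simp: algebra_simps)
 qed
 have int: "pedge ps i' \<inter> pedge ps i = {z}" using pedge_inter[OF i'(1) vertex(1) i'(3)] i'(2) vertex(2) by simp
 have np: "u' ~= k *R u" if k: "k > 0" for k
 proof
  assume e: "u' = k *R u"
  define t where "t = min 1 (1 / k)"
  have t: "0 < t" "t <= 1" "t * k <= 1" unfolding t_def using k by (auto simp: min_def field_simps)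
  have "z + t *R u' \<in> pedge ps i'" unfolding ei' using t by (auto intro: less_imp_le)
  moreover have "z + t *R u' \<in> pedge ps i" unfolding ei e using t k by (auto intro!: exI[of _ "t * k"])
  ultimately have "z + t *R u' = z" using int by blast
  thus False using t u0 by simp
 qed
 have "z \<notin> pedge ps j" if j: "j \<in> {..<n} - {i, i'}" for j
 proof
  assume "z \<in> pedge ps j"
  hence zj: "z \<in> pedge ps i \<inter> pedge ps j" using pedge_pv(1)[of i] vertex(2) by auto
  have jn: "j < n" "i ~= j" using j by auto
  from zj have "Suc i mod n = j & z = pv ps j | Suc j mod n = i" unfolding pedge_inter[OF vertex(1) jn] by (auto split: if_splits)
  thus False
  proof
   assume "Suc i mod n = j & z = pv ps j"
   hence "pv ps i = pv ps (Suc i)" using vertex(2) pv_mod by metis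
   thus False using pv_neq[OF vertex(1)] by simp
  next
   assume "Suc j mod n = i"
   hence "Suc j mod n = Suc i' mod n" using i' by simp
   hence "j = i'" using jn(1) i'(1) by (simp add: mod_Suc split: if_splits)
   thus False using j by blast
  qed
 qed
 then obtain r where r: "r > 0" "\<forall>j\<in>{..<n} - {i, i'}. ball z r \<inter> pedge ps j = {}" using avoid_edges[of "{..<n} - {i, i'}" z] by auto
 define r0 where "r0 = min r (min (norm u) (norm u'))"
 have r0: "r0 > 0" "r0 <= r" "r0 <= norm u" "r0 <= norm u'" unfolding r0_def using r u0 by auto
 have "y \<in> \<Gamma> \<longleftrightarrow> (\<exists>\<alpha>\<ge>0. y = z + \<alpha> *R u) | (\<exists>\<alpha>\<ge>0. y = z + \<alpha> *R u')" if y: "y \<in> ball z r0" for y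
 proof
  assume "y \<in> \<Gamma>"
  then obtain j where j: "j < n" "y \<in> pedge ps j" unfolding polygon_image_def by blast
  hence "j = i | j = i'" using r(2) y subset_ball[OF r0(2), of z] by blast
  hence "y \<in> pedge ps i | y \<in> pedge ps i'" using j(2) by auto
  thus "(\<exists>\<alpha>\<ge>0. y = z + \<alpha> *R u) | (\<exists>\<alpha>\<ge>0. y = z + \<alpha> *R u')" unfolding ei ei' by blast
 next
  assume "(\<exists>\<alpha>\<ge>0. y = z + \<alpha> *R u) | (\<exists>\<alpha>\<ge>0. y = z + \<alpha> *R u')"
  thus "y \<in> \<Gamma>"
  proof
   assume "\<exists>\<alpha>\<ge>0. y = z + \<alpha> *R u"
   then obtain c where c: "c >= 0" "y = z + c *R u" by blast
   have "c * norm u < r0" using y c by (simp add: dist_norm)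
   hence "c * norm u < 1 * norm u" using r0 by linarith
   hence "c < 1" using u0 by auto
   hence "y \<in> pedge ps i" unfolding ei using c by auto
   thus ?thesis using vertex(1) unfolding polygon_image_def by blast
  next
   assume "\<exists>\<alpha>\<ge>0. y = z + \<alpha> *R u'"
   then obtain c where c: "c >= 0" "y = z + c *R u'" by blast
   have "c * norm u' < r0" using y c by (simp add: dist_norm)
   hence "c * norm u' < 1 * norm u'" using r0 by linarith
   hence "c < 1" using u0 by auto
   hence "y \<in> pedge ps i'" unfolding ei' using c by auto
   thus ?thesis using i'(1) unfolding polygon_image_def by blast
  qed
 qed
 thus ?thesis using u0 np r0(1) by blast
qed

text \<open>Each of the two sectors avoids \<Gamma>, so it lies in the interior or misses it. A
  boundary point is also a limit of exterior points, so at most one sector is inside, and a single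
  sector is connected.\<close>

theorem locally_connected_inside:
 assumes "z \<in> closure \<Omega>" shows "\<exists>r0>0. \<forall>r. 0 < r & r < r0 --> connected (\<Omega> \<inter> ball z r)"
proof (cases "z \<in> \<Omega>")
 case True
 then obtain r0 where r0: "r0 > 0" "ball z r0 \<subseteq> \<Omega>" using jordan(1) by (meson openE)
 have "connected (\<Omega> \<inter> ball z r)" if "0 < r" "r < r0" for r
 proof -
  have "\<Omega> \<inter> ball z r = ball z r" using r0 that subset_ball[of r r0 z] by auto
  thus ?thesis by simp
 qed
 thus ?thesis using r0 by blast
next
 case False
 hence zG: "z \<in> \<Gamma>" using assms jordan(5) jordan(1) by (metis DiffI frontier_def interior_open)
 obtain u u' r0 where u: "u ~= 0" "u' ~= 0" "\<forall>k>0. u' ~= k *R u" "r0 > 0"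
  "\<forall>y\<in>ball z r0. y \<in> \<Gamma> \<longleftrightarrow> (\<exists>\<alpha>\<ge>0. y = z + \<alpha> *R u) | (\<exists>\<alpha>\<ge>0. y = z + \<alpha> *R u')" using local_rays[OF zG] by blast
 have "connected (\<Omega> \<inter> ball z r)" if r: "0 < r" "r < r0" for r
 proof -
  obtain P1 P2 where P: "connected P1" "connected P2"
   "P1 \<union> P2 = ball z r - {y. (\<exists>\<alpha>\<ge>0. y = z + \<alpha> *R u) | (\<exists>\<alpha>\<ge>0. y = z + \<alpha> *R u')}"
   using sector_components[OF u(1,2) _ r(1), of z] u(3) by blast
  have sub: "ball z r \<subseteq> ball z r0" using r by (intro subset_ball) simp
  have un: "P1 \<union> P2 = ball z r - \<Gamma>" unfolding P(3) using u(5) sub by blast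
  have oo: "open (outside \<Gamma>)" using open_outside[OF Gamma_closed] .
  have dich: "P \<subseteq> \<Omega> | P \<inter> \<Omega> = {}" if "connected P" "P \<subseteq> - \<Gamma>" for P
   using connectedD[OF that(1) jordan(1) oo] that(2) jordan(7,8) by blast
  have d1: "P1 \<subseteq> \<Omega> | P1 \<inter> \<Omega> = {}" and d2: "P2 \<subseteq> \<Omega> | P2 \<inter> \<Omega> = {}" using dich P un by blast+
  have "z \<in> closure (outside \<Gamma>)" using zG jordan(6) unfolding frontier_def by blast
  then obtain y where y: "y \<in> outside \<Gamma>" "dist y z < r" using r(1) unfolding closure_approachable by blast
  have "y \<notin> \<Gamma>" "y \<notin> \<Omega>" using y(1) jordan(7,8) by blast+
  hence "y \<in> P1 \<union> P2" "y \<notin> \<Omega>" unfolding un using y(2) by (simp_all add: dist_commute)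
  hence "\<not> P1 \<subseteq> \<Omega> | \<not> P2 \<subseteq> \<Omega>" by blast
  moreover have "\<Omega> \<inter> ball z r = \<Omega> \<inter> (P1 \<union> P2)" unfolding un using jordan(8) by blast
  ultimately have "\<Omega> \<inter> ball z r = P1 | \<Omega> \<inter> ball z r = P2 | \<Omega> \<inter> ball z r = {}" using d1 d2 by blast
  thus ?thesis using P by auto
 qed
 thus ?thesis using u(4) by blast
qed

end

section \<open>The double-layer operator in edge parameters\<close>

context polygon begin

text \<open>The orientation of the vertex list: 1 if counterclockwise, -1 if clockwise.\<close>

definition W0 :: real where "W0 = (SOME w. (w = 1 | w = -1) & (\<forall>x\<in>\<Omega>. Wd x = w))"

lemma W0: "W0 = 1 | W0 = -1" "\<And>x. x \<in> \<Omega> ==> Wd x = W0"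
proof -
 have "\<exists>w::real. (w = 1 | w = -1) & (\<forall>x\<in>\<Omega>. Wd x = w)"
 proof (rule Wd_inside)
  fix w :: real assume "w = 1 | w = -1" "\<And>x. x \<in> \<Omega> ==> Wd x = w"
  thus ?thesis by (intro exI[of _ w] conjI ballI)
 qed
 from someI_ex[OF this] show "W0 = 1 | W0 = -1" "\<And>x. x \<in> \<Omega> ==> Wd x = W0" unfolding W0_def by blast+
qed

abbreviation "qe i \<equiv> pv ps (Suc i) - pv ps i"

definition xe :: "nat => real => point" where "xe i t = pv ps i + t *R qe i"

lemma qe_neq: "i < n ==> qe i ~= 0" using pv_neq by force

lemma rn_inner: "x \<bullet> rn i = det2 x (qe i)" by (simp add: inner_2 det2_def right_diff_distrib)

lemma rn_sq: "rn i \<bullet> rn i = (norm (qe i))^2"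
 by (simp add: inner_2 power2_norm_eq_inner algebra_simps)

text \<open>The choice in \<open>outward_normal\<close> is forced: there are only two unit normals,
  and by \<open>edge_sides\<close> the other one leads from the midpoint straight into
  \<Omega>.\<close>

lemma outward_normal_eq:
 assumes i: "i < n" shows "outward_normal \<Omega> (pv ps i) (pv ps (Suc i)) = (W0 / norm (qe i)) *R rn i"
proof -
 let ?n0 = "(W0 / norm (qe i)) *R rn i"
 have q0: "norm (qe i) > 0" using qe_neq[OF i] by simp
 have W2: "W0 * W0 = 1" using W0(1) by auto
 have mid: "midpoint (pv ps i) (pv ps (Suc i)) = pv ps i + (1/2) *R qe i"
  by (intro point_eqI) (simp_all add: midpoint_def field_simps)
 note E = edge_sides[OF W0 i, of "1/2", simplified, OF mid]
 obtain b where b: "b > 0" "\<forall>d>0. d < b --> midpoint (pv ps i) (pv ps (Suc i)) + (d * W0) *R rn i \<notin> \<Omega>"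
  using E(2) unfolding eventually_at_right_field by blast
 obtain b' where b': "b' > 0" "\<forall>d>0. d < b' --> midpoint (pv ps i) (pv ps (Suc i)) - (d * W0) *R rn i \<in> \<Omega>"
  using E(3) unfolding eventually_at_right_field by blast
 have nr: "norm (rn i) = norm (qe i)" using rn_sq[of i] by (simp add: norm_eq_sqrt_inner)
 show ?thesis unfolding outward_normal_def
 proof (rule some_equality, intro conjI)
  show "norm ?n0 = 1" using W0(1) q0 nr by auto
  have "qe i \<bullet> rn i = 0" unfolding rn_inner by (simp add: det2_simps(9))
  thus "?n0 \<bullet> qe i = 0" by (simp add: inner_commute)
  have "midpoint (pv ps i) (pv ps (Suc i)) + \<delta> *R ?n0 \<notin> \<Omega>" if "0 < \<delta>" "\<delta> < b * norm (qe i)" for \<delta>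
  proof -
   have "0 < \<delta> / norm (qe i)" "\<delta> / norm (qe i) < b" using that q0 by (simp_all add: field_simps)
   thus ?thesis using b(2)[rule_format, of "\<delta> / norm (qe i)"] by simp
  qed
  thus "\<exists>\<epsilon>>0. \<forall>\<delta>. 0 < \<delta> & \<delta> < \<epsilon> --> midpoint (pv ps i) (pv ps (Suc i)) + \<delta> *R ?n0 \<notin> \<Omega>"
   using b(1) q0 by (intro exI[of _ "b * norm (qe i)"]) simp
 next
  fix \<nu> assume a: "norm \<nu> = 1 & \<nu> \<bullet> qe i = 0 & (\<exists>\<epsilon>>0. \<forall>\<delta>. 0 < \<delta> & \<delta> < \<epsilon> --> midpoint (pv ps i) (pv ps (Suc i)) + \<delta> *R \<nu> \<notin> \<Omega>)"
  then obtain e where e: "e > 0" "\<forall>\<delta>. 0 < \<delta> & \<delta> < e --> midpoint (pv ps i) (pv ps (Suc i)) + \<delta> *R \<nu> \<notin> \<Omega>" by blast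
  define k where "k = (\<nu> \<bullet> rn i) / (norm (qe i))^2"
  have sq: "(norm (qe i))^2 = (qe i) $ 1 * (qe i) $ 1 + (qe i) $ 2 * (qe i) $ 2" by (simp add: power2_norm_eq_inner inner_2)
  have nu: "\<nu> = k *R rn i"
  proof -
   have "(norm (qe i))^2 *R \<nu> = (\<nu> \<bullet> rn i) *R rn i"
   proof -
    have o: "\<nu> $ 1 * qe i $ 1 = - (\<nu> $ 2 * qe i $ 2)" using a by (simp add: inner_2 algebra_simps)
    define x y where "x = qe i $ 1" and "y = qe i $ 2"
    have o: "\<nu> $ 1 * x = - (\<nu> $ 2 * y)" using o unfolding x_def y_def .
    have c: "rn i $ 1 = y" "rn i $ 2 = - x" unfolding x_def y_def by simp_all
    have "(x * x + y * y) * \<nu> $ 1 = (\<nu> $ 1 * y - \<nu> $ 2 * x) * y" "(x * x + y * y) * \<nu> $ 2 = (\<nu> $ 1 * y - \<nu> $ 2 * x) * - x"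
     using o by algebra+
    thus ?thesis unfolding sq x_def[symmetric] y_def[symmetric] inner_2 c
     by (intro point_eqI) (simp_all add: c del: rn_nth)
   qed
   hence "(1 / (norm (qe i))^2) *R ((norm (qe i))^2 *R \<nu>) = (1 / (norm (qe i))^2) *R ((\<nu> \<bullet> rn i) *R rn i)" by simp
   thus ?thesis unfolding k_def using q0 by simp
  qed
  have "\<bar>k\<bar> * norm (qe i) = 1" using a nu nr by simp
  hence "\<bar>k\<bar> = 1 / norm (qe i)" using q0 by (simp add: field_simps)
  hence "k = W0 / norm (qe i) | k = - W0 / norm (qe i)" using W0(1) by (auto simp: abs_if split: if_splits)
  moreover have "k ~= - W0 / norm (qe i)"
  proof
   assume k: "k = - W0 / norm (qe i)"
   define d where "d = min (b' / 2) (e / (2 * norm (qe i)))"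
   have d: "d > 0" "d < b'" unfolding d_def using b' e q0 by auto
   have "d * norm (qe i) <= e / (2 * norm (qe i)) * norm (qe i)" unfolding d_def using q0 by (intro mult_right_mono) auto
   hence d3: "d * norm (qe i) < e" using q0 e by (simp add: field_simps)
   have "midpoint (pv ps i) (pv ps (Suc i)) + (d * norm (qe i)) *R \<nu> = midpoint (pv ps i) (pv ps (Suc i)) - (d * W0) *R rn i"
    unfolding nu k using q0 by simp
   thus False using b'(2) e(2) d d3 q0 by (metis mult_pos_pos)
  qed
  ultimately show "\<nu> = ?n0" using nu by blast
 qed
qed

text \<open>The kernel of K along edge j, arc length factor included; the edge length has cancelled
  against the normalisation of the normal.\<close>

definition dker :: "nat => point => real => real" where
 "dker j x t = - W0 * det2 (xe j t - x) (qe j) / (2 * pi * (norm (xe j t - x))^2)"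

lemma double_layer_eq: "double_layer \<Omega> ps v x = (\<Sum>j<n. integral {0..1} (%t. dker j x t * v (xe j t)))"
 unfolding double_layer_def
proof (rule sum.cong)
 fix j assume "j \<in> {..<n}" hence j: "j < n" by simp
 have q0: "norm (qe j) > 0" using qe_neq[OF j] by simp
 have "norm (qe j) * (((x - xe j t) \<bullet> outward_normal \<Omega> (pv ps j) (pv ps (Suc j))) / (2 * pi * (norm (x - xe j t))^2) * v (xe j t)) = dker j x t * v (xe j t)" for t
 proof -
  have "(x - xe j t) \<bullet> outward_normal \<Omega> (pv ps j) (pv ps (Suc j)) = - W0 / norm (qe j) * det2 (xe j t - x) (qe j)"
   unfolding outward_normal_eq[OF j] inner_scaleR_right rn_inner det2_simps(3) by (simp add: algebra_simps)
  thus ?thesis unfolding dker_def norm_minus_commute[of x] using q0 by (simp add: field_simps)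
 qed
 thus "norm (qe j) * integral {0..1} (%t. let y = pv ps j + t *R qe j in ((x - y) \<bullet> outward_normal \<Omega> (pv ps j) (pv ps (Suc j))) / (2 * pi * (norm (x - y))^2) * v y)
  = integral {0..1} (%t. dker j x t * v (xe j t))"
  unfolding Let_def xe_def[symmetric] integral_mult_right[symmetric] by simp
qed simp

text \<open>On its own line an edge sees only directions orthogonal to the normal. At s = t the
  denominator vanishes too, and the quotient is 0 by convention.\<close>

lemma dker_own: "dker i (xe i s) t = 0"
 unfolding dker_def xe_def by (simp add: det2_def algebra_simps)

definition blay :: "nat => nat => (point => real) => real => real" where
 "blay i j u s = integral {0..1} (%t. dker j (xe i s) t * u (xe j t))"

text \<open>Open parameter intervals remove the corners, where the kernels of adjacent edges are
  singular.\<close>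

lemma bterm_eq: "bterm \<Omega> ps u = (\<Sum>i<n. norm (qe i) * integral {0<..<1} (%s. u (xe i s) / 2 - (\<Sum>j\<in>{..<n} - {i}. blay i j u s)))"
 unfolding bterm_def bdry_int_def
proof (rule sum.cong)
 fix i assume i: "i \<in> {..<n}"
 have "double_layer \<Omega> ps u (xe i s) = (\<Sum>j\<in>{..<n} - {i}. blay i j u s)" for s
  unfolding double_layer_eq blay_def using i by (subst sum.remove[of _ i]) (simp_all add: dker_own)
 thus "norm (qe i) * integral {0..1} (%t. u (pv ps i + t *R qe i) / 2 - double_layer \<Omega> ps u (pv ps i + t *R qe i)) =
  norm (qe i) * integral {0<..<1} (%s. u (xe i s) / 2 - (\<Sum>j\<in>{..<n} - {i}. blay i j u s))"
  unfolding xe_def[symmetric] integral_open_interval_real by simp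
qed simp

lemma xe_mem: "0 <= t ==> t <= 1 ==> xe j t \<in> pedge ps j"
 unfolding pedge_def xe_def closed_segment_def by (auto intro!: exI[of _ t] simp: algebra_simps)

lemma xe_Gamma: "j < n ==> 0 <= t ==> t <= 1 ==> xe j t \<in> \<Gamma>"
 using xe_mem unfolding polygon_image_def by blast

text \<open>Since K 1 = -1/2 at inner edge points, the integrand is 1 and the value is the
  perimeter.\<close>

lemma bterm_one:
 assumes "\<And>x. x \<in> \<Gamma> ==> u x = 1" shows "bterm \<Omega> ps u > 0"
proof -
 have "integral {0<..<1} (%s. u (xe i s) / 2 - (\<Sum>j\<in>{..<n} - {i}. blay i j u s)) = 1" if i: "i < n" for i
 proof -
  have "u (xe i s) / 2 - (\<Sum>j\<in>{..<n} - {i}. blay i j u s) = 1" if s: "s \<in> {0<..<1}" for s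
  proof -
   have "blay i j u s = - W0 * fl (pv ps j) (pv ps (Suc j)) (xe i s) / (2 * pi)" if j: "j \<in> {..<n} - {i}" for j
   proof -
    have "blay i j u s = integral {0..1} (%t. (- W0 / (2 * pi)) * (det2 (xe j t - xe i s) (qe j) / (norm (xe j t - xe i s))^2))"
     unfolding blay_def by (rule Henstock_Kurzweil_Integration.integral_cong) (use j assms xe_Gamma in \<open>simp add: dker_def\<close>)
    thus ?thesis unfolding integral_mult_right fl_def xe_def[of j] by simp
   qed
   hence "(\<Sum>j\<in>{..<n} - {i}. blay i j u s) = - (W0 * (\<Sum>j\<in>{..<n} - {i}. fl (pv ps j) (pv ps (Suc j)) (xe i s)) / (2 * pi))"
    by (simp add: sum_negf sum_distrib_left sum_divide_distrib)
   also have "... = - 1 / 2" using edge_sides(1)[OF W0 i _ _ xe_def[of i s]] s by simp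
   finally show ?thesis using assms xe_Gamma[OF i, of s] s by simp
  qed
  hence "integral {0<..<1} (%s. u (xe i s) / 2 - (\<Sum>j\<in>{..<n} - {i}. blay i j u s)) = integral {0<..<1::real} (%s. 1::real)"
   by (intro Henstock_Kurzweil_Integration.integral_cong)
  also have "... = 1" unfolding integral_open_interval_real[symmetric] by simp
  finally show ?thesis .
 qed
 hence "bterm \<Omega> ps u = (\<Sum>i<n. norm (qe i))" unfolding bterm_eq by simp
 moreover have "0 < (\<Sum>i<n. norm (qe i))" by (rule sum_pos) (use n0 qe_neq in auto)
 ultimately show ?thesis by simp
qed

end

section \<open>Corner singularities of the kernel and locality of the boundary functional\<close>

lemma homogeneous_gap:
 fixes u w :: point
 assumes ne: "\<And>l. 0 <= l ==> l <= 1 ==> l *R u ~= (1 - l) *R w"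
 shows "\<exists>c>0. \<forall>sg\<ge>0. \<forall>\<tau>\<ge>0. c * (sg + \<tau>) <= norm (sg *R u - \<tau> *R w)"
proof -
 let ?f = "%l::real. norm (l *R u - (1 - l) *R w)"
 \<comment> \<open>By homogeneity it is enough to minimise over the compact set where the two
   parameters add up to 1.\<close>
 have "\<exists>l\<in>{0..1}. \<forall>m\<in>{0..1}. ?f l <= ?f m"
  by (intro continuous_attains_inf continuous_intros) auto
 then obtain l where l: "l \<in> {0..1}" "\<And>m. m \<in> {0..1} ==> ?f l <= ?f m" by blast
 have "?f l > 0" using ne[of l] l(1) by simp
 moreover have "?f l * (sg + \<tau>) <= norm (sg *R u - \<tau> *R w)" if st: "sg >= 0" "\<tau> >= 0" for sg \<tau>
 proof (cases "sg + \<tau> = 0")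
  case False
  hence p: "sg + \<tau> > 0" using st by simp
  define m where "m = sg / (sg + \<tau>)"
  have m: "m \<in> {0..1}" "1 - m = \<tau> / (sg + \<tau>)" unfolding m_def using st p by (auto simp: field_simps)
  have "m *R u - (1 - m) *R w = (1 / (sg + \<tau>)) *R (sg *R u - \<tau> *R w)"
   unfolding m(2) unfolding m_def by (simp add: scaleR_diff_right)
  hence "?f m = norm (sg *R u - \<tau> *R w) / (sg + \<tau>)" using p by simp
  thus ?thesis using l(2)[OF m(1)] p by (simp add: pos_le_divide_eq)
 qed simp
 ultimately show ?thesis by blast
qed

lemma uniform_pos_constant:
 fixes f g :: "'a => 'b => real"
 assumes "finite A" "\<And>a. a \<in> A ==> \<exists>c>0. \<forall>x. P x --> c * f a x <= g a x" "\<And>a x. P x ==> 0 <= f a x"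
 shows "\<exists>c>0. \<forall>a\<in>A. \<forall>x. P x --> c * f a x <= g a x"
 using assms(1,2)
proof (induction A rule: finite_induct)
 case empty
 show ?case by (intro exI[of _ 1]) simp
next
 case (insert a A)
 obtain c1 where c1: "c1 > 0" "\<forall>x. P x --> c1 * f a x <= g a x" using insert.prems by blast
 obtain c2 where c2: "c2 > 0" "\<forall>a\<in>A. \<forall>x. P x --> c2 * f a x <= g a x" using insert.IH insert.prems by blast
 have "min c1 c2 * f b x <= g b x" if "b \<in> insert a A" "P x" for b x
 proof -
  have "min c1 c2 * f b x <= c1 * f b x" "min c1 c2 * f b x <= c2 * f b x" using assms(3)[OF that(2)] by (auto intro: mult_right_mono)
  thus ?thesis using that c1(2) c2(2) by (metis insert_iff order_trans)
 qed
 thus ?case using c1(1) c2(1) by (intro exI[of _ "min c1 c2"]) auto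
qed

text \<open>Comparable to the distance from t to the nearer end of the unit interval, so one weight
  serves both corners of an edge.\<close>

abbreviation ww :: "real => real" where "ww t \<equiv> t * (1 - t)"

lemma ww_pos: "0 < t ==> t < 1 ==> 0 < ww t & ww t <= 1"
 by (simp add: mult_le_one)

lemma ww_integrable:
 assumes "p > -1" shows "(%t. ww t powr p) integrable_on {0<..<1::real}"
proof -
 have "(%t::real. t powr (p + 1 - 1) * (1 - t) powr (p + 1 - 1)) integrable_on {0..1}"
  using has_integral_Beta_real[of "p + 1" "p + 1"] assms unfolding integrable_on_def by auto
 hence "(%t::real. t powr p * (1 - t) powr p) integrable_on {0<..<1}" unfolding integrable_on_Icc_iff_Ioo by simp
 thus ?thesis by (rule integrable_eq) (simp add: powr_mult)
qed

lemma continuous_dominated_integrable: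
 fixes f g :: "real => real"
 assumes "continuous_on {a<..<b} f" "g integrable_on {a<..<b}" "\<And>x. x \<in> {a<..<b} ==> \<bar>f x\<bar> <= g x"
 shows "f integrable_on {a<..<b}"
 by (rule measurable_bounded_by_integrable_imp_integrable[OF _ assms(2)])
  (use assms in \<open>auto intro: continuous_imp_measurable_on_sets_lebesgue\<close>)

context polygon begin

text \<open>The two edges leave their common corner in different directions, so the distance of two
  points is at least a multiple of the sum of their distances to the corner.\<close>

lemma edge_gap_adj:
 assumes i: "i < n" and j: "j < n" and a: "Suc i mod n = j"
 shows "\<exists>c>0. \<forall>s\<in>{0..1}. \<forall>t\<in>{0..1}. c * max (ww s) (ww t) <= dist (xe i s) (xe j t)"
proof -
 define z where "z = pv ps (Suc i)"
 have zj: "pv ps j = z" unfolding z_def using a by (auto simp: pv_def)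
 have ij: "i ~= j" using a i n3 by (cases "Suc i = n") auto
 define u w where "u = pv ps i - z" and "w = pv ps (Suc j) - z"
 have u0: "u ~= 0" "w ~= 0" using pv_neq[OF i] pv_neq[OF j] unfolding u_def w_def z_def[symmetric] zj by (auto simp: z_def)
 have xi: "xe i s = z + (1 - s) *R u" for s unfolding xe_def u_def z_def by (simp add: algebra_simps)
 have xj: "xe j t = z + t *R w" for t unfolding xe_def w_def zj by simp
 have "\<exists>c>0. \<forall>sg\<ge>0. \<forall>\<tau>\<ge>0. c * (sg + \<tau>) <= norm (sg *R u - \<tau> *R w)"
 proof (rule homogeneous_gap)
  fix l :: real assume l: "0 <= l" "l <= 1"
  show "l *R u ~= (1 - l) *R w"
  proof
   assume e: "l *R u = (1 - l) *R w"
   have "l ~= 0" "l ~= 1" using e u0 by auto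
   hence l': "0 < 1 - l" "1 - l < 1" using l by auto
   have "xe i (1 - l) = xe j (1 - l)" unfolding xi xj using e by simp
   moreover have "xe j (1 - l) \<in> pedge ps j" by (rule xe_mem) (use l in auto)
   ultimately show False using other_edges_open[OF i l'] j ij unfolding xe_def[symmetric] by auto
  qed
 qed
 then obtain c where c: "c > 0" "\<forall>sg\<ge>0. \<forall>\<tau>\<ge>0. c * (sg + \<tau>) <= norm (sg *R u - \<tau> *R w)" by blast
 have "c * max (ww s) (ww t) <= dist (xe i s) (xe j t)" if st: "s \<in> {0..1}" "t \<in> {0..1}" for s t
 proof -
  have "ww s <= 1 - s" "ww t <= t" using st by (auto intro: mult_left_le mult_left_le_one_le)
  hence "max (ww s) (ww t) <= (1 - s) + t" using st by auto
  hence "c * max (ww s) (ww t) <= c * ((1 - s) + t)" using c(1) by simp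
  also have "... <= norm ((1 - s) *R u - t *R w)" using c(2) st by simp
  finally show ?thesis unfolding xi xj dist_norm by simp
 qed
 thus ?thesis using c(1) by blast
qed

lemma edge_gap_pair:
 assumes i: "i < n" and j: "j < n" and ij: "i ~= j"
 shows "\<exists>c>0. \<forall>s\<in>{0..1}. \<forall>t\<in>{0..1}. c * max (ww s) (ww t) <= dist (xe i s) (xe j t)"
proof -
 consider "Suc i mod n = j" | "Suc j mod n = i" | "pedge ps i \<inter> pedge ps j = {}" using pedge_inter[OF i j ij] by presburger
 thus ?thesis
 proof cases
  case 1
  thus ?thesis using edge_gap_adj[OF i j] by blast
 next
  case 2
  then obtain c where "c > 0" "\<forall>s\<in>{0..1}. \<forall>t\<in>{0..1}. c * max (ww s) (ww t) <= dist (xe j s) (xe i t)" using edge_gap_adj[OF j i] by blast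
  moreover have "max (ww s) (ww t) = max (ww t) (ww s)" for s t by (rule max.commute)
  ultimately show ?thesis by (intro exI[of _ c]) (metis dist_commute)
 next
  case 3
  have "\<exists>d>0. \<forall>x\<in>pedge ps i. \<forall>y\<in>pedge ps j. d <= dist x y"
   by (rule separate_compact_closed) (use 3 in \<open>auto simp: pedge_def\<close>)
  then obtain d where d: "d > 0" "\<forall>x\<in>pedge ps i. \<forall>y\<in>pedge ps j. d <= dist x y" by blast
  have "d * max (ww s) (ww t) <= dist (xe i s) (xe j t)" if st: "s \<in> {0..1}" "t \<in> {0..1}" for s t
  proof -
   have "max (ww s) (ww t) <= 1" using st by (auto intro: mult_le_one)
   hence "d * max (ww s) (ww t) <= d * 1" using d(1) by (intro mult_left_mono) auto
   also have "... <= dist (xe i s) (xe j t)" using d(2) xe_mem st by simp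
   finally show ?thesis .
  qed
  thus ?thesis using d(1) by blast
 qed
qed

lemma edge_gap: "\<exists>c>0. \<forall>i<n. \<forall>j<n. i ~= j --> (\<forall>s\<in>{0..1}. \<forall>t\<in>{0..1}. c * max (ww s) (ww t) <= dist (xe i s) (xe j t))"
proof -
 let ?A = "{(i, j). i < n & j < n & i ~= j}"
 have "\<exists>c>0. \<forall>a\<in>?A. \<forall>x. x \<in> {0..1} \<times> {0..1} --> c * (max (ww (fst x)) (ww (snd x))) <= dist (xe (fst a) (fst x)) (xe (snd a) (snd x))"
 proof (rule uniform_pos_constant)
  have "?A \<subseteq> {..<n} \<times> {..<n}" by auto
  thus "finite ?A" by (rule finite_subset) simp
  fix a assume "a \<in> ?A"
  hence "fst a < n" "snd a < n" "fst a ~= snd a" by auto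
  thus "\<exists>c>0. \<forall>x. x \<in> {0..1} \<times> {0..1} --> c * max (ww (fst x)) (ww (snd x)) <= dist (xe (fst a) (fst x)) (xe (snd a) (snd x))"
   using edge_gap_pair[of "fst a" "snd a"] by fastforce
 next
  fix x :: "real \<times> real" assume "x \<in> {0..1} \<times> {0..1}"
  thus "0 <= max (ww (fst x)) (ww (snd x))" by (auto simp: le_max_iff_disj)
 qed
 then obtain c where c: "c > 0" "\<And>a x. a \<in> ?A ==> x \<in> {0..1} \<times> {0..1} ==> c * (max (ww (fst x)) (ww (snd x))) <= dist (xe (fst a) (fst x)) (xe (snd a) (snd x))" by blast
 have "c * max (ww s) (ww t) <= dist (xe i s) (xe j t)" if "i < n" "j < n" "i ~= j" "s \<in> {0..1}" "t \<in> {0..1}" for i j s t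
  using c(2)[of "(i, j)" "(s, t)"] that by simp
 thus ?thesis using c(1) by (intro exI[of _ c]) simp
qed

text \<open>The kernel is bounded by the inverse distance, and the distance dominates both weights.
  Splitting the exponent 1 as 3/4 + 1/4 keeps both powers integrable and leaves the weaker
  singularity on the variable of the function u, where it limits the decay rate.\<close>

lemma dker_bound:
 "\<exists>C>0. \<forall>i<n. \<forall>j<n. i ~= j --> (\<forall>s\<in>{0<..<1}. \<forall>t\<in>{0<..<1}. \<bar>dker j (xe i s) t\<bar> <= C * ww s powr (-3/4) * ww t powr (-1/4))"
proof -
 obtain c where c: "c > 0" "\<forall>i<n. \<forall>j<n. i ~= j --> (\<forall>s\<in>{0..1}. \<forall>t\<in>{0..1}. c * max (ww s) (ww t) <= dist (xe i s) (xe j t))" using edge_gap by blast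
 define Q where "Q = (\<Sum>j<n. norm (qe j))"
 have Q: "norm (qe j) <= Q" if "j < n" for j unfolding Q_def using that by (intro member_le_sum) auto
 have Q0: "Q > 0" using Q[OF n0(1)] qe_neq[OF n0(1)] by (metis less_le_trans zero_less_norm_iff)
 have "\<bar>dker j (xe i s) t\<bar> <= (Q / c) * ww s powr (-3/4) * ww t powr (-1/4)"
  if a: "i < n" "j < n" "i ~= j" "s \<in> {0<..<1}" "t \<in> {0<..<1}" for i j s t
 proof -
  define D where "D = norm (xe j t - xe i s)"
  have w: "ww s > 0" "ww t > 0" using a ww_pos by auto
  have m: "c * max (ww s) (ww t) <= D" using c(2) a unfolding D_def by (auto simp: dist_norm norm_minus_commute)
  have "c * ww s <= c * max (ww s) (ww t)" "c * ww t <= c * max (ww s) (ww t)" using c(1) by (auto intro: mult_left_mono)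
  hence D: "c * ww s <= D" "c * ww t <= D" using m by linarith+
  have p: "c * ww s > 0" "c * ww t > 0" using c(1) w by auto
  hence D0: "D > 0" using D by linarith
  have "\<bar>dker j (xe i s) t\<bar> = \<bar>det2 (xe j t - xe i s) (qe j)\<bar> / (2 * pi * D^2)"
   unfolding dker_def D_def using W0(1) by (auto simp: abs_mult)
  also have "... <= (D * norm (qe j)) / (2 * pi * D^2)"
   using det2_le_norm[of "xe j t - xe i s" "qe j"] unfolding D_def by (intro divide_right_mono) auto
  also have "... = (norm (qe j) / (2 * pi)) * (1 / D)" using D0 by (simp add: power2_eq_square)
  also have "... <= Q * (1 / D)"
  proof -
   have "norm (qe j) / (2 * pi) <= norm (qe j) / 1" using pi_gt3 by (intro divide_left_mono) auto
   thus ?thesis using Q[OF a(2)] D0 by (intro mult_right_mono) auto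
  qed
  also have "1 / D = D powr (-3/4) * D powr (-1/4)" using D0 by (simp add: powr_minus_divide flip: powr_add)
  also have "... <= (c * ww s) powr (-3/4) * (c * ww t) powr (-1/4)"
   using D p by (intro mult_mono powr_mono2') auto
  also have "... = (c powr (-3/4) * c powr (-1/4)) * ww s powr (-3/4) * ww t powr (-1/4)" using c(1) w by (simp add: powr_mult)
  also have "c powr (-3/4) * c powr (-1/4) = 1 / c" using c(1) by (simp add: powr_minus_divide flip: powr_add)
  finally show ?thesis using Q0 by (simp add: mult_left_mono algebra_simps)
 qed
 thus ?thesis using Q0 c(1) by (intro exI[of _ "Q / c"]) auto
qed

lemma continuous_xe: "continuous_on A (xe j)" unfolding xe_def by (intro continuous_intros)

lemma continuous_u: "continuous_on \<Gamma> u ==> j < n ==> continuous_on {0..1} (%t. u (xe j t))"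
 by (rule continuous_on_compose2[OF _ continuous_xe]) (use xe_Gamma in auto)

lemma blay_continuous2:
 assumes u: "continuous_on \<Gamma> u" and i: "i < n" and j: "j < n" and ij: "i ~= j"
 shows "continuous_on ({0<..<1} \<times> {0..1}) (%(s, t). dker j (xe i s) t * u (xe j t))"
proof -
 have nz: "xe j t - xe i s ~= 0" if "s \<in> {0<..<1}" "t \<in> {0..1}" for s t
 proof -
  have "xe i s \<notin> pedge ps j" using other_edges_open[OF i, of s] that(1) j ij unfolding xe_def[symmetric] by auto
  moreover have "xe j t \<in> pedge ps j" using xe_mem that(2) by simp
  ultimately show ?thesis by auto
 qed
 have c1: "continuous_on ({0<..<1} \<times> {0..1}) (%x. xe i (fst x))" "continuous_on ({0<..<1} \<times> {0..1}) (%x. xe j (snd x))"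
  unfolding xe_def by (intro continuous_intros)+
 have c2: "continuous_on ({0<..<1::real} \<times> {0..1}) (%x. u (xe j (snd x)))"
  by (rule continuous_on_compose2[OF u c1(2)]) (use xe_Gamma[OF j] in auto)
 show ?thesis unfolding case_prod_beta dker_def det2_def
  by (intro continuous_intros c1 c2) (use nz in auto)
qed

lemma blay_inner:
 assumes u: "continuous_on \<Gamma> u" and ij: "i < n" "j < n" "i ~= j" and s: "s \<in> {0<..<1}"
 shows "(%t. dker j (xe i s) t * u (xe j t)) integrable_on {0..1}"
proof -
 have "continuous_on {0..1} (%t. (%(s, t). dker j (xe i s) t * u (xe j t)) (s, t))"
  by (rule continuous_on_compose2[OF blay_continuous2[OF u ij]]) (use s in \<open>auto intro!: continuous_intros\<close>)
 thus ?thesis by (intro integrable_continuous_real) simp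
qed

text \<open>The weighted L1 norm against which layer potentials are bounded, up to the integrable
  factor \<open>ww s powr (-3/4)\<close>.\<close>

definition wnorm :: "nat => (point => real) => real" where
 "wnorm j u = integral {0<..<1} (%t. ww t powr (-1/4) * \<bar>u (xe j t)\<bar>)"

lemma wnorm_integrable:
 assumes u: "continuous_on \<Gamma> u" and j: "j < n"
 shows "(%t. ww t powr (-1/4) * \<bar>u (xe j t)\<bar>) integrable_on {0<..<1}"
proof -
 note cu = continuous_u[OF u j]
 have "bounded ((%t. u (xe j t)) ` {0..1})" using cu by (intro compact_imp_bounded compact_continuous_image) auto
 then obtain B where B: "\<And>t. t \<in> {0..1} ==> \<bar>u (xe j t)\<bar> <= B" unfolding bounded_iff by (metis (no_types) imageI real_norm_def)
 show ?thesis
 proof (rule continuous_dominated_integrable[OF _ integrable_on_mult_right[OF ww_integrable, of "-1/4" B]])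
  have cu: "continuous_on {0<..<1} (%t. u (xe j t))" using cu by (rule continuous_on_subset) auto
  have "continuous_on {0<..<1} (%t::real. ww t powr (-1/4))" by (rule continuous_on_powr) (auto intro!: continuous_intros)
  thus "continuous_on {0<..<1} (%t. ww t powr (-1/4) * \<bar>u (xe j t)\<bar>)" using cu by (intro continuous_on_mult continuous_on_rabs)
  fix t :: real assume t: "t \<in> {0<..<1}"
  have "ww t powr (-1/4) * \<bar>u (xe j t)\<bar> <= ww t powr (-1/4) * B" by (rule mult_left_mono) (use B[of t] t in auto)
  thus "\<bar>ww t powr (-1/4) * \<bar>u (xe j t)\<bar>\<bar> <= B * ww t powr (-1/4)" by (simp add: abs_mult mult.commute)
 qed auto
qed

lemma blay_bound:
 "\<exists>C>0. \<forall>i<n. \<forall>j<n. i ~= j --> (\<forall>u. continuous_on \<Gamma> u --> (\<forall>s\<in>{0<..<1}. \<bar>blay i j u s\<bar> <= C * ww s powr (-3/4) * wnorm j u))"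
proof -
 obtain C where C: "C > 0" "\<forall>i<n. \<forall>j<n. i ~= j --> (\<forall>s\<in>{0<..<1}. \<forall>t\<in>{0<..<1}. \<bar>dker j (xe i s) t\<bar> <= C * ww s powr (-3/4) * ww t powr (-1/4))" using dker_bound by blast
 have "\<bar>blay i j u s\<bar> <= C * ww s powr (-3/4) * wnorm j u" if a: "i < n" "j < n" "i ~= j" "continuous_on \<Gamma> u" "s \<in> {0<..<1}" for i j u s
 proof -
  have "norm (integral {0<..<1} (%t. dker j (xe i s) t * u (xe j t))) <= integral {0<..<1} (%t. C * ww s powr (-3/4) * (ww t powr (-1/4) * \<bar>u (xe j t)\<bar>))"
  proof (rule Henstock_Kurzweil_Integration.integral_norm_bound_integral)
   show "(%t. dker j (xe i s) t * u (xe j t)) integrable_on {0<..<1}" using blay_inner[OF a(4,1,2,3,5)] by (simp add: integrable_on_Icc_iff_Ioo)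
   show "(%t. C * ww s powr (-3/4) * (ww t powr (-1/4) * \<bar>u (xe j t)\<bar>)) integrable_on {0<..<1}" using wnorm_integrable[OF a(4,2)] by (rule integrable_on_mult_right)
   fix t :: real assume t: "t \<in> {0<..<1}"
   have "\<bar>dker j (xe i s) t\<bar> * \<bar>u (xe j t)\<bar> <= (C * ww s powr (-3/4) * ww t powr (-1/4)) * \<bar>u (xe j t)\<bar>"
    using C(2) a t by (intro mult_right_mono) auto
   thus "norm (dker j (xe i s) t * u (xe j t)) <= C * ww s powr (-3/4) * (ww t powr (-1/4) * \<bar>u (xe j t)\<bar>)" by (simp add: abs_mult mult.assoc)
  qed
  thus ?thesis unfolding blay_def wnorm_def integral_open_interval_real integral_mult_right by simp
 qed
 thus ?thesis using C(1) by blast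
qed

lemma blay_integrable:
 assumes u: "continuous_on \<Gamma> u" and ij: "i < n" "j < n" "i ~= j"
 shows "blay i j u integrable_on {0<..<1}"
proof -
 obtain C where C: "C > 0" "\<forall>i<n. \<forall>j<n. i ~= j --> (\<forall>u. continuous_on \<Gamma> u --> (\<forall>s\<in>{0<..<1}. \<bar>blay i j u s\<bar> <= C * ww s powr (-3/4) * wnorm j u))" using blay_bound by blast
 have "continuous_on {0<..<1} (blay i j u)"
  using integral_continuous_on_param[of "{0<..<1}" 0 1 "%s t. dker j (xe i s) t * u (xe j t)"] blay_continuous2[OF u ij] unfolding blay_def[abs_def] by simp
 thus ?thesis
  by (rule continuous_dominated_integrable[where g = "%s. (C * wnorm j u) * ww s powr (-3/4)"])
   (use C(2)[rule_format, OF ij u] in \<open>auto intro!: integrable_on_mult_right ww_integrable simp: ac_simps\<close>)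
qed

lemma blay_lin:
 assumes u: "continuous_on \<Gamma> u" "continuous_on \<Gamma> v" and ij: "i < n" "j < n" "i ~= j" and s: "s \<in> {0<..<1}"
 shows "blay i j (%x. a * u x + b * v x) s = a * blay i j u s + b * blay i j v s"
proof -
 have "blay i j (%x. a * u x + b * v x) s = integral {0..1} (%t. a * (dker j (xe i s) t * u (xe j t)) + b * (dker j (xe i s) t * v (xe j t)))"
  unfolding blay_def by (simp add: algebra_simps)
 also have "... = a * blay i j u s + b * blay i j v s" unfolding blay_def integral_mult_right[symmetric]
  by (intro Henstock_Kurzweil_Integration.integral_add integrable_on_mult_right blay_inner[OF _ ij s] u)
 finally show ?thesis .
qed

definition bint :: "nat => (point => real) => real => real" where
 "bint i u s = u (xe i s) / 2 - (\<Sum>j\<in>{..<n} - {i}. blay i j u s)"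

lemma bterm_bint: "bterm \<Omega> ps u = (\<Sum>i<n. norm (qe i) * integral {0<..<1} (bint i u))"
 unfolding bterm_eq bint_def[abs_def] ..

lemma bint_integrable:
 assumes u: "continuous_on \<Gamma> u" and i: "i < n" shows "bint i u integrable_on {0<..<1}"
proof -
 have "(%s. u (xe i s) / 2) integrable_on {0..1}" using continuous_u[OF u i] by (intro integrable_continuous_real continuous_intros) auto
 thus ?thesis unfolding bint_def[abs_def] integrable_on_Icc_iff_Ioo
  by (intro Henstock_Kurzweil_Integration.integrable_diff integrable_sum) (use blay_integrable[OF u i] in auto)
qed

lemma bterm_lin:
 assumes u: "continuous_on \<Gamma> u" "continuous_on \<Gamma> v"
 shows "bterm \<Omega> ps (%x. a * u x + b * v x) = a * bterm \<Omega> ps u + b * bterm \<Omega> ps v"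
proof -
 have "integral {0<..<1} (bint i (%x. a * u x + b * v x)) = a * integral {0<..<1} (bint i u) + b * integral {0<..<1} (bint i v)" if i: "i < n" for i
 proof -
  have "integral {0<..<1} (bint i (%x. a * u x + b * v x)) = integral {0<..<1} (%s. a * bint i u s + b * bint i v s)"
  proof (rule Henstock_Kurzweil_Integration.integral_cong)
   fix s :: real assume s: "s \<in> {0<..<1}"
   have "(\<Sum>j\<in>{..<n} - {i}. blay i j (%x. a * u x + b * v x) s) = (\<Sum>j\<in>{..<n} - {i}. a * blay i j u s + b * blay i j v s)"
    by (rule sum.cong) (use blay_lin[OF u i _ _ s] in auto)
   thus "bint i (%x. a * u x + b * v x) s = a * bint i u s + b * bint i v s"
    unfolding bint_def by (simp add: sum.distrib sum_distrib_left algebra_simps add_divide_distrib)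
  qed
  also have "... = a * integral {0<..<1} (bint i u) + b * integral {0<..<1} (bint i v)" unfolding integral_mult_right[symmetric]
   by (intro Henstock_Kurzweil_Integration.integral_add integrable_on_mult_right bint_integrable i u)
  finally show ?thesis .
 qed
 thus ?thesis unfolding bterm_bint sum_distrib_left sum.distrib[symmetric]
  by (intro sum.cong) (simp_all add: algebra_simps)
qed

lemma bterm_sum:
 assumes "finite I" "\<And>i. i \<in> I ==> continuous_on \<Gamma> (f i)"
 shows "bterm \<Omega> ps (%x. \<Sum>i\<in>I. c i * f i x) = (\<Sum>i\<in>I. c i * bterm \<Omega> ps (f i))"
 using assms
proof (induction I rule: finite_induct)
 case empty
 have "continuous_on \<Gamma> (%x. 0::real)" by simp
 from bterm_lin[OF this this, of 0 0] show ?case by simp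
next
 case (insert i I)
 have "continuous_on \<Gamma> (%x. \<Sum>i\<in>I. c i * f i x)" using insert.prems by (intro continuous_intros) auto
 with bterm_lin[of "f i" "%x. \<Sum>i\<in>I. c i * f i x" "c i" 1] show ?case using insert by simp
qed

lemma bterm_bound: "\<exists>C\<ge>0. \<forall>u. continuous_on \<Gamma> u --> \<bar>bterm \<Omega> ps u\<bar> <= C * (\<Sum>j<n. wnorm j u)"
proof -
 obtain C where C: "C > 0" "\<forall>i<n. \<forall>j<n. i ~= j --> (\<forall>u. continuous_on \<Gamma> u --> (\<forall>s\<in>{0<..<1}. \<bar>blay i j u s\<bar> <= C * ww s powr (-3/4) * wnorm j u))" using blay_bound by blast
 define Q where "Q = (\<Sum>j<n. norm (qe j))"
 define B where "B = integral {0<..<1} (%s. ww s powr (-3/4))"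
 have B0: "B >= 0" unfolding B_def by (intro integral_nonneg ww_integrable) auto
 have "\<bar>bterm \<Omega> ps u\<bar> <= (Q * (1 + C * B)) * (\<Sum>j<n. wnorm j u)" if u: "continuous_on \<Gamma> u" for u
 proof -
  let ?S = "\<Sum>j<n. wnorm j u"
  have w0: "wnorm j u >= 0" if "j < n" for j unfolding wnorm_def by (intro integral_nonneg wnorm_integrable u that) auto
  have "\<bar>integral {0<..<1} (bint i u)\<bar> <= (1 + C * B) * ?S" if i: "i < n" for i
  proof -
   have "norm (integral {0<..<1} (bint i u)) <= integral {0<..<1} (%s. ww s powr (-1/4) * \<bar>u (xe i s)\<bar> + (C * ?S) * ww s powr (-3/4))"
   proof (rule Henstock_Kurzweil_Integration.integral_norm_bound_integral[OF bint_integrable[OF u i]])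
    show "(%s. ww s powr (-1/4) * \<bar>u (xe i s)\<bar> + (C * ?S) * ww s powr (-3/4)) integrable_on {0<..<1}"
     by (intro Henstock_Kurzweil_Integration.integrable_add integrable_on_mult_right ww_integrable wnorm_integrable u i) auto
    fix s :: real assume s: "s \<in> {0<..<1}"
    have w: "0 < ww s" "ww s <= 1" using ww_pos[of s] s by auto
    \<comment> \<open>The weight is at least 1, so the local term u/2 is covered by the same
      norm.\<close>
    have "1 <= ww s powr (-1/4)" using powr_mono2'[of "-1/4" "ww s" 1] w by simp
    hence 1: "\<bar>u (xe i s)\<bar> <= ww s powr (-1/4) * \<bar>u (xe i s)\<bar>" using mult_right_mono[of 1 "ww s powr (-1/4)" "\<bar>u (xe i s)\<bar>"] by simp
    have "\<bar>\<Sum>j\<in>{..<n} - {i}. blay i j u s\<bar> <= (\<Sum>j\<in>{..<n} - {i}. C * ww s powr (-3/4) * wnorm j u)"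
     by (rule order_trans[OF sum_abs sum_mono]) (use C(2) i u s in auto)
    also have "... <= (\<Sum>j<n. C * ww s powr (-3/4) * wnorm j u)" using C(1) w0 by (intro sum_mono2) auto
    also have "... = (C * ?S) * ww s powr (-3/4)" by (simp add: sum_distrib_left sum_distrib_right algebra_simps)
    finally have "\<bar>u (xe i s) / 2\<bar> + \<bar>\<Sum>j\<in>{..<n} - {i}. blay i j u s\<bar> <= ww s powr (-1/4) * \<bar>u (xe i s)\<bar> + (C * ?S) * ww s powr (-3/4)" using 1 by simp
    thus "norm (bint i u s) <= ww s powr (-1/4) * \<bar>u (xe i s)\<bar> + (C * ?S) * ww s powr (-3/4)" unfolding bint_def real_norm_def by linarith
   qed
   also have "... = wnorm i u + (C * ?S) * B" unfolding wnorm_def B_def integral_mult_right[symmetric]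
    by (intro Henstock_Kurzweil_Integration.integral_add integrable_on_mult_right ww_integrable wnorm_integrable u i) auto
   also have "wnorm i u <= ?S" using w0 i by (intro member_le_sum) auto
   finally show ?thesis by (simp add: algebra_simps)
  qed
  hence "\<bar>norm (qe i) * integral {0<..<1} (bint i u)\<bar> <= norm (qe i) * ((1 + C * B) * ?S)" if "i < n" for i
   using that by (auto simp: abs_mult intro!: mult_left_mono)
  hence "\<bar>bterm \<Omega> ps u\<bar> <= (\<Sum>i<n. norm (qe i) * ((1 + C * B) * ?S))" unfolding bterm_bint
   by (intro order_trans[OF sum_abs sum_mono]) auto
  thus ?thesis unfolding Q_def by (simp add: sum_distrib_right mult.assoc)
 qed
 moreover have "Q >= 0" unfolding Q_def by (intro sum_nonneg) auto
 ultimately show ?thesis using C(1) B0 by (intro exI[of _ "Q * (1 + C * B)"]) auto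
qed

text \<open>The support meets the edge in an interval of length at most 4h/q. Where ww is at least
  h, the weight is at most h^(-1/4); where it is smaller, the weight is below h^(5/8) times the
  integrable power -7/8. As the interval is also no longer than 1, its length may be raised to the
  power 7/8, and 7/8 - 1/4 = 5/8 holds for large h as well.\<close>

lemma wnorm_local:
 assumes j: "j < n"
 shows "\<exists>C\<ge>0. \<forall>u z h. continuous_on \<Gamma> u --> h > 0 --> (\<forall>x\<in>\<Gamma>. \<bar>u x\<bar> <= 1) --> (\<forall>x\<in>\<Gamma>. h < dist x z --> u x = 0) --> wnorm j u <= C * h powr (5/8)"
proof -
 define B where "B = integral {0<..<1} (%s. ww s powr (-7/8))"
 have B0: "B >= 0" unfolding B_def by (intro integral_nonneg ww_integrable) auto
 define q where "q = norm (qe j)"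
 have q0: "q > 0" using qe_neq[OF j] unfolding q_def by simp
 have "wnorm j u <= ((4 / q) powr (7/8) + B) * h powr (5/8)"
  if u: "continuous_on \<Gamma> u" and h: "h > 0" and u1: "\<forall>x\<in>\<Gamma>. \<bar>u x\<bar> <= 1" and u0: "\<forall>x\<in>\<Gamma>. h < dist x z --> u x = 0" for u z h
 proof -
  define E where "E = {t \<in> {0<..<1}. dist (xe j t) z <= h}"
  obtain t1 where t1: "E \<subseteq> {t1 - 2 * h / q..t1 + 2 * h / q}"
  proof (cases "E = {}")
   case False
   then obtain t1 where t1: "t1 \<in> E" by blast
   have "\<bar>t - t1\<bar> <= 2 * h / q" if "t \<in> E" for t
   proof -
    have "dist (xe j t) (xe j t1) <= 2 * h" using dist_triangle2[of "xe j t" "xe j t1" z] that t1 unfolding E_def by auto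
    moreover have "xe j t - xe j t1 = (t - t1) *R qe j" unfolding xe_def by (simp add: algebra_simps)
    ultimately have "\<bar>t - t1\<bar> * q <= 2 * h" unfolding dist_norm q_def by simp
    thus ?thesis using q0 by (simp add: field_simps)
   qed
   hence "E \<subseteq> {t1 - 2 * h / q..t1 + 2 * h / q}" by (intro subsetI) (fastforce simp: abs_le_iff)
   thus ?thesis by (rule that)
  qed (use that[of 0] in simp)
  \<comment> \<open>The interval is clipped to the edge; the outer maximum keeps a \<le> b even if
    the support misses the edge.\<close>
  define a b where "a = max 0 (t1 - 2 * h / q)" and "b = max a (min 1 (t1 + 2 * h / q))"
  have E': "E \<subseteq> {a..b}" using t1 unfolding E_def a_def b_def by auto
  show ?thesis
  proof (cases "E = {}")
   case True
   have "(%t. ww t powr (-1/4) * \<bar>u (xe j t)\<bar>) t = 0" if "t \<in> {0<..<1}" for t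
   proof -
    have "h < dist (xe j t) z" using True that unfolding E_def by (auto simp: not_le)
    thus ?thesis using u0 xe_Gamma[OF j, of t] that by simp
   qed
   hence "wnorm j u = 0" unfolding wnorm_def by (subst Henstock_Kurzweil_Integration.integral_cong[where g = "%_. 0"]) auto
   thus ?thesis using B0 by simp
  next
   case False
   then obtain t where "t \<in> E" by blast
   hence t: "0 < t" "t < 1" "t1 - 2 * h / q <= t" "t <= t1 + 2 * h / q" using t1 unfolding E_def by auto
   have b1: "b <= 1" "0 <= a" "a <= b" unfolding b_def a_def using t by auto
   have ba: "b - a <= 4 * h / q"
   proof -
    have "a <= min 1 (t1 + 2 * h / q)" unfolding a_def using t by auto
    hence "b = min 1 (t1 + 2 * h / q)" unfolding b_def by simp
    hence "b <= t1 + 2 * h / q" "t1 - 2 * h / q <= a" unfolding a_def by auto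
    thus ?thesis by simp
   qed
   have hi: "((%t. if t \<in> {a..b} then 1 else 0::real) has_integral (b - a)) {0<..<1}"
   proof -
    have "((%t. 1::real) has_integral (b - a)) {a..b}" using has_integral_const_real[of "1::real" a b] b1 by simp
    hence "((%t. if t \<in> {a..b} then 1 else 0::real) has_integral (b - a)) {0..1}" by (subst has_integral_restrict) (use b1 in auto)
    thus ?thesis by (simp only: has_integral_Icc_iff_Ioo)
   qed
   have "wnorm j u <= integral {0<..<1} (%t. h powr (-1/4) * (if t \<in> {a..b} then 1 else 0) + h powr (5/8) * ww t powr (-7/8))"
    unfolding wnorm_def
   proof (rule integral_le[OF wnorm_integrable[OF u j]])
    show "(%t. h powr (-1/4) * (if t \<in> {a..b} then 1 else 0) + h powr (5/8) * ww t powr (-7/8)) integrable_on {0<..<1}"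
     by (intro Henstock_Kurzweil_Integration.integrable_add integrable_on_mult_right ww_integrable has_integral_integrable[OF hi]) auto
    fix t :: real assume t: "t \<in> {0<..<1}"
    have w: "0 < ww t" "ww t <= 1" using ww_pos[of t] t by auto
    show "ww t powr (-1/4) * \<bar>u (xe j t)\<bar> <= h powr (-1/4) * (if t \<in> {a..b} then 1 else 0) + h powr (5/8) * ww t powr (-7/8)"
    proof (cases "t \<in> E")
     case False
     hence "u (xe j t) = 0" using u0 xe_Gamma[OF j, of t] t unfolding E_def by auto
     thus ?thesis by simp
    next
     case True
     hence tab: "t \<in> {a..b}" using E' by blast
     have "ww t powr (-1/4) * \<bar>u (xe j t)\<bar> <= ww t powr (-1/4) * 1" using u1 xe_Gamma[OF j, of t] t by (intro mult_left_mono) auto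
     also have "... <= h powr (-1/4) + h powr (5/8) * ww t powr (-7/8)"
     proof (cases "h <= ww t")
      case True
      hence "ww t powr (-1/4) <= h powr (-1/4)" using h by (intro powr_mono2') auto
      thus ?thesis by (simp add: add_increasing2)
     next
      case False
      hence "ww t powr (5/8) <= h powr (5/8)" using w by (intro powr_mono2) auto
      hence "ww t powr (5/8) * ww t powr (-7/8) <= h powr (5/8) * ww t powr (-7/8)" by (intro mult_right_mono) auto
      moreover have "ww t powr (5/8) * ww t powr (-7/8) = ww t powr (-1/4)" using w by (simp flip: powr_add)
      ultimately show ?thesis by (simp add: add_increasing)
     qed
     finally show ?thesis using tab by simp
    qed
   qed
   also have "... = h powr (-1/4) * (b - a) + h powr (5/8) * B"
    unfolding B_def integral_unique[OF hi, symmetric] integral_mult_right[symmetric]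
    by (intro Henstock_Kurzweil_Integration.integral_add integrable_on_mult_right ww_integrable has_integral_integrable[OF hi]) auto
   also have "h powr (-1/4) * (b - a) <= (4 / q) powr (7/8) * h powr (5/8)"
   proof (cases "b = a")
    case False
    have "b - a = (b - a) powr (1/8) * (b - a) powr (7/8)" using False b1 by (simp flip: powr_add)
    also have "... <= 1 * (4 * h / q) powr (7/8)" using ba b1 by (intro mult_mono powr_mono2 powr_le1) auto
    also have "... = (4 / q) powr (7/8) * h powr (7/8)" using q0 h by (simp flip: powr_mult)
    finally have "h powr (-1/4) * (b - a) <= h powr (-1/4) * ((4 / q) powr (7/8) * h powr (7/8))" by (intro mult_left_mono) auto
    also have "... = (4 / q) powr (7/8) * (h powr (-1/4) * h powr (7/8))" by simp
    also have "h powr (-1/4) * h powr (7/8) = h powr (5/8)" by (simp flip: powr_add)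
    finally show ?thesis .
   qed simp
   finally show ?thesis by (simp add: algebra_simps)
  qed
 qed
 thus ?thesis using B0 by (intro exI[of _ "(4 / q) powr (7/8) + B"]) auto
qed

theorem bterm_local:
 "\<exists>C\<ge>0. \<forall>u z h. continuous_on \<Gamma> u --> h > 0 --> (\<forall>x\<in>\<Gamma>. \<bar>u x\<bar> <= 1) --> (\<forall>x\<in>\<Gamma>. h < dist x z --> u x = 0) --> \<bar>bterm \<Omega> ps u\<bar> <= C * h powr (5/8)"
proof -
 obtain C where C: "C >= 0" "\<forall>u. continuous_on \<Gamma> u --> \<bar>bterm \<Omega> ps u\<bar> <= C * (\<Sum>j<n. wnorm j u)" using bterm_bound by blast
 have "\<forall>j. \<exists>c\<ge>0. j < n --> (\<forall>u z h. continuous_on \<Gamma> u --> h > 0 --> (\<forall>x\<in>\<Gamma>. \<bar>u x\<bar> <= 1) --> (\<forall>x\<in>\<Gamma>. h < dist x z --> u x = 0) --> wnorm j u <= c * h powr (5/8))"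
  using wnorm_local by blast
 from choice[OF this] obtain c where c: "\<And>j. c j >= 0"
  "\<And>j u z h. j < n ==> continuous_on \<Gamma> u ==> h > 0 ==> (\<forall>x\<in>\<Gamma>. \<bar>u x\<bar> <= 1) ==> (\<forall>x\<in>\<Gamma>. h < dist x z --> u x = 0) ==> wnorm j u <= c j * h powr (5/8)" by blast
 have "\<bar>bterm \<Omega> ps u\<bar> <= (C * (\<Sum>j<n. c j)) * h powr (5/8)"
  if a: "continuous_on \<Gamma> u" "h > 0" "\<forall>x\<in>\<Gamma>. \<bar>u x\<bar> <= 1" "\<forall>x\<in>\<Gamma>. h < dist x z --> u x = 0" for u z h
 proof -
  have "(\<Sum>j<n. wnorm j u) <= (\<Sum>j<n. c j * h powr (5/8))" by (intro sum_mono c(2)[OF _ a]) simp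
  hence "C * (\<Sum>j<n. wnorm j u) <= C * (\<Sum>j<n. c j * h powr (5/8))" using C(1) by (rule mult_left_mono)
  thus ?thesis using C(2) a(1) by (fastforce simp: sum_distrib_right mult.assoc)
 qed
 moreover have "C * (\<Sum>j<n. c j) >= 0" using C(1) c(1) by (simp add: sum_nonneg)
 ultimately show ?thesis by blast
qed

lemma Gamma_negligible: "negligible \<Gamma>"
proof -
 have "negligible (pedge ps i)" if i: "i < n" for i
 proof (rule negligible_subset)
  have "rn i ~= 0" using rn_sq[of i] qe_neq[OF i] by auto
  thus "negligible {x. rn i \<bullet> x = rn i \<bullet> pv ps i}" by (intro negligible_hyperplane) blast
  have "rn i \<bullet> qe i = 0" unfolding inner_commute[of "rn i"] rn_inner by (simp add: det2_simps(9))
  hence e: "rn i \<bullet> pv ps (Suc i) = rn i \<bullet> pv ps i" by (simp add: inner_diff_right)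
  show "pedge ps i \<subseteq> {x. rn i \<bullet> x = rn i \<bullet> pv ps i}" unfolding pedge_def closed_segment_def by (auto simp: inner_add_right e left_diff_distrib)
 qed
 thus ?thesis unfolding polygon_image_def by (intro negligible_Union finite_imageI) auto
qed

lemma Gamma_thin: "thin \<Gamma>"
proof -
 define Q where "Q = (\<Sum>j<n. norm (qe j))"
 have Q: "norm (qe j) <= Q" if "j < n" for j unfolding Q_def using that by (intro member_le_sum) auto
 have Q0: "Q >= 0" unfolding Q_def by (intro sum_nonneg) auto
 have "\<exists>X. finite X & real (card X) <= (real n * (Q + 3)) / h & \<Gamma> \<subseteq> (\<Union>x\<in>X. ball x h)" if h: "0 < h" "h <= 1" for h
 proof -
  \<comment> \<open>So many equal pieces per edge that each is shorter than h; the 1 keeps m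
    positive.\<close>
  define m where "m = nat \<lfloor>Q / h\<rfloor> + 1"
  have m1: "Q / h < real m" unfolding m_def using Q0 h by linarith
  have m2: "real m <= Q / h + 1" unfolding m_def using Q0 h by simp
  have m0: "m > 0" unfolding m_def by simp
  define X where "X = (%(i, k). xe i (real k / real m)) ` ({..<n} \<times> {..m})"
  have "card X <= card ({..<n} \<times> {..m})" unfolding X_def by (rule card_image_le) simp
  hence "card X <= n * (m + 1)" by simp
  hence "real (card X) <= real n * (real m + 1)" by (metis of_nat_1 of_nat_add of_nat_le_iff of_nat_mult)
  also have "... <= real n * ((Q + 3) / h)"
  proof (rule mult_left_mono)
   have "2 <= 3 / h" using h by (simp add: field_simps)
   thus "real m + 1 <= (Q + 3) / h" using m2 by (simp add: add_divide_distrib)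
  qed simp
  finally have c: "real (card X) <= (real n * (Q + 3)) / h" by simp
  have "\<Gamma> \<subseteq> (\<Union>x\<in>X. ball x h)"
  proof
   fix y assume "y \<in> \<Gamma>"
   then obtain i t where i: "i < n" and t: "0 <= t" "t <= 1" "y = (1 - t) *R pv ps i + t *R pv ps (Suc i)"
    unfolding polygon_image_def pedge_def closed_segment_def by blast
   have y: "y = xe i t" unfolding t(3) xe_def by (simp add: algebra_simps)
   define k where "k = nat \<lfloor>t * m\<rfloor>"
   have k: "real k <= t * m" "t * m < real k + 1" unfolding k_def using t(1) by auto
   have "t * m <= m" using t(2) by (simp add: mult_left_le_one_le t(1))
   hence km: "k <= m" using k(1) by linarith
   have "\<bar>t - real k / real m\<bar> * real m = \<bar>t * m - k\<bar>" using m0 by (simp add: abs_mult_pos field_simps)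
   hence "\<bar>t - real k / real m\<bar> * real m <= 1" using k by linarith
   hence tk: "\<bar>t - real k / real m\<bar> <= 1 / real m" using m0 by (simp add: field_simps)
   have "xe i t - xe i (real k / real m) = (t - real k / real m) *R qe i" unfolding xe_def by (simp add: algebra_simps)
   hence "dist y (xe i (real k / real m)) = \<bar>t - real k / real m\<bar> * norm (qe i)" unfolding y dist_norm by simp
   also have "... <= (1 / real m) * Q" using tk Q[OF i] by (intro mult_mono) auto
   also have "... < h" using m1 m0 h by (simp add: field_simps)
   finally have "y \<in> ball (xe i (real k / real m)) h" by (simp add: dist_commute)
   moreover have "xe i (real k / real m) \<in> X" unfolding X_def using i km by auto
   ultimately show "y \<in> (\<Union>x\<in>X. ball x h)" by blast
  qed
  thus ?thesis using c unfolding X_def by (intro exI[of _ X]) (auto simp: X_def)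
 qed
 thus ?thesis unfolding thin_def using Q0 by (intro exI[of _ "real n * (Q + 3)"]) auto
qed

lemma bterm_zero: assumes "\<forall>x\<in>\<Gamma>. u x = 0" shows "bterm \<Omega> ps u = 0"
proof -
 have z: "u (xe j t) = 0" if "j < n" "t \<in> {0..1}" for j t using assms xe_Gamma that by simp
 have "blay i j u s = 0" if "j < n" for i j s
  unfolding blay_def by (subst Henstock_Kurzweil_Integration.integral_cong[where g = "%_. 0"]) (use z[OF that] in auto)
 hence "bint i u s = 0" if "i < n" "s \<in> {0<..<1}" for i s unfolding bint_def using z[OF that(1), of s] that(2) by simp
 hence "integral {0<..<1} (bint i u) = 0" if "i < n" for i
  by (subst Henstock_Kurzweil_Integration.integral_cong[where g = "%_. 0"]) (use that in auto)
 thus ?thesis unfolding bterm_bint by simp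
qed

end

section \<open>Verification of the additive Schwarz hypotheses\<close>

context dom begin

text \<open>The splitting controls v only up to a constant m. This m is recovered from the boundary
  functional, positive on constants and square summable over the hats, and is then distributed over
  the initial hats, whose sum is 1.\<close>

lemma preconditioner_bounds:
 fixes A :: "point => real^2^2" and ps :: "point list" and B :: "(point => real) => real"
 assumes A: "admissible_coeff \<Omega> A" and neg: "negligible (closure \<Omega> - \<Omega>)" and B: "B = bterm \<Omega> ps"
  and Blin: "\<And>a b u v. continuous_on (closure \<Omega>) u ==> continuous_on (closure \<Omega>) v ==> B (%x. a * u x + b * v x) = a * B u + b * B v"
  and Bsum: "\<And>(I :: (nat \<times> point) set) c f. finite I ==> (\<And>i. i \<in> I ==> continuous_on (closure \<Omega>) (f i)) ==> B (%x. \<Sum>i\<in>I. c i * f i x) = (\<Sum>i\<in>I. c i * B (f i))"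
  and Bsum': "\<And>(I :: point set) c f. finite I ==> (\<And>i. i \<in> I ==> continuous_on (closure \<Omega>) (f i)) ==> B (%x. \<Sum>i\<in>I. c i * f i x) = (\<Sum>i\<in>I. c i * B (f i))"
  and Bone: "B (%x. if x \<in> closure \<Omega> then 1 else 0) > 0"
  and Bev: "\<exists>C::real. C >= 0 & (\<forall>T L. seqT T L --> (\<Sum>(l, z)\<in>events T L. (B (hat (T l) z))^2) <= C)"
 shows "\<exists>d D. 0 < d & d <= D & (\<forall>T L. seqT T L --> (\<exists>P. is_inverse_on (nodes (T L)) (Pinv \<Omega> ps A T L) P \<and>
       symmetric_on (nodes (T L)) P & pos_def_on (nodes (T L)) P \<and>
       (\<forall>X. d * qform (nodes (T L)) P X <= qform (nodes (T L)) (Amat \<Omega> ps A (T L)) X \<and>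
         qform (nodes (T L)) (Amat \<Omega> ps A (T L)) X <= D * qform (nodes (T L)) P X)))"
  (is "\<exists>d D. _ & _ & (\<forall>T L. _ --> ?P d D T L)")
proof -
 define E where "E = (%u v. LINT x:\<Omega>|lebesgue. (A x *v grad u x) \<bullet> grad v x)"
 have af: "aform \<Omega> ps A u v = E u v + B u * B v" for u v unfolding aform_def E_def B by simp
 obtain c1 C1 :: real where c1: "0 < c1" "0 < C1" and F0: "\<forall>T. fmesh T --> (\<exists>m :: ltri => real^2^2.
  (\<forall>u v. pwaff T u --> pwaff T v --> E u v = (\<Sum>t\<in>T. (m t *v tgrad u t) \<bullet> tgrad v t)) \<and>
  (\<forall>t\<in>T. \<forall>p. c1 * ar t * (norm p)^2 <= (m t *v p) \<bullet> p & (m t *v p) \<bullet> p <= C1 * ar t * (norm p)^2))"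
  using form_energy[OF A neg] by (elim exE conjE) (erule (2) that[unfolded E_def])
 obtain CB :: real where CB0: "CB >= 0 & (\<forall>T L. seqT T L --> (\<Sum>(l, z)\<in>events T L. (B (hat (T l) z))^2) <= CB)" by (rule exE[OF Bev]) (rule that)
 note CB = conjunct1[OF CB0] conjunct2[OF CB0, rule_format]
 obtain Cu :: real where Cu0: "Cu >= 0 & (\<forall>T L c. seqT T L -->
  energy (T L) (%x. \<Sum>(l, z)\<in>events T L. c l z * hat (T l) z x) <= Cu * (\<Sum>(l, z)\<in>events T L. (c l z)^2))" by (rule exE[OF energy_upper]) (rule that)
 note Cu = conjunct1[OF Cu0] conjunct2[OF Cu0, rule_format]
 define one where "one = (%x. if x \<in> closure \<Omega> then 1 else 0 :: real)"
 obtain Ce :: real where Ce0: "Ce >= 0 & (\<forall>T L v. seqT T L --> pwaff (T L) v -->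
  (\<exists>m c. (\<forall>x. v x = m * one x + (\<Sum>(l, z)\<in>events T L. c l z * hat (T l) z x)) \<and>
    (\<Sum>(l, z)\<in>events T L. (c l z)^2) <= Ce * energy (T L) v))" by (rule exE[OF energy_lower]) (erule that[unfolded one_def])
 note Ce = conjunct1[OF Ce0] conjunct2[OF Ce0, rule_format]
 define b1 where "b1 = B one"
 have b1: "b1 > 0" using Bone unfolding b1_def one_def .
 have Eb: "c1 * energy T u <= E u u & E u u <= C1 * energy T u" if T: "fmesh T" and u: "pwaff T u" for T u
 proof -
  obtain m where m: "\<forall>u v. pwaff T u --> pwaff T v --> E u v = (\<Sum>t\<in>T. (m t *v tgrad u t) \<bullet> tgrad v t)"
   "\<forall>t\<in>T. \<forall>p. c1 * ar t * (norm p)^2 <= (m t *v p) \<bullet> p & (m t *v p) \<bullet> p <= C1 * ar t * (norm p)^2"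
   using F0[rule_format, OF T] by (elim exE conjE) (rule that)
  have "E u u = (\<Sum>t\<in>T. (m t *v tgrad u t) \<bullet> tgrad u t)" using m(1) u by simp
  moreover have "c1 * energy T u <= (\<Sum>t\<in>T. (m t *v tgrad u t) \<bullet> tgrad u t)"
   unfolding energy_def sum_distrib_left by (rule sum_mono) (use m(2) in \<open>simp add: mult.assoc\<close>)
  moreover have "(\<Sum>t\<in>T. (m t *v tgrad u t) \<bullet> tgrad u t) <= C1 * energy T u"
   unfolding energy_def sum_distrib_left by (rule sum_mono) (use m(2) in \<open>simp add: mult.assoc\<close>)
  ultimately show ?thesis by linarith
 qed
 have Elin: "E (%x. \<Sum>z\<in>J. X z * f z x) (%x. \<Sum>z\<in>J. X z * f z x) = (\<Sum>j\<in>J. \<Sum>k\<in>J. E (f k) (f j) * X k * X j)"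
  if T: "fmesh T" and f: "\<And>z. z \<in> J ==> pwaff T (f z)" for T J X and f :: "point => point => real"
 proof -
  obtain m where m: "\<forall>u v. pwaff T u --> pwaff T v --> E u v = (\<Sum>t\<in>T. (m t *v tgrad u t) \<bullet> tgrad v t)"
   using F0[rule_format, OF T] by (elim exE conjE) (rule that)
  have pw: "pwaff T (%x. \<Sum>z\<in>J. X z * f z x)" using f by (rule pwaff_sum)
  have "(m t *v (\<Sum>k\<in>J. X k *R tgrad (f k) t)) \<bullet> (\<Sum>j\<in>J. X j *R tgrad (f j) t) = (\<Sum>j\<in>J. \<Sum>k\<in>J. ((m t *v tgrad (f k) t) \<bullet> tgrad (f j) t) * X k * X j)" for t
  proof -
   have "m t *v (\<Sum>k\<in>J. X k *R tgrad (f k) t) = (\<Sum>k\<in>J. X k *R (m t *v tgrad (f k) t))"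
    by (simp add: linear_sum[OF matrix_vector_mul_linear] matrix_vector_mult_scaleR)
   thus ?thesis by (simp add: inner_sum_left inner_sum_right mult.assoc sum_distrib_left mult.left_commute mult.commute)
  qed
  hence "E (%x. \<Sum>z\<in>J. X z * f z x) (%x. \<Sum>z\<in>J. X z * f z x) = (\<Sum>t\<in>T. \<Sum>j\<in>J. \<Sum>k\<in>J. ((m t *v tgrad (f k) t) \<bullet> tgrad (f j) t) * X k * X j)"
   using m pw by (simp add: tgrad_sum)
  also have "... = (\<Sum>j\<in>J. \<Sum>k\<in>J. \<Sum>t\<in>T. ((m t *v tgrad (f k) t) \<bullet> tgrad (f j) t) * X k * X j)"
   by (subst sum.swap) (intro sum.cong HOL.refl sum.swap)
  also have "... = (\<Sum>j\<in>J. \<Sum>k\<in>J. E (f k) (f j) * X k * X j)" using m f by (intro sum.cong HOL.refl) (simp add: sum_distrib_right)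
  finally show ?thesis .
 qed
 \<comment> \<open>Bounds the form at any sum of hats by the sum of squared coefficients.\<close>
 define C2 where "C2 = C1 * Cu + CB"
 have C20: "C2 >= 0" unfolding C2_def using c1 Cu(1) CB(1) by simp
 define N0 where "N0 = real (card (nodes T0))"
 \<comment> \<open>Relative to the form at v, q1 bounds the squared coefficients and q2 the square
   of the constant m.\<close>
 define q1 q2 where "q1 = Ce / c1" and "q2 = 2 / b1^2 * (1 + CB * q1)"
 have q0: "q1 >= 0" "q2 >= 0" unfolding q1_def q2_def using Ce(1) CB(1) c1 b1 by simp_all
 define K where "K = C2 * (2 * q1 + 2 * N0 * q2)"
 have K0: "K >= 0" unfolding K_def N0_def using C20 q0 by simp
 \<comment> \<open>K may be 0, hence K + 1.\<close>
 define d where "d = 1 / (K + 1)"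
 have d0: "d > 0" unfolding d_def using K0 by simp
 define D where "D = max d (C2 * sg / c1)"
 have "?P d D T L" if S: "seqT T L" for T L
 proof -
  let ?N = "nodes (T L)" and ?I = "events T L"
  note fm = seq_fmesh[OF S order_refl]
  note cL = fmeshD(1)[OF fm]
  have fN: "finite ?N" using finite_nodes[OF conformingD(1)[OF cL]] .
  have fI: "finite ?I" using finite_events[OF S] .
  define et where "et = (%i. hat (T (fst i)) (snd i))"
  have pw: "pwaff (T L) (et i)" if "i \<in> ?I" for i
  proof -
   have "fst i <= L" using that unfolding events_def by auto
   thus ?thesis unfolding et_def by (rule hat_pwaff_L[OF S])
  qed
  have cont: "continuous_on (closure \<Omega>) u" if "pwaff (T L) u" for u
   using pwaff_continuous_on[OF conformingD(1)[OF cL] that] closure_T[OF S order_refl] by simp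
  have CBI: "(\<Sum>i\<in>?I. (B (et i))^2) <= CB" using CB(2)[OF S] unfolding et_def by (simp add: case_prod_beta)
  have CuI: "energy (T L) (%x. \<Sum>i\<in>?I. c i * et i x) <= Cu * (\<Sum>i\<in>?I. (c i)^2)" for c
   using Cu(2)[OF S, of "%l z. c (l, z)"] unfolding et_def by (simp add: case_prod_beta)
  define q where "q = (%u. E u u + (B u)^2)"
  have qE: "c1 * energy (T L) u <= q u" "(B u)^2 <= q u" "q u <= C1 * energy (T L) u + (B u)^2" "0 <= q u" if "pwaff (T L) u" for u
  proof -
   have "0 <= c1 * energy (T L) u" unfolding energy_def using c1 by (simp add: sum_nonneg)
   thus "c1 * energy (T L) u <= q u" "(B u)^2 <= q u" "q u <= C1 * energy (T L) u + (B u)^2" "0 <= q u"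
    using Eb[OF fm that] zero_le_power2[of "B u"] unfolding q_def by linarith+
  qed
  have qf: "qform ?N (Amat \<Omega> ps A (T L)) X = q (%x. \<Sum>z\<in>?N. X z * hat (T L) z x)" for X
  proof -
   have "B (%x. \<Sum>z\<in>?N. X z * hat (T L) z x) = (\<Sum>z\<in>?N. X z * B (hat (T L) z))"
    by (rule Bsum'[OF fN]) (rule cont[OF pwaff_hat[OF cL]])
   hence "(B (%x. \<Sum>z\<in>?N. X z * hat (T L) z x))^2 = (\<Sum>j\<in>?N. \<Sum>k\<in>?N. B (hat (T L) k) * B (hat (T L) j) * X k * X j)"
    unfolding power2_eq_square by (simp add: sum_product algebra_simps)
   thus ?thesis unfolding q_def Elin[OF fm pwaff_hat[OF cL]] qform_alt Amat_def af
    by (simp add: sum.distrib[symmetric] algebra_simps)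
  qed
  define Dg where "Dg = (%i. aform \<Omega> ps A (et i) (et i))"
  have Dq: "Dg i = q (et i)" for i unfolding Dg_def af q_def by (simp add: power2_eq_square)
  \<comment> \<open>One triangle of the fan already has energy at least 1/sg, at every size, since
    the Dirichlet energy is scale invariant in the plane.\<close>
  have Dlo: "c1 / sg <= Dg i" if i: "i \<in> ?I" for i
  proof -
   have l: "fst i <= L" "snd i \<in> newnodes T (fst i)" using i unfolding events_def by auto
   note fl = seq_fmesh[OF S l(1)]
   note cl = fmeshD(1)[OF fl]
   have "snd i \<in> nodes (T (fst i))" using newnodes_sub[OF S l(1)] l(2) by blast
   then obtain t where t: "t \<in> T (fst i)" "snd i \<in> verts t" unfolding nodes_def by blast
   have n: "nd t" using conformingD(3)[OF cl t(1)] .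
   have "tgrad (et i) t = (\<Sum>z\<in>verts t. if z = snd i then bgr t (snd i) else 0)" unfolding tgrad_def et_def
    by (intro sum.cong HOL.refl) (use hat_node[OF cl nodesI[OF t(1)]] in auto)
   hence g: "tgrad (et i) t = bgr t (snd i)" using t(2) by simp
   have "1 <= (norm (bgr t (snd i)))^2 * Qs t" by (rule norm_bgr_ge[OF n t(2)])
   also have "... <= (norm (bgr t (snd i)))^2 * (sg * ar t)" by (rule mult_left_mono[OF Qs_le[OF subsetD[OF fmeshD(2)[OF fl] t(1)]]]) simp
   finally have "1 / sg <= ar t * (norm (tgrad (et i) t))^2" unfolding g using sig1 by (simp add: field_simps)
   also have "... <= energy (T (fst i)) (et i)" unfolding energy_def by (rule member_le_sum) (use t(1) conformingD(1)[OF cl] in auto)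
   finally have "c1 * (1 / sg) <= c1 * energy (T (fst i)) (et i)" using c1 by (intro mult_left_mono) auto
   also have "... <= E (et i) (et i)" using Eb[OF fl, of "et i"] pwaff_hat[OF cl] unfolding et_def by blast
   finally show ?thesis unfolding Dq q_def by (simp add: add_increasing2)
  qed
  have cs: "c1 / sg > 0" using c1 sig1 by simp
  \<comment> \<open>The upper bounds for sums of hats, applied to a single coefficient 1.\<close>
  have Dhi: "Dg i <= C2" if i: "i \<in> ?I" for i
  proof -
   have "(%x. \<Sum>j\<in>?I. (if j = i then 1 else 0) * et j x) = et i"
   proof
    fix x
    have "(\<Sum>j\<in>?I. (if j = i then 1 else 0) * et j x) = (\<Sum>j\<in>?I. if j = i then et i x else 0)" by (intro sum.cong) auto
    thus "(\<Sum>j\<in>?I. (if j = i then 1 else 0) * et j x) = et i x" using i fI by simp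
   qed
   moreover have "(\<Sum>j\<in>?I. (if j = i then 1 else 0 :: real)^2) = (\<Sum>j\<in>?I. if j = i then 1 else 0)" by (intro sum.cong) auto
   ultimately have "energy (T L) (et i) <= Cu" using CuI[of "%j. if j = i then 1 else 0"] i fI by simp
   hence "C1 * energy (T L) (et i) <= C1 * Cu" using c1 by (intro mult_left_mono) auto
   moreover have "(B (et i))^2 <= (\<Sum>i\<in>?I. (B (et i))^2)" by (rule member_le_sum) (use i fI in auto)
   ultimately show ?thesis using qE(3)[OF pw[OF i]] CBI unfolding Dq C2_def by linarith
  qed
  define SS where "SS = (%i j. Itil T L (fst i) j (snd i))"
  have SS: "SS i n = et i n" if "i \<in> ?I" "n \<in> ?N" for i n
   unfolding SS_def Itil_def using coeffs_eq[OF cL pw[OF that(1)] that(2)] unfolding et_def .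
  have Bw: "(B (%x. \<Sum>i\<in>?I. c i * et i x))^2 <= CB * (\<Sum>i\<in>?I. (c i)^2)" for c
  proof -
   have "B (%x. \<Sum>i\<in>?I. c i * et i x) = (\<Sum>i\<in>?I. c i * B (et i))" by (rule Bsum[OF fI]) (rule cont[OF pw])
   hence "(B (%x. \<Sum>i\<in>?I. c i * et i x))^2 <= (\<Sum>i\<in>?I. (c i)^2) * (\<Sum>i\<in>?I. (B (et i))^2)" using Cauchy_Schwarz_ineq_sum by simp
   also have "... <= (\<Sum>i\<in>?I. (c i)^2) * CB" using CBI by (intro mult_left_mono sum_nonneg) auto
   finally show ?thesis by (simp add: mult.commute)
  qed
  show ?thesis
  proof (rule additive_schwarz[OF fN fI _ d0])
   show "Dg i > 0" if "i \<in> ?I" for i using Dlo[OF that] cs by linarith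
   show "Pinv \<Omega> ps A T L j k = (\<Sum>i\<in>?I. SS i j * inverse (Dg i) * SS i k)" for j k
    unfolding Pinv_def events_def SS_def Dg_def et_def
    by (subst sum.Sigma) (use finite_newnodes[OF S] in \<open>auto simp: case_prod_beta\<close>)
   fix X :: "point => real"
   define v where "v = (%x. \<Sum>z\<in>?N. X z * hat (T L) z x)"
   have pv: "pwaff (T L) v" unfolding v_def by (rule pwaff_of_nodes[OF cL])
   have vX: "v n = X n" if "n \<in> ?N" for n unfolding v_def by (rule of_nodes_node[OF cL that])
   obtain m c where mc: "\<forall>x. v x = m * one x + (\<Sum>(l, z)\<in>?I. c l z * hat (T l) z x)" "(\<Sum>(l, z)\<in>?I. (c l z)^2) <= Ce * energy (T L) v"
    using Ce(2)[OF S pv] by (elim exE conjE) (rule that)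
   define cc where "cc = (%i. c (fst i) (snd i))"
   have vE: "v = (%x. m * one x + 1 * (\<Sum>i\<in>?I. cc i * et i x))" using mc(1) unfolding cc_def et_def by (auto simp: case_prod_beta)
   define s where "s = (\<Sum>i\<in>?I. (cc i)^2)"
   have "s <= Ce * energy (T L) v" using mc(2) unfolding s_def cc_def by (simp add: case_prod_beta)
   also have "... = q1 * (c1 * energy (T L) v)" unfolding q1_def using c1 by simp
   also have "... <= q1 * q v" using qE(1)[OF pv] q0(1) by (rule mult_left_mono)
   finally have s1: "s <= q1 * q v" .
   have c1': "continuous_on (closure \<Omega>) one" unfolding one_def by (rule continuous_on_eq[of _ "%_. 1"]) auto
   have "B v = m * b1 + 1 * B (%x. \<Sum>i\<in>?I. cc i * et i x)" unfolding b1_def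
    by (subst vE) (intro Blin c1' cont[OF pwaff_sum] pw)
   hence "m * b1 = B v - B (%x. \<Sum>i\<in>?I. cc i * et i x)" by simp
   hence "(m * b1)^2 <= 2 * (B v)^2 + 2 * (B (%x. \<Sum>i\<in>?I. cc i * et i x))^2"
    using sq_sum_le[of "B v" "(B v)^2" "- B (%x. \<Sum>i\<in>?I. cc i * et i x)" "(B (%x. \<Sum>i\<in>?I. cc i * et i x))^2"] by simp
   also have "... <= 2 * q v + 2 * (CB * (q1 * q v))"
   proof -
    have "CB * s <= CB * (q1 * q v)" using s1 CB(1) by (rule mult_left_mono)
    thus ?thesis using qE(2)[OF pv] Bw[of cc] unfolding s_def by linarith
   qed
   finally have "m^2 <= q2 * q v" unfolding q2_def using b1 by (simp add: power_mult_distrib field_simps)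
   \<comment> \<open>The events of level 0 are the initial nodes, so adding m to their coefficients
     adds m times the partition of unity.\<close>
   define c' where "c' = (%i::nat \<times> point. cc i + (if fst i = 0 then m else 0))"
   have lvl0: "(\<Sum>i\<in>?I. (if fst i = 0 then f (snd i) else 0)) = (\<Sum>z\<in>nodes T0. f z)" for f :: "point => real"
    using sum_events[OF S, of "%l z. if l = 0 then f z else 0"] by (simp add: case_prod_beta)
   have T0: "T 0 = T0" using S unfolding seqT_def by blast
   have "X n = (\<Sum>i\<in>?I. c' i * SS i n)" if n: "n \<in> ?N" for n
   proof -
    have "n \<in> closure \<Omega>"
    proof -
     obtain t where "t \<in> T L" "n \<in> verts t" using n unfolding nodes_def by blast
     thus ?thesis using verts_tri closure_T[OF S order_refl] by blast
    qed
    hence "one n = (\<Sum>z\<in>nodes T0. hat T0 z n)" using of_nodes_one[OF conf0] cl unfolding one_def by simp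
    also have "... = (\<Sum>i\<in>?I. (if fst i = 0 then hat T0 (snd i) n else 0))" by (rule lvl0[symmetric])
    finally have "m * one n = (\<Sum>i\<in>?I. m * (if fst i = 0 then hat T0 (snd i) n else 0))" by (simp only: sum_distrib_left)
    also have "... = (\<Sum>i\<in>?I. (if fst i = 0 then m else 0) * et i n)" unfolding et_def by (intro sum.cong) (simp_all add: T0)
    finally have "m * one n = (\<Sum>i\<in>?I. (if fst i = 0 then m else 0) * et i n)" .
    moreover have "X n = m * one n + (\<Sum>i\<in>?I. cc i * et i n)" using vX[OF n] fun_cong[OF vE, of n] by simp
    moreover have "(\<Sum>i\<in>?I. c' i * SS i n) = (\<Sum>i\<in>?I. c' i * et i n)" using SS n by (intro sum.cong) auto
    ultimately show ?thesis unfolding c'_def by (simp add: distrib_right sum.distrib)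
   qed
   moreover have "d * (\<Sum>i\<in>?I. Dg i * (c' i)^2) <= qform ?N (Amat \<Omega> ps A (T L)) X"
   proof -
    have "(\<Sum>i\<in>?I. (c' i)^2) <= (\<Sum>i\<in>?I. 2 * (cc i)^2 + 2 * (if fst i = 0 then m\<^sup>2 else 0))"
     unfolding c'_def by (intro sum_mono) (auto intro: sq_sum_le)
    also have "... = 2 * s + 2 * (N0 * m^2)" unfolding sum.distrib sum_distrib_left[symmetric] s_def N0_def using lvl0[of "%_. m^2"] by simp
    also have "... <= 2 * (q1 * q v) + 2 * (N0 * (q2 * q v))"
     using s1 mult_left_mono[OF \<open>m\<^sup>2 <= q2 * q v\<close>, of N0] unfolding N0_def by simp
    finally have cs: "(\<Sum>i\<in>?I. (c' i)^2) <= (2 * q1 + 2 * N0 * q2) * q v" by (simp add: algebra_simps)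
    have "(\<Sum>i\<in>?I. Dg i * (c' i)^2) <= (\<Sum>i\<in>?I. C2 * (c' i)^2)" using Dhi by (intro sum_mono mult_right_mono) auto
    also have "... = C2 * (\<Sum>i\<in>?I. (c' i)^2)" by (simp add: sum_distrib_left)
    also have "... <= C2 * ((2 * q1 + 2 * N0 * q2) * q v)" using cs C20 by (rule mult_left_mono)
    also have "... = K * q v" unfolding K_def by simp
    also have "... <= (K + 1) * q v" using qE(4)[OF pv] by (simp add: distrib_right)
    finally have "d * (\<Sum>i\<in>?I. Dg i * (c' i)^2) <= d * ((K + 1) * q v)" using d0 by (intro mult_left_mono) auto
    also have "... = q v" unfolding d_def using K0 by simp
    finally show ?thesis unfolding qf v_def .
   qed
   ultimately show "\<exists>c. (\<forall>n\<in>?N. X n = (\<Sum>i\<in>?I. c i * SS i n)) & d * (\<Sum>i\<in>?I. Dg i * (c i)^2) <= qform ?N (Amat \<Omega> ps A (T L)) X"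
    by (intro exI[of _ c'] conjI ballI)
  next
   fix c :: "nat \<times> point => real"
   define w where "w = (%x. \<Sum>i\<in>?I. c i * et i x)"
   have pww: "pwaff (T L) w" unfolding w_def by (rule pwaff_sum) (rule pw)
   have "(\<Sum>z\<in>?N. (\<Sum>i\<in>?I. c i * SS i z) * hat (T L) z x) = w x" for x
   proof -
    have "(\<Sum>z\<in>?N. (\<Sum>i\<in>?I. c i * SS i z) * hat (T L) z x) = (\<Sum>z\<in>?N. w z * hat (T L) z x)"
     unfolding w_def using SS by (intro sum.cong HOL.refl arg_cong2[where f = "(*)"]) auto
    thus ?thesis using pwaff_rep[OF cL pww, of x] by simp
   qed
   hence "qform ?N (Amat \<Omega> ps A (T L)) (%n. \<Sum>i\<in>?I. c i * SS i n) = q w" unfolding qf by simp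
   also have "... <= C1 * energy (T L) w + (B w)^2" by (rule qE(3)[OF pww])
   also have "... <= C1 * (Cu * (\<Sum>i\<in>?I. (c i)^2)) + CB * (\<Sum>i\<in>?I. (c i)^2)"
    using CuI[of c] Bw[of c] c1 unfolding w_def by (intro add_mono mult_left_mono) auto
   also have "... = (C2 * sg / c1) * (\<Sum>i\<in>?I. (c1 / sg) * (c i)^2)" unfolding C2_def sum_distrib_left[symmetric] using c1 sig1 by (simp add: field_simps)
   also have "... <= (C2 * sg / c1) * (\<Sum>i\<in>?I. Dg i * (c i)^2)"
    using Dlo C20 c1 sig1 by (intro mult_left_mono sum_mono mult_right_mono) auto
   also have "... <= D * (\<Sum>i\<in>?I. Dg i * (c i)^2)"
   proof (rule mult_right_mono)
    show "C2 * sg / c1 <= D" unfolding D_def by simp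
    show "0 <= (\<Sum>i\<in>?I. Dg i * (c i)^2)"
    proof (rule sum_nonneg)
     fix i assume "i \<in> ?I"
     hence "0 <= Dg i" using Dlo[of i] cs by linarith
     thus "0 <= Dg i * (c i)^2" by simp
    qed
   qed
   finally show "qform ?N (Amat \<Omega> ps A (T L)) (%n. \<Sum>i\<in>?I. c i * SS i n) <= D * (\<Sum>i\<in>?I. Dg i * (c i)^2)" .
  qed
 qed
 thus ?thesis using d0 unfolding D_def by (intro exI[of _ d] exI[of _ "max d (C2 * sg / c1)"]) auto
qed

text \<open>Minimality of the refinement enters here, through the depth bound of two bisections per
  step.\<close>

lemma seqT_refine:
 assumes "T 0 = T0" "\<forall>l<L. M l \<subseteq> T l & M l ~= {} & nvb_refine (T l) (M l) (T (Suc l))" shows "seqT T L"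
proof -
 have c: "conforming (T l)" if "l <= L" for l
 proof (cases l)
  case 0
  thus ?thesis using assms(1) conf0 by simp
 next
  case (Suc k)
  thus ?thesis using assms(2) that unfolding nvb_refine_def by simp
 qed
 show ?thesis unfolding seqT_def
 proof (intro conjI allI impI ballI)
  fix l assume l: "l < L"
  hence r: "nvb_refine (T l) (M l) (T (Suc l))" "M l \<subseteq> T l" using assms(2) by auto
  thus "nvb_ref (T l) (T (Suc l))" "conforming (T (Suc l))" unfolding nvb_refine_def by auto
  fix t ka assume "t \<in> T l" "ka \<in> T (Suc l)" "desc t ka"
  thus "ar t <= 4 * ar ka" using nvb_refine_depth[OF r(1) c r(2)] l by simp
 qed (fact assms(1))
qed

end

lemma dom_of_polygon:
 assumes "simple_polygon ps" "triangulation (inside (polygon_image ps)) T0"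
 shows "\<exists>sg. dom T0 sg (inside (polygon_image ps))"
proof -
 interpret polygon ps by unfold_locales (fact assms(1))
 have c: "conforming T0" "\<Union> (tri ` T0) = closure \<Omega>" using assms(2) unfolding triangulation_def by auto
 \<comment> \<open>The worst shape ratio of the finitely many initial triangles; inserting 1 gives
   sg \<ge> 1.\<close>
 define sg where "sg = Max (insert 1 ((%t. Qs t / ar t) ` T0))"
 have fin: "finite T0" using conformingD(1)[OF c(1)] .
 have "dom T0 sg \<Omega>"
 proof unfold_locales
  show "mesh T0" using conforming_mesh[OF c(1)] .
  show "T0 ~= {}" using conformingD(2)[OF c(1)] .
  show "1 <= sg" unfolding sg_def using fin by (intro Max_ge) auto
  fix t assume t: "t \<in> T0"
  have "Qs t / ar t <= sg" unfolding sg_def using fin t by (intro Max_ge) auto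
  thus "Qs t <= sg * ar t" using ar_pos[OF conformingD(3)[OF c(1) t]] by (simp add: field_simps)
 qed (use c jordan(1,2) locally_connected_inside in blast)+
 thus ?thesis by blast
qed

theorem theorem3p1:
  fixes \<Omega> :: "point set" and ps :: "point list" and A :: "point \<Rightarrow> real^2^2" and T0 :: "ltri set"
  assumes "simple_polygon ps"
    and "\<Omega> = inside (polygon_image ps)"
    and "admissible_coeff \<Omega> A"
    and "triangulation \<Omega> T0"
  shows "\<exists>d D. 0 < d \<and> d \<le> D \<and>
    (\<forall>(L::nat) (T :: nat \<Rightarrow> ltri set) (M :: nat \<Rightarrow> ltri set).
       T 0 = T0 \<and> (\<forall>l<L. M l \<subseteq> T l \<and> M l \<noteq> {} \<and> nvb_refine (T l) (M l) (T (Suc l)))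
       \<longrightarrow> (\<exists>P. is_inverse_on (nodes (T L)) (Pinv \<Omega> ps A T L) P \<and>
              symmetric_on (nodes (T L)) P \<and> pos_def_on (nodes (T L)) P \<and>
              (\<forall>X. d * qform (nodes (T L)) P X \<le> qform (nodes (T L)) (Amat \<Omega> ps A (T L)) X \<and>
                   qform (nodes (T L)) (Amat \<Omega> ps A (T L)) X \<le> D * qform (nodes (T L)) P X)))"
proof -
 interpret p: polygon ps by unfold_locales (fact assms(1))
 obtain sg where "dom T0 sg \<Omega>" using dom_of_polygon[OF assms(1)] assms(2,4) by blast
 then interpret dom T0 sg \<Omega> .
 let ?G = "polygon_image ps" and ?B = "bterm \<Omega> ps"
 have G: "?G \<subseteq> closure \<Omega>" using p.jordan(5) unfolding assms(2) frontier_def by blast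
 have cG: "continuous_on ?G u" if "continuous_on (closure \<Omega>) u" for u :: "point => real" using that G by (rule continuous_on_subset)
 \<comment> \<open>By the Jordan curve theorem the frontier of the interior is the polygon itself, a
   finite union of segments and so a null set.\<close>
 have "closure \<Omega> - \<Omega> = ?G" using p.jordan(1,5) unfolding assms(2) frontier_def by (simp add: interior_open)
 hence neg: "negligible (closure \<Omega> - \<Omega>)" using p.Gamma_negligible by simp
 obtain CB where CB: "CB >= 0" "\<forall>u z h. continuous_on ?G u --> h > 0 --> (\<forall>x\<in>?G. \<bar>u x\<bar> <= 1) --> (\<forall>x\<in>?G. h < dist x z --> u x = 0) --> \<bar>?B u\<bar> <= CB * h powr (5/8)"
  using p.bterm_local unfolding assms(2)[symmetric] by (elim exE conjE) (rule that)
 have ev: "\<exists>C::real. C >= 0 & (\<forall>T L. seqT T L --> (\<Sum>(l, z)\<in>events T L. (?B (hat (T l) z))^2) <= C)"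
  by (rule events_functional[OF p.Gamma_thin G CB(1) CB(2)[rule_format] p.bterm_zero[folded assms(2)]]) blast+
 let "\<exists>d D. _ & _ & (\<forall>L T M. _ --> ?P d D L T)" = ?thesis
 have "\<exists>d D. 0 < d & d <= D & (\<forall>T L. seqT T L --> ?P d D L T)"
 proof (rule preconditioner_bounds[OF assms(3) neg HOL.refl _ _ _ _ ev])
  show "?B (%x. a * u x + b * v x) = a * ?B u + b * ?B v" if "continuous_on (closure \<Omega>) u" "continuous_on (closure \<Omega>) v" for a b u v
   using p.bterm_lin[OF cG[OF that(1)] cG[OF that(2)]] unfolding assms(2) .
  show "?B (%x. \<Sum>i\<in>I. c i * f i x) = (\<Sum>i\<in>I. c i * ?B (f i))" if "finite I" "\<And>i. i \<in> I ==> continuous_on (closure \<Omega>) (f i)" for I :: "(nat \<times> point) set" and c f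
   using p.bterm_sum[OF that(1) cG[OF that(2)]] unfolding assms(2) .
  show "?B (%x. \<Sum>i\<in>I. c i * f i x) = (\<Sum>i\<in>I. c i * ?B (f i))" if "finite I" "\<And>i. i \<in> I ==> continuous_on (closure \<Omega>) (f i)" for I :: "point set" and c f
   using p.bterm_sum[OF that(1) cG[OF that(2)]] unfolding assms(2) .
  have "0 < bterm (inside ?G) ps (%x. if x \<in> closure \<Omega> then 1 else 0)" by (rule p.bterm_one) (use G in auto)
  thus "0 < ?B (%x. if x \<in> closure \<Omega> then 1 else 0)" unfolding assms(2) .
 qed
 then obtain d D where d: "0 < d" "d <= D" and main: "\<forall>T L. seqT T L --> ?P d D L T"
  by (elim exE conjE) (rule that)
 show ?thesis
  by (rule exI[of _ d], rule exI[of _ D], intro conjI d allI impI, elim conjE, rule main[rule_format], rule seqT_refine)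
qed

end
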